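(* Let $W:A^{\mathbb{Z}}\times\mathcal{B}^{\mathbb{Z}}\to\mathbb{C}$ be a stationary ergodic DIMA cq-channel. Then $C_{pp}(W)=C_{\mathrm{erg}}(W)$. Moreover, for each $\varepsilon>0$ and every code $\mathcal{C}_n=(u_i,b_i)_{i=1}^{M_n}$ of blocklength $n$ with $M_n\ge2^{n(C_{pp}(W)+\varepsilon)}$, $$\bar e(\mathcal{C}_n)\ge1-\frac{C_{pp}(W)+\frac1n}{C_{pp}(W)+\varepsilon}.$$
   Context: $A$ finite, $\mathcal{B}=\mathcal{L}(\mathcal{H})$ with $\mathcal{H}$ finite-dimensional, $\mathcal{B}^{\mathbb{Z}}$ the quasi-local algebra, $\mathcal{B}^{[n,m]}=\bigotimes_{i=n}^m\mathcal{B}$, $\mathcal{B}^n=\mathcal{B}^{[1,n]}$. A cq-channel $W$: $x\mapsto W(x,b)$ Borel measurable, $b\mapsto W(x,b)$ a state. Stationary: $W(T_{in}x,b)=W(x,T_{out}b)$. DIMA: for each $\varepsilon>0$ there are $m(\varepsilon),a(\varepsilon)\ge0$ such that for all $n\in\mathbb{Z}$, $k\in\mathbb{N}$, $b\in\mathcal{B}^{[n,n+k]}$ with $0\le b\le\mathbf{1}$, $m\ge m(\varepsilon)$, $a\ge a(\varepsilon)$: $|W(x,b)-W(x',b)|\le\varepsilon$ whenever $x_i=x'_i$ for $n-m\le i\le n+k+a$. Joint state $\psi_{p,W}(f\otimes b)=\int fW(\cdot,b)dp$ on $C(A^{\mathbb{Z}})\otimes\mathcal{B}^{\mathbb{Z}}\cong(\mathfrak{F}(A)\otimes\mathcal{B})^{\mathbb{Z}}$;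 $W$ ergodic if $\psi_{p,W}$ is ergodic (extreme among shift-invariant states) for every stationary ergodic $p$. $\psi_p$: $p$ as a state on $C(A^{\mathbb{Z}})$; $\psi_{q(p)}$: restriction of $\psi_{p,W}$ to $\mathcal{B}^{\mathbb{Z}}$. Entropy rate $s(\psi)=\lim_n\frac1nS(D_{\psi^n})$ ($\psi^n$ restriction to sites $1,\dots,n$, $S(D)=-\mathrm{tr}D\log D$); these limits exist for stationary states and for periodic (invariant under some power of the shift) states. $i(p,W)=s(\psi_p)+s(\psi_{q(p)})-s(\psi_{p,W})$. $C_{\mathrm{erg}}(W)=\sup\{i(p,W):p$ stationary ergodic$\}$; $C_{pp}(W)=\sup\{i(p,W):p$ periodic product$\}$, where $p$ is periodic product if for some $t\in\mathbb{N}$ and some distribution $\pi$ on $A^t$, $p$ is the product measure $\bigotimes_{k\in\mathbb{Z}}\pi$ over the blocks of coordinates $[kt+1,(k+1)t]$. A code $(u_i,b_i)_{i=1}^M$: $u_i\in A^n$, $0\le b_i\in\mathcal{B}^n$, $\sum b_i\le\mathbf{1}$; average error $\bar e=\frac1M\sum_i\sup_{x\in[u_i]}(1-W(x,b_i))$, $[u_i]$ the cylinder set. Logs base 2. *)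

theory Defs
  imports "HOL-Probability.Probability" "Jordan_Normal_Form.Char_Poly"
begin

type_synonym 'a seq = "int \<Rightarrow> 'a"

definition seq_space :: "('a seq) measure" where
  "seq_space = PiM UNIV (\<lambda>_. count_space UNIV)"

definition shift :: "'a seq \<Rightarrow> 'a seq" where
  "shift x = (\<lambda>i. x (i + 1))"

definition cyl :: "int \<Rightarrow> 'a list \<Rightarrow> 'a seq set" where
  "cyl n w = {x. \<forall>j<length w. x (n + int j) = w ! j}"

definition words :: "nat \<Rightarrow> 'a list set" where
  "words k = {w. length w = k}"

definition is_source :: "('a seq) measure \<Rightarrow> bool" where
  "is_source p \<longleftrightarrow> prob_space p \<and> sets p = sets seq_space"

definition stationary_source :: "('a seq) measure \<Rightarrow> bool" where
  "stationary_source p \<longleftrightarrow> is_source p \<and>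
     (\<forall>S\<in>sets seq_space. measure p (shift -` S) = measure p S)"

definition ergodic_source :: "('a seq) measure \<Rightarrow> bool" where
  "ergodic_source p \<longleftrightarrow> stationary_source p \<and>
     (\<forall>S\<in>sets seq_space. shift -` S = S \<longrightarrow> measure p S = 0 \<or> measure p S = 1)"

text \<open>periodic product source: product of copies of a distribution pi on A^t over the
  blocks of coordinates [kt+1,(k+1)t]; it is specified by its values on cylinders made
  of consecutive whole blocks, which determine the measure.\<close>
definition periodic_product :: "('a seq) measure \<Rightarrow> bool" where
  "periodic_product p \<longleftrightarrow> is_source p \<and>
     (\<exists>t>0. \<exists>\<pi> :: 'a list pmf. set_pmf \<pi> \<subseteq> words t \<and>
        (\<forall>k::int. \<forall>us :: 'a list list. (\<forall>u\<in>set us. length u = t) \<longrightarrow>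
            measure p (cyl (k * int t + 1) (concat us)) = (\<Prod>u\<leftarrow>us. pmf \<pi> u)))"

section \<open>Matrices: local algebras B^[n,n+k-1] are d^k x d^k complex matrices
  (site n is the most significant tensor factor)\<close>

definition psd :: "complex mat \<Rightarrow> bool" where
  "psd B \<longleftrightarrow> B \<in> carrier_mat (dim_row B) (dim_row B) \<and>
     (\<forall>v\<in>carrier_vec (dim_row B). Im ((B *\<^sub>v v) \<bullet>c v) = 0 \<and> Re ((B *\<^sub>v v) \<bullet>c v) \<ge> 0)"

definition mtrace :: "complex mat \<Rightarrow> complex" where
  "mtrace D = (\<Sum>i<dim_row D. D $$ (i, i))"

definition msum :: "nat \<Rightarrow> ('i \<Rightarrow> complex mat) \<Rightarrow> 'i set \<Rightarrow> complex mat" where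
  "msum D f I = mat D D (\<lambda>(i, j). \<Sum>s\<in>I. f s $$ (i, j))"

definition ptrace_last :: "nat \<Rightarrow> complex mat \<Rightarrow> complex mat" where
  "ptrace_last d D = (let m = dim_row D div d in
     mat m m (\<lambda>(i, j). \<Sum>a<d. D $$ (i * d + a, j * d + a)))"

definition ptrace_first :: "nat \<Rightarrow> complex mat \<Rightarrow> complex mat" where
  "ptrace_first d D = (let m = dim_row D div d in
     mat m m (\<lambda>(i, j). \<Sum>a<d. D $$ (a * m + i, a * m + j)))"

definition eta :: "real \<Rightarrow> real" where
  "eta t = (if t \<le> 0 then 0 else - t * log 2 t)"

definition vn_entropy :: "complex mat \<Rightarrow> real" where
  "vn_entropy D = (\<Sum>z\<in>{z. poly (char_poly D) z = 0}.
      real (order z (char_poly D)) * eta (Re z))"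

section \<open>States on the quasi-local algebra, given by their consistent local density matrices\<close>

text \<open>rho n k is the density matrix of the restriction to the sites n, ..., n+k-1\<close>
definition local_state_family :: "nat \<Rightarrow> (int \<Rightarrow> nat \<Rightarrow> complex mat) \<Rightarrow> bool" where
  "local_state_family d \<rho> \<longleftrightarrow>
     (\<forall>n k. \<rho> n k \<in> carrier_mat (d ^ k) (d ^ k) \<and> psd (\<rho> n k) \<and> mtrace (\<rho> n k) = 1) \<and>
     (\<forall>n k. ptrace_last d (\<rho> n (Suc k)) = \<rho> n k \<and> ptrace_first d (\<rho> n (Suc k)) = \<rho> (n + 1) k)"

text \<open>cq-channel: W x n k is the density matrix of W(x,.) on the sites n..n+k-1,
  so W(x,b) = mtrace (W x n k * b) for b in B^[n,n+k-1]\<close>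
definition cq_channel :: "nat \<Rightarrow> ('a seq \<Rightarrow> int \<Rightarrow> nat \<Rightarrow> complex mat) \<Rightarrow> bool" where
  "cq_channel d W \<longleftrightarrow> (\<forall>x. local_state_family d (W x)) \<and>
     (\<forall>n k i j. i < d ^ k \<longrightarrow> j < d ^ k \<longrightarrow>
        (\<lambda>x. W x n k $$ (i, j)) \<in> borel_measurable seq_space)"

definition stationary_channel :: "('a seq \<Rightarrow> int \<Rightarrow> nat \<Rightarrow> complex mat) \<Rightarrow> bool" where
  "stationary_channel W \<longleftrightarrow> (\<forall>x n k. W (shift x) n k = W x (n + 1) k)"

definition dima :: "nat \<Rightarrow> ('a seq \<Rightarrow> int \<Rightarrow> nat \<Rightarrow> complex mat) \<Rightarrow> bool" where
  "dima d W \<longleftrightarrow> (\<forall>\<epsilon>>0. \<exists>m0 a0 :: nat. \<forall>n::int. \<forall>k::nat. \<forall>b m a x x'.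
     b \<in> carrier_mat (d ^ (k + 1)) (d ^ (k + 1)) \<and> psd b \<and> psd (1\<^sub>m (d ^ (k + 1)) - b) \<and>
     m \<ge> m0 \<and> a \<ge> a0 \<and>
     (\<forall>i. n - int m \<le> i \<and> i \<le> n + int k + int a \<longrightarrow> x i = x' i) \<longrightarrow>
     cmod (mtrace (W x n (k + 1) * b) - mtrace (W x' n (k + 1) * b)) \<le> \<epsilon>)"

section \<open>Joint states on (F(A) (x) B)^Z, given by their local cq-densities:
  J n k w (for a word w of length k) is the block of the local density on the sites
  n..n+k-1 belonging to the classical configuration w\<close>

definition joint_state_family :: "nat \<Rightarrow> (int \<Rightarrow> nat \<Rightarrow> 'a::finite list \<Rightarrow> complex mat) \<Rightarrow> bool" where
  "joint_state_family d J \<longleftrightarrow>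
     (\<forall>n k. (\<forall>w\<in>words k. J n k w \<in> carrier_mat (d ^ k) (d ^ k) \<and> psd (J n k w)) \<and>
            (\<Sum>w\<in>words k. mtrace (J n k w)) = 1) \<and>
     (\<forall>n k. \<forall>w\<in>words k.
        msum (d ^ k) (\<lambda>a. ptrace_last d (J n (Suc k) (w @ [a]))) UNIV = J n k w \<and>
        msum (d ^ k) (\<lambda>a. ptrace_first d (J n (Suc k) (a # w))) UNIV = J (n + 1) k w)"

definition joint_invariant :: "(int \<Rightarrow> nat \<Rightarrow> 'a list \<Rightarrow> complex mat) \<Rightarrow> bool" where
  "joint_invariant J \<longleftrightarrow> (\<forall>n k. \<forall>w\<in>words k. J (n + 1) k w = J n k w)"

definition joint_ergodic :: "nat \<Rightarrow> (int \<Rightarrow> nat \<Rightarrow> 'a::finite list \<Rightarrow> complex mat) \<Rightarrow> bool" where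
  "joint_ergodic d J \<longleftrightarrow> joint_state_family d J \<and> joint_invariant J \<and>
     (\<forall>J1 J2 (l::real). joint_state_family d J1 \<and> joint_invariant J1 \<and>
        joint_state_family d J2 \<and> joint_invariant J2 \<and> 0 < l \<and> l < 1 \<and>
        (\<forall>n k. \<forall>w\<in>words k. J n k w = complex_of_real l \<cdot>\<^sub>m J1 n k w + complex_of_real (1 - l) \<cdot>\<^sub>m J2 n k w)
        \<longrightarrow> (\<forall>n k. \<forall>w\<in>words k. J1 n k w = J n k w))"

text \<open>the joint state psi_{p,W}: psi(1_[w] (x) b) = integral over [w] of W(.,b) dp\<close>
definition joint_fam :: "nat \<Rightarrow> ('a seq) measure \<Rightarrow> ('a seq \<Rightarrow> int \<Rightarrow> nat \<Rightarrow> complex mat)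
    \<Rightarrow> int \<Rightarrow> nat \<Rightarrow> 'a list \<Rightarrow> complex mat" where
  "joint_fam d p W n k w = mat (d ^ k) (d ^ k)
     (\<lambda>(i, j). LINT x|p. indicator (cyl n w) x * W x n k $$ (i, j))"

definition output_fam :: "nat \<Rightarrow> ('a seq) measure \<Rightarrow> ('a seq \<Rightarrow> int \<Rightarrow> nat \<Rightarrow> complex mat)
    \<Rightarrow> int \<Rightarrow> nat \<Rightarrow> complex mat" where
  "output_fam d p W n k = mat (d ^ k) (d ^ k) (\<lambda>(i, j). LINT x|p. W x n k $$ (i, j))"

definition ergodic_channel :: "nat \<Rightarrow> ('a::finite seq \<Rightarrow> int \<Rightarrow> nat \<Rightarrow> complex mat) \<Rightarrow> bool" where
  "ergodic_channel d W \<longleftrightarrow>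
     (\<forall>p. ergodic_source p \<longrightarrow> joint_ergodic d (joint_fam d p W))"

definition s_source :: "('a::finite seq) measure \<Rightarrow> real" where
  "s_source p = lim (\<lambda>n. (\<Sum>w\<in>words n. eta (measure p (cyl 1 w))) / real n)"

definition s_output :: "nat \<Rightarrow> ('a seq) measure \<Rightarrow> ('a seq \<Rightarrow> int \<Rightarrow> nat \<Rightarrow> complex mat) \<Rightarrow> real" where
  "s_output d p W = lim (\<lambda>n. vn_entropy (output_fam d p W 1 n) / real n)"

text \<open>entropy of the block-diagonal cq-density sum_w |w><w| (x) sigma_w is sum_w S(sigma_w)\<close>
definition s_joint :: "nat \<Rightarrow> ('a::finite seq) measure \<Rightarrow> ('a seq \<Rightarrow> int \<Rightarrow> nat \<Rightarrow> complex mat) \<Rightarrow> real" where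
  "s_joint d p W = lim (\<lambda>n. (\<Sum>w\<in>words n. vn_entropy (joint_fam d p W 1 n w)) / real n)"

definition mutual_info :: "nat \<Rightarrow> ('a::finite seq) measure \<Rightarrow> ('a seq \<Rightarrow> int \<Rightarrow> nat \<Rightarrow> complex mat) \<Rightarrow> real" where
  "mutual_info d p W = s_source p + s_output d p W - s_joint d p W"

definition C_erg :: "nat \<Rightarrow> ('a::finite seq \<Rightarrow> int \<Rightarrow> nat \<Rightarrow> complex mat) \<Rightarrow> real" where
  "C_erg d W = (SUP p\<in>{p. ergodic_source p}. mutual_info d p W)"

definition C_pp :: "nat \<Rightarrow> ('a::finite seq \<Rightarrow> int \<Rightarrow> nat \<Rightarrow> complex mat) \<Rightarrow> real" where
  "C_pp d W = (SUP p\<in>{p. periodic_product p}. mutual_info d p W)"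

definition is_code :: "nat \<Rightarrow> nat \<Rightarrow> nat \<Rightarrow> (nat \<Rightarrow> 'a list) \<Rightarrow> (nat \<Rightarrow> complex mat) \<Rightarrow> bool" where
  "is_code d n M u b \<longleftrightarrow>
     (\<forall>i<M. length (u i) = n \<and> b i \<in> carrier_mat (d ^ n) (d ^ n) \<and> psd (b i)) \<and>
     psd (1\<^sub>m (d ^ n) - msum (d ^ n) b {..<M})"

definition avg_error :: "nat \<Rightarrow> ('a seq \<Rightarrow> int \<Rightarrow> nat \<Rightarrow> complex mat) \<Rightarrow> nat \<Rightarrow> nat
    \<Rightarrow> (nat \<Rightarrow> 'a list) \<Rightarrow> (nat \<Rightarrow> complex mat) \<Rightarrow> real" where
  "avg_error d W n M u b = (1 / real M) *
     (\<Sum>i<M. (SUP x\<in>cyl 1 (u i). 1 - Re (mtrace (W x 1 n * b i))))"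

end

theory Submission
  imports Defs "Jordan_Normal_Form.Spectral_Radius"
begin

text \<open>Entropies of positive operators are handled through eigenvalues and Bessel's inequality, which
  gives almost affinity (up to the entropy of the weights) and continuity in the trace norm. The
  relative entropy is the integral over u in (0,1) of (1 - u) Q(u), where each Q(u) is a supremum of
  linear functionals of the two operators. Hence it is jointly convex and superadditive over
  blocks against product references, so that with output entropy S(B) and joint entropy S(XB) the
  gain S(B) - S(XB) is superadditive over adjacent blocks.

  For a periodic product source, the average over one period of its translates is stationary,
  ergodic by a zero-one law, and has the same information rate since entropy is almost affine;
  this bounds C_pp by C_erg. Conversely, replace an ergodic source by independent copies of its
  marginal on a block of length t. By DIMA the joint states on the block, shortened by a bounded
  number of sites on either side, are close, so the information of a block changes by at most
  a small multiple of t, and superadditivity bounds the rate of the product source from below.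

  For the converse coding statement, take independent copies of the uniform distribution on the
  code words. The decoder is a test between the joint state and the product of its marginals, and
  the same family of linear functionals yields Fano's inequality for it, while superadditivity
  bounds the information of one block by C_pp times its length.\<close>

section \<open>The function eta\<close>

text \<open>The classical inequalities are usually derived from operator logarithms and operator
  convexity; here neither appears. The scalar a ln a - a ln b - a + b is the integral Taylor
  remainder of x ln x at b, which explains the weight 1 - u. Applied to pairs of eigenvalues of R
  and S, its integrand becomes a sum over two eigenbases, and this sum is the maximum over Y of 2 Re
  tr Y(R - S) - u tr Y R Y' - (1 - u) tr Y' S Y, with Y' the adjoint. The logarithms return only
  after integration. The rates are defined with \<open>lim\<close>, which carries no information
  before convergence is shown; hence subadditivity and the cost of dropping sites are established
  for every starting site, as the sources involved are merely periodic. The continuity estimate is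
  applied separately to the block of each input word, with an error proportional to the probability
  of that word. An error uniform over words would be multiplied by their exponential number. This is
  why the closeness of the joint states is carried through as a bound in terms of cylinder
  masses.\<close>

lemma eta_eq: "0 \<le> t \<Longrightarrow> eta t = - t * log 2 t"
  by (auto simp: eta_def)

lemma eta_0 [simp]: "eta 0 = 0" and eta_1 [simp]: "eta 1 = 0"
  by (simp_all add: eta_def)

lemma eta_ge_0: "0 \<le> t \<Longrightarrow> t \<le> 1 \<Longrightarrow> 0 \<le> eta t"
  by (auto simp: eta_def mult_nonneg_nonpos)

lemma eta_mult: "0 \<le> a \<Longrightarrow> 0 \<le> b \<Longrightarrow> eta (a * b) = a * eta b + b * eta a"
  by (cases "a = 0 \<or> b = 0") (auto simp: eta_def log_mult algebra_simps mult_le_0_iff)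

text \<open>The right-hand side is the tangent of the concave function \<open>eta\<close> at y;
  Jensen's inequality below is a weighted sum of this bound.\<close>

lemma eta_gibbs:
  assumes "0 \<le> x" "0 < y"
  shows "eta x \<le> - x * log 2 y + (y - x) / ln 2"
proof (cases "x = 0")
  case False
  then have x: "x > 0" using assms by auto
  have "ln (y / x) \<le> y / x - 1" using x assms by (intro ln_le_minus_one) auto
  then have "x * ln (y / x) \<le> x * (y / x - 1)" using x by (intro mult_left_mono) auto
  then have "x * (ln y - ln x) \<le> y - x"
    using x assms by (simp add: ln_div algebra_simps)
  then have "x * (ln y - ln x) / ln 2 \<le> (y - x) / ln 2"
    by (intro divide_right_mono) auto
  then show ?thesis using x
    by (simp add: eta_eq log_def diff_divide_distrib algebra_simps)
qed (use assms in auto)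

text \<open>Total weight below 1 is admissible because the missing weight can be placed at the point
  0, where \<open>eta\<close> vanishes. This is the form that Bessel's inequality supplies in
  \<open>ent_le_decomp\<close>.\<close>

lemma eta_jensen_sub:
  assumes fin: "finite K" and a: "\<And>k. k \<in> K \<Longrightarrow> 0 \<le> a k" and s: "(\<Sum>k\<in>K. a k) \<le> 1"
    and x: "\<And>k. k \<in> K \<Longrightarrow> 0 \<le> x k"
  shows "(\<Sum>k\<in>K. a k * eta (x k)) \<le> eta (\<Sum>k\<in>K. a k * x k)"
proof -
  define y where "y = (\<Sum>k\<in>K. a k * x k)"
  have y0: "y \<ge> 0" unfolding y_def by (intro sum_nonneg mult_nonneg_nonneg a x)
  show ?thesis
  proof (cases "y = 0")
    case True
    then have "\<forall>k\<in>K. a k * x k = 0" unfolding y_def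
      using a x fin by (subst (asm) sum_nonneg_eq_0_iff) auto
    then have "(\<Sum>k\<in>K. a k * eta (x k)) = 0" by (intro sum.neutral) auto
    then show ?thesis using True y_def by simp
  next
    case False
    then have yp: "y > 0" using y0 by auto
    have "(\<Sum>k\<in>K. a k * eta (x k)) \<le> (\<Sum>k\<in>K. a k * (- x k * log 2 y + (y - x k) / ln 2))"
      by (intro sum_mono mult_left_mono eta_gibbs a x yp)
    also have "\<dots> = (\<Sum>k\<in>K. (a k * x k) * (- log 2 y - 1 / ln 2) + a k * (y / ln 2))"
      by (intro sum.cong) (auto simp: algebra_simps diff_divide_distrib)
    also have "\<dots> = y * (- log 2 y - 1 / ln 2) + (\<Sum>k\<in>K. a k) * (y / ln 2)"
      by (simp only: sum.distrib sum_distrib_right[symmetric] y_def[symmetric])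
    also have "\<dots> = - y * log 2 y + (y * (\<Sum>k\<in>K. a k) - y) / ln 2"
      by (simp add: algebra_simps diff_divide_distrib)
    also have "\<dots> \<le> - y * log 2 y"
      using s yp by (simp add: divide_nonpos_pos mult_left_le)
    also have "\<dots> = eta y" using y0 by (simp add: eta_eq)
    finally show ?thesis by (simp add: y_def)
  qed
qed

text \<open>Jensen with equal weights: splitting a mass into at most N pieces adds at most log N per
  unit of mass.\<close>

lemma eta_sum_le_card:
  assumes fin: "finite K" "card K \<le> N" and x: "\<And>k. k \<in> K \<Longrightarrow> 0 \<le> x k"
  shows "(\<Sum>k\<in>K. eta (x k)) \<le> eta (\<Sum>k\<in>K. x k) + (\<Sum>k\<in>K. x k) * log 2 (real N)"
proof (cases "K = {}")
  case False
  then have N: "card K > 0" using fin by (simp add: card_gt_0_iff)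
  let ?c = "real (card K)"
  have "(\<Sum>k\<in>K. (1 / ?c) * eta (x k)) \<le> eta (\<Sum>k\<in>K. (1 / ?c) * x k)"
    using N by (intro eta_jensen_sub fin x) auto
  also have "(\<Sum>k\<in>K. (1 / ?c) * x k) = (1 / ?c) * (\<Sum>k\<in>K. x k)"
    by (simp add: sum_distrib_left)
  also have "eta \<dots> = (1 / ?c) * eta (\<Sum>k\<in>K. x k) + (\<Sum>k\<in>K. x k) * eta (1 / ?c)"
    by (intro eta_mult sum_nonneg x) auto
  also have "eta (1 / ?c) = (1 / ?c) * log 2 ?c"
    using N by (simp add: eta_eq log_divide)
  finally have "?c * (\<Sum>k\<in>K. (1 / ?c) * eta (x k)) \<le>
     ?c * ((1 / ?c) * eta (\<Sum>k\<in>K. x k) + (\<Sum>k\<in>K. x k) * ((1 / ?c) * log 2 ?c))"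
    by (intro mult_left_mono) auto
  then have "(\<Sum>k\<in>K. eta (x k)) \<le> eta (\<Sum>k\<in>K. x k) + (\<Sum>k\<in>K. x k) * log 2 ?c"
    using N by (simp add: sum_divide_distrib[symmetric] distrib_left)
  also have "\<dots> \<le> eta (\<Sum>k\<in>K. x k) + (\<Sum>k\<in>K. x k) * log 2 (real N)"
    using N fin by (intro add_left_mono mult_left_mono sum_nonneg x) auto
  finally show ?thesis .
qed auto

text \<open>Each part is at most the total, so its logarithm may be replaced by the logarithm of the
  total.\<close>

lemma eta_sum_ge:
  assumes "finite K" and x: "\<And>k. k \<in> K \<Longrightarrow> 0 \<le> x k"
  shows "eta (\<Sum>k\<in>K. x k) \<le> (\<Sum>k\<in>K. eta (x k))"
proof -
  define y where "y = (\<Sum>k\<in>K. x k)"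
  have "eta y = (\<Sum>k\<in>K. - x k * log 2 y)"
    using x by (simp add: y_def eta_eq sum_nonneg sum_distrib_right sum_negf)
  also have "\<dots> \<le> (\<Sum>k\<in>K. eta (x k))"
  proof (intro sum_mono)
    fix k assume k: "k \<in> K"
    show "- x k * log 2 y \<le> eta (x k)"
    proof (cases "x k = 0")
      case False
      then have xk: "x k > 0" using x k by force
      have "x k \<le> y" unfolding y_def using k assms by (intro member_le_sum) auto
      then have "log 2 (x k) \<le> log 2 y" using xk by simp
      then show ?thesis using xk by (simp add: eta_eq)
    qed auto
  qed
  finally show ?thesis by (simp add: y_def)
qed

section \<open>Spectral decompositions of matrices over finite index sets\<close>

text \<open>Operators are functions of two indices over an arbitrary finite set rather than
  matrices: a bipartite system is then \<open>I \<times> J\<close>, a partial trace is a plain sum,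
  and regrouping sites is a bijection of index sets. The form is antilinear in its first
  argument.\<close>

definition ip :: "'i set \<Rightarrow> ('i \<Rightarrow> complex) \<Rightarrow> ('i \<Rightarrow> complex) \<Rightarrow> complex" where
  "ip I f g = (\<Sum>x\<in>I. cnj (f x) * g x)"

definition qf :: "'i set \<Rightarrow> ('i \<Rightarrow> 'i \<Rightarrow> complex) \<Rightarrow> ('i \<Rightarrow> complex) \<Rightarrow> ('i \<Rightarrow> complex) \<Rightarrow> complex" where
  "qf I A f g = (\<Sum>x\<in>I. \<Sum>y\<in>I. cnj (f x) * A x y * g y)"

definition herm_on :: "'i set \<Rightarrow> ('i \<Rightarrow> 'i \<Rightarrow> complex) \<Rightarrow> bool" where
  "herm_on I A \<longleftrightarrow> (\<forall>v. Im (qf I A v v) = 0)"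

definition psd_on :: "'i set \<Rightarrow> ('i \<Rightarrow> 'i \<Rightarrow> complex) \<Rightarrow> bool" where
  "psd_on I A \<longleftrightarrow> (\<forall>v. Im (qf I A v v) = 0 \<and> Re (qf I A v v) \<ge> 0)"

definition tr_on :: "'i set \<Rightarrow> ('i \<Rightarrow> 'i \<Rightarrow> complex) \<Rightarrow> real" where
  "tr_on I A = (\<Sum>x\<in>I. Re (A x x))"

text \<open>Orthonormality and completeness stand side by side so that Parseval and trace formulas
  can be read off at once. Bases are indexed by \<open>I\<close> itself, which fixes their
  cardinality.\<close>

definition onb :: "'i set \<Rightarrow> ('i \<Rightarrow> 'i \<Rightarrow> complex) \<Rightarrow> bool" where
  "onb I e \<longleftrightarrow> (\<forall>j\<in>I. \<forall>k\<in>I. ip I (e j) (e k) = (if j = k then 1 else 0)) \<and>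
     (\<forall>x\<in>I. \<forall>y\<in>I. (\<Sum>k\<in>I. e k x * cnj (e k y)) = (if x = y then 1 else 0))"

definition spec :: "'i set \<Rightarrow> ('i \<Rightarrow> 'i \<Rightarrow> complex) \<Rightarrow> ('i \<Rightarrow> 'i \<Rightarrow> complex) \<Rightarrow> ('i \<Rightarrow> real) \<Rightarrow> bool" where
  "spec I A e l \<longleftrightarrow> onb I e \<and>
     (\<forall>x\<in>I. \<forall>y\<in>I. A x y = (\<Sum>k\<in>I. complex_of_real (l k) * e k x * cnj (e k y)))"

lemma onbD1: "onb I e \<Longrightarrow> j \<in> I \<Longrightarrow> k \<in> I \<Longrightarrow> ip I (e j) (e k) = (if j = k then 1 else 0)"
  and onbD2: "onb I e \<Longrightarrow> x \<in> I \<Longrightarrow> y \<in> I \<Longrightarrow> (\<Sum>k\<in>I. e k x * cnj (e k y)) = (if x = y then 1 else 0)"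
  unfolding onb_def by auto

lemma specD: "spec I A e l \<Longrightarrow> onb I e"
  "spec I A e l \<Longrightarrow> x \<in> I \<Longrightarrow> y \<in> I \<Longrightarrow> A x y = (\<Sum>k\<in>I. complex_of_real (l k) * e k x * cnj (e k y))"
  unfolding spec_def by auto

lemma ip_cnj: "cnj (ip I f g) = ip I g f"
  unfolding ip_def by (simp add: mult.commute)

lemma ip_same: "ip I f f = complex_of_real (\<Sum>x\<in>I. (cmod (f x))\<^sup>2)"
  unfolding ip_def of_real_sum
  by (intro sum.cong) (auto simp: complex_norm_square mult.commute simp del: of_real_power)

lemma psd_on_herm: "psd_on I A \<Longrightarrow> herm_on I A"
  unfolding psd_on_def herm_on_def by auto

lemma qf_cong: "(\<And>x y. x \<in> I \<Longrightarrow> y \<in> I \<Longrightarrow> A x y = B x y) \<Longrightarrow> (\<And>x. x \<in> I \<Longrightarrow> f x = f' x) \<Longrightarrow>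
   (\<And>x. x \<in> I \<Longrightarrow> g x = g' x) \<Longrightarrow> qf I A f g = qf I B f' g'"
  unfolding qf_def by (intro sum.cong) auto

lemma psd_on_cong: "(\<And>x y. x \<in> I \<Longrightarrow> y \<in> I \<Longrightarrow> A x y = B x y) \<Longrightarrow> psd_on I A = psd_on I B"
  unfolding psd_on_def using qf_cong[of I A B] by auto

lemma spec_cong: "(\<And>x y. x \<in> I \<Longrightarrow> y \<in> I \<Longrightarrow> A x y = B x y) \<Longrightarrow> spec I A e l = spec I B e l"
  unfolding spec_def by auto

lemma qf_sum: "qf I (\<lambda>x y. \<Sum>s\<in>S. A s x y) f g = (\<Sum>s\<in>S. qf I (A s) f g)"
proof -
  have "qf I (\<lambda>x y. \<Sum>s\<in>S. A s x y) f g = (\<Sum>x\<in>I. \<Sum>y\<in>I. \<Sum>s\<in>S. cnj (f x) * A s x y * g y)"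
    unfolding qf_def by (simp add: sum_distrib_left sum_distrib_right)
  also have "\<dots> = (\<Sum>x\<in>I. \<Sum>s\<in>S. \<Sum>y\<in>I. cnj (f x) * A s x y * g y)"
    by (intro sum.cong refl sum.swap)
  also have "\<dots> = (\<Sum>s\<in>S. qf I (A s) f g)"
    unfolding qf_def by (rule sum.swap)
  finally show ?thesis .
qed

lemma qf_add: "qf I (\<lambda>x y. A x y + B x y) f g = qf I A f g + qf I B f g"
  and qf_diff: "qf I (\<lambda>x y. A x y - B x y) f g = qf I A f g - qf I B f g"
  and qf_scale: "qf I (\<lambda>x y. c * A x y) f g = c * qf I A f g"
  unfolding qf_def by (simp_all add: algebra_simps sum.distrib sum_subtractf sum_distrib_left)

lemma qf_outer: "qf I (\<lambda>x y. v x * cnj (w y)) f g = ip I f v * ip I w g"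
proof -
  have "ip I f v * ip I w g = (\<Sum>x\<in>I. \<Sum>y\<in>I. (cnj (f x) * v x) * (cnj (w y) * g y))"
    unfolding ip_def by (rule sum_product)
  then show ?thesis unfolding qf_def by (simp add: mult.assoc)
qed

lemma onb_parseval:
  assumes "finite I" "onb I e"
  shows "(\<Sum>k\<in>I. ip I f (e k) * ip I (e k) g) = ip I f g"
proof -
  have "(\<Sum>k\<in>I. ip I f (e k) * ip I (e k) g) = (\<Sum>k\<in>I. qf I (\<lambda>x y. e k x * cnj (e k y)) f g)"
    by (simp add: qf_outer)
  also have "\<dots> = qf I (\<lambda>x y. \<Sum>k\<in>I. e k x * cnj (e k y)) f g"
    by (simp add: qf_sum)
  also have "\<dots> = qf I (\<lambda>x y. if x = y then 1 else 0) f g"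
    using assms by (intro qf_cong) (auto simp: onbD2)
  also have "\<dots> = ip I f g"
    unfolding qf_def ip_def using assms(1)
    by (intro sum.cong refl) (simp add: mult_delta_right mult_delta_left)
  finally show ?thesis .
qed

lemma onb_parseval_norm:
  assumes "finite I" "onb I e"
  shows "(\<Sum>k\<in>I. (cmod (ip I (e k) g))\<^sup>2) = (\<Sum>x\<in>I. (cmod (g x))\<^sup>2)"
proof -
  have "complex_of_real (\<Sum>k\<in>I. (cmod (ip I (e k) g))\<^sup>2) = (\<Sum>k\<in>I. ip I g (e k) * ip I (e k) g)"
    unfolding of_real_sum complex_norm_square by (intro sum.cong) (simp_all add: ip_cnj mult.commute)
  also have "\<dots> = ip I g g" by (rule onb_parseval[OF assms])
  also have "\<dots> = complex_of_real (\<Sum>x\<in>I. (cmod (g x))\<^sup>2)" by (rule ip_same)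
  finally show ?thesis by (simp only: of_real_eq_iff)
qed

lemma spec_qf:
  assumes "spec I A e l"
  shows "qf I A f g = (\<Sum>k\<in>I. complex_of_real (l k) * (ip I f (e k) * ip I (e k) g))"
proof -
  have "qf I A f g = qf I (\<lambda>x y. \<Sum>k\<in>I. complex_of_real (l k) * (e k x * cnj (e k y))) f g"
    using assms by (intro qf_cong) (auto simp: specD mult.assoc)
  then show ?thesis by (simp add: qf_sum qf_scale qf_outer)
qed

lemma spec_qf_same:
  assumes "spec I A e l"
  shows "qf I A f f = complex_of_real (\<Sum>k\<in>I. l k * (cmod (ip I (e k) f))\<^sup>2)"
  unfolding spec_qf[OF assms] of_real_sum of_real_mult complex_norm_square
  by (intro sum.cong refl) (simp add: ip_cnj mult.commute mult.left_commute)

lemma spec_qf_basis: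
  assumes "finite I" "spec I A e l" "j \<in> I" "k \<in> I"
  shows "qf I A (e j) (e k) = (if j = k then complex_of_real (l k) else 0)"
proof -
  have "qf I A (e j) (e k) = (\<Sum>i\<in>I. complex_of_real (l i) * ((if j = i then 1 else 0) * (if i = k then 1 else 0)))"
    unfolding spec_qf[OF assms(2)] using assms onbD1[OF specD(1)[OF assms(2)]]
    by (intro sum.cong) auto
  also have "\<dots> = (\<Sum>i\<in>I. if i = k then (if j = k then complex_of_real (l k) else 0) else 0)"
    by (intro sum.cong) auto
  finally show ?thesis using assms by simp
qed

lemma spec_psd:
  assumes "finite I" "spec I A e l"
  shows "psd_on I A \<longleftrightarrow> (\<forall>k\<in>I. 0 \<le> l k)"
proof
  assume "psd_on I A"
  then show "\<forall>k\<in>I. 0 \<le> l k"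
    unfolding psd_on_def using spec_qf_basis[OF assms] by (metis Re_complex_of_real)
next
  assume "\<forall>k\<in>I. 0 \<le> l k"
  then show "psd_on I A"
    unfolding psd_on_def spec_qf_same[OF assms(2)] by (auto intro!: sum_nonneg)
qed

lemma spec_tr:
  assumes "finite I" "spec I A e l"
  shows "tr_on I A = (\<Sum>k\<in>I. l k)"
proof -
  have "complex_of_real (\<Sum>k\<in>I. l k) = (\<Sum>k\<in>I. complex_of_real (l k) * ip I (e k) (e k))"
    using onbD1[OF specD(1)[OF assms(2)]] by simp
  also have "\<dots> = (\<Sum>k\<in>I. \<Sum>x\<in>I. complex_of_real (l k) * e k x * cnj (e k x))"
    unfolding ip_def by (simp add: sum_distrib_left algebra_simps)
  also have "\<dots> = (\<Sum>x\<in>I. A x x)"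
    by (subst sum.swap) (simp add: specD(2)[OF assms(2)])
  finally show ?thesis unfolding tr_on_def
    by (metis Re_complex_of_real Re_sum)
qed

lemma tr_on_psd_nonneg:
  assumes "finite I" "psd_on I A" shows "tr_on I A \<ge> 0"
  unfolding tr_on_def
proof (intro sum_nonneg)
  fix x assume x: "x \<in> I"
  have "qf I A (\<lambda>y. if y = x then 1 else 0) (\<lambda>y. if y = x then 1 else 0) = A x x"
    unfolding qf_def using x assms
    by (simp add: mult_delta_right mult_delta_left if_distrib[of cnj] cong: if_cong)
  then show "0 \<le> Re (A x x)" using assms unfolding psd_on_def by metis
qed

lemma tr_on_sum: "tr_on I (\<lambda>x y. \<Sum>s\<in>S. A s x y) = (\<Sum>s\<in>S. tr_on I (A s))"
  unfolding tr_on_def Re_sum by (rule sum.swap)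

lemma tr_on_diff: "tr_on I (\<lambda>x y. A x y - B x y) = tr_on I A - tr_on I B"
  unfolding tr_on_def by (simp_all add: sum.distrib sum_subtractf)

lemma tr_on_scale: "tr_on I (\<lambda>x y. complex_of_real c * A x y) = c * tr_on I A"
  unfolding tr_on_def by (simp add: sum_distrib_left)

lemma psd_on_sum: "(\<And>s. s \<in> S \<Longrightarrow> psd_on I (A s)) \<Longrightarrow> psd_on I (\<lambda>x y. \<Sum>s\<in>S. A s x y)"
  unfolding psd_on_def by (auto simp: qf_sum intro!: sum_nonneg sum.neutral)

lemma psd_on_add: "psd_on I A \<Longrightarrow> psd_on I B \<Longrightarrow> psd_on I (\<lambda>x y. A x y + B x y)"
  unfolding psd_on_def by (auto simp: qf_add)

lemma psd_on_scale: "psd_on I A \<Longrightarrow> 0 \<le> c \<Longrightarrow> psd_on I (\<lambda>x y. complex_of_real c * A x y)"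
  unfolding psd_on_def by (auto simp: qf_scale)

lemma psd_on_outer: "psd_on I (\<lambda>x y. v x * cnj (v y))"
proof -
  have "qf I (\<lambda>x y. v x * cnj (v y)) f f = complex_of_real ((cmod (ip I v f))\<^sup>2)" for f
    unfolding qf_outer complex_norm_square by (simp add: ip_cnj mult.commute)
  then show ?thesis unfolding psd_on_def by simp
qed

lemma qf_sum_left: "qf I A (\<lambda>x. \<Sum>j\<in>J. c j * e j x) g = (\<Sum>j\<in>J. cnj (c j) * qf I A (e j) g)"
proof -
  have "qf I A (\<lambda>x. \<Sum>j\<in>J. c j * e j x) g = (\<Sum>x\<in>I. \<Sum>y\<in>I. \<Sum>j\<in>J. cnj (c j) * (cnj (e j x) * A x y * g y))"
    unfolding qf_def by (simp add: sum_distrib_left sum_distrib_right mult.assoc)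
  also have "\<dots> = (\<Sum>x\<in>I. \<Sum>j\<in>J. \<Sum>y\<in>I. cnj (c j) * (cnj (e j x) * A x y * g y))"
    by (intro sum.cong refl sum.swap)
  also have "\<dots> = (\<Sum>j\<in>J. \<Sum>x\<in>I. \<Sum>y\<in>I. cnj (c j) * (cnj (e j x) * A x y * g y))"
    by (rule sum.swap)
  finally show ?thesis unfolding qf_def by (simp add: sum_distrib_left)
qed

lemma qf_adjoint: "qf I A f g = cnj (qf I (\<lambda>x y. cnj (A y x)) g f)"
  unfolding qf_def by (subst sum.swap) (simp add: mult_ac)

lemma qf_sum_right: "qf I A f (\<lambda>x. \<Sum>j\<in>J. c j * e j x) = (\<Sum>j\<in>J. c j * qf I A f (e j))"
  by (subst qf_adjoint, subst qf_sum_left) (simp add: qf_adjoint[of I A])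

lemma qf_delta:
  assumes "finite I" "x \<in> I" "y \<in> I"
  shows "qf I A (\<lambda>z. if z = x then 1 else 0) (\<lambda>z. if z = y then 1 else 0) = A x y"
  unfolding qf_def using assms
  by (simp add: mult_delta_right mult_delta_left if_distrib[of cnj] cong: if_cong)

text \<open>Polarization on two coordinates: the form is real on the sum of the unit vectors at x
  and y and on their combination with the imaginary unit, which fixes the imaginary and the real
  part of the off-diagonal entries.\<close>

lemma herm_on_sym:
  fixes I :: "'i set"
  assumes fin: "finite I" and h: "herm_on I A" and x: "x \<in> I" and y: "y \<in> I"
  shows "A y x = cnj (A x y)"
proof -
  define d where "d = (\<lambda>(x::'i) z. if z = x then (1::complex) else 0)"
  have q: "qf I A (d x) (d y) = A x y" if "x \<in> I" "y \<in> I" for x y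
    unfolding d_def using qf_delta[OF fin that] .
  have *: "Im (\<Sum>j\<in>{True,False}. \<Sum>k\<in>{True,False}. cnj (c j) * (c k * A (if j then x else y) (if k then x else y))) = 0"
    for c :: "bool \<Rightarrow> complex"
  proof -
    have "qf I A (\<lambda>z. \<Sum>j\<in>{True,False}. c j * d (if j then x else y) z) (\<lambda>z. \<Sum>j\<in>{True,False}. c j * d (if j then x else y) z)
      = (\<Sum>j\<in>{True,False}. \<Sum>k\<in>{True,False}. cnj (c j) * (c k * A (if j then x else y) (if k then x else y)))"
      unfolding qf_sum_left qf_sum_right sum_distrib_left using x y by (intro sum.cong refl) (auto simp: q)
    then show ?thesis using h unfolding herm_on_def by metis
  qed
  have 1: "Im (A z z) = 0" if "z \<in> I" for z using h q[OF that that] unfolding herm_on_def by metis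
  have 2: "Im (A x y) + Im (A y x) = 0" using *[of "\<lambda>_. 1"] 1 x y by simp
  have 3: "Re (A x y) = Re (A y x)"
    using *[of "\<lambda>j. if j then 1 else \<i>"] 1 x y by (simp add: algebra_simps)
  show ?thesis using 2 3 by (simp add: complex_eq_iff)
qed

section \<open>Householder reflections and the spectral theorem\<close>

lemma qf_herm_cnj:
  assumes "finite I" "herm_on I A"
  shows "qf I A f g = cnj (qf I A g f)"
proof -
  have h: "qf I (\<lambda>x y. cnj (A y x)) g f = qf I A g f"
    by (intro qf_cong refl; rule herm_on_sym[OF assms, symmetric]; assumption)
  show ?thesis by (rule trans[OF qf_adjoint], rule arg_cong[where f = cnj], rule h)
qed

text \<open>A Householder reflection carries the unit vector at a to v, and its columns form the
  basis. The coordinate of v at a has to be real because a reflection is self-adjoint.\<close>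

lemma householder:
  fixes v :: "'i \<Rightarrow> complex"
  assumes fin: "finite I" and a: "a \<in> I" and v1: "ip I v v = 1" and va: "Im (v a) = 0"
  shows "\<exists>e. onb I e \<and> (\<forall>x\<in>I. e a x = v x)"
proof -
  define D where "D = (\<lambda>(k::'i) x. if k = x then (1::complex) else 0)"
  define u where "u = (\<lambda>x. v x - D a x)"
  define N where "N = (\<Sum>x\<in>I. (cmod (u x))\<^sup>2)"
  \<comment> \<open>If v already is the unit vector at a, then N = 0, and 2 / 0 = 0 makes e the
    standard basis; the identity \<open>c2\<close> holds in both cases.\<close>
  define c where "c = complex_of_real (2 / N)"
  define e where "e = (\<lambda>k x. D k x - c * u x * cnj (u k))"
  have Dcnj: "cnj (D k x) = D k x" for k x by (simp add: D_def)
  have Nu: "complex_of_real N = (\<Sum>x\<in>I. u x * cnj (u x))"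
    unfolding N_def of_real_sum complex_norm_square by simp
  have "(\<Sum>x\<in>I. u x * cnj (u x)) = (\<Sum>x\<in>I. cnj (v x) * v x) - (\<Sum>x\<in>I. v x * D a x) - (\<Sum>x\<in>I. cnj (v x) * D a x) + (\<Sum>x\<in>I. D a x * D a x)"
    unfolding u_def by (simp add: Dcnj algebra_simps sum.distrib sum_subtractf)
  also have "\<dots> = 1 - v a - cnj (v a) + 1"
    using v1 a fin unfolding ip_def by (simp add: D_def mult_delta_right)
  also have "\<dots> = complex_of_real (2 - 2 * Re (v a))" using va by (simp add: complex_eq_iff)
  finally have N2: "N = 2 - 2 * Re (v a)" using Nu by (simp only: of_real_eq_iff)
  have c2: "c * c * complex_of_real N = 2 * c" unfolding c_def by simp
  have cc: "cnj c = c" unfolding c_def by simp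
  have sym: "cnj (e k x) = e x k" for k x
    unfolding e_def by (simp add: Dcnj cc) (auto simp: D_def)
  have compl: "(\<Sum>k\<in>I. e k x * cnj (e k y)) = D x y" if "x \<in> I" "y \<in> I" for x y
  proof -
    have "(\<Sum>k\<in>I. e k x * cnj (e k y)) =
       (\<Sum>k\<in>I. D k x * D k y) - c * cnj (u y) * (\<Sum>k\<in>I. D k x * u k) - c * u x * (\<Sum>k\<in>I. D k y * cnj (u k))
        + c * c * u x * cnj (u y) * (\<Sum>k\<in>I. u k * cnj (u k))"
      unfolding e_def by (simp add: Dcnj cc algebra_simps sum.distrib sum_subtractf sum_distrib_left)
    also have "(\<Sum>k\<in>I. D k x * D k y) = D x y" using that fin
      by (simp add: D_def mult_delta_right mult_delta_left)
    also have "(\<Sum>k\<in>I. D k x * u k) = u x" using that fin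
      by (simp add: D_def mult_delta_right mult_delta_left)
    also have "(\<Sum>k\<in>I. D k y * cnj (u k)) = cnj (u y)" using that fin
      by (simp add: D_def mult_delta_right mult_delta_left)
    also have "D x y - c * cnj (u y) * u x - c * u x * cnj (u y) + c * c * u x * cnj (u y) * (\<Sum>k\<in>I. u k * cnj (u k))
        = D x y + u x * cnj (u y) * (c * c * complex_of_real N - 2 * c)"
      unfolding Nu by (simp add: algebra_simps)
    finally show ?thesis using c2 by simp
  qed
  have orth: "ip I (e j) (e k) = D j k" if "j \<in> I" "k \<in> I" for j k
  proof -
    have "ip I (e j) (e k) = (\<Sum>x\<in>I. e x j * cnj (e x k))" unfolding ip_def by (simp add: sym)
    then show ?thesis using compl[OF that] by simp
  qed
  have first: "e a x = v x" if "x \<in> I" for x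
  proof (cases "N = 0")
    case True
    then have "u x = 0" using that fin unfolding N_def by (simp add: sum_nonneg_eq_0_iff)
    then show ?thesis unfolding e_def by (simp add: u_def)
  next
    case False
    have ua: "cnj (u a) = - complex_of_real (N / 2)"
      using va N2 unfolding u_def D_def by (simp add: complex_eq_iff field_simps)
    have "c * u x * cnj (u a) = - u x" unfolding ua c_def using False by simp
    then show ?thesis unfolding e_def by (simp add: u_def)
  qed
  have "onb I e" unfolding onb_def using orth compl unfolding D_def by simp
  then show ?thesis using first by blast
qed

lemma eigenvector_exists:
  fixes A :: "nat \<Rightarrow> nat \<Rightarrow> complex"
  assumes "0 < n"
  shows "\<exists>v c. (\<exists>x<n. v x \<noteq> 0) \<and> (\<forall>x<n. (\<Sum>y<n. A x y * v y) = c * v x)"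
proof -
  define M where "M = mat n n (\<lambda>(i, j). A i j)"
  have M: "M \<in> carrier_mat n n" by (simp add: M_def)
  from spectrum_non_empty[OF M] assms obtain c where "eigenvalue M c"
    unfolding spectrum_def by auto
  then obtain w where w: "w \<in> carrier_vec n" "w \<noteq> 0\<^sub>v n" "M *\<^sub>v w = c \<cdot>\<^sub>v w"
    unfolding eigenvalue_def eigenvector_def using M by auto
  have "\<exists>x<n. w $ x \<noteq> 0" using w(1,2) by (metis carrier_vecD eq_vecI index_zero_vec(1,2))
  moreover have "(\<Sum>y<n. A x y * w $ y) = c * w $ x" if "x < n" for x
  proof -
    have "(M *\<^sub>v w) $ x = (\<Sum>y<n. A x y * w $ y)"
      using that w(1) M by (simp add: M_def scalar_prod_def atLeast0LessThan)
    then show ?thesis using w that by simp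
  qed
  ultimately show ?thesis by blast
qed

lemma onb_expand:
  fixes I :: "'i set"
  assumes fin: "finite I" and o: "onb I e" and x: "x \<in> I" and y: "y \<in> I"
  shows "A x y = (\<Sum>j\<in>I. \<Sum>k\<in>I. qf I A (e j) (e k) * e j x * cnj (e k y))"
proof -
  define d where "d = (\<lambda>(x::'i) z. if z = x then (1::complex) else 0)"
  have d: "d x z = (\<Sum>j\<in>I. cnj (e j x) * e j z)" if "z \<in> I" "x \<in> I" for x z
    using onbD2[OF o that] by (simp add: d_def mult.commute)
  have "A x y = qf I A (d x) (d y)" unfolding d_def using qf_delta[OF fin x y, of A] by simp
  also have "\<dots> = qf I A (\<lambda>z. \<Sum>j\<in>I. cnj (e j x) * e j z) (\<lambda>z. \<Sum>j\<in>I. cnj (e j y) * e j z)"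
    using x y by (intro qf_cong) (auto simp: d)
  also have "\<dots> = (\<Sum>j\<in>I. \<Sum>k\<in>I. qf I A (e j) (e k) * e j x * cnj (e k y))"
    unfolding qf_sum_left qf_sum_right sum_distrib_left by (intro sum.cong refl) (simp add: mult_ac)
  finally show ?thesis .
qed

text \<open>Deflation: a unit eigenvector is completed to a basis by a reflection. In this basis the
  operator splits into its eigenvalue and a self-adjoint block of size n, to which the induction
  hypothesis applies.\<close>

lemma spectral_nat:
  fixes n :: nat
  assumes "herm_on {..<n} A"
  shows "\<exists>e l. spec {..<n} A e l"
  using assms
proof (induction n arbitrary: A)
  case 0
  show ?case by (simp add: spec_def onb_def)
next
  case (Suc n)
  let ?I = "{..<Suc n}"
  note h = Suc.prems
  obtain w c where w: "\<exists>x<Suc n. w x \<noteq> 0" "\<forall>x<Suc n. (\<Sum>y<Suc n. A x y * w y) = c * w x"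
    using eigenvector_exists[of "Suc n" A] by blast
  define r where "r = sqrt (\<Sum>x\<in>?I. (cmod (w x))\<^sup>2)"
  have pos: "(\<Sum>x\<in>?I. (cmod (w x))\<^sup>2) > 0"
    using w(1) by (auto intro!: sum_pos2 simp del: sum.lessThan_Suc)
  have r: "r > 0" "r\<^sup>2 = (\<Sum>x\<in>?I. (cmod (w x))\<^sup>2)" unfolding r_def using pos by (auto simp: less_imp_le)
  \<comment> \<open>Besides normalizing, \<alpha> rotates the phase of the eigenvector so that its
    last coordinate is real, as \<open>householder\<close> requires.\<close>
  define \<alpha> where "\<alpha> = (if w n = 0 then 1 else cnj (w n) / cmod (w n)) / complex_of_real r"
  define v where "v = (\<lambda>x. \<alpha> * w x)"
  have \<alpha>: "(cmod \<alpha>)\<^sup>2 = 1 / r\<^sup>2" unfolding \<alpha>_def using r(1)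
    by (auto simp: norm_divide power_divide)
  have "(\<Sum>x\<in>?I. (cmod (v x))\<^sup>2) = (cmod \<alpha>)\<^sup>2 * (\<Sum>x\<in>?I. (cmod (w x))\<^sup>2)"
    unfolding v_def norm_mult power_mult_distrib by (rule sum_distrib_left[symmetric])
  also have "\<dots> = 1" using \<alpha> r(2) pos by simp
  finally have v1: "ip ?I v v = 1" unfolding ip_same by simp
  have "w n * cnj (w n) = complex_of_real ((cmod (w n))\<^sup>2)" by (rule complex_norm_square[symmetric])
  then have va: "Im (v n) = 0" unfolding v_def \<alpha>_def
    by (auto simp: mult.commute)
  have Av: "(\<Sum>y\<in>?I. A x y * v y) = c * v x" if "x \<in> ?I" for x
  proof -
    have "(\<Sum>y\<in>?I. A x y * v y) = \<alpha> * (\<Sum>y\<in>?I. A x y * w y)"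
      unfolding v_def sum_distrib_left by (intro sum.cong refl) (simp add: mult_ac)
    then show ?thesis using w(2) that unfolding v_def by (simp add: mult_ac)
  qed
  have qv: "qf ?I A f v = c * ip ?I f v" for f
  proof -
    have "qf ?I A f v = (\<Sum>x\<in>?I. cnj (f x) * (\<Sum>y\<in>?I. A x y * v y))"
      unfolding qf_def by (simp add: sum_distrib_left mult.assoc del: sum.lessThan_Suc)
    also have "\<dots> = (\<Sum>x\<in>?I. cnj (f x) * (c * v x))"
      by (intro sum.cong refl) (use Av in simp)
    finally show ?thesis unfolding ip_def by (simp add: sum_distrib_left mult_ac del: sum.lessThan_Suc)
  qed
  define \<mu> where "\<mu> = Re c"
  have "Im (qf ?I A v v) = 0" using h unfolding herm_on_def by auto
  then have c: "c = complex_of_real \<mu>" unfolding qv v1 \<mu>_def by (simp add: complex_eq_iff)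
  obtain e where e: "onb ?I e" "\<forall>x\<in>?I. e n x = v x"
    using householder[OF _ _ v1 va] by auto
  have qen: "qf ?I A (e j) (e n) = (if j = n then complex_of_real \<mu> else 0)" if "j \<in> ?I" for j
  proof -
    have "qf ?I A (e j) (e n) = qf ?I A (e j) v" by (rule qf_cong) (use e(2) in auto)
    also have "\<dots> = c * ip ?I (e j) (e n)" unfolding qv ip_def using e(2) by simp
    also have "\<dots> = (if j = n then complex_of_real \<mu> else 0)"
      using onbD1[OF e(1) that] c by simp
    finally show ?thesis .
  qed
  have qne: "qf ?I A (e n) (e j) = (if j = n then complex_of_real \<mu> else 0)" if "j \<in> ?I" for j
    using qf_herm_cnj[OF _ h, of "e n" "e j"] qen[OF that] by simp
  \<comment> \<open>The compression of A to the first n basis vectors, in the coordinates of e; g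
    below carries the eigenvectors of B back.\<close>
  define B where "B = (\<lambda>j k. qf ?I A (e j) (e k))"
  have "qf {..<n} B f f = qf ?I A (\<lambda>x. \<Sum>j<n. f j * e j x) (\<lambda>x. \<Sum>j<n. f j * e j x)" for f
    unfolding qf_sum_left qf_sum_right by (simp add: qf_def[of "{..<n}"] B_def sum_distrib_left mult_ac)
  then have "herm_on {..<n} B" using h unfolding herm_on_def by simp
  from Suc.IH[OF this] obtain f l where f: "spec {..<n} B f l" by blast
  define g where "g = (\<lambda>k x. if k = n then e n x else (\<Sum>j<n. f k j * e j x))"
  define L where "L = (\<lambda>k. if k = n then \<mu> else l k)"
  have ipe: "ip ?I (e j) (e k) = (if j = k then 1 else 0)" if "j \<le> n" "k \<le> n" for j k
    using onbD1[OF e(1)] that by simp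
  have ipl: "ip ?I (\<lambda>x. \<Sum>j<n. p j * e j x) u = (\<Sum>j<n. cnj (p j) * ip ?I (e j) u)" for p u
    unfolding ip_def cnj_sum sum_distrib_right sum_distrib_left by (subst sum.swap) (simp add: mult_ac)
  have ipr: "ip ?I u (\<lambda>x. \<Sum>j<n. p j * e j x) = (\<Sum>j<n. p j * ip ?I u (e j))" for p u
    unfolding ip_def sum_distrib_left by (subst sum.swap) (simp add: mult_ac)
  have orth: "ip ?I (g j) (g k) = (if j = k then 1 else 0)" if "j \<in> ?I" "k \<in> ?I" for j k
  proof -
    have a: "g n = e n" "\<And>k. k \<noteq> n \<Longrightarrow> g k = (\<lambda>x. \<Sum>j<n. f k j * e j x)" unfolding g_def by auto
    have "j < n \<or> j = n" "k < n \<or> k = n" using that by (simp_all add: less_Suc_eq)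
    then consider "j = n" "k = n" | "j = n" "k < n" | "j < n" "k = n" | "j < n" "k < n" by blast
    then show ?thesis
    proof cases
      case 4
      have "ip ?I (g j) (g k) = (\<Sum>i<n. \<Sum>m<n. cnj (f j i) * (f k m * ip ?I (e i) (e m)))"
        using 4 by (simp add: a ipl ipr sum_distrib_left)
      also have "\<dots> = (\<Sum>i<n. \<Sum>m<n. if i = m then cnj (f j i) * f k m else 0)"
        by (intro sum.cong refl) (simp add: ipe)
      also have "\<dots> = ip {..<n} (f j) (f k)" unfolding ip_def by simp
      finally show ?thesis using onbD1[OF specD(1)[OF f]] 4 by simp
    qed (simp_all add: a ipl ipr ipe)
  qed
  \<comment> \<open>Stated for arbitrary coefficients t: constant 1 gives completeness of g, the
    eigenvalues give the spectral formula.\<close>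
  have dbl: "(\<Sum>k\<in>{..<n}. t k * g k x * cnj (g k y)) = (\<Sum>i<n. \<Sum>j<n. (\<Sum>k<n. t k * f k i * cnj (f k j)) * e i x * cnj (e j y))"
    for t x y
  proof -
    have "(\<Sum>k\<in>{..<n}. t k * g k x * cnj (g k y)) = (\<Sum>k<n. \<Sum>i<n. \<Sum>j<n. t k * f k i * cnj (f k j) * e i x * cnj (e j y))"
      by (intro sum.cong refl) (simp add: g_def cnj_sum sum_product sum_distrib_left mult_ac)
    also have "\<dots> = (\<Sum>i<n. \<Sum>k<n. \<Sum>j<n. t k * f k i * cnj (f k j) * e i x * cnj (e j y))"
      by (rule sum.swap)
    also have "\<dots> = (\<Sum>i<n. \<Sum>j<n. \<Sum>k<n. t k * f k i * cnj (f k j) * e i x * cnj (e j y))"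
      by (intro sum.cong refl sum.swap)
    finally show ?thesis by (simp add: sum_distrib_right)
  qed
  have compl: "(\<Sum>k\<in>?I. g k x * cnj (g k y)) = (if x = y then 1 else 0)" if "x \<in> ?I" "y \<in> ?I" for x y
  proof -
    have "(\<Sum>k\<in>{..<n}. g k x * cnj (g k y)) = (\<Sum>i<n. \<Sum>j<n. (\<Sum>k<n. f k i * cnj (f k j)) * e i x * cnj (e j y))"
      using dbl[of "\<lambda>_. 1"] by simp
    also have "\<dots> = (\<Sum>i<n. \<Sum>j<n. if i = j then e i x * cnj (e j y) else 0)"
      using onbD2[OF specD(1)[OF f]] by (intro sum.cong refl) simp
    finally have "(\<Sum>k\<in>?I. g k x * cnj (g k y)) = (\<Sum>i<Suc n. e i x * cnj (e i y))"
      by (simp add: g_def)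
    then show ?thesis using onbD2[OF e(1) that] by simp
  qed
  have "A x y = (\<Sum>k\<in>?I. complex_of_real (L k) * g k x * cnj (g k y))" if "x \<in> ?I" "y \<in> ?I" for x y
  proof -
    have "A x y = (\<Sum>j\<in>?I. \<Sum>k\<in>?I. qf ?I A (e j) (e k) * e j x * cnj (e k y))"
      by (rule onb_expand[OF _ e(1) that]) simp
    also have "\<dots> = (\<Sum>j<n. \<Sum>k<n. B j k * e j x * cnj (e k y)) + complex_of_real \<mu> * e n x * cnj (e n y)"
      by (simp add: qen qne sum.distrib B_def)
    also have "(\<Sum>j<n. \<Sum>k<n. B j k * e j x * cnj (e k y)) = (\<Sum>k<n. complex_of_real (l k) * g k x * cnj (g k y))"
      unfolding dbl using specD(2)[OF f] by (intro sum.cong refl) simp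
    also have "\<dots> = (\<Sum>k<n. complex_of_real (L k) * g k x * cnj (g k y))"
      by (intro sum.cong refl) (simp add: L_def)
    finally show ?thesis by (simp add: L_def g_def)
  qed
  then have "spec ?I A g L" unfolding spec_def onb_def using orth compl by blast
  then show ?case by blast
qed

lemma ip_reindex:
  assumes "bij_betw h I J"
  shows "ip I (\<lambda>x. f (h x)) (\<lambda>x. g (h x)) = ip J f g"
  unfolding ip_def by (rule sum.reindex_bij_betw[OF assms])

lemma qf_reindex:
  assumes "bij_betw h I J"
  shows "qf I (\<lambda>x y. A (h x) (h y)) (\<lambda>x. f (h x)) (\<lambda>x. g (h x)) = qf J A f g"
  unfolding qf_def
  by (subst sum.reindex_bij_betw[OF assms, symmetric], intro sum.cong refl,
      subst sum.reindex_bij_betw[OF assms, symmetric]) simp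

lemma spec_reindex:
  assumes b: "bij_betw h I J" and s: "spec J A e l"
  shows "spec I (\<lambda>x y. A (h x) (h y)) (\<lambda>k x. e (h k) (h x)) (\<lambda>k. l (h k))"
proof -
  have hI: "x \<in> I \<Longrightarrow> h x \<in> J" for x using b by (auto simp: bij_betw_def)
  have inj: "x \<in> I \<Longrightarrow> y \<in> I \<Longrightarrow> (h x = h y) = (x = y)" for x y
    using b by (auto simp: bij_betw_def inj_on_def)
  show ?thesis unfolding spec_def onb_def
    using specD[OF s] onbD1[OF specD(1)[OF s]] onbD2[OF specD(1)[OF s]] hI
    by (auto simp: inj ip_reindex[OF b] sum.reindex_bij_betw[OF b, of "\<lambda>k. e k _ * cnj (e k _)"]
      sum.reindex_bij_betw[OF b, of "\<lambda>k. complex_of_real (l k) * e k _ * cnj (e k _)"])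
qed

lemma psd_on_reindex:
  assumes b: "bij_betw h I J"
  shows "psd_on I (\<lambda>x y. A (h x) (h y)) = psd_on J A"
proof
  assume "psd_on J A"
  moreover have "qf I (\<lambda>x y. A (h x) (h y)) v v = qf J A (\<lambda>y. v (inv_into I h y)) (\<lambda>y. v (inv_into I h y))" for v
    unfolding qf_reindex[OF b, symmetric] using b by (intro qf_cong) (auto simp: bij_betw_def)
  ultimately show "psd_on I (\<lambda>x y. A (h x) (h y))" unfolding psd_on_def by simp
next
  assume "psd_on I (\<lambda>x y. A (h x) (h y))"
  then show "psd_on J A" unfolding psd_on_def qf_reindex[OF b, symmetric] by simp
qed

lemma herm_on_reindex:
  assumes b: "bij_betw h I J" and "herm_on J A"
  shows "herm_on I (\<lambda>x y. A (h x) (h y))"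
proof -
  have "qf I (\<lambda>x y. A (h x) (h y)) v v = qf J A (\<lambda>y. v (inv_into I h y)) (\<lambda>y. v (inv_into I h y))" for v
    unfolding qf_reindex[OF b, symmetric] using b by (intro qf_cong) (auto simp: bij_betw_def)
  then show ?thesis using assms unfolding herm_on_def by simp
qed

theorem spectral:
  assumes "finite I" "herm_on I A"
  shows "\<exists>e l. spec I A e l"
proof -
  obtain h where h: "bij_betw h {..<card I} I"
    using ex_bij_betw_nat_finite[OF assms(1)] by (auto simp: atLeast0LessThan)
  obtain e l where s: "spec {..<card I} (\<lambda>x y. A (h x) (h y)) e l"
    using spectral_nat[OF herm_on_reindex[OF h assms(2)]] by blast
  define g where "g = inv_into {..<card I} h"
  have g: "bij_betw g I {..<card I}" unfolding g_def by (rule bij_betw_inv_into[OF h])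
  have hg: "h (g x) = x" if "x \<in> I" for x
    unfolding g_def using h that by (metis bij_betw_inv_into_right)
  have "spec I (\<lambda>x y. A (h (g x)) (h (g y))) (\<lambda>k x. e (g k) (g x)) (\<lambda>k. l (g k))"
    by (rule spec_reindex[OF g s])
  then have "spec I A (\<lambda>k x. e (g k) (g x)) (\<lambda>k. l (g k))"
    by (subst (asm) spec_cong[where B = A]) (auto simp: hg)
  then show ?thesis by blast
qed

section \<open>Entropy\<close>

text \<open>For positive operators the choice is immaterial: by \<open>ent_spec\<close> all spectral
  decompositions yield the same sum.\<close>

definition ent :: "'i set \<Rightarrow> ('i \<Rightarrow> 'i \<Rightarrow> complex) \<Rightarrow> real" where
  "ent I A = (SOME s. \<exists>e l. spec I A e l \<and> s = (\<Sum>k\<in>I. eta (l k)))"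

lemma onb_norm: "onb I e \<Longrightarrow> k \<in> I \<Longrightarrow> (\<Sum>x\<in>I. (cmod (e k x))\<^sup>2) = 1"
  using onbD1[of I e k k] unfolding ip_same by (metis of_real_eq_1_iff)

lemma cmod_ip_commute: "cmod (ip I f g) = cmod (ip I g f)"
  by (metis complex_mod_cnj ip_cnj)

lemma onb_overlap_sum1:
  assumes "finite I" "onb I e" "onb I f" "j \<in> I"
  shows "(\<Sum>k\<in>I. (cmod (ip I (e k) (f j)))\<^sup>2) = 1"
  using onb_parseval_norm[OF assms(1,2), of "f j"] onb_norm[OF assms(3,4)] by simp

lemma onb_overlap_sum2:
  assumes "finite I" "onb I e" "onb I f" "k \<in> I"
  shows "(\<Sum>j\<in>I. (cmod (ip I (e k) (f j)))\<^sup>2) = 1"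
  using onb_overlap_sum1[OF assms(1,3,2,4)] by (simp add: cmod_ip_commute[of I "e k"])

text \<open>The diagonal of A in the basis f consists of averages of the eigenvalues with the doubly
  stochastic weights |<e_k, f_j>|^2, and \<open>eta\<close> is concave. Applied both ways to two
  eigenbases, this makes the entropy well defined.\<close>

lemma spec_eta_le_basis:
  assumes fin: "finite I" and s: "spec I A e l" and p: "psd_on I A" and f: "onb I f"
  shows "(\<Sum>k\<in>I. eta (l k)) \<le> (\<Sum>j\<in>I. eta (Re (qf I A (f j) (f j))))"
proof -
  note e = specD(1)[OF s]
  define a where "a = (\<lambda>j k. (cmod (ip I (e k) (f j)))\<^sup>2)"
  have l: "k \<in> I \<Longrightarrow> 0 \<le> l k" for k using p spec_psd[OF fin s] by auto
  have "(\<Sum>k\<in>I. eta (l k)) = (\<Sum>k\<in>I. (\<Sum>j\<in>I. a j k) * eta (l k))"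
    using onb_overlap_sum2[OF fin e f] by (simp add: a_def)
  also have "\<dots> = (\<Sum>j\<in>I. \<Sum>k\<in>I. a j k * eta (l k))"
    unfolding sum_distrib_right by (rule sum.swap)
  also have "\<dots> \<le> (\<Sum>j\<in>I. eta (\<Sum>k\<in>I. a j k * l k))"
    by (intro sum_mono eta_jensen_sub fin l) (auto simp: a_def onb_overlap_sum1[OF fin e f])
  also have "\<dots> = (\<Sum>j\<in>I. eta (Re (qf I A (f j) (f j))))"
    unfolding spec_qf_same[OF s] Re_complex_of_real a_def by (simp add: mult.commute)
  finally show ?thesis .
qed

lemma ent_spec:
  assumes fin: "finite I" and p: "psd_on I A" and s: "spec I A e l"
  shows "ent I A = (\<Sum>k\<in>I. eta (l k))"
proof -
  have "\<exists>e' l'. spec I A e' l' \<and> ent I A = (\<Sum>k\<in>I. eta (l' k))"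
    unfolding ent_def by (rule someI_ex) (use s in blast)
  then obtain e' l' where s': "spec I A e' l'" "ent I A = (\<Sum>k\<in>I. eta (l' k))" by blast
  have *: "(\<Sum>k\<in>I. eta (l k)) \<le> (\<Sum>k\<in>I. eta (l' k))"
    if "spec I A e l" "spec I A e' l'" for e l e' l'
    using spec_eta_le_basis[OF fin that(1) p specD(1)[OF that(2)]]
      spec_qf_basis[OF fin that(2)] by simp
  show ?thesis using *[OF s s'(1)] *[OF s'(1) s] s'(2) by simp
qed

lemma psd_spec:
  assumes "finite I" "psd_on I A"
  obtains e l where "spec I A e l" "\<And>k. k \<in> I \<Longrightarrow> 0 \<le> l k" "ent I A = (\<Sum>k\<in>I. eta (l k))"
  using spectral[OF assms(1) psd_on_herm[OF assms(2)]] ent_spec[OF assms] spec_psd[OF assms(1)] assms(2)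
  by metis

lemma ent_cong:
  assumes "\<And>x y. x \<in> I \<Longrightarrow> y \<in> I \<Longrightarrow> A x y = B x y"
  shows "ent I A = ent I B"
  unfolding ent_def using spec_cong[of I A B] assms by presburger

lemma ent_le_basis:
  assumes "finite I" "psd_on I A" "onb I f"
  shows "ent I A \<le> (\<Sum>j\<in>I. eta (Re (qf I A (f j) (f j))))"
  using psd_spec[OF assms(1,2)] spec_eta_le_basis[OF assms(1) _ assms(2,3)] by metis

lemma qf_psd_nonneg: "psd_on I A \<Longrightarrow> 0 \<le> Re (qf I A f f)"
  unfolding psd_on_def by auto

lemma onb_trace:
  assumes "finite I" "onb I f"
  shows "(\<Sum>j\<in>I. Re (qf I A (f j) (f j))) = tr_on I A"
proof -
  have "(\<Sum>j\<in>I. qf I A (f j) (f j)) = (\<Sum>j\<in>I. \<Sum>x\<in>I. \<Sum>y\<in>I. A x y * (f j y * cnj (f j x)))"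
    unfolding qf_def by (simp add: mult_ac)
  also have "\<dots> = (\<Sum>x\<in>I. \<Sum>j\<in>I. \<Sum>y\<in>I. A x y * (f j y * cnj (f j x)))"
    by (rule sum.swap)
  also have "\<dots> = (\<Sum>x\<in>I. \<Sum>y\<in>I. \<Sum>j\<in>I. A x y * (f j y * cnj (f j x)))"
    by (intro sum.cong refl sum.swap)
  also have "\<dots> = (\<Sum>x\<in>I. \<Sum>y\<in>I. A x y * (if y = x then 1 else 0))"
    unfolding sum_distrib_left[symmetric] using onbD2[OF assms(2)] by (intro sum.cong refl) simp
  also have "\<dots> = (\<Sum>x\<in>I. A x x)" using assms(1) by (simp add: mult_delta_right)
  finally show ?thesis unfolding tr_on_def by (metis Re_sum)
qed

text \<open>Dually to the bound by an orthonormal basis, the eigenvalues majorize the weights of any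
  decomposition into rank-one operators; the coefficients of the vectors in the eigenbasis form
  a substochastic matrix by Bessel's inequality.\<close>
lemma ent_le_decomp:
  assumes fin: "finite I" and R: "finite R"
    and A: "\<And>x y. x \<in> I \<Longrightarrow> y \<in> I \<Longrightarrow> A x y = (\<Sum>r\<in>R. v r x * cnj (v r y))"
  shows "ent I A \<le> (\<Sum>r\<in>R. eta (\<Sum>x\<in>I. (cmod (v r x))\<^sup>2))"
proof -
  have "psd_on I (\<lambda>x y. \<Sum>r\<in>R. v r x * cnj (v r y))" by (intro psd_on_sum psd_on_outer)
  then have p: "psd_on I A" by (subst psd_on_cong[OF A])
  obtain e l where s: "spec I A e l" "\<And>k. k \<in> I \<Longrightarrow> 0 \<le> l k" "ent I A = (\<Sum>k\<in>I. eta (l k))"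
    using psd_spec[OF fin p] by blast
  note e = specD(1)[OF s(1)]
  define c where "c = (\<lambda>r k. ip I (e k) (v r))"
  \<comment> \<open>Zero eigenvalues are dropped because the weights a divide by l k.\<close>
  define K where "K = {k \<in> I. 0 < l k}"
  have K: "finite K" "K \<subseteq> I" unfolding K_def using fin by auto
  have cc: "(\<Sum>r\<in>R. c r j * cnj (c r k)) = (if j = k then complex_of_real (l k) else 0)"
    if "j \<in> I" "k \<in> I" for j k
  proof -
    have "(\<Sum>r\<in>R. c r j * cnj (c r k)) = (\<Sum>r\<in>R. qf I (\<lambda>x y. v r x * cnj (v r y)) (e j) (e k))"
      unfolding c_def qf_outer by (simp add: ip_cnj)
    also have "\<dots> = qf I A (e j) (e k)"
      unfolding qf_sum[symmetric] by (intro qf_cong refl) (simp add: A)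
    finally show ?thesis using spec_qf_basis[OF fin s(1) that] by simp
  qed
  have ccr: "(\<Sum>r\<in>R. (cmod (c r k))\<^sup>2) = l k" if "k \<in> I" for k
  proof -
    have "complex_of_real (\<Sum>r\<in>R. (cmod (c r k))\<^sup>2) = complex_of_real (l k)"
      unfolding of_real_sum complex_norm_square using cc[OF that that] by simp
    then show ?thesis by (simp only: of_real_eq_iff)
  qed
  have c0: "c r k = 0" if "k \<in> I - K" "r \<in> R" for r k
  proof -
    have "(\<Sum>r\<in>R. (cmod (c r k))\<^sup>2) = 0" using ccr[of k] that s(2)[of k] unfolding K_def by auto
    then show ?thesis using that(2) R by (simp add: sum_nonneg_eq_0_iff)
  qed
  define a where "a = (\<lambda>r k. (cmod (c r k))\<^sup>2 / l k)"
  have a1: "(\<Sum>r\<in>R. a r k) = 1" if "k \<in> K" for k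
    unfolding a_def sum_divide_distrib[symmetric] using ccr[of k] that K_def by auto
  have bessel: "(\<Sum>k\<in>K. a r k) \<le> 1" if r: "r \<in> R" for r
  proof -
    \<comment> \<open>The vectors q \<mapsto> c q k / sqrt (l k), k in K, are orthonormal by
      \<open>cc\<close>. w is the projection of the unit vector at r onto their span; S is both its
      squared norm and its coordinate at r, so S^2 \<le> S.\<close>
    define t where "t = (\<lambda>k. cnj (c r k) / complex_of_real (l k))"
    define w where "w = (\<lambda>q. \<Sum>k\<in>K. t k * c q k)"
    define S where "S = (\<Sum>k\<in>K. a r k)"
    have S0: "S \<ge> 0" unfolding S_def a_def by (intro sum_nonneg) (auto simp: K_def)
    have ta: "t k * c r k = complex_of_real (a r k)" for k
      unfolding t_def a_def of_real_divide complex_norm_square by simp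
    have wr: "w r = complex_of_real S"
      unfolding w_def S_def of_real_sum using ta by simp
    have "complex_of_real (\<Sum>q\<in>R. (cmod (w q))\<^sup>2) = (\<Sum>q\<in>R. w q * cnj (w q))"
      unfolding of_real_sum complex_norm_square by simp
    also have "\<dots> = (\<Sum>q\<in>R. \<Sum>j\<in>K. \<Sum>k\<in>K. t j * cnj (t k) * (c q j * cnj (c q k)))"
      unfolding w_def by (intro sum.cong refl) (simp add: cnj_sum sum_product mult_ac)
    also have "\<dots> = (\<Sum>j\<in>K. \<Sum>q\<in>R. \<Sum>k\<in>K. t j * cnj (t k) * (c q j * cnj (c q k)))"
      by (rule sum.swap)
    also have "\<dots> = (\<Sum>j\<in>K. \<Sum>k\<in>K. \<Sum>q\<in>R. t j * cnj (t k) * (c q j * cnj (c q k)))"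
      by (intro sum.cong refl sum.swap)
    also have "\<dots> = (\<Sum>j\<in>K. \<Sum>k\<in>K. if j = k then t j * cnj (t k) * complex_of_real (l k) else 0)"
      unfolding sum_distrib_left[symmetric] by (intro sum.cong refl) (simp add: cc subsetD[OF K(2)])
    also have "\<dots> = (\<Sum>j\<in>K. t j * cnj (t j) * complex_of_real (l j))" using K(1) by simp
    also have "\<dots> = (\<Sum>j\<in>K. complex_of_real (a r j))"
    proof (intro sum.cong refl)
      fix j assume j: "j \<in> K"
      then have "l j \<noteq> 0" unfolding K_def by auto
      then have "cnj (t j) * complex_of_real (l j) = c r j" unfolding t_def by simp
      then show "t j * cnj (t j) * complex_of_real (l j) = complex_of_real (a r j)"
        using ta[of j] by (simp add: mult.assoc)
    qed
    finally have "(\<Sum>q\<in>R. (cmod (w q))\<^sup>2) = S" unfolding S_def of_real_sum[symmetric]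
      by (simp only: of_real_eq_iff)
    moreover have "(cmod (w r))\<^sup>2 \<le> (\<Sum>q\<in>R. (cmod (w q))\<^sup>2)"
      using r R by (intro member_le_sum) auto
    ultimately have "S\<^sup>2 \<le> S" unfolding wr using S0 by simp
    then have "S \<le> 1" by (cases "0 < S") (auto simp: power2_eq_square mult_le_cancel_left2)
    then show ?thesis by (simp add: S_def)
  qed
  have nv: "(\<Sum>x\<in>I. (cmod (v r x))\<^sup>2) = (\<Sum>k\<in>K. a r k * l k)" if "r \<in> R" for r
  proof -
    have "(\<Sum>x\<in>I. (cmod (v r x))\<^sup>2) = (\<Sum>k\<in>I. (cmod (c r k))\<^sup>2)"
      unfolding c_def using onb_parseval_norm[OF fin e] by simp
    also have "\<dots> = (\<Sum>k\<in>K. (cmod (c r k))\<^sup>2)"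
      using c0 that by (intro sum.mono_neutral_right fin K) auto
    also have "\<dots> = (\<Sum>k\<in>K. a r k * l k)" by (intro sum.cong refl) (auto simp: a_def K_def)
    finally show ?thesis .
  qed
  have "ent I A = (\<Sum>k\<in>K. eta (l k))" unfolding s(3)
  proof (intro sum.mono_neutral_right fin)
    show "\<forall>i\<in>I - K. eta (l i) = 0"
    proof
      fix i assume "i \<in> I - K"
      then have "l i = 0" using s(2)[of i] unfolding K_def by auto
      then show "eta (l i) = 0" by simp
    qed
  qed (rule K(2))
  also have "\<dots> = (\<Sum>k\<in>K. (\<Sum>r\<in>R. a r k) * eta (l k))" by (simp add: a1)
  also have "\<dots> = (\<Sum>r\<in>R. \<Sum>k\<in>K. a r k * eta (l k))"
    unfolding sum_distrib_right by (rule sum.swap)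
  also have "\<dots> \<le> (\<Sum>r\<in>R. eta (\<Sum>k\<in>K. a r k * l k))"
    by (intro sum_mono eta_jensen_sub K(1) bessel) (auto simp: a_def K_def)
  finally show ?thesis by (simp add: nv)
qed

lemma psd_decomp:
  assumes fin: "finite I" and p: "psd_on I A"
  obtains e l where "onb I e" "\<And>k. k \<in> I \<Longrightarrow> 0 \<le> l k" "ent I A = (\<Sum>k\<in>I. eta (l k))"
    "tr_on I A = (\<Sum>k\<in>I. l k)"
    "\<And>x y. x \<in> I \<Longrightarrow> y \<in> I \<Longrightarrow>
      A x y = (\<Sum>k\<in>I. (complex_of_real (sqrt (l k)) * e k x) * cnj (complex_of_real (sqrt (l k)) * e k y))"
proof -
  obtain e l where s: "spec I A e l" "\<And>k. k \<in> I \<Longrightarrow> 0 \<le> l k" "ent I A = (\<Sum>k\<in>I. eta (l k))"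
    using psd_spec[OF fin p] by blast
  have "A x y = (\<Sum>k\<in>I. (complex_of_real (sqrt (l k)) * e k x) * cnj (complex_of_real (sqrt (l k)) * e k y))"
    if "x \<in> I" "y \<in> I" for x y
    unfolding specD(2)[OF s(1) that]
  proof (intro sum.cong refl)
    fix k assume "k \<in> I"
    then have "complex_of_real (l k) = complex_of_real (sqrt (l k)) * complex_of_real (sqrt (l k))"
      using s(2)[of k] by (simp flip: of_real_mult)
    then show "complex_of_real (l k) * e k x * cnj (e k y) =
      complex_of_real (sqrt (l k)) * e k x * cnj (complex_of_real (sqrt (l k)) * e k y)"
      by (simp add: mult_ac)
  qed
  then show ?thesis using that s(2,3) specD(1)[OF s(1)] spec_tr[OF fin s(1)] by blast
qed

text \<open>The eigenvectors of all summands, scaled by the roots of their eigenvalues, form one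
  rank-one decomposition of the sum, to which \<open>ent_le_decomp\<close> applies.\<close>

lemma ent_sum_le:
  assumes fin: "finite I" and S: "finite S" and p: "\<And>s. s \<in> S \<Longrightarrow> psd_on I (A s)"
  shows "ent I (\<lambda>x y. \<Sum>s\<in>S. A s x y) \<le> (\<Sum>s\<in>S. ent I (A s))"
proof -
  have "\<forall>s\<in>S. \<exists>e l. onb I e \<and> (\<forall>k\<in>I. 0 \<le> l k) \<and> ent I (A s) = (\<Sum>k\<in>I. eta (l k)) \<and>
    (\<forall>x\<in>I. \<forall>y\<in>I. A s x y = (\<Sum>k\<in>I. (complex_of_real (sqrt (l k)) * e k x) * cnj (complex_of_real (sqrt (l k)) * e k y)))"
  proof
    fix s assume "s \<in> S"
    show "\<exists>e l. onb I e \<and> (\<forall>k\<in>I. 0 \<le> l k) \<and> ent I (A s) = (\<Sum>k\<in>I. eta (l k)) \<and>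
      (\<forall>x\<in>I. \<forall>y\<in>I. A s x y = (\<Sum>k\<in>I. (complex_of_real (sqrt (l k)) * e k x) * cnj (complex_of_real (sqrt (l k)) * e k y)))"
      by (rule psd_decomp[OF fin p[OF \<open>s \<in> S\<close>]]) blast
  qed
  from bchoice[OF this] obtain e where "\<forall>s\<in>S. \<exists>l. onb I (e s) \<and> (\<forall>k\<in>I. 0 \<le> l k) \<and> ent I (A s) = (\<Sum>k\<in>I. eta (l k)) \<and>
    (\<forall>x\<in>I. \<forall>y\<in>I. A s x y = (\<Sum>k\<in>I. (complex_of_real (sqrt (l k)) * e s k x) * cnj (complex_of_real (sqrt (l k)) * e s k y)))" ..
  from bchoice[OF this] obtain l where el: "\<And>s. s \<in> S \<Longrightarrow> onb I (e s)" "\<And>s k. s \<in> S \<Longrightarrow> k \<in> I \<Longrightarrow> 0 \<le> l s k"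
    "\<And>s. s \<in> S \<Longrightarrow> ent I (A s) = (\<Sum>k\<in>I. eta (l s k))"
    "\<And>s x y. s \<in> S \<Longrightarrow> x \<in> I \<Longrightarrow> y \<in> I \<Longrightarrow> A s x y = (\<Sum>k\<in>I. (complex_of_real (sqrt (l s k)) * e s k x) * cnj (complex_of_real (sqrt (l s k)) * e s k y))"
    by blast
  define v where "v = (\<lambda>(s, k) x. complex_of_real (sqrt (l s k)) * e s k x)"
  have "ent I (\<lambda>x y. \<Sum>s\<in>S. A s x y) \<le> (\<Sum>r\<in>S \<times> I. eta (\<Sum>x\<in>I. (cmod (v r x))\<^sup>2))"
  proof (intro ent_le_decomp)
    fix x y assume xy: "x \<in> I" "y \<in> I"
    have "(\<Sum>s\<in>S. A s x y) = (\<Sum>s\<in>S. \<Sum>k\<in>I. v (s, k) x * cnj (v (s, k) y))"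
      using xy by (intro sum.cong refl) (simp add: el(4) v_def)
    then show "(\<Sum>s\<in>S. A s x y) = (\<Sum>r\<in>S \<times> I. v r x * cnj (v r y))"
      by (simp add: sum.cartesian_product)
  qed (use fin S in auto)
  also have "\<dots> = (\<Sum>s\<in>S. \<Sum>k\<in>I. eta (\<Sum>x\<in>I. (cmod (v (s, k) x))\<^sup>2))"
    by (simp add: sum.cartesian_product)
  also have "\<dots> = (\<Sum>s\<in>S. \<Sum>k\<in>I. eta (l s k))"
    using el(2) onb_norm[OF el(1)]
    by (intro sum.cong refl) (simp add: v_def norm_mult power_mult_distrib sum_distrib_left[symmetric])
  finally show ?thesis using el(3) by simp
qed

text \<open>All summands are measured in the eigenbasis of the sum. There each eigenvalue of the sum
  is split into at most N parts, which costs log N per unit of trace. With \<open>ent_sum_le\<close>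
  this is the almost affinity of the entropy.\<close>

lemma ent_sum_ge:
  assumes fin: "finite I" and S: "finite S" "card S \<le> N" and p: "\<And>s. s \<in> S \<Longrightarrow> psd_on I (A s)"
  shows "(\<Sum>s\<in>S. ent I (A s)) \<le> ent I (\<lambda>x y. \<Sum>s\<in>S. A s x y) + (\<Sum>s\<in>S. tr_on I (A s)) * log 2 (real N)"
proof -
  have P: "psd_on I (\<lambda>x y. \<Sum>s\<in>S. A s x y)" using p by (rule psd_on_sum)
  obtain e l where s: "spec I (\<lambda>x y. \<Sum>s\<in>S. A s x y) e l" "ent I (\<lambda>x y. \<Sum>s\<in>S. A s x y) = (\<Sum>k\<in>I. eta (l k))"
    using psd_spec[OF fin P] by blast
  note e = specD(1)[OF s(1)]
  define q where "q = (\<lambda>s k. Re (qf I (A s) (e k) (e k)))"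
  have l: "l k = (\<Sum>s\<in>S. q s k)" if "k \<in> I" for k
    using spec_qf_basis[OF fin s(1) that that] unfolding q_def qf_sum
    by (metis Re_complex_of_real Re_sum)
  have "(\<Sum>s\<in>S. ent I (A s)) \<le> (\<Sum>s\<in>S. \<Sum>k\<in>I. eta (q s k))"
    unfolding q_def by (intro sum_mono ent_le_basis fin p e)
  also have "\<dots> = (\<Sum>k\<in>I. \<Sum>s\<in>S. eta (q s k))" by (rule sum.swap)
  also have "\<dots> \<le> (\<Sum>k\<in>I. eta (\<Sum>s\<in>S. q s k) + (\<Sum>s\<in>S. q s k) * log 2 (real N))"
    using p S by (intro sum_mono eta_sum_le_card) (auto simp: q_def qf_psd_nonneg)
  also have "\<dots> = (\<Sum>k\<in>I. eta (l k)) + (\<Sum>k\<in>I. \<Sum>s\<in>S. q s k) * log 2 (real N)"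
    by (simp add: l sum.distrib sum_distrib_right)
  also have "(\<Sum>k\<in>I. \<Sum>s\<in>S. q s k) = (\<Sum>s\<in>S. tr_on I (A s))"
    unfolding onb_trace[OF fin e, symmetric] q_def by (rule sum.swap)
  finally show ?thesis using s(2) by simp
qed

lemma spec_scale: "spec I A e l \<Longrightarrow> spec I (\<lambda>x y. complex_of_real c * A x y) e (\<lambda>k. c * l k)"
  unfolding spec_def by (simp add: sum_distrib_left mult.assoc)

lemma ent_scale:
  assumes fin: "finite I" and p: "psd_on I A" and c: "0 \<le> c"
  shows "ent I (\<lambda>x y. complex_of_real c * A x y) = c * ent I A + tr_on I A * eta c"
proof -
  obtain e l where s: "spec I A e l" "\<And>k. k \<in> I \<Longrightarrow> 0 \<le> l k" "ent I A = (\<Sum>k\<in>I. eta (l k))"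
    using psd_spec[OF fin p] by blast
  have "ent I (\<lambda>x y. complex_of_real c * A x y) = (\<Sum>k\<in>I. eta (c * l k))"
    by (rule ent_spec[OF fin psd_on_scale[OF p c] spec_scale[OF s(1)]])
  also have "\<dots> = (\<Sum>k\<in>I. c * eta (l k) + l k * eta c)"
    using s(2) c by (intro sum.cong refl) (auto simp: eta_mult)
  finally show ?thesis unfolding s(3) spec_tr[OF fin s(1)]
    by (simp add: sum.distrib sum_distrib_left sum_distrib_right)
qed

lemma ent_nonneg:
  assumes fin: "finite I" and p: "psd_on I A" and t: "tr_on I A \<le> 1"
  shows "0 \<le> ent I A"
proof -
  obtain e l where s: "spec I A e l" "\<And>k. k \<in> I \<Longrightarrow> 0 \<le> l k" "ent I A = (\<Sum>k\<in>I. eta (l k))"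
    using psd_spec[OF fin p] by blast
  have "l k \<le> 1" if "k \<in> I" for k
    using member_le_sum[of k I l] s(2) that fin t spec_tr[OF fin s(1)] by auto
  then show ?thesis unfolding s(3) using s(2) by (intro sum_nonneg eta_ge_0)
qed

lemma ent_le_card:
  assumes fin: "finite I" and p: "psd_on I A"
  shows "ent I A \<le> eta (tr_on I A) + tr_on I A * log 2 (real (card I))"
proof -
  obtain e l where s: "spec I A e l" "\<And>k. k \<in> I \<Longrightarrow> 0 \<le> l k" "ent I A = (\<Sum>k\<in>I. eta (l k))"
    using psd_spec[OF fin p] by blast
  then show ?thesis unfolding s(3) spec_tr[OF fin s(1)] using fin by (intro eta_sum_le_card) auto
qed

lemma ent_ge_eta_trace:
  assumes fin: "finite I" and p: "psd_on I A"
  shows "eta (tr_on I A) \<le> ent I A"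
proof -
  obtain e l where s: "spec I A e l" "\<And>k. k \<in> I \<Longrightarrow> 0 \<le> l k" "ent I A = (\<Sum>k\<in>I. eta (l k))"
    using psd_spec[OF fin p] by blast
  then show ?thesis unfolding s(3) spec_tr[OF fin s(1)] using fin by (intro eta_sum_ge) auto
qed

lemma ent_reindex:
  assumes b: "bij_betw h I J" and fin: "finite J" and p: "psd_on J A"
  shows "ent I (\<lambda>x y. A (h x) (h y)) = ent J A"
proof -
  have fI: "finite I" using b fin by (simp add: bij_betw_finite)
  obtain e l where s: "spec J A e l" "ent J A = (\<Sum>k\<in>J. eta (l k))"
    using psd_spec[OF fin p] by blast
  have "ent I (\<lambda>x y. A (h x) (h y)) = (\<Sum>k\<in>I. eta (l (h k)))"
    using ent_spec[OF fI _ spec_reindex[OF b s(1)]] psd_on_reindex[OF b] p by metis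
  then show ?thesis using s(2) sum.reindex_bij_betw[OF b, of "\<lambda>k. eta (l k)"] by simp
qed

lemma tr_on_reindex: "bij_betw h I J \<Longrightarrow> tr_on I (\<lambda>x y. A (h x) (h y)) = tr_on J A"
  unfolding tr_on_def by (rule sum.reindex_bij_betw)

section \<open>Partial traces and the entropy cost of discarding a factor\<close>

definition ptr2 :: "'j set \<Rightarrow> ('i \<times> 'j \<Rightarrow> 'i \<times> 'j \<Rightarrow> complex) \<Rightarrow> 'i \<Rightarrow> 'i \<Rightarrow> complex" where
  "ptr2 J A x x' = (\<Sum>j\<in>J. A (x, j) (x', j))"

definition ptr1 :: "'i set \<Rightarrow> ('i \<times> 'j \<Rightarrow> 'i \<times> 'j \<Rightarrow> complex) \<Rightarrow> 'j \<Rightarrow> 'j \<Rightarrow> complex" where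
  "ptr1 I A y y' = (\<Sum>i\<in>I. A (i, y) (i, y'))"

text \<open>Slicing each eigenvector along J turns the partial trace into a rank-one decomposition
  in which every eigenvalue is split into at most \<open>card J\<close> parts.\<close>

lemma ent_ptr2:
  assumes I: "finite I" and J: "finite J" and p: "psd_on (I \<times> J) A"
  shows "ent I (ptr2 J A) \<le> ent (I \<times> J) A + tr_on (I \<times> J) A * log 2 (real (card J))"
proof -
  have fin: "finite (I \<times> J)" using I J by simp
  obtain e l where s: "onb (I \<times> J) e" "\<And>k. k \<in> I \<times> J \<Longrightarrow> 0 \<le> l k" "ent (I \<times> J) A = (\<Sum>k\<in>I \<times> J. eta (l k))"
     "tr_on (I \<times> J) A = (\<Sum>k\<in>I \<times> J. l k)"
    "\<And>x y. x \<in> I \<times> J \<Longrightarrow> y \<in> I \<times> J \<Longrightarrow>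
      A x y = (\<Sum>k\<in>I \<times> J. (complex_of_real (sqrt (l k)) * e k x) * cnj (complex_of_real (sqrt (l k)) * e k y))"
    using psd_decomp[OF fin p] by blast
  define v where "v = (\<lambda>(j, k) x. complex_of_real (sqrt (l k)) * e k (x, j))"
  define q where "q = (\<lambda>k j. l k * (\<Sum>x\<in>I. (cmod (e k (x, j)))\<^sup>2))"
  have q0: "k \<in> I \<times> J \<Longrightarrow> 0 \<le> q k j" for k j
    unfolding q_def using s(2) by (intro mult_nonneg_nonneg sum_nonneg) auto
  have qs: "(\<Sum>j\<in>J. q k j) = l k" if "k \<in> I \<times> J" for k
  proof -
    have "(\<Sum>j\<in>J. q k j) = l k * (\<Sum>x\<in>I. \<Sum>j\<in>J. (cmod (e k (x, j)))\<^sup>2)"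
      unfolding q_def sum_distrib_left[symmetric] by (subst sum.swap) simp
    then show ?thesis using onb_norm[OF s(1) that] by (simp add: sum.cartesian_product)
  qed
  have "ent I (ptr2 J A) \<le> (\<Sum>r\<in>J \<times> (I \<times> J). eta (\<Sum>x\<in>I. (cmod (v r x))\<^sup>2))"
  proof (intro ent_le_decomp)
    fix x y assume xy: "x \<in> I" "y \<in> I"
    have "ptr2 J A x y = (\<Sum>j\<in>J. \<Sum>k\<in>I \<times> J. v (j, k) x * cnj (v (j, k) y))"
      unfolding ptr2_def using xy by (intro sum.cong refl) (simp add: s(5) v_def)
    then show "ptr2 J A x y = (\<Sum>r\<in>J \<times> (I \<times> J). v r x * cnj (v r y))"
      by (simp add: sum.cartesian_product)
  qed (use I J in auto)
  also have "\<dots> = (\<Sum>j\<in>J. \<Sum>k\<in>I \<times> J. eta (\<Sum>x\<in>I. (cmod (v (j, k) x))\<^sup>2))"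
    by (simp add: sum.cartesian_product)
  also have "\<dots> = (\<Sum>j\<in>J. \<Sum>k\<in>I \<times> J. eta (q k j))"
  proof (intro sum.cong refl arg_cong[where f = eta])
    fix j k assume "k \<in> I \<times> J"
    then show "(\<Sum>x\<in>I. (cmod (v (j, k) x))\<^sup>2) = q k j"
      using s(2)[of k] by (simp add: v_def q_def norm_mult power_mult_distrib sum_distrib_left)
  qed
  also have "\<dots> = (\<Sum>k\<in>I \<times> J. \<Sum>j\<in>J. eta (q k j))" by (rule sum.swap)
  also have "\<dots> \<le> (\<Sum>k\<in>I \<times> J. eta (\<Sum>j\<in>J. q k j) + (\<Sum>j\<in>J. q k j) * log 2 (real (card J)))"
    using J q0 by (intro sum_mono eta_sum_le_card) auto
  also have "\<dots> = (\<Sum>k\<in>I \<times> J. eta (l k) + l k * log 2 (real (card J)))"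
    by (intro sum.cong refl) (simp add: qs)
  finally show ?thesis unfolding s(3,4) by (simp add: sum.distrib sum_distrib_right)
qed

lemma ent_ptr1:
  assumes I: "finite I" and J: "finite J" and p: "psd_on (I \<times> J) A"
  shows "ent J (ptr1 I A) \<le> ent (I \<times> J) A + tr_on (I \<times> J) A * log 2 (real (card I))"
proof -
  have b: "bij_betw prod.swap (J \<times> I) (I \<times> J)" by (auto simp: bij_betw_def inj_on_def image_def)
  have fin: "finite (I \<times> J)" using I J by simp
  show ?thesis
    using ent_ptr2[OF J I, of "\<lambda>x y. A (prod.swap x) (prod.swap y)"] p
    unfolding psd_on_reindex[OF b] ent_reindex[OF b fin p] tr_on_reindex[OF b]
    by (simp add: ptr2_def[abs_def] ptr1_def[abs_def])
qed

section \<open>Effects, the trace pairing and continuity of the entropy\<close>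

definition trp :: "'i set \<Rightarrow> ('i \<Rightarrow> 'i \<Rightarrow> complex) \<Rightarrow> ('i \<Rightarrow> 'i \<Rightarrow> complex) \<Rightarrow> real" where
  "trp I A B = Re (\<Sum>x\<in>I. \<Sum>y\<in>I. A x y * B y x)"

definition effect_on :: "'i set \<Rightarrow> ('i \<Rightarrow> 'i \<Rightarrow> complex) \<Rightarrow> bool" where
  "effect_on I T \<longleftrightarrow> psd_on I T \<and> psd_on I (\<lambda>x y. (if x = y then 1 else 0) - T x y)"

lemma trp_spec:
  assumes "spec I T e t"
  shows "trp I A T = (\<Sum>k\<in>I. t k * Re (qf I A (e k) (e k)))"
proof -
  have "(\<Sum>x\<in>I. \<Sum>y\<in>I. A x y * T y x) = (\<Sum>x\<in>I. \<Sum>y\<in>I. \<Sum>k\<in>I. complex_of_real (t k) * (cnj (e k x) * A x y * e k y))"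
    by (intro sum.cong refl) (simp add: specD(2)[OF assms] sum_distrib_left mult_ac)
  also have "\<dots> = (\<Sum>x\<in>I. \<Sum>k\<in>I. \<Sum>y\<in>I. complex_of_real (t k) * (cnj (e k x) * A x y * e k y))"
    by (intro sum.cong refl sum.swap)
  also have "\<dots> = (\<Sum>k\<in>I. \<Sum>x\<in>I. \<Sum>y\<in>I. complex_of_real (t k) * (cnj (e k x) * A x y * e k y))"
    by (rule sum.swap)
  also have "\<dots> = (\<Sum>k\<in>I. complex_of_real (t k) * qf I A (e k) (e k))"
    unfolding qf_def by (simp add: sum_distrib_left)
  finally show ?thesis unfolding trp_def by simp
qed

lemma spec_one_minus:
  assumes "spec I T e t"
  shows "spec I (\<lambda>x y. (if x = y then 1 else 0) - T x y) e (\<lambda>k. 1 - t k)"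
  using assms onbD2[OF specD(1)[OF assms]] unfolding spec_def
  by (simp add: algebra_simps sum_subtractf)

lemma effect_spec:
  assumes "finite I" "spec I T e t"
  shows "effect_on I T \<longleftrightarrow> (\<forall>k\<in>I. 0 \<le> t k \<and> t k \<le> 1)"
  unfolding effect_on_def spec_psd[OF assms] spec_psd[OF assms(1) spec_one_minus[OF assms(2)]] by auto

lemma trp_nonneg:
  assumes "finite I" "psd_on I A" "psd_on I B" shows "0 \<le> trp I A B"
proof -
  obtain e l where s: "spec I B e l" "\<And>k. k \<in> I \<Longrightarrow> 0 \<le> l k"
    using psd_spec[OF assms(1,3)] by blast
  show ?thesis unfolding trp_spec[OF s(1)] using s(2) qf_psd_nonneg[OF assms(2)]
    by (intro sum_nonneg mult_nonneg_nonneg) auto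
qed

lemma spec_sub:
  assumes o: "onb I e"
  shows "spec I (\<lambda>x y. \<Sum>k\<in>I. complex_of_real (l k) * e k x * cnj (e k y)) e l"
  using assms unfolding spec_def by simp

text \<open>Continuity in the trace norm: the difference of two positive operators is split into its
  positive and negative part, and both sides of A + N = B + P are compared with the almost
  additivity of the entropy.\<close>
lemma ent_continuity:
  assumes fin: "finite I" "card I \<ge> 1" and pA: "psd_on I A" and pB: "psd_on I B"
    and tr: "tr_on I A = \<tau>" "tr_on I B = \<tau>"
    and close: "\<And>T. effect_on I T \<Longrightarrow> trp I A T - trp I B T \<le> \<nu>"
  shows "ent I B \<le> ent I A + \<nu> * log 2 (real (card I)) + (\<tau> + \<nu>)"
proof -
  have "herm_on I (\<lambda>x y. A x y - B x y)"
    using pA pB unfolding herm_on_def psd_on_def qf_diff by simp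
  then obtain e l where s: "spec I (\<lambda>x y. A x y - B x y) e l" using spectral[OF fin(1)] by blast
  note o = specD(1)[OF s]
  \<comment> \<open>N and P are the negative and positive parts of A - B. T below projects onto the
    support of P and is the effect that best separates A from B, so the hypothesis on effects bounds
    the trace of P.\<close>
  define N where "N = (\<lambda>x y. \<Sum>k\<in>I. complex_of_real (max 0 (- l k)) * e k x * cnj (e k y))"
  define P where "P = (\<lambda>x y. \<Sum>k\<in>I. complex_of_real (max 0 (l k)) * e k x * cnj (e k y))"
  define T where "T = (\<lambda>x y. \<Sum>k\<in>I. complex_of_real (if 0 < l k then 1 else 0) * e k x * cnj (e k y))"
  have sN: "spec I N e (\<lambda>k. max 0 (- l k))" unfolding N_def by (rule spec_sub[OF o])
  have sP: "spec I P e (\<lambda>k. max 0 (l k))" unfolding P_def by (rule spec_sub[OF o])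
  have sT: "spec I T e (\<lambda>k. if 0 < l k then 1 else 0)" unfolding T_def by (rule spec_sub[OF o])
  have pN: "psd_on I N" and pP: "psd_on I P" and eT: "effect_on I T"
    unfolding spec_psd[OF fin(1) sN] spec_psd[OF fin(1) sP] effect_spec[OF fin(1) sT] by auto
  define \<beta> where "\<beta> = tr_on I P"
  have tr0: "(\<Sum>k\<in>I. l k) = 0" using spec_tr[OF fin(1) s] tr by (simp add: tr_on_diff)
  have "max 0 (l k) - max 0 (- l k) = l k" for k by auto
  then have "tr_on I P - tr_on I N = 0"
    unfolding spec_tr[OF fin(1) sP] spec_tr[OF fin(1) sN] sum_subtractf[symmetric] using tr0 by simp
  then have trN: "tr_on I N = \<beta>" by (simp add: \<beta>_def)
  have "trp I A T - trp I B T = (\<Sum>k\<in>I. (if 0 < l k then 1 else 0) * Re (qf I (\<lambda>x y. A x y - B x y) (e k) (e k)))"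
    unfolding trp_spec[OF sT] by (simp add: qf_diff sum_subtractf[symmetric] algebra_simps)
  also have "\<dots> = (\<Sum>k\<in>I. max 0 (l k))"
    by (intro sum.cong refl) (auto simp: spec_qf_basis[OF fin(1) s])
  finally have \<beta>: "0 \<le> \<beta>" "\<beta> \<le> \<nu>" using close[OF eT] spec_tr[OF fin(1) sP] tr_on_psd_nonneg[OF fin(1) pP]
    by (auto simp: \<beta>_def)
  have AN: "A x y + N x y = B x y + P x y" if "x \<in> I" "y \<in> I" for x y
  proof -
    have "P x y - N x y = A x y - B x y"
      unfolding P_def N_def specD(2)[OF s that] sum_subtractf[symmetric]
      by (intro sum.cong refl) (auto simp: max_def)
    then show ?thesis by (simp add: algebra_simps)
  qed
  have two: "ent I X + ent I Y \<le> ent I (\<lambda>x y. X x y + Y x y) + (tr_on I X + tr_on I Y)"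
            "ent I (\<lambda>x y. X x y + Y x y) \<le> ent I X + ent I Y"
    if "psd_on I X" "psd_on I Y" for X Y
    using ent_sum_ge[OF fin(1), of "{True, False}" 2 "\<lambda>b. if b then X else Y"]
      ent_sum_le[OF fin(1), of "{True, False}" "\<lambda>b. if b then X else Y"] that by auto
  have "ent I B + ent I P \<le> ent I (\<lambda>x y. B x y + P x y) + (\<tau> + \<beta>)"
    using two(1)[OF pB pP] tr by (simp add: \<beta>_def)
  also have "ent I (\<lambda>x y. B x y + P x y) = ent I (\<lambda>x y. A x y + N x y)"
    by (rule ent_cong) (simp add: AN)
  also have "\<dots> \<le> ent I A + ent I N" by (rule two(2)[OF pA pN])
  also have "ent I N \<le> eta \<beta> + \<beta> * log 2 (real (card I))"
    using ent_le_card[OF fin(1) pN] by (simp add: trN)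
  \<comment> \<open>The term eta \<beta> in the bound for N is cancelled by the lower bound eta
    \<beta> for the entropy of P, since N and P have equal trace; the error thus stays linear in
    \<beta>.\<close>
  finally have "ent I B \<le> ent I A + \<beta> * log 2 (real (card I)) + (\<tau> + \<beta>)"
    using ent_ge_eta_trace[OF fin(1) pP] by (simp add: \<beta>_def)
  also have "\<dots> \<le> ent I A + \<nu> * log 2 (real (card I)) + (\<tau> + \<nu>)"
    using \<beta> fin by (intro add_mono mult_right_mono) auto
  finally show ?thesis .
qed

section \<open>Relative entropy as an integral of quadratic forms\<close>

text \<open>In trace notation: 2 Re tr Y(R - S) - u tr Y R Y' - (1 - u) tr Y' S Y, with Y' the
  adjoint of Y. R and S multiply Y from different sides, so both quadratic terms are diagonal in one
  basis of operators; for fixed Y the value is linear in the pair (R, S).\<close>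

definition Fu :: "'i set \<Rightarrow> ('i \<Rightarrow> 'i \<Rightarrow> complex) \<Rightarrow> ('i \<Rightarrow> 'i \<Rightarrow> complex) \<Rightarrow> real \<Rightarrow> ('i \<Rightarrow> 'i \<Rightarrow> complex) \<Rightarrow> real" where
  "Fu I R S u Y = 2 * Re (\<Sum>x\<in>I. \<Sum>y\<in>I. Y x y * (R y x - S y x))
     - u * (\<Sum>z\<in>I. Re (qf I R (\<lambda>x. cnj (Y z x)) (\<lambda>x. cnj (Y z x))))
     - (1 - u) * (\<Sum>z\<in>I. Re (qf I S (\<lambda>x. Y x z) (\<lambda>x. Y x z)))"

text \<open>By completing the square this is the quadratic form of the inverse of Y \<mapsto> u Y R
  + (1 - u) S Y at R - S; the supremum avoids inverting a possibly singular map.\<close>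

definition Qu :: "'i set \<Rightarrow> ('i \<Rightarrow> 'i \<Rightarrow> complex) \<Rightarrow> ('i \<Rightarrow> 'i \<Rightarrow> complex) \<Rightarrow> real \<Rightarrow> real" where
  "Qu I R S u = (SUP Y. Fu I R S u Y)"

lemma Fu_sum:
  "Fu I (\<lambda>x y. \<Sum>s\<in>T. R s x y) (\<lambda>x y. \<Sum>s\<in>T. S s x y) u Y = (\<Sum>s\<in>T. Fu I (R s) (S s) u Y)"
proof -
  have 1: "(\<Sum>x\<in>I. \<Sum>y\<in>I. Y x y * ((\<Sum>s\<in>T. R s y x) - (\<Sum>s\<in>T. S s y x)))
    = (\<Sum>s\<in>T. \<Sum>x\<in>I. \<Sum>y\<in>I. Y x y * (R s y x - S s y x))"
  proof -
    have "(\<Sum>x\<in>I. \<Sum>y\<in>I. Y x y * ((\<Sum>s\<in>T. R s y x) - (\<Sum>s\<in>T. S s y x)))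
      = (\<Sum>x\<in>I. \<Sum>y\<in>I. \<Sum>s\<in>T. Y x y * (R s y x - S s y x))"
      by (simp add: sum_subtractf[symmetric] sum_distrib_left)
    also have "\<dots> = (\<Sum>x\<in>I. \<Sum>s\<in>T. \<Sum>y\<in>I. Y x y * (R s y x - S s y x))"
      by (intro sum.cong refl sum.swap)
    also have "\<dots> = (\<Sum>s\<in>T. \<Sum>x\<in>I. \<Sum>y\<in>I. Y x y * (R s y x - S s y x))"
      by (rule sum.swap)
    finally show ?thesis .
  qed
  have 2: "(\<Sum>z\<in>I. \<Sum>s\<in>T. g s z) = (\<Sum>s\<in>T. \<Sum>z\<in>I. g s z)" for g :: "'b \<Rightarrow> 'a \<Rightarrow> real"
    by (rule sum.swap)
  show ?thesis
    unfolding Fu_def 1 qf_sum Re_sum 2 sum_distrib_left sum_subtractf ..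
qed

text \<open>With the matrix elements of Y taken between the eigenbasis e of R and the eigenbasis f
  of S, the functional decouples into one scalar quadratic for each pair (i, j).\<close>

lemma Fu_spec:
  assumes fin: "finite I" and e: "spec I R e l" and f: "spec I S f m"
  shows "Fu I R S u Y = (\<Sum>i\<in>I. \<Sum>j\<in>I. 2 * (l i - m j) * Re (ip I (f j) (\<lambda>x. \<Sum>z\<in>I. Y x z * e i z) * ip I (e i) (f j))
     - (u * l i + (1 - u) * m j) * (cmod (ip I (f j) (\<lambda>x. \<Sum>z\<in>I. Y x z * e i z)))\<^sup>2)"
proof -
  note oe = specD(1)[OF e] and of = specD(1)[OF f]
  define y where "y = (\<lambda>i j. ip I (f j) (\<lambda>x. \<Sum>z\<in>I. Y x z * e i z))"
  define c where "c = (\<lambda>i j. ip I (e i) (f j))"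
  have y': "y i j = ip I (\<lambda>z. \<Sum>x\<in>I. cnj (Y x z) * f j x) (e i)" for i j
    unfolding y_def ip_def cnj_sum sum_distrib_left sum_distrib_right
    by (subst sum.swap) (simp add: mult_ac)
  have tr: "(\<Sum>x\<in>I. \<Sum>y\<in>I. Y x y * A y x) = (\<Sum>k\<in>I. complex_of_real (n k) * ip I (g k) (\<lambda>x. \<Sum>z\<in>I. Y x z * g k z))"
    if "spec I A g n" for A g n
  proof -
    have "(\<Sum>x\<in>I. \<Sum>y\<in>I. Y x y * A y x) = (\<Sum>x\<in>I. \<Sum>y\<in>I. \<Sum>k\<in>I. complex_of_real (n k) * (cnj (g k x) * (Y x y * g k y)))"
      by (intro sum.cong refl) (simp add: specD(2)[OF that] sum_distrib_left mult_ac)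
    also have "\<dots> = (\<Sum>x\<in>I. \<Sum>k\<in>I. \<Sum>y\<in>I. complex_of_real (n k) * (cnj (g k x) * (Y x y * g k y)))"
      by (intro sum.cong refl sum.swap)
    also have "\<dots> = (\<Sum>k\<in>I. \<Sum>x\<in>I. \<Sum>y\<in>I. complex_of_real (n k) * (cnj (g k x) * (Y x y * g k y)))"
      by (rule sum.swap)
    finally show ?thesis unfolding ip_def by (simp add: sum_distrib_left)
  qed
  have trR: "(\<Sum>x\<in>I. \<Sum>y\<in>I. Y x y * R y x) = (\<Sum>i\<in>I. \<Sum>j\<in>I. complex_of_real (l i) * (c i j * y i j))"
    unfolding tr[OF e] c_def y_def sum_distrib_left[symmetric] onb_parseval[OF fin of] ..
  have "ip I (f j) (\<lambda>x. \<Sum>z\<in>I. Y x z * f j z) = ip I (\<lambda>z. \<Sum>x\<in>I. cnj (Y x z) * f j x) (f j)" for j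
    unfolding ip_def cnj_sum sum_distrib_left sum_distrib_right
    by (subst sum.swap) (simp add: mult_ac)
  then have trS: "(\<Sum>x\<in>I. \<Sum>y\<in>I. Y x y * S y x) = (\<Sum>j\<in>I. \<Sum>i\<in>I. complex_of_real (m j) * (y i j * c i j))"
    unfolding tr[OF f] c_def y' sum_distrib_left[symmetric] onb_parseval[OF fin oe] by simp
  have A: "Re (\<Sum>x\<in>I. \<Sum>y\<in>I. Y x y * (R y x - S y x)) = (\<Sum>i\<in>I. \<Sum>j\<in>I. (l i - m j) * Re (y i j * c i j))"
  proof -
    have "(\<Sum>x\<in>I. \<Sum>y\<in>I. Y x y * (R y x - S y x)) = (\<Sum>x\<in>I. \<Sum>y\<in>I. Y x y * R y x) - (\<Sum>x\<in>I. \<Sum>y\<in>I. Y x y * S y x)"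
      by (simp add: right_diff_distrib sum_subtractf)
    also have "(\<Sum>x\<in>I. \<Sum>y\<in>I. Y x y * S y x) = (\<Sum>i\<in>I. \<Sum>j\<in>I. complex_of_real (m j) * (y i j * c i j))"
      unfolding trS by (rule sum.swap)
    finally have "(\<Sum>x\<in>I. \<Sum>y\<in>I. Y x y * (R y x - S y x)) =
        (\<Sum>i\<in>I. \<Sum>j\<in>I. complex_of_real (l i - m j) * (y i j * c i j))"
      unfolding trR by (simp add: sum_subtractf[symmetric] algebra_simps)
    then show ?thesis by simp
  qed
  have B: "(\<Sum>z\<in>I. Re (qf I R (\<lambda>x. cnj (Y z x)) (\<lambda>x. cnj (Y z x)))) = (\<Sum>i\<in>I. \<Sum>j\<in>I. l i * (cmod (y i j))\<^sup>2)"
  proof -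
    have 1: "cmod (ip I (e i) (\<lambda>x. cnj (Y z x))) = cmod (\<Sum>x\<in>I. Y z x * e i x)" for i z
    proof -
      have "ip I (e i) (\<lambda>x. cnj (Y z x)) = cnj (\<Sum>x\<in>I. Y z x * e i x)"
        unfolding ip_def by (simp add: mult.commute)
      then show ?thesis by (simp only: complex_mod_cnj)
    qed
    have "(\<Sum>z\<in>I. Re (qf I R (\<lambda>x. cnj (Y z x)) (\<lambda>x. cnj (Y z x)))) = (\<Sum>z\<in>I. \<Sum>i\<in>I. l i * (cmod (\<Sum>x\<in>I. Y z x * e i x))\<^sup>2)"
      unfolding spec_qf_same[OF e] Re_complex_of_real 1 ..
    also have "\<dots> = (\<Sum>i\<in>I. \<Sum>z\<in>I. l i * (cmod (\<Sum>x\<in>I. Y z x * e i x))\<^sup>2)" by (rule sum.swap)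
    also have "\<dots> = (\<Sum>i\<in>I. \<Sum>j\<in>I. l i * (cmod (y i j))\<^sup>2)"
      unfolding sum_distrib_left[symmetric] y_def onb_parseval_norm[OF fin of] ..
    finally show ?thesis .
  qed
  have C: "(\<Sum>z\<in>I. Re (qf I S (\<lambda>x. Y x z) (\<lambda>x. Y x z))) = (\<Sum>i\<in>I. \<Sum>j\<in>I. m j * (cmod (y i j))\<^sup>2)"
  proof -
    have 1: "cmod (ip I (f j) (\<lambda>x. Y x z)) = cmod (\<Sum>x\<in>I. cnj (Y x z) * f j x)" for j z
    proof -
      have "ip I (f j) (\<lambda>x. Y x z) = cnj (\<Sum>x\<in>I. cnj (Y x z) * f j x)"
        unfolding ip_def by (simp add: mult.commute)
      then show ?thesis by (simp only: complex_mod_cnj)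
    qed
    have "(\<Sum>z\<in>I. Re (qf I S (\<lambda>x. Y x z) (\<lambda>x. Y x z))) = (\<Sum>z\<in>I. \<Sum>j\<in>I. m j * (cmod (\<Sum>x\<in>I. cnj (Y x z) * f j x))\<^sup>2)"
      unfolding spec_qf_same[OF f] Re_complex_of_real 1 ..
    also have "\<dots> = (\<Sum>j\<in>I. \<Sum>z\<in>I. m j * (cmod (\<Sum>x\<in>I. cnj (Y x z) * f j x))\<^sup>2)" by (rule sum.swap)
    also have "\<dots> = (\<Sum>j\<in>I. \<Sum>i\<in>I. m j * (cmod (y i j))\<^sup>2)"
      unfolding sum_distrib_left[symmetric] y' cmod_ip_commute[of I _ "e _"] onb_parseval_norm[OF fin oe] ..
    also have "\<dots> = (\<Sum>i\<in>I. \<Sum>j\<in>I. m j * (cmod (y i j))\<^sup>2)" by (rule sum.swap)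
    finally show ?thesis .
  qed
  have "Fu I R S u Y = (\<Sum>i\<in>I. \<Sum>j\<in>I. 2 * ((l i - m j) * Re (y i j * c i j)) - u * (l i * (cmod (y i j))\<^sup>2)
      - (1 - u) * (m j * (cmod (y i j))\<^sup>2))"
    unfolding Fu_def A B C sum_distrib_left sum_subtractf ..
  also have "\<dots> = (\<Sum>i\<in>I. \<Sum>j\<in>I. 2 * (l i - m j) * Re (y i j * c i j) - (u * l i + (1 - u) * m j) * (cmod (y i j))\<^sup>2)"
    by (intro sum.cong refl) (simp add: ring_distribs)
  finally show ?thesis unfolding y_def c_def .
qed

text \<open>A vanishing D forces the linear term to vanish too, in agreement with division by zero
  giving 0.\<close>

lemma complete_square_bound:
  fixes y c :: complex and a D :: real
  assumes "0 \<le> D" "D = 0 \<Longrightarrow> a = 0"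
  shows "2 * a * Re (y * c) - D * (cmod y)\<^sup>2 \<le> (cmod c)\<^sup>2 * a\<^sup>2 / D"
proof (cases "D = 0")
  case False
  then have D: "D > 0" using assms by auto
  have "\<bar>Re (y * c)\<bar> \<le> cmod y * cmod c" using abs_Re_le_cmod[of "y * c"] by (simp add: norm_mult)
  then have "\<bar>a * Re (y * c)\<bar> \<le> \<bar>a\<bar> * (cmod y * cmod c)"
    unfolding abs_mult by (rule mult_left_mono) simp
  then have 1: "a * Re (y * c) \<le> \<bar>a\<bar> * (cmod y * cmod c)" by linarith
  have "(D * cmod y - \<bar>a\<bar> * cmod c)\<^sup>2 \<ge> 0" by simp
  then have "2 * (\<bar>a\<bar> * (cmod y * cmod c)) * D \<le> (cmod c)\<^sup>2 * a\<^sup>2 + D * (cmod y)\<^sup>2 * D"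
    by (simp add: power2_diff power_mult_distrib algebra_simps) (simp add: power2_eq_square algebra_simps)
  then have "2 * (\<bar>a\<bar> * (cmod y * cmod c)) \<le> (cmod c)\<^sup>2 * a\<^sup>2 / D + D * (cmod y)\<^sup>2"
    using D by (simp add: field_simps)
  then show ?thesis using 1 by linarith
qed (use assms in simp)

lemma
  assumes fin: "finite I" and pR: "psd_on I R" and pS: "psd_on I S" and u: "0 < u" "u < 1"
    and e: "spec I R e l" and f: "spec I S f m"
  shows Qu_spec: "Qu I R S u = (\<Sum>i\<in>I. \<Sum>j\<in>I. (cmod (ip I (e i) (f j)))\<^sup>2 * (l i - m j)\<^sup>2 / (u * l i + (1 - u) * m j))"
    and Fu_le_spec: "Fu I R S u Y \<le> (\<Sum>i\<in>I. \<Sum>j\<in>I. (cmod (ip I (e i) (f j)))\<^sup>2 * (l i - m j)\<^sup>2 / (u * l i + (1 - u) * m j))"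
    and Fu_attained: "\<exists>Y. Fu I R S u Y = (\<Sum>i\<in>I. \<Sum>j\<in>I. (cmod (ip I (e i) (f j)))\<^sup>2 * (l i - m j)\<^sup>2 / (u * l i + (1 - u) * m j))"
proof -
  define c where "c = (\<lambda>i j. ip I (e i) (f j))"
  define D where "D = (\<lambda>i j. u * l i + (1 - u) * m j)"
  define X where "X = (\<Sum>i\<in>I. \<Sum>j\<in>I. (cmod (c i j))\<^sup>2 * (l i - m j)\<^sup>2 / D i j)"
  have l: "k \<in> I \<Longrightarrow> 0 \<le> l k" and m: "k \<in> I \<Longrightarrow> 0 \<le> m k" for k
    using spec_psd[OF fin e] spec_psd[OF fin f] pR pS by auto
  have D0: "0 \<le> D i j" if "i \<in> I" "j \<in> I" for i j
    unfolding D_def using l m that u by (intro add_nonneg_nonneg mult_nonneg_nonneg) auto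
  have D1: "l i - m j = 0" if "i \<in> I" "j \<in> I" "D i j = 0" for i j
  proof -
    have "u * l i = 0 \<and> (1 - u) * m j = 0"
      using that l[of i] m[of j] u unfolding D_def by (subst (asm) add_nonneg_eq_0_iff) auto
    then show ?thesis using u by auto
  qed
  have le: "Fu I R S u Y \<le> X" for Y
  proof -
    have "Fu I R S u Y = (\<Sum>i\<in>I. \<Sum>j\<in>I. 2 * (l i - m j) * Re (ip I (f j) (\<lambda>x. \<Sum>z\<in>I. Y x z * e i z) * c i j)
      - D i j * (cmod (ip I (f j) (\<lambda>x. \<Sum>z\<in>I. Y x z * e i z)))\<^sup>2)"
      unfolding Fu_spec[OF fin e f] c_def D_def ..
    also have "\<dots> \<le> X" unfolding X_def by (intro sum_mono complete_square_bound D0 D1)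
    finally show ?thesis .
  qed
  \<comment> \<open>The maximizer of the scalar quadratic for (i, j); Y is the operator with these
    matrix elements.\<close>
  define t where "t = (\<lambda>i j. cnj (c i j) * complex_of_real ((l i - m j) / D i j))"
  define Y where "Y = (\<lambda>x z. \<Sum>i\<in>I. \<Sum>j\<in>I. t i j * f j x * cnj (e i z))"
  have y: "ip I (f j) (\<lambda>x. \<Sum>z\<in>I. Y x z * e i z) = t i j" if ij: "i \<in> I" "j \<in> I" for i j
  proof -
    have 1: "(\<Sum>z\<in>I. Y x z * e i z) = (\<Sum>k\<in>I. t i k * f k x)" for x
    proof -
      have "(\<Sum>z\<in>I. Y x z * e i z) = (\<Sum>z\<in>I. \<Sum>i'\<in>I. \<Sum>j'\<in>I. t i' j' * f j' x * (cnj (e i' z) * e i z))"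
        unfolding Y_def sum_distrib_right by (simp add: mult_ac)
      also have "\<dots> = (\<Sum>i'\<in>I. \<Sum>z\<in>I. \<Sum>j'\<in>I. t i' j' * f j' x * (cnj (e i' z) * e i z))"
        by (rule sum.swap)
      also have "\<dots> = (\<Sum>i'\<in>I. \<Sum>j'\<in>I. \<Sum>z\<in>I. t i' j' * f j' x * (cnj (e i' z) * e i z))"
        by (intro sum.cong refl sum.swap)
      also have "\<dots> = (\<Sum>i'\<in>I. \<Sum>j'\<in>I. t i' j' * f j' x * ip I (e i') (e i))"
        unfolding ip_def by (simp add: sum_distrib_left)
      also have "\<dots> = (\<Sum>i'\<in>I. if i' = i then \<Sum>j'\<in>I. t i' j' * f j' x else 0)"
        by (intro sum.cong refl) (simp add: onbD1[OF specD(1)[OF e]] ij)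
      finally show ?thesis using ij fin by simp
    qed
    have "ip I (f j) (\<lambda>x. \<Sum>z\<in>I. Y x z * e i z) = (\<Sum>x\<in>I. \<Sum>k\<in>I. t i k * (cnj (f j x) * f k x))"
      unfolding 1 ip_def by (simp add: sum_distrib_left mult_ac)
    also have "\<dots> = (\<Sum>k\<in>I. \<Sum>x\<in>I. t i k * (cnj (f j x) * f k x))" by (rule sum.swap)
    also have "\<dots> = (\<Sum>k\<in>I. t i k * ip I (f j) (f k))" unfolding ip_def by (simp add: sum_distrib_left)
    also have "\<dots> = (\<Sum>k\<in>I. if k = j then t i k else 0)"
      by (intro sum.cong refl) (simp add: onbD1[OF specD(1)[OF f]] ij)
    finally show ?thesis using ij fin by simp
  qed
  have "Fu I R S u Y = (\<Sum>i\<in>I. \<Sum>j\<in>I. 2 * (l i - m j) * Re (t i j * c i j) - D i j * (cmod (t i j))\<^sup>2)"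
    unfolding Fu_spec[OF fin e f] by (intro sum.cong refl) (simp add: y c_def D_def)
  also have "\<dots> = X" unfolding X_def
  proof (intro sum.cong refl)
    fix i j assume ij: "i \<in> I" "j \<in> I"
    have "cnj (c i j) * c i j = complex_of_real ((cmod (c i j))\<^sup>2)"
      unfolding complex_norm_square by (rule mult.commute)
    then have "t i j * c i j = complex_of_real ((cmod (c i j))\<^sup>2 * ((l i - m j) / D i j))"
      unfolding t_def by (simp add: mult_ac)
    then have 1: "Re (t i j * c i j) = (cmod (c i j))\<^sup>2 * ((l i - m j) / D i j)" by simp
    have 2: "(cmod (t i j))\<^sup>2 = (cmod (c i j))\<^sup>2 * ((l i - m j) / D i j)\<^sup>2"
      unfolding t_def norm_mult power_mult_distrib norm_of_real power2_abs by simp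
    show "2 * (l i - m j) * Re (t i j * c i j) - D i j * (cmod (t i j))\<^sup>2 = (cmod (c i j))\<^sup>2 * (l i - m j)\<^sup>2 / D i j"
      unfolding 1 2 by (cases "D i j = 0") (auto simp: power2_eq_square field_simps)
  qed
  finally have att: "Fu I R S u Y = X" .
  have "Qu I R S u = X" unfolding Qu_def
    by (rule cSup_eq_maximum) (use att le in auto)
  then show "Qu I R S u = (\<Sum>i\<in>I. \<Sum>j\<in>I. (cmod (ip I (e i) (f j)))\<^sup>2 * (l i - m j)\<^sup>2 / (u * l i + (1 - u) * m j))"
    unfolding X_def c_def D_def .
  show "Fu I R S u Y' \<le> (\<Sum>i\<in>I. \<Sum>j\<in>I. (cmod (ip I (e i) (f j)))\<^sup>2 * (l i - m j)\<^sup>2 / (u * l i + (1 - u) * m j))" for Y'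
    using le[of Y'] unfolding X_def c_def D_def .
  show "\<exists>Y. Fu I R S u Y = (\<Sum>i\<in>I. \<Sum>j\<in>I. (cmod (ip I (e i) (f j)))\<^sup>2 * (l i - m j)\<^sup>2 / (u * l i + (1 - u) * m j))"
    using att unfolding X_def c_def D_def by blast
qed

lemma
  assumes fin: "finite I" and pR: "psd_on I R" and pS: "psd_on I S" and u: "0 < u" "u < 1"
  shows Fu_le_Qu: "Fu I R S u Y \<le> Qu I R S u" and Qu_attained: "\<exists>Y. Qu I R S u = Fu I R S u Y"
proof -
  obtain e l f m where "spec I R e l" "spec I S f m"
    using spectral[OF fin psd_on_herm] pR pS by metis
  note * = fin pR pS u this
  show "Fu I R S u Y \<le> Qu I R S u" using Fu_le_spec[OF *] Qu_spec[OF *] by simp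
  show "\<exists>Y. Qu I R S u = Fu I R S u Y" using Fu_attained[OF *] Qu_spec[OF *] by metis
qed

lemma Qu_nonneg:
  assumes "finite I" "psd_on I R" "psd_on I S" "0 < u" "u < 1"
  shows "0 \<le> Qu I R S u"
  using Fu_le_Qu[OF assms, of "\<lambda>_ _. 0"] by (simp add: Fu_def qf_def)

text \<open>\<open>Qu\<close> is a supremum of functionals linear in the pair of operators; this gives joint convexity.\<close>
lemma Qu_sum_le:
  assumes fin: "finite I" and p: "\<And>s. s \<in> T \<Longrightarrow> psd_on I (R s)" "\<And>s. s \<in> T \<Longrightarrow> psd_on I (S s)"
    and u: "0 < u" "u < 1"
  shows "Qu I (\<lambda>x y. \<Sum>s\<in>T. R s x y) (\<lambda>x y. \<Sum>s\<in>T. S s x y) u \<le> (\<Sum>s\<in>T. Qu I (R s) (S s) u)"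
proof -
  have "psd_on I (\<lambda>x y. \<Sum>s\<in>T. R s x y)" "psd_on I (\<lambda>x y. \<Sum>s\<in>T. S s x y)"
    by (intro psd_on_sum p; assumption)+
  from Qu_attained[OF fin this u]
  obtain Y where "Qu I (\<lambda>x y. \<Sum>s\<in>T. R s x y) (\<lambda>x y. \<Sum>s\<in>T. S s x y) u = (\<Sum>s\<in>T. Fu I (R s) (S s) u Y)"
    unfolding Fu_sum by blast
  also have "\<dots> \<le> (\<Sum>s\<in>T. Qu I (R s) (S s) u)"
    by (intro sum_mono Fu_le_Qu fin p u)
  finally show ?thesis .
qed

text \<open>Taylor's formula with integral remainder for x ln x around b, evaluated at a: the
  denominator comes from the second derivative 1 / x on the segment from b to a, the weight 1 - u
  from the remainder.\<close>

lemma scalar_rel_integral: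
  fixes a b :: real
  assumes "0 \<le> a" "0 \<le> b" "b = 0 \<Longrightarrow> a = 0"
  shows "((\<lambda>u. (1 - u) * ((a - b)\<^sup>2 / (u * a + (1 - u) * b))) has_integral (a * ln a - a * ln b - a + b)) {0<..<1}"
proof (cases "b = 0")
  case True
  then show ?thesis using assms by simp
next
  case False
  then have b: "b > 0" using assms by auto
  \<comment> \<open>An antiderivative after the splitting in \<open>eq\<close>. For a = 0 the
    logarithm degenerates at u = 1, but its coefficient is then 0; hence the case distinction for
    continuity.\<close>
  define F where "F = (\<lambda>u. a * ln (b + u * (a - b)) - (a - b) * u)"
  have pos: "b + u * (a - b) > 0" if "0 < u" "u < 1" for u
  proof -
    have "b + u * (a - b) = u * a + (1 - u) * b" by (simp add: algebra_simps)
    also have "\<dots> > 0" using that b assms(1) by (intro add_nonneg_pos mult_nonneg_nonneg mult_pos_pos) auto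
    finally show ?thesis .
  qed
  have cont: "continuous_on {0..1} F"
  proof (cases "a = 0")
    case True
    then show ?thesis unfolding F_def by (auto intro!: continuous_intros)
  next
    case False
    then have a: "a > 0" using assms by auto
    have "b + u * (a - b) \<noteq> 0" if "u \<in> {0..1}" for u
    proof -
      have "u = 0 \<or> u = 1 \<or> (0 < u \<and> u < 1)" using that by auto
      then show ?thesis using pos[of u] a b by auto
    qed
    then show ?thesis unfolding F_def by (auto intro!: continuous_intros)
  qed
  have "((\<lambda>u. (1 - u) * ((a - b)\<^sup>2 / (u * a + (1 - u) * b))) has_integral F 1 - F 0) {0..1}"
  proof (rule fundamental_theorem_of_calculus_interior[OF _ cont])
    fix u :: real assume u: "u \<in> {0<..<1}"
    then have p: "b + u * (a - b) > 0" using pos by auto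
    have eq: "(1 - u) * ((a - b)\<^sup>2 / (u * a + (1 - u) * b)) = a * ((a - b) / (b + u * (a - b))) - (a - b)"
    proof -
      have "u * a + (1 - u) * b = b + u * (a - b)" by (simp add: algebra_simps)
      then show ?thesis using p by (simp add: field_simps power2_eq_square)
    qed
    have "(F has_real_derivative a * ((a - b) / (b + u * (a - b))) - (a - b)) (at u)"
      unfolding F_def using p by (auto intro!: derivative_eq_intros)
    then show "(F has_vector_derivative (1 - u) * ((a - b)\<^sup>2 / (u * a + (1 - u) * b))) (at u)"
      unfolding eq by (simp add: has_real_derivative_iff_has_vector_derivative)
  qed simp
  moreover have "F 1 - F 0 = a * ln a - a * ln b - a + b" unfolding F_def by simp
  ultimately show ?thesis by (simp add: has_integral_Icc_iff_Ioo)
qed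

text \<open>Integrating the eigenvalue formula for \<open>Qu\<close> term by term gives the relative
  entropy in natural units, plus tr S - tr R; the diagonal of R in the eigenbasis of S stands for tr
  R ln S. By \<open>supp\<close> the kernel of S carries no weight of R, so ln 0 never
  contributes.\<close>

lemma rel_entropy_integral:
  assumes fin: "finite I" and pR: "psd_on I R" and pS: "psd_on I S" and f: "spec I S f m"
    and supp: "\<And>j. j \<in> I \<Longrightarrow> m j = 0 \<Longrightarrow> Re (qf I R (f j) (f j)) = 0"
  shows "((\<lambda>u. (1 - u) * Qu I R S u) has_integral
     (- ln 2 * ent I R - (\<Sum>j\<in>I. Re (qf I R (f j) (f j)) * ln (m j)) - tr_on I R + tr_on I S)) {0<..<1}"
proof -
  obtain e l where e: "spec I R e l" "\<And>k. k \<in> I \<Longrightarrow> 0 \<le> l k" "ent I R = (\<Sum>k\<in>I. eta (l k))"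
    using psd_spec[OF fin pR] by blast
  have m: "k \<in> I \<Longrightarrow> 0 \<le> m k" for k using spec_psd[OF fin f] pS by auto
  define w where "w = (\<lambda>i j. (cmod (ip I (e i) (f j)))\<^sup>2)"
  have q: "Re (qf I R (f j) (f j)) = (\<Sum>i\<in>I. l i * w i j)" for j
    unfolding spec_qf_same[OF e(1)] w_def by simp
  have z: "l i = 0 \<or> w i j = 0" if "i \<in> I" "j \<in> I" "m j = 0" for i j
  proof -
    have "(\<Sum>i\<in>I. l i * w i j) = 0" using supp[of j] that q by simp
    then have "l i * w i j = 0" using that fin e(2)
      by (subst (asm) sum_nonneg_eq_0_iff) (auto simp: w_def)
    then show ?thesis by simp
  qed
  note oe = specD(1)[OF e(1)] and of = specD(1)[OF f]
  have w1: "(\<Sum>j\<in>I. w i j) = 1" if "i \<in> I" for i unfolding w_def by (rule onb_overlap_sum2[OF fin oe of that])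
  have w2: "(\<Sum>i\<in>I. w i j) = 1" if "j \<in> I" for j unfolding w_def by (rule onb_overlap_sum1[OF fin oe of that])
  have int: "((\<lambda>u. \<Sum>i\<in>I. \<Sum>j\<in>I. w i j * ((1 - u) * ((l i - m j)\<^sup>2 / (u * l i + (1 - u) * m j)))) has_integral
     (\<Sum>i\<in>I. \<Sum>j\<in>I. w i j * (l i * ln (l i) - l i * ln (m j) - l i + m j))) {0<..<1}"
  proof (intro has_integral_sum fin)
    fix i j assume ij: "i \<in> I" "j \<in> I"
    show "((\<lambda>u. w i j * ((1 - u) * ((l i - m j)\<^sup>2 / (u * l i + (1 - u) * m j)))) has_integral
      w i j * (l i * ln (l i) - l i * ln (m j) - l i + m j)) {0<..<1}"
    proof (cases "w i j = 0")
      case False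
      then show ?thesis using ij z[OF ij]
        by (intro has_integral_mult_right scalar_rel_integral e(2) m) auto
    qed simp
  qed
  have "((\<lambda>u. (1 - u) * Qu I R S u) has_integral
     (\<Sum>i\<in>I. \<Sum>j\<in>I. w i j * (l i * ln (l i) - l i * ln (m j) - l i + m j))) {0<..<1}"
  proof (rule has_integral_eq[OF _ int])
    fix u :: real assume "u \<in> {0<..<1}"
    then have u: "0 < u" "u < 1" by auto
    show "(\<Sum>i\<in>I. \<Sum>j\<in>I. w i j * ((1 - u) * ((l i - m j)\<^sup>2 / (u * l i + (1 - u) * m j)))) = (1 - u) * Qu I R S u"
      unfolding Qu_spec[OF fin pR pS u e(1) f] w_def sum_distrib_left
      by (intro sum.cong refl) (simp add: mult_ac)
  qed
  moreover have "(\<Sum>i\<in>I. \<Sum>j\<in>I. w i j * (l i * ln (l i) - l i * ln (m j) - l i + m j)) =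
     - ln 2 * ent I R - (\<Sum>j\<in>I. Re (qf I R (f j) (f j)) * ln (m j)) - tr_on I R + tr_on I S"
  proof -
    have "(\<Sum>i\<in>I. \<Sum>j\<in>I. w i j * (l i * ln (l i) - l i * ln (m j) - l i + m j)) =
      (\<Sum>i\<in>I. \<Sum>j\<in>I. w i j * (l i * ln (l i)) - l i * w i j * ln (m j) - w i j * l i + w i j * m j)"
      by (intro sum.cong refl) (simp add: ring_distribs)
    also have "\<dots> =
       (\<Sum>i\<in>I. (\<Sum>j\<in>I. w i j) * (l i * ln (l i))) - (\<Sum>i\<in>I. \<Sum>j\<in>I. l i * w i j * ln (m j))
        - (\<Sum>i\<in>I. (\<Sum>j\<in>I. w i j) * l i) + (\<Sum>i\<in>I. \<Sum>j\<in>I. w i j * m j)"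
      unfolding sum_subtractf sum.distrib sum_distrib_right ..
    also have "(\<Sum>i\<in>I. (\<Sum>j\<in>I. w i j) * (l i * ln (l i))) = - ln 2 * ent I R"
      unfolding e(3) sum_distrib_left
      by (intro sum.cong refl) (simp add: w1 eta_eq[OF e(2)] log_def)
    also have "(\<Sum>i\<in>I. \<Sum>j\<in>I. l i * w i j * ln (m j)) = (\<Sum>j\<in>I. Re (qf I R (f j) (f j)) * ln (m j))"
      unfolding q sum_distrib_right by (rule sum.swap)
    also have "(\<Sum>i\<in>I. (\<Sum>j\<in>I. w i j) * l i) = tr_on I R" unfolding spec_tr[OF fin e(1)] by (simp add: w1)
    also have "(\<Sum>i\<in>I. \<Sum>j\<in>I. w i j * m j) = tr_on I S"
      unfolding spec_tr[OF fin f]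
      by (subst sum.swap) (simp add: sum_distrib_right[symmetric] w2)
    finally show ?thesis .
  qed
  ultimately show ?thesis by simp
qed

section \<open>Product reference states\<close>

definition tens :: "('i \<Rightarrow> 'i \<Rightarrow> complex) \<Rightarrow> ('j \<Rightarrow> 'j \<Rightarrow> complex) \<Rightarrow> 'i \<times> 'j \<Rightarrow> 'i \<times> 'j \<Rightarrow> complex" where
  "tens A B p q = A (fst p) (fst q) * B (snd p) (snd q)"

definition tensv :: "('i \<Rightarrow> 'i \<Rightarrow> complex) \<Rightarrow> ('j \<Rightarrow> 'j \<Rightarrow> complex) \<Rightarrow> 'i \<times> 'j \<Rightarrow> 'i \<times> 'j \<Rightarrow> complex" where
  "tensv e f k p = e (fst k) (fst p) * f (snd k) (snd p)"

lemma sum_product_Times: "(\<Sum>p\<in>I \<times> J. f (fst p) * g (snd p)) = (\<Sum>x\<in>I. f x) * (\<Sum>y\<in>J. (g y :: 'b :: comm_semiring_0))"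
  unfolding sum_product sum.cartesian_product by (simp add: case_prod_beta)

lemma onb_tensv:
  assumes "onb I e" "onb J f"
  shows "onb (I \<times> J) (tensv e f)"
proof -
  have 1: "ip (I \<times> J) (tensv e f k) (tensv e f k') = ip I (e (fst k)) (e (fst k')) * ip J (f (snd k)) (f (snd k'))" for k k'
    unfolding ip_def tensv_def sum_product_Times[symmetric] by (simp add: mult_ac)
  have 2: "(\<Sum>k\<in>I \<times> J. tensv e f k p * cnj (tensv e f k q)) =
     (\<Sum>k\<in>I. e k (fst p) * cnj (e k (fst q))) * (\<Sum>k\<in>J. f k (snd p) * cnj (f k (snd q)))" for p q
    unfolding tensv_def sum_product_Times[symmetric] by (simp add: mult_ac)
  show ?thesis unfolding onb_def 1 2 using assms unfolding onb_def by (auto simp: prod_eq_iff)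
qed

lemma spec_tens:
  assumes "spec I A e l" "spec J B f m"
  shows "spec (I \<times> J) (tens A B) (tensv e f) (\<lambda>k. l (fst k) * m (snd k))"
proof -
  have eq: "(\<Sum>k\<in>I \<times> J. complex_of_real (l (fst k) * m (snd k)) * tensv e f k p * cnj (tensv e f k q)) =
    (\<Sum>k\<in>I. complex_of_real (l k) * e k (fst p) * cnj (e k (fst q))) * (\<Sum>k\<in>J. complex_of_real (m k) * f k (snd p) * cnj (f k (snd q)))" for p q
    unfolding tensv_def sum_product_Times[symmetric] by (simp add: mult_ac)
  show ?thesis unfolding spec_def
  proof (intro conjI ballI)
    show "onb (I \<times> J) (tensv e f)" by (intro onb_tensv specD(1)[OF assms(1)] specD(1)[OF assms(2)])
    fix p q assume "p \<in> I \<times> J" "q \<in> I \<times> J"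
    then have "fst p \<in> I" "snd p \<in> J" "fst q \<in> I" "snd q \<in> J" by auto
    then show "tens A B p q = (\<Sum>k\<in>I \<times> J. complex_of_real (l (fst k) * m (snd k)) * tensv e f k p * cnj (tensv e f k q))"
      unfolding eq tens_def by (simp only: specD(2)[OF assms(1)] specD(2)[OF assms(2)])
  qed
qed

lemma tr_on_tens: "finite I \<Longrightarrow> finite J \<Longrightarrow> psd_on I A \<Longrightarrow> psd_on J B \<Longrightarrow>
   tr_on (I \<times> J) (tens A B) = tr_on I A * tr_on J B \<and> psd_on (I \<times> J) (tens A B)"
proof -
  assume *: "finite I" "finite J" "psd_on I A" "psd_on J B"
  obtain e l where s: "spec I A e l" "\<And>k. k \<in> I \<Longrightarrow> 0 \<le> l k" using psd_spec[OF *(1,3)] by blast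
  obtain f m where t: "spec J B f m" "\<And>k. k \<in> J \<Longrightarrow> 0 \<le> m k" using psd_spec[OF *(2,4)] by blast
  have fin: "finite (I \<times> J)" using * by simp
  show ?thesis
    unfolding spec_tr[OF fin spec_tens[OF s(1) t(1)]] spec_psd[OF fin spec_tens[OF s(1) t(1)]]
      spec_tr[OF *(1) s(1)] spec_tr[OF *(2) t(1)] sum_product_Times
    using s(2) t(2) by auto
qed

text \<open>Completeness of f collapses the sum over j to the diagonal of the second factor, which
  is the partial trace.\<close>

lemma qf_tensv_marginal2:
  assumes J: "finite J" and f: "onb J f"
  shows "(\<Sum>j\<in>J. qf (I \<times> J) A (tensv e f (i, j)) (tensv e f (i, j))) = qf I (ptr2 J A) (e i) (e i)"
proof -
  let ?t = "\<lambda>j x y x' y'. (cnj (e i x) * A (x, y) (x', y') * e i x') * (f j y' * cnj (f j y))"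
  have "(\<Sum>j\<in>J. qf (I \<times> J) A (tensv e f (i, j)) (tensv e f (i, j))) =
     (\<Sum>j\<in>J. \<Sum>p\<in>I \<times> J. \<Sum>q\<in>I \<times> J. ?t j (fst p) (snd p) (fst q) (snd q))"
    unfolding qf_def by (intro sum.cong refl) (simp add: tensv_def mult_ac)
  also have "\<dots> = (\<Sum>p\<in>I \<times> J. \<Sum>j\<in>J. \<Sum>q\<in>I \<times> J. ?t j (fst p) (snd p) (fst q) (snd q))"
    by (rule sum.swap)
  also have "\<dots> = (\<Sum>p\<in>I \<times> J. \<Sum>q\<in>I \<times> J. \<Sum>j\<in>J. ?t j (fst p) (snd p) (fst q) (snd q))"
    by (intro sum.cong refl sum.swap)
  also have "\<dots> = (\<Sum>p\<in>I \<times> J. \<Sum>q\<in>I \<times> J. (cnj (e i (fst p)) * A p q * e i (fst q)) * (if snd q = snd p then 1 else 0))"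
    unfolding sum_distrib_left[symmetric] using onbD2[OF f] by (intro sum.cong refl) auto
  also have "\<dots> = (\<Sum>x\<in>I. \<Sum>y\<in>J. \<Sum>x'\<in>I. \<Sum>y'\<in>J. (cnj (e i x) * A (x, y) (x', y') * e i x') * (if y' = y then 1 else 0))"
    by (simp add: sum.cartesian_product' case_prod_beta)
  also have "\<dots> = (\<Sum>x\<in>I. \<Sum>y\<in>J. \<Sum>x'\<in>I. cnj (e i x) * A (x, y) (x', y) * e i x')"
    using J by (intro sum.cong refl) (simp add: mult_delta_right)
  also have "\<dots> = (\<Sum>x\<in>I. \<Sum>x'\<in>I. \<Sum>y\<in>J. cnj (e i x) * A (x, y) (x', y) * e i x')"
    by (intro sum.cong refl sum.swap)
  also have "\<dots> = qf I (ptr2 J A) (e i) (e i)"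
    unfolding qf_def ptr2_def by (simp add: sum_distrib_left sum_distrib_right)
  finally show ?thesis .
qed

lemma qf_tensv_marginal1:
  assumes I: "finite I" and e: "onb I e"
  shows "(\<Sum>i\<in>I. qf (I \<times> J) A (tensv e f (i, j)) (tensv e f (i, j))) = qf J (ptr1 I A) (f j) (f j)"
proof -
  have b: "bij_betw prod.swap (J \<times> I) (I \<times> J)" by (auto simp: bij_betw_def inj_on_def image_def)
  have "qf (I \<times> J) A (tensv e f (i, j)) (tensv e f (i, j)) =
    qf (J \<times> I) (\<lambda>x y. A (prod.swap x) (prod.swap y)) (tensv f e (j, i)) (tensv f e (j, i))" for i
    unfolding qf_reindex[OF b, symmetric] by (rule qf_cong) (auto simp: tensv_def)
  then show ?thesis
    using qf_tensv_marginal2[OF I e, of J "\<lambda>x y. A (prod.swap x) (prod.swap y)" f j]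
    by (simp add: ptr2_def[abs_def] ptr1_def[abs_def])
qed

lemma psd_ptr2:
  fixes J :: "'j set"
  assumes I: "finite I" and J: "finite J" and p: "psd_on (I \<times> J) A"
  shows "psd_on I (ptr2 J A)" "tr_on I (ptr2 J A) = tr_on (I \<times> J) A"
proof -
  define d where "d = (\<lambda>(j::'j) y. if j = y then (1::complex) else 0)"
  have o: "onb J d" unfolding onb_def ip_def d_def using J
    by (simp add: mult_delta_left mult_delta_right if_distrib[of cnj] cong: if_cong)
  \<comment> \<open>The constant family ignores its index, hence \<open>undefined\<close>: the
    vectors are v tensored with the standard basis of J.\<close>
  have "qf I (ptr2 J A) v v = (\<Sum>j\<in>J. qf (I \<times> J) A (tensv (\<lambda>_. v) d (undefined, j)) (tensv (\<lambda>_. v) d (undefined, j)))" for v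
    using qf_tensv_marginal2[OF J o, of I A "\<lambda>_. v" undefined] by simp
  then show "psd_on I (ptr2 J A)" using p unfolding psd_on_def by (auto intro!: sum_nonneg)
  show "tr_on I (ptr2 J A) = tr_on (I \<times> J) A"
    unfolding tr_on_def ptr2_def by (simp add: sum.cartesian_product' )
qed

lemma psd_ptr1:
  assumes I: "finite I" and J: "finite J" and p: "psd_on (I \<times> J) A"
  shows "psd_on J (ptr1 I A)" "tr_on J (ptr1 I A) = tr_on (I \<times> J) A"
proof -
  have b: "bij_betw prod.swap (J \<times> I) (I \<times> J)" by (auto simp: bij_betw_def inj_on_def image_def)
  show "psd_on J (ptr1 I A)" "tr_on J (ptr1 I A) = tr_on (I \<times> J) A"
    using psd_ptr2[OF J I, of "\<lambda>x y. A (prod.swap x) (prod.swap y)"] p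
    unfolding psd_on_reindex[OF b] tr_on_reindex[OF b]
    by (simp_all add: ptr2_def[abs_def] ptr1_def[abs_def])
qed

section \<open>Strong subadditivity for families of operators\<close>

text \<open>\<open>\<rho> w v\<close> is the block of a classical-quantum state with labels w, v and
  quantum parts I, J; a marginal discards one label together with one quantum part.\<close>

definition marg1 :: "'v set \<Rightarrow> 'j set \<Rightarrow> ('w \<Rightarrow> 'v \<Rightarrow> 'i \<times> 'j \<Rightarrow> 'i \<times> 'j \<Rightarrow> complex) \<Rightarrow> 'w \<Rightarrow> 'i \<Rightarrow> 'i \<Rightarrow> complex" where
  "marg1 V J \<rho> w = ptr2 J (\<lambda>p q. \<Sum>v\<in>V. \<rho> w v p q)"

definition marg2 :: "'w set \<Rightarrow> 'i set \<Rightarrow> ('w \<Rightarrow> 'v \<Rightarrow> 'i \<times> 'j \<Rightarrow> 'i \<times> 'j \<Rightarrow> complex) \<Rightarrow> 'v \<Rightarrow> 'j \<Rightarrow> 'j \<Rightarrow> complex" where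
  "marg2 W I \<rho> v = ptr1 I (\<lambda>p q. \<Sum>w\<in>W. \<rho> w v p q)"

lemma psd_marg1:
  assumes fin: "finite W" "finite V" "finite I" "finite J" and w: "w \<in> W"
    and p: "\<And>w v. w \<in> W \<Longrightarrow> v \<in> V \<Longrightarrow> psd_on (I \<times> J) (\<rho> w v)"
  shows "psd_on I (marg1 V J \<rho> w)" "tr_on I (marg1 V J \<rho> w) = (\<Sum>v\<in>V. tr_on (I \<times> J) (\<rho> w v))"
proof -
  have "psd_on (I \<times> J) (\<lambda>p q. \<Sum>v\<in>V. \<rho> w v p q)" by (intro psd_on_sum p w)
  from psd_ptr2[OF fin(3,4) this]
  show "psd_on I (marg1 V J \<rho> w)" "tr_on I (marg1 V J \<rho> w) = (\<Sum>v\<in>V. tr_on (I \<times> J) (\<rho> w v))"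
    unfolding marg1_def tr_on_sum by auto
qed

lemma psd_marg2:
  assumes fin: "finite W" "finite V" "finite I" "finite J" and v: "v \<in> V"
    and p: "\<And>w v. w \<in> W \<Longrightarrow> v \<in> V \<Longrightarrow> psd_on (I \<times> J) (\<rho> w v)"
  shows "psd_on J (marg2 W I \<rho> v)" "tr_on J (marg2 W I \<rho> v) = (\<Sum>w\<in>W. tr_on (I \<times> J) (\<rho> w v))"
proof -
  have "psd_on (I \<times> J) (\<lambda>p q. \<Sum>w\<in>W. \<rho> w v p q)" by (intro psd_on_sum p v)
  from psd_ptr1[OF fin(3,4) this]
  show "psd_on J (marg2 W I \<rho> v)" "tr_on J (marg2 W I \<rho> v) = (\<Sum>w\<in>W. tr_on (I \<times> J) (\<rho> w v))"
    unfolding marg2_def tr_on_sum by auto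
qed

lemma psd_spec_choice:
  assumes "finite I" "\<And>w. w \<in> W \<Longrightarrow> psd_on I (A w)"
  shows "\<exists>e a. \<forall>w\<in>W. spec I (A w) (e w) (a w) \<and> (\<forall>i\<in>I. 0 \<le> a w i) \<and> ent I (A w) = (\<Sum>i\<in>I. eta (a w i))"
proof -
  have "\<forall>w\<in>W. \<exists>e a. spec I (A w) e a \<and> (\<forall>i\<in>I. 0 \<le> a i) \<and> ent I (A w) = (\<Sum>i\<in>I. eta (a i))"
  proof
    fix w assume "w \<in> W"
    show "\<exists>e a. spec I (A w) e a \<and> (\<forall>i\<in>I. 0 \<le> a i) \<and> ent I (A w) = (\<Sum>i\<in>I. eta (a i))"
      by (rule psd_spec[OF assms(1) assms(2)[OF \<open>w \<in> W\<close>]]) blast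
  qed
  from bchoice[OF this] obtain e where
    "\<forall>w\<in>W. \<exists>a. spec I (A w) (e w) a \<and> (\<forall>i\<in>I. 0 \<le> a i) \<and> ent I (A w) = (\<Sum>i\<in>I. eta (a i))" ..
  from bchoice[OF this] obtain a where
    "\<forall>w\<in>W. spec I (A w) (e w) (a w) \<and> (\<forall>i\<in>I. 0 \<le> a w i) \<and> ent I (A w) = (\<Sum>i\<in>I. eta (a w i))" ..
  then show ?thesis by blast
qed

lemma eta_ln: "0 \<le> t \<Longrightarrow> ln 2 * eta t = - (t * ln t)"
  by (simp add: eta_eq log_def)

text \<open>The value is the mutual information between the subsystems (W, I) and (V, J). For a
  product reference the logarithm splits into two sums weighted by the spectra of the two marginals,
  and the trace terms cancel because both states are normalized.\<close>

lemma product_ref_integral: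
  assumes fin: "finite W" "finite V" "finite I" "finite J"
    and p: "\<And>w v. w \<in> W \<Longrightarrow> v \<in> V \<Longrightarrow> psd_on (I \<times> J) (\<rho> w v)"
    and tr: "(\<Sum>w\<in>W. \<Sum>v\<in>V. tr_on (I \<times> J) (\<rho> w v)) = 1"
  shows "((\<lambda>u. (1 - u) * (\<Sum>w\<in>W. \<Sum>v\<in>V. Qu (I \<times> J) (\<rho> w v) (tens (marg1 V J \<rho> w) (marg2 W I \<rho> v)) u)) has_integral
     ln 2 * ((\<Sum>w\<in>W. ent I (marg1 V J \<rho> w)) + (\<Sum>v\<in>V. ent J (marg2 W I \<rho> v)) - (\<Sum>w\<in>W. \<Sum>v\<in>V. ent (I \<times> J) (\<rho> w v)))) {0<..<1}"
proof -
  have finIJ: "finite (I \<times> J)" using fin by simp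
  have p1: "psd_on I (marg1 V J \<rho> w)" "tr_on I (marg1 V J \<rho> w) = (\<Sum>v\<in>V. tr_on (I \<times> J) (\<rho> w v))" if "w \<in> W" for w
  proof -
    show "psd_on I (marg1 V J \<rho> w)" by (rule psd_marg1(1)[OF fin that]) (rule p)
    show "tr_on I (marg1 V J \<rho> w) = (\<Sum>v\<in>V. tr_on (I \<times> J) (\<rho> w v))" by (rule psd_marg1(2)[OF fin that]) (rule p)
  qed
  have p2: "psd_on J (marg2 W I \<rho> v)" "tr_on J (marg2 W I \<rho> v) = (\<Sum>w\<in>W. tr_on (I \<times> J) (\<rho> w v))" if "v \<in> V" for v
  proof -
    show "psd_on J (marg2 W I \<rho> v)" by (rule psd_marg2(1)[OF fin that]) (rule p)
    show "tr_on J (marg2 W I \<rho> v) = (\<Sum>w\<in>W. tr_on (I \<times> J) (\<rho> w v))" by (rule psd_marg2(2)[OF fin that]) (rule p)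
  qed
  have "\<exists>e a. \<forall>w\<in>W. spec I (marg1 V J \<rho> w) (e w) (a w) \<and> (\<forall>i\<in>I. 0 \<le> a w i) \<and> ent I (marg1 V J \<rho> w) = (\<Sum>i\<in>I. eta (a w i))"
    by (rule psd_spec_choice[OF fin(3)]) (rule p1)
  then obtain e a where e': "\<forall>w\<in>W. spec I (marg1 V J \<rho> w) (e w) (a w) \<and> (\<forall>i\<in>I. 0 \<le> a w i) \<and> ent I (marg1 V J \<rho> w) = (\<Sum>i\<in>I. eta (a w i))"
    by (elim exE)
  have e: "\<And>w. w \<in> W \<Longrightarrow> spec I (marg1 V J \<rho> w) (e w) (a w)" "\<And>w i. w \<in> W \<Longrightarrow> i \<in> I \<Longrightarrow> 0 \<le> a w i"
    "\<And>w. w \<in> W \<Longrightarrow> ent I (marg1 V J \<rho> w) = (\<Sum>i\<in>I. eta (a w i))"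
    using e' by auto
  have "\<exists>f b. \<forall>v\<in>V. spec J (marg2 W I \<rho> v) (f v) (b v) \<and> (\<forall>j\<in>J. 0 \<le> b v j) \<and> ent J (marg2 W I \<rho> v) = (\<Sum>j\<in>J. eta (b v j))"
    by (rule psd_spec_choice[OF fin(4)]) (rule p2)
  then obtain f b where f': "\<forall>v\<in>V. spec J (marg2 W I \<rho> v) (f v) (b v) \<and> (\<forall>j\<in>J. 0 \<le> b v j) \<and> ent J (marg2 W I \<rho> v) = (\<Sum>j\<in>J. eta (b v j))"
    by (elim exE)
  have f: "\<And>v. v \<in> V \<Longrightarrow> spec J (marg2 W I \<rho> v) (f v) (b v)" "\<And>v j. v \<in> V \<Longrightarrow> j \<in> J \<Longrightarrow> 0 \<le> b v j"
    "\<And>v. v \<in> V \<Longrightarrow> ent J (marg2 W I \<rho> v) = (\<Sum>j\<in>J. eta (b v j))"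
    using f' by auto
  \<comment> \<open>The diagonal of the state in the product of the marginal eigenbases; summing out
    one side leaves the eigenvalues of the marginal on the other.\<close>
  define q where "q = (\<lambda>w v i j. Re (qf (I \<times> J) (\<rho> w v) (tensv (e w) (f v) (i, j)) (tensv (e w) (f v) (i, j))))"
  have q0: "0 \<le> q w v i j" if "w \<in> W" "v \<in> V" for w v i j
    unfolding q_def by (rule qf_psd_nonneg[OF p[OF that]])
  have qa: "(\<Sum>v\<in>V. \<Sum>j\<in>J. q w v i j) = a w i" if w: "w \<in> W" "i \<in> I" for w i
  proof -
    have 1: "(\<Sum>j\<in>J. qf (I \<times> J) (\<rho> w v) (tensv (e w) (f v) (i, j)) (tensv (e w) (f v) (i, j))) = qf I (ptr2 J (\<rho> w v)) (e w i) (e w i)"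
      if "v \<in> V" for v by (rule qf_tensv_marginal2[OF fin(4) specD(1)[OF f(1)[OF that]]])
    have "(\<Sum>v\<in>V. \<Sum>j\<in>J. q w v i j) = Re (\<Sum>v\<in>V. \<Sum>j\<in>J. qf (I \<times> J) (\<rho> w v) (tensv (e w) (f v) (i, j)) (tensv (e w) (f v) (i, j)))"
      unfolding q_def by simp
    also have "\<dots> = Re (\<Sum>v\<in>V. qf I (ptr2 J (\<rho> w v)) (e w i) (e w i))" using 1 by simp
    also have "\<dots> = Re (qf I (marg1 V J \<rho> w) (e w i) (e w i))"
    proof -
      have "marg1 V J \<rho> w = (\<lambda>x y. \<Sum>v\<in>V. ptr2 J (\<rho> w v) x y)"
        unfolding marg1_def ptr2_def[abs_def] by (intro ext sum.swap)
      then show ?thesis by (simp only: qf_sum)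
    qed
    finally show ?thesis using spec_qf_basis[OF fin(3) e(1)[OF w(1)] w(2) w(2)] by simp
  qed
  have qb: "(\<Sum>w\<in>W. \<Sum>i\<in>I. q w v i j) = b v j" if v: "v \<in> V" "j \<in> J" for v j
  proof -
    have 1: "(\<Sum>i\<in>I. qf (I \<times> J) (\<rho> w v) (tensv (e w) (f v) (i, j)) (tensv (e w) (f v) (i, j))) = qf J (ptr1 I (\<rho> w v)) (f v j) (f v j)"
      if "w \<in> W" for w by (rule qf_tensv_marginal1[OF fin(3) specD(1)[OF e(1)[OF that]]])
    have "(\<Sum>w\<in>W. \<Sum>i\<in>I. q w v i j) = Re (\<Sum>w\<in>W. \<Sum>i\<in>I. qf (I \<times> J) (\<rho> w v) (tensv (e w) (f v) (i, j)) (tensv (e w) (f v) (i, j)))"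
      unfolding q_def by simp
    also have "\<dots> = Re (\<Sum>w\<in>W. qf J (ptr1 I (\<rho> w v)) (f v j) (f v j))" using 1 by simp
    also have "\<dots> = Re (qf J (marg2 W I \<rho> v) (f v j) (f v j))"
    proof -
      have "marg2 W I \<rho> v = (\<lambda>x y. \<Sum>w\<in>W. ptr1 I (\<rho> w v) x y)"
        unfolding marg2_def ptr1_def[abs_def] by (intro ext sum.swap)
      then show ?thesis by (simp only: qf_sum)
    qed
    finally show ?thesis using spec_qf_basis[OF fin(4) f(1)[OF v(1)] v(2) v(2)] by simp
  qed
  \<comment> \<open>A vanishing marginal eigenvalue is a sum of nonnegative weights q, so each of
    them vanishes; the value of ln at 0 is thereby harmless.\<close>
  have za: "q w v i j = 0" if "w \<in> W" "v \<in> V" "i \<in> I" "j \<in> J" "a w i = 0 \<or> b v j = 0" for w v i j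
    using that(5)
  proof
    assume "a w i = 0"
    then have "(\<Sum>v\<in>V. \<Sum>j\<in>J. q w v i j) = 0" using qa that by simp
    then have "(\<Sum>j\<in>J. q w v i j) = 0" using that q0 fin
      by (subst (asm) sum_nonneg_eq_0_iff) (auto intro!: sum_nonneg)
    then show ?thesis using that q0 fin by (subst (asm) sum_nonneg_eq_0_iff) auto
  next
    assume "b v j = 0"
    then have "(\<Sum>w\<in>W. \<Sum>i\<in>I. q w v i j) = 0" using qb that by simp
    then have "(\<Sum>i\<in>I. q w v i j) = 0" using that q0 fin
      by (subst (asm) sum_nonneg_eq_0_iff) (auto intro!: sum_nonneg)
    then show ?thesis using that q0 fin by (subst (asm) sum_nonneg_eq_0_iff) auto
  qed
  let ?val = "\<lambda>w v. - ln 2 * ent (I \<times> J) (\<rho> w v) - (\<Sum>k\<in>I \<times> J. q w v (fst k) (snd k) * ln (a w (fst k) * b v (snd k)))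
      - tr_on (I \<times> J) (\<rho> w v) + tr_on I (marg1 V J \<rho> w) * tr_on J (marg2 W I \<rho> v)"
  have int: "((\<lambda>u. \<Sum>w\<in>W. \<Sum>v\<in>V. (1 - u) * Qu (I \<times> J) (\<rho> w v) (tens (marg1 V J \<rho> w) (marg2 W I \<rho> v)) u)
       has_integral (\<Sum>w\<in>W. \<Sum>v\<in>V. ?val w v)) {0<..<1}"
  proof (intro has_integral_sum fin)
    fix w v assume wv: "w \<in> W" "v \<in> V"
    note t = tr_on_tens[OF fin(3,4) p1(1)[OF wv(1)] p2(1)[OF wv(2)]]
    have "q w v (fst k) (snd k) = 0" if "k \<in> I \<times> J" "a w (fst k) * b v (snd k) = 0" for k
      using za[OF wv, of "fst k" "snd k"] that by auto
    then show "((\<lambda>u. (1 - u) * Qu (I \<times> J) (\<rho> w v) (tens (marg1 V J \<rho> w) (marg2 W I \<rho> v)) u) has_integral ?val w v) {0<..<1}"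
      using rel_entropy_integral[OF finIJ p[OF wv] conjunct2[OF t] spec_tens[OF e(1)[OF wv(1)] f(1)[OF wv(2)]]]
      unfolding conjunct1[OF t] q_def by simp
  qed
  have "(\<Sum>k\<in>I \<times> J. q w v (fst k) (snd k) * ln (a w (fst k) * b v (snd k))) =
     (\<Sum>i\<in>I. \<Sum>j\<in>J. q w v i j * ln (a w i)) + (\<Sum>i\<in>I. \<Sum>j\<in>J. q w v i j * ln (b v j))" if wv: "w \<in> W" "v \<in> V" for w v
  proof -
    have "(\<Sum>k\<in>I \<times> J. q w v (fst k) (snd k) * ln (a w (fst k) * b v (snd k))) = (\<Sum>i\<in>I. \<Sum>j\<in>J. q w v i j * ln (a w i * b v j))"
      by (simp add: sum.cartesian_product case_prod_beta)
    also have "\<dots> = (\<Sum>i\<in>I. \<Sum>j\<in>J. q w v i j * ln (a w i) + q w v i j * ln (b v j))"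
    proof (intro sum.cong refl)
      fix i j assume ij: "i \<in> I" "j \<in> J"
      show "q w v i j * ln (a w i * b v j) = q w v i j * ln (a w i) + q w v i j * ln (b v j)"
      proof (cases "a w i = 0 \<or> b v j = 0")
        case False
        then have "0 < a w i" "0 < b v j" using e(2)[OF wv(1) ij(1)] f(2)[OF wv(2) ij(2)] by auto
        then show ?thesis by (simp add: ln_mult distrib_left)
      qed (use za[OF wv ij] in simp)
    qed
    finally show ?thesis by (simp add: sum.distrib)
  qed
  then have "(\<Sum>w\<in>W. \<Sum>v\<in>V. \<Sum>k\<in>I \<times> J. q w v (fst k) (snd k) * ln (a w (fst k) * b v (snd k))) =
     (\<Sum>w\<in>W. \<Sum>v\<in>V. \<Sum>i\<in>I. \<Sum>j\<in>J. q w v i j * ln (a w i)) + (\<Sum>w\<in>W. \<Sum>v\<in>V. \<Sum>i\<in>I. \<Sum>j\<in>J. q w v i j * ln (b v j))"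
    by (simp add: sum.distrib)
  moreover have "(\<Sum>w\<in>W. \<Sum>v\<in>V. \<Sum>i\<in>I. \<Sum>j\<in>J. q w v i j * ln (a w i)) = - ln 2 * (\<Sum>w\<in>W. ent I (marg1 V J \<rho> w))"
  proof -
    have "(\<Sum>w\<in>W. \<Sum>v\<in>V. \<Sum>i\<in>I. \<Sum>j\<in>J. q w v i j * ln (a w i)) = (\<Sum>w\<in>W. \<Sum>i\<in>I. \<Sum>v\<in>V. \<Sum>j\<in>J. q w v i j * ln (a w i))"
      by (intro sum.cong refl sum.swap)
    also have "\<dots> = (\<Sum>w\<in>W. \<Sum>i\<in>I. a w i * ln (a w i))"
      unfolding sum_distrib_right[symmetric] by (intro sum.cong refl) (simp add: qa)
    also have "\<dots> = - ln 2 * (\<Sum>w\<in>W. ent I (marg1 V J \<rho> w))"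
      unfolding sum_distrib_left using e(2,3) by (intro sum.cong refl) (simp add: sum_distrib_left eta_ln sum_negf)
    finally show ?thesis .
  qed
  moreover have "(\<Sum>w\<in>W. \<Sum>v\<in>V. \<Sum>i\<in>I. \<Sum>j\<in>J. q w v i j * ln (b v j)) = - ln 2 * (\<Sum>v\<in>V. ent J (marg2 W I \<rho> v))"
  proof -
    have "(\<Sum>w\<in>W. \<Sum>v\<in>V. \<Sum>i\<in>I. \<Sum>j\<in>J. q w v i j * ln (b v j)) = (\<Sum>v\<in>V. \<Sum>w\<in>W. \<Sum>i\<in>I. \<Sum>j\<in>J. q w v i j * ln (b v j))"
      by (rule sum.swap)
    also have "\<dots> = (\<Sum>v\<in>V. \<Sum>w\<in>W. \<Sum>j\<in>J. \<Sum>i\<in>I. q w v i j * ln (b v j))"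
      by (intro sum.cong refl sum.swap)
    also have "\<dots> = (\<Sum>v\<in>V. \<Sum>j\<in>J. \<Sum>w\<in>W. \<Sum>i\<in>I. q w v i j * ln (b v j))"
      by (intro sum.cong refl sum.swap)
    also have "\<dots> = (\<Sum>v\<in>V. \<Sum>j\<in>J. b v j * ln (b v j))"
      unfolding sum_distrib_right[symmetric] by (intro sum.cong refl) (simp add: qb)
    also have "\<dots> = - ln 2 * (\<Sum>v\<in>V. ent J (marg2 W I \<rho> v))"
      unfolding sum_distrib_left using f(2,3) by (intro sum.cong refl) (simp add: sum_distrib_left eta_ln sum_negf)
    finally show ?thesis .
  qed
  moreover have "(\<Sum>w\<in>W. \<Sum>v\<in>V. tr_on I (marg1 V J \<rho> w) * tr_on J (marg2 W I \<rho> v)) = 1"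
  proof -
    have "(\<Sum>v\<in>V. tr_on J (marg2 W I \<rho> v)) = 1" using tr p2(2) by (subst (asm) sum.swap) simp
    moreover have "(\<Sum>w\<in>W. tr_on I (marg1 V J \<rho> w)) = 1" using tr p1(2) by simp
    ultimately show ?thesis unfolding sum_product[symmetric] by simp
  qed
  ultimately have "(\<Sum>w\<in>W. \<Sum>v\<in>V. ?val w v) = ln 2 * ((\<Sum>w\<in>W. ent I (marg1 V J \<rho> w)) + (\<Sum>v\<in>V. ent J (marg2 W I \<rho> v)) - (\<Sum>w\<in>W. \<Sum>v\<in>V. ent (I \<times> J) (\<rho> w v)))"
    unfolding sum.distrib sum_subtractf tr by (simp add: sum_distrib_left[symmetric] sum_negf algebra_simps)
  then show ?thesis using int by (simp add: sum_distrib_left)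
qed

text \<open>Forgetting the classical labels sums both the blocks of the state and the products of
  their marginals, so \<open>Qu_sum_le\<close> under the integral shows that the mutual information
  cannot increase.\<close>

theorem strong_subadditivity:
  assumes fin: "finite W" "finite V" "finite I" "finite J"
    and p: "\<And>w v. w \<in> W \<Longrightarrow> v \<in> V \<Longrightarrow> psd_on (I \<times> J) (\<rho> w v)"
    and tr: "(\<Sum>w\<in>W. \<Sum>v\<in>V. tr_on (I \<times> J) (\<rho> w v)) = 1"
  defines "P \<equiv> \<lambda>p q. \<Sum>w\<in>W. \<Sum>v\<in>V. \<rho> w v p q"
  shows "ent I (ptr2 J P) + ent J (ptr1 I P) - ent (I \<times> J) P
     \<le> (\<Sum>w\<in>W. ent I (marg1 V J \<rho> w)) + (\<Sum>v\<in>V. ent J (marg2 W I \<rho> v)) - (\<Sum>w\<in>W. \<Sum>v\<in>V. ent (I \<times> J) (\<rho> w v))"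
    and "0 \<le> ent I (ptr2 J P) + ent J (ptr1 I P) - ent (I \<times> J) P"
proof -
  have finIJ: "finite (I \<times> J)" using fin by simp
  have pP: "psd_on (I \<times> J) P" unfolding P_def by (intro psd_on_sum p)
  have trP: "tr_on (I \<times> J) P = 1" unfolding P_def tr_on_sum using tr .
  note int1 = product_ref_integral[OF fin p tr]
  \<comment> \<open>Label sets with a single element turn the same formula into the mutual
    information of the unlabelled state P.\<close>
  have int2: "((\<lambda>u. (1 - u) * Qu (I \<times> J) P (tens (ptr2 J P) (ptr1 I P)) u) has_integral
      ln 2 * (ent I (ptr2 J P) + ent J (ptr1 I P) - ent (I \<times> J) P)) {0<..<1}"
    using product_ref_integral[of "{()}" "{()}" I J "\<lambda>_ _. P"] fin pP trP
    by (simp add: marg1_def marg2_def)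
  have p1: "psd_on I (marg1 V J \<rho> w)" if "w \<in> W" for w
    by (rule psd_marg1(1)[OF fin that]) (rule p)
  have p2: "psd_on J (marg2 W I \<rho> v)" if "v \<in> V" for v
    by (rule psd_marg2(1)[OF fin that]) (rule p)
  \<comment> \<open>By bilinearity the product of the marginals of P is the sum of the products of
    labelled marginals over all pairs of labels.\<close>
  have T: "tens (ptr2 J P) (ptr1 I P) = (\<lambda>p q. \<Sum>s\<in>W \<times> V. tens (marg1 V J \<rho> (fst s)) (marg2 W I \<rho> (snd s)) p q)"
  proof (intro ext)
    fix p q
    have 1: "ptr2 J P x y = (\<Sum>w\<in>W. marg1 V J \<rho> w x y)" for x y
      unfolding marg1_def ptr2_def P_def by (rule sum.swap)
    have 2: "ptr1 I P x y = (\<Sum>v\<in>V. marg2 W I \<rho> v x y)" for x y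
    proof -
      have "ptr1 I P x y = (\<Sum>i\<in>I. \<Sum>v\<in>V. \<Sum>w\<in>W. \<rho> w v (i, x) (i, y))"
        unfolding ptr1_def P_def by (intro sum.cong refl sum.swap)
      also have "\<dots> = (\<Sum>v\<in>V. marg2 W I \<rho> v x y)"
        unfolding marg2_def ptr1_def by (rule sum.swap)
      finally show ?thesis .
    qed
    show "tens (ptr2 J P) (ptr1 I P) p q = (\<Sum>s\<in>W \<times> V. tens (marg1 V J \<rho> (fst s)) (marg2 W I \<rho> (snd s)) p q)"
      unfolding tens_def 1 2 by (rule sum_product_Times[symmetric])
  qed
  have PT: "P = (\<lambda>p q. \<Sum>s\<in>W \<times> V. \<rho> (fst s) (snd s) p q)"
    unfolding P_def by (simp add: sum.cartesian_product case_prod_beta)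
  have le: "Qu (I \<times> J) P (tens (ptr2 J P) (ptr1 I P)) u \<le> (\<Sum>w\<in>W. \<Sum>v\<in>V. Qu (I \<times> J) (\<rho> w v) (tens (marg1 V J \<rho> w) (marg2 W I \<rho> v)) u)"
    if "0 < u" "u < 1" for u
  proof -
    have "Qu (I \<times> J) P (tens (ptr2 J P) (ptr1 I P)) u \<le>
      (\<Sum>s\<in>W \<times> V. Qu (I \<times> J) (\<rho> (fst s) (snd s)) (tens (marg1 V J \<rho> (fst s)) (marg2 W I \<rho> (snd s))) u)"
      unfolding T by (subst PT, rule Qu_sum_le[OF finIJ _ _ that])
        (use p p1 p2 tr_on_tens[OF fin(3,4)] in auto)
    then show ?thesis by (simp add: sum.cartesian_product case_prod_beta)
  qed
  have "ln 2 * (ent I (ptr2 J P) + ent J (ptr1 I P) - ent (I \<times> J) P) \<le>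
    ln 2 * ((\<Sum>w\<in>W. ent I (marg1 V J \<rho> w)) + (\<Sum>v\<in>V. ent J (marg2 W I \<rho> v)) - (\<Sum>w\<in>W. \<Sum>v\<in>V. ent (I \<times> J) (\<rho> w v)))"
    by (rule has_integral_le[OF int2 int1]) (use le in \<open>auto intro: mult_left_mono\<close>)
  then show "ent I (ptr2 J P) + ent J (ptr1 I P) - ent (I \<times> J) P
     \<le> (\<Sum>w\<in>W. ent I (marg1 V J \<rho> w)) + (\<Sum>v\<in>V. ent J (marg2 W I \<rho> v)) - (\<Sum>w\<in>W. \<Sum>v\<in>V. ent (I \<times> J) (\<rho> w v))"
    by (rule mult_left_le_imp_le) simp
  have "psd_on (I \<times> J) (tens (ptr2 J P) (ptr1 I P))"
    using tr_on_tens[OF fin(3,4) psd_ptr2(1)[OF fin(3,4) pP] psd_ptr1(1)[OF fin(3,4) pP]] by auto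
  then have "0 \<le> ln 2 * (ent I (ptr2 J P) + ent J (ptr1 I P) - ent (I \<times> J) P)"
    using Qu_nonneg[OF finIJ pP] by (intro has_integral_nonneg[OF int2]) auto
  then show "0 \<le> ent I (ptr2 J P) + ent J (ptr1 I P) - ent (I \<times> J) P"
    by (simp add: zero_le_mult_iff)
qed

section \<open>Two-outcome tests\<close>

text \<open>Data processing for the measurement with outcomes T and 1 - T: choosing Y = c T + d (1 -
  T) leaves the functional of two-point distributions. As Y^2 \<le> c^2 T + d^2 (1 - T), replacing
  the quadratic terms only lowers the value.\<close>

lemma Fu_test_bound:
  fixes c d :: real
  assumes fin: "finite I" and pR: "psd_on I R" and pS: "psd_on I S" and T: "spec I T g t"
    and t: "\<And>k. k \<in> I \<Longrightarrow> 0 \<le> t k \<and> t k \<le> 1" and u: "0 < u" "u < 1"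
  defines "Y \<equiv> (\<lambda>x y. \<Sum>k\<in>I. complex_of_real (c * t k + d * (1 - t k)) * g k x * cnj (g k y))"
  shows "2 * (c * (trp I R T - trp I S T) + d * ((tr_on I R - trp I R T) - (tr_on I S - trp I S T)))
     - u * (c\<^sup>2 * trp I R T + d\<^sup>2 * (tr_on I R - trp I R T))
     - (1 - u) * (c\<^sup>2 * trp I S T + d\<^sup>2 * (tr_on I S - trp I S T)) \<le> Fu I R S u Y"
proof -
  note og = specD(1)[OF T]
  define y where "y = (\<lambda>k. c * t k + d * (1 - t k))"
  have sY: "spec I Y g y" unfolding Y_def y_def by (rule spec_sub[OF og])
  have Ysym: "cnj (Y x z) = Y z x" for x z unfolding Y_def by (simp add: mult_ac)
  have lin: "(\<Sum>k\<in>I. (c' * t k + d' * (1 - t k)) * Re (qf I A (g k) (g k))) = c' * trp I A T + d' * (tr_on I A - trp I A T)"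
    for A and c' d' :: real
  proof -
    have "(\<Sum>k\<in>I. (c' * t k + d' * (1 - t k)) * Re (qf I A (g k) (g k))) =
       c' * (\<Sum>k\<in>I. t k * Re (qf I A (g k) (g k))) + d' * ((\<Sum>k\<in>I. Re (qf I A (g k) (g k))) - (\<Sum>k\<in>I. t k * Re (qf I A (g k) (g k))))"
      by (simp add: sum_distrib_left sum_subtractf[symmetric] sum.distrib[symmetric] algebra_simps)
    then show ?thesis unfolding trp_spec[OF T] onb_trace[OF fin og] .
  qed
  have quad: "(\<Sum>z\<in>I. Re (qf I A (\<lambda>x. Y x z) (\<lambda>x. Y x z))) \<le> c\<^sup>2 * trp I A T + d\<^sup>2 * (tr_on I A - trp I A T)"
    if pA: "psd_on I A" for A
  proof -
    have "qf I A (\<lambda>x. Y x z) (\<lambda>x. Y x z) = (\<Sum>j\<in>I. \<Sum>k\<in>I. complex_of_real (y j * y k) * qf I A (g j) (g k) * (g j z * cnj (g k z)))" for z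
    proof -
      have "(\<lambda>x. Y x z) = (\<lambda>x. \<Sum>k\<in>I. (complex_of_real (y k) * cnj (g k z)) * g k x)"
        unfolding Y_def y_def by (simp add: mult_ac)
      then have "qf I A (\<lambda>x. Y x z) (\<lambda>x. Y x z) = qf I A (\<lambda>x. \<Sum>k\<in>I. (complex_of_real (y k) * cnj (g k z)) * g k x) (\<lambda>x. \<Sum>k\<in>I. (complex_of_real (y k) * cnj (g k z)) * g k x)"
        by simp
      then show ?thesis unfolding qf_sum_left qf_sum_right sum_distrib_left
        by (simp add: mult_ac)
    qed
    then have "(\<Sum>z\<in>I. qf I A (\<lambda>x. Y x z) (\<lambda>x. Y x z)) =
       (\<Sum>z\<in>I. \<Sum>j\<in>I. \<Sum>k\<in>I. complex_of_real (y j * y k) * qf I A (g j) (g k) * (g j z * cnj (g k z)))" by simp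
    also have "\<dots> = (\<Sum>j\<in>I. \<Sum>z\<in>I. \<Sum>k\<in>I. complex_of_real (y j * y k) * qf I A (g j) (g k) * (g j z * cnj (g k z)))"
      by (rule sum.swap)
    also have "\<dots> = (\<Sum>j\<in>I. \<Sum>k\<in>I. \<Sum>z\<in>I. complex_of_real (y j * y k) * qf I A (g j) (g k) * (g j z * cnj (g k z)))"
      by (intro sum.cong refl sum.swap)
    also have "\<dots> = (\<Sum>j\<in>I. \<Sum>k\<in>I. complex_of_real (y j * y k) * qf I A (g j) (g k) * ip I (g k) (g j))"
      unfolding sum_distrib_left[symmetric] ip_def by (simp add: mult.commute)
    also have "\<dots> = (\<Sum>j\<in>I. \<Sum>k\<in>I. if j = k then complex_of_real (y j * y k) * qf I A (g j) (g k) else 0)"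
      by (intro sum.cong refl) (simp add: onbD1[OF og])
    also have "\<dots> = (\<Sum>j\<in>I. complex_of_real ((y j)\<^sup>2) * qf I A (g j) (g j))"
      using fin by (simp add: power2_eq_square)
    finally have "(\<Sum>z\<in>I. Re (qf I A (\<lambda>x. Y x z) (\<lambda>x. Y x z))) = (\<Sum>j\<in>I. (y j)\<^sup>2 * Re (qf I A (g j) (g j)))"
      unfolding Re_sum[symmetric] by (simp add: of_real_power[symmetric] del: of_real_power)
    also have "\<dots> \<le> (\<Sum>j\<in>I. (c\<^sup>2 * t j + d\<^sup>2 * (1 - t j)) * Re (qf I A (g j) (g j)))"
    proof (intro sum_mono mult_right_mono qf_psd_nonneg pA)
      fix j assume "j \<in> I"
      \<comment> \<open>This product is exactly the gap in the inequality that follows.\<close>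
      then have "0 \<le> t j * (1 - t j) * (c - d)\<^sup>2" using t by auto
      then show "(y j)\<^sup>2 \<le> c\<^sup>2 * t j + d\<^sup>2 * (1 - t j)"
        unfolding y_def by (simp add: power2_eq_square algebra_simps)
    qed
    finally show ?thesis unfolding lin .
  qed
  have "Re (\<Sum>x\<in>I. \<Sum>y\<in>I. Y x y * (R y x - S y x)) = trp I (\<lambda>x y. R x y - S x y) Y"
    unfolding trp_def by (subst sum.swap) (simp add: mult.commute)
  also have "\<dots> = c * (trp I R T - trp I S T) + d * ((tr_on I R - trp I R T) - (tr_on I S - trp I S T))"
    unfolding trp_spec[OF sY] y_def lin unfolding tr_on_diff trp_spec[OF T] qf_diff
    by (simp add: right_diff_distrib sum_subtractf)
  finally have E: "Re (\<Sum>x\<in>I. \<Sum>y\<in>I. Y x y * (R y x - S y x)) =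
     c * (trp I R T - trp I S T) + d * ((tr_on I R - trp I R T) - (tr_on I S - trp I S T))" .
  have "u * (\<Sum>z\<in>I. Re (qf I R (\<lambda>x. Y x z) (\<lambda>x. Y x z))) \<le> u * (c\<^sup>2 * trp I R T + d\<^sup>2 * (tr_on I R - trp I R T))"
    using u by (intro mult_left_mono quad pR) auto
  moreover have "(1 - u) * (\<Sum>z\<in>I. Re (qf I S (\<lambda>x. Y x z) (\<lambda>x. Y x z))) \<le> (1 - u) * (c\<^sup>2 * trp I S T + d\<^sup>2 * (tr_on I S - trp I S T))"
    using u by (intro mult_left_mono quad pS) auto
  ultimately show ?thesis unfolding Fu_def Ysym E by linarith
qed

text \<open>Binary entropy is at most one bit; this is the source of the subtracted 1 in the Fano
  bound.\<close>

lemma binary_entropy_le: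
  fixes p :: real
  assumes "0 \<le> p" "p \<le> 1"
  shows "- ln 2 \<le> p * ln p + (1 - p) * ln (1 - p)"
proof -
  have "(\<Sum>k\<in>{True, False}. eta (if k then p else 1 - p)) \<le> eta (\<Sum>k\<in>{True, False}. if k then p else 1 - p) + (\<Sum>k\<in>{True, False}. if k then p else 1 - p) * log 2 (real 2)"
    using assms by (intro eta_sum_le_card) auto
  then have "eta p + eta (1 - p) \<le> 1" by simp
  then have "ln 2 * (eta p + eta (1 - p)) \<le> ln 2 * 1" by (rule mult_left_mono) simp
  then show ?thesis using assms by (simp add: distrib_left eta_ln)
qed

text \<open>The integral dominates the binary relative entropy of the outcome probabilities p and q,
  which is at least p ln (1 / q) - ln 2. The hypotheses for q = 0 and q = 1 are absolute continuity
  for the two outcomes, as the scalar integral formula demands.\<close>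

lemma test_integral_bound:
  fixes M :: real
  assumes fin: "finite I" and R: "\<And>s. s \<in> \<Omega> \<Longrightarrow> psd_on I (R s)" and S: "\<And>s. s \<in> \<Omega> \<Longrightarrow> psd_on I (S s)"
    and T: "\<And>s. s \<in> \<Omega> \<Longrightarrow> effect_on I (T s)"
    and trR: "(\<Sum>s\<in>\<Omega>. tr_on I (R s)) = 1" and trS: "(\<Sum>s\<in>\<Omega>. tr_on I (S s)) = 1"
    and pq: "p = (\<Sum>s\<in>\<Omega>. trp I (R s) (T s))" "q = (\<Sum>s\<in>\<Omega>. trp I (S s) (T s))"
    and int: "((\<lambda>u. (1 - u) * (\<Sum>s\<in>\<Omega>. Qu I (R s) (S s) u)) has_integral X) {0<..<1}"
    and M: "1 \<le> M" "q \<le> 1 / M" and abs: "q = 0 \<Longrightarrow> p = 0" "q = 1 \<Longrightarrow> p = 1"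
  shows "p * ln M - ln 2 \<le> X"
proof -
  have T': "psd_on I (T s)" if "s \<in> \<Omega>" for s using T[OF that] by (simp add: effect_on_def)
  have range: "0 \<le> trp I A (T s) \<and> trp I A (T s) \<le> tr_on I A" if s: "s \<in> \<Omega>" and A: "psd_on I A" for s A
  proof -
    obtain g t where g: "spec I (T s) g t" using psd_spec[OF fin T'[OF s]] by blast
    have t: "\<forall>k\<in>I. 0 \<le> t k \<and> t k \<le> 1" using effect_spec[OF fin g] T[OF s] by simp
    have "trp I A (T s) \<le> (\<Sum>k\<in>I. 1 * Re (qf I A (g k) (g k)))"
      unfolding trp_spec[OF g] using t qf_psd_nonneg[OF A] by (intro sum_mono mult_right_mono) auto
    then show ?thesis using trp_nonneg[OF fin A T'[OF s]] onb_trace[OF fin specD(1)[OF g], of A] by simp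
  qed
  have p01: "0 \<le> p" "p \<le> 1"
    unfolding pq using range R trR sum_mono[of \<Omega> "\<lambda>s. trp I (R s) (T s)" "\<lambda>s. tr_on I (R s)"] by (auto intro!: sum_nonneg)
  have q01: "0 \<le> q" "q \<le> 1"
    unfolding pq using range S trS sum_mono[of \<Omega> "\<lambda>s. trp I (S s) (T s)" "\<lambda>s. tr_on I (S s)"] by (auto intro!: sum_nonneg)
  have key: "(p - q)\<^sup>2 / (u * p + (1 - u) * q) + ((1 - p) - (1 - q))\<^sup>2 / (u * (1 - p) + (1 - u) * (1 - q))
     \<le> (\<Sum>s\<in>\<Omega>. Qu I (R s) (S s) u)" if u: "0 < u" "u < 1" for u
  proof -
    define D1 where "D1 = u * p + (1 - u) * q"
    define D0 where "D0 = u * (1 - p) + (1 - u) * (1 - q)"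
    \<comment> \<open>c and d maximize the two scalar quadratics, one for each outcome.\<close>
    define c where "c = (p - q) / D1"
    define d where "d = (q - p) / D0"
    have "u * p \<ge> 0" "(1 - u) * q \<ge> 0" "u * (1 - p) \<ge> 0" "(1 - u) * (1 - q) \<ge> 0" using u p01 q01 by auto
    then have z: "D1 = 0 \<Longrightarrow> p - q = 0" "D0 = 0 \<Longrightarrow> p - q = 0"
      unfolding D1_def D0_def using u by (auto simp: add_nonneg_eq_0_iff)
    let ?l = "\<lambda>s. 2 * (c * (trp I (R s) (T s) - trp I (S s) (T s)) + d * ((tr_on I (R s) - trp I (R s) (T s)) - (tr_on I (S s) - trp I (S s) (T s))))
     - u * (c\<^sup>2 * trp I (R s) (T s) + d\<^sup>2 * (tr_on I (R s) - trp I (R s) (T s)))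
     - (1 - u) * (c\<^sup>2 * trp I (S s) (T s) + d\<^sup>2 * (tr_on I (S s) - trp I (S s) (T s)))"
    have "?l s \<le> Qu I (R s) (S s) u" if s: "s \<in> \<Omega>" for s
    proof -
      obtain g t where g: "spec I (T s) g t" using psd_spec[OF fin T'[OF s]] by blast
      have t: "\<And>k. k \<in> I \<Longrightarrow> 0 \<le> t k \<and> t k \<le> 1" using effect_spec[OF fin g] T[OF s] by simp
      show ?thesis
        by (rule order_trans[OF Fu_test_bound[OF fin R[OF s] S[OF s] g t u] Fu_le_Qu[OF fin R[OF s] S[OF s] u]])
    qed
    then have "(\<Sum>s\<in>\<Omega>. ?l s) \<le> (\<Sum>s\<in>\<Omega>. Qu I (R s) (S s) u)" by (rule sum_mono)
    also have "(\<Sum>s\<in>\<Omega>. ?l s) = 2 * (c * (p - q) + d * ((1 - p) - (1 - q))) - u * (c\<^sup>2 * p + d\<^sup>2 * (1 - p)) - (1 - u) * (c\<^sup>2 * q + d\<^sup>2 * (1 - q))"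
      by (simp only: sum_subtractf sum.distrib sum_distrib_left[symmetric] trR trS pq(1)[symmetric] pq(2)[symmetric])
    also have "\<dots> = (2 * c * (p - q) - c\<^sup>2 * D1) + (2 * d * (q - p) - d\<^sup>2 * D0)"
      unfolding D1_def D0_def by (simp add: algebra_simps)
    also have "2 * c * (p - q) - c\<^sup>2 * D1 = (p - q)\<^sup>2 / D1"
      unfolding c_def using z(1) by (cases "D1 = 0") (auto simp: power2_eq_square field_simps)
    also have "2 * d * (q - p) - d\<^sup>2 * D0 = ((1 - p) - (1 - q))\<^sup>2 / D0"
      unfolding d_def using z(2) by (cases "D0 = 0") (auto simp: power2_eq_square field_simps)
    finally show ?thesis unfolding D1_def D0_def .
  qed
  have "((\<lambda>u. (1 - u) * ((p - q)\<^sup>2 / (u * p + (1 - u) * q)) + (1 - u) * (((1 - p) - (1 - q))\<^sup>2 / (u * (1 - p) + (1 - u) * (1 - q)))) has_integral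
     (p * ln p - p * ln q - p + q) + ((1 - p) * ln (1 - p) - (1 - p) * ln (1 - q) - (1 - p) + (1 - q))) {0<..<1}"
    using p01 q01 abs by (intro has_integral_add scalar_rel_integral) auto
  then have "(p * ln p - p * ln q - p + q) + ((1 - p) * ln (1 - p) - (1 - p) * ln (1 - q) - (1 - p) + (1 - q)) \<le> X"
  proof (rule has_integral_le[OF _ int])
    fix u :: real assume "u \<in> {0<..<1}"
    then have u: "0 < u" "u < 1" by auto
    show "(1 - u) * ((p - q)\<^sup>2 / (u * p + (1 - u) * q)) + (1 - u) * (((1 - p) - (1 - q))\<^sup>2 / (u * (1 - p) + (1 - u) * (1 - q)))
       \<le> (1 - u) * (\<Sum>s\<in>\<Omega>. Qu I (R s) (S s) u)"
      unfolding distrib_left[symmetric] using u by (intro mult_left_mono key) auto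
  qed
  moreover have "p * ln M \<le> - p * ln q"
  proof (cases "q = 0")
    case False
    then have q: "q > 0" using q01 by auto
    have "ln q \<le> ln (1 / M)" using q M by simp
    then have "ln M \<le> - ln q" using M by (simp add: ln_div)
    then have "p * ln M \<le> p * (- ln q)" using p01 by (intro mult_left_mono) auto
    then show ?thesis by simp
  qed (use abs in simp)
  moreover have "0 \<le> - (1 - p) * ln (1 - q)"
  proof (cases "q = 1")
    case False
    then have "ln (1 - q) \<le> 0" using q01 by simp
    then have "(1 - p) * ln (1 - q) \<le> 0" using p01 by (intro mult_nonneg_nonpos) auto
    then show ?thesis by (simp only: mult_minus_left neg_0_le_iff_le)
  qed (use abs in simp)
  ultimately show ?thesis using binary_entropy_le[OF p01] by (simp add: algebra_simps)
qed

section \<open>Positive semidefinite matrices\<close>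

lemma psd_iff_psd_on:
  assumes M: "M \<in> carrier_mat n n"
  shows "psd M \<longleftrightarrow> psd_on {..<n} (\<lambda>i j. M $$ (i, j))"
proof -
  have q: "(M *\<^sub>v v) \<bullet>c v = qf {..<n} (\<lambda>i j. M $$ (i, j)) (\<lambda>i. v $ i) (\<lambda>i. v $ i)" if "v \<in> carrier_vec n" for v
  proof -
    have "(M *\<^sub>v v) \<bullet>c v = (\<Sum>i<n. (\<Sum>j<n. M $$ (i, j) * v $ j) * cnj (v $ i))"
      using that M by (simp add: scalar_prod_def atLeast0LessThan)
    also have "\<dots> = qf {..<n} (\<lambda>i j. M $$ (i, j)) (\<lambda>i. v $ i) (\<lambda>i. v $ i)"
      unfolding qf_def sum_distrib_right by (intro sum.cong refl) (simp add: mult_ac)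
    finally show ?thesis .
  qed
  have v: "qf {..<n} (\<lambda>i j. M $$ (i, j)) f f = (M *\<^sub>v vec n f) \<bullet>c vec n f" for f
    unfolding q[OF vec_carrier] by (rule qf_cong) auto
  have "psd M \<longleftrightarrow> (\<forall>v\<in>carrier_vec n. Im ((M *\<^sub>v v) \<bullet>c v) = 0 \<and> Re ((M *\<^sub>v v) \<bullet>c v) \<ge> 0)"
    unfolding psd_def using M by (metis carrier_matD(1))
  also have "\<dots> \<longleftrightarrow> psd_on {..<n} (\<lambda>i j. M $$ (i, j))"
  proof
    assume "\<forall>v\<in>carrier_vec n. Im ((M *\<^sub>v v) \<bullet>c v) = 0 \<and> Re ((M *\<^sub>v v) \<bullet>c v) \<ge> 0"
    then show "psd_on {..<n} (\<lambda>i j. M $$ (i, j))" unfolding psd_on_def v using vec_carrier by blast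
  next
    assume "psd_on {..<n} (\<lambda>i j. M $$ (i, j))"
    then show "\<forall>v\<in>carrier_vec n. Im ((M *\<^sub>v v) \<bullet>c v) = 0 \<and> Re ((M *\<^sub>v v) \<bullet>c v) \<ge> 0"
      unfolding psd_on_def using q by metis
  qed
  finally show ?thesis .
qed

lemma order_prod_linear:
  fixes as :: "complex list"
  shows "order z (\<Prod>a\<leftarrow>as. [:- a, 1:]) = count_list as z"
proof (induction as)
  case (Cons a as)
  have "(\<Prod>a\<leftarrow>as. [:- a, 1:]) \<noteq> 0" by (auto simp: prod_list_zero_iff)
  moreover have "order z [:- a, 1:] = (if z = a then 1 else 0)"
    using order_power_n_n[of a 1] by (auto intro: order_0I)
  ultimately show ?case using Cons by (simp add: order_mult del: mult_pCons_left)
qed (auto intro: order_0I)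

lemma sum_count_list:
  assumes "finite X" "set xs \<subseteq> X"
  shows "(\<Sum>z\<in>X. real (count_list xs z) * f z) = (\<Sum>z\<leftarrow>xs. f z)"
  using assms(2)
proof (induction xs)
  case (Cons x xs)
  have "(\<Sum>z\<in>X. real (count_list (x # xs) z) * f z) = (\<Sum>z\<in>X. real (count_list xs z) * f z + (if z = x then f z else 0))"
    by (intro sum.cong refl) (auto simp: distrib_right)
  then show ?case using Cons assms(1) by (simp add: sum.distrib)
qed simp

text \<open>Diagonalizing by the unitary matrix of eigenvectors makes the characteristic polynomial
  a product of linear factors, so the orders of its roots count repeated eigenvalues.\<close>

lemma vn_entropy_ent:
  assumes M: "M \<in> carrier_mat n n" and p: "psd M"
  shows "vn_entropy M = ent {..<n} (\<lambda>i j. M $$ (i, j))"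
proof -
  let ?A = "\<lambda>i j. M $$ (i, j)"
  have pA: "psd_on {..<n} ?A" using p psd_iff_psd_on[OF M] by simp
  obtain e l where s: "spec {..<n} ?A e l" "ent {..<n} ?A = (\<Sum>k<n. eta (l k))"
    using psd_spec[OF finite_lessThan pA] by blast
  define U where "U = mat n n (\<lambda>(x, k). e k x)"
  define V where "V = mat n n (\<lambda>(k, x). cnj (e k x))"
  define D where "D = mat n n (\<lambda>(i, j). if i = j then complex_of_real (l i) else 0)"
  have c: "U \<in> carrier_mat n n" "V \<in> carrier_mat n n" "D \<in> carrier_mat n n" unfolding U_def V_def D_def by auto
  have UV: "U * V = 1\<^sub>m n"
    by (rule eq_matI) (use onbD2[OF specD(1)[OF s(1)]] in \<open>auto simp: U_def V_def scalar_prod_def atLeast0LessThan\<close>)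
  have VU: "V * U = 1\<^sub>m n"
    by (rule eq_matI) (use onbD1[OF specD(1)[OF s(1)]] in \<open>auto simp: U_def V_def scalar_prod_def atLeast0LessThan ip_def\<close>)
  define X where "X = U * D"
  have X: "X \<in> carrier_mat n n" unfolding X_def using c by simp
  have UD: "X $$ (i, j) = complex_of_real (l j) * e j i" if "i < n" "j < n" for i j
    using that by (simp add: X_def U_def D_def scalar_prod_def atLeast0LessThan mult_delta_right mult.commute)
  have "M = X * V"
  proof (rule eq_matI)
    fix i j assume "i < dim_row (X * V)" "j < dim_col (X * V)"
    then have ij: "i < n" "j < n" using c X by auto
    have "(X * V) $$ (i, j) = (\<Sum>k<n. X $$ (i, k) * V $$ (k, j))"
      using ij c X by (simp add: scalar_prod_def atLeast0LessThan)
    also have "\<dots> = (\<Sum>k<n. complex_of_real (l k) * e k i * cnj (e k j))"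
      using ij UD by (intro sum.cong refl) (simp add: V_def)
    finally show "M $$ (i, j) = (X * V) $$ (i, j)" using specD(2)[OF s(1)] ij by simp
  qed (use M c X in auto)
  then have "M = U * D * V" unfolding X_def .
  then have "similar_mat M D" using M c UV VU by (intro similar_matI[of M D U V n]) auto
  then have "char_poly M = char_poly D" by (rule char_poly_similar)
  also have "\<dots> = (\<Prod>a\<leftarrow>diag_mat D. [:- a, 1:])"
    by (rule char_poly_upper_triangular[OF c(3)]) (auto simp: upper_triangular_def D_def)
  finally have cp: "char_poly M = (\<Prod>a\<leftarrow>diag_mat D. [:- a, 1:])" .
  have dg: "diag_mat D = map (\<lambda>k. complex_of_real (l k)) [0..<n]"
    unfolding diag_mat_def by (auto simp: D_def)
  have roots: "{z. poly (char_poly M) z = 0} = set (diag_mat D)"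
    unfolding cp poly_prod_list by (auto simp: prod_list_zero_iff)
  have "vn_entropy M = (\<Sum>z\<in>set (diag_mat D). real (count_list (diag_mat D) z) * eta (Re z))"
    unfolding vn_entropy_def roots unfolding cp order_prod_linear ..
  also have "\<dots> = (\<Sum>z\<leftarrow>diag_mat D. eta (Re z))" by (rule sum_count_list) auto
  also have "\<dots> = (\<Sum>k<n. eta (l k))" unfolding dg by (simp add: interv_sum_list_conv_sum_set_nat atLeast0LessThan comp_def)
  finally show ?thesis using s(2) by simp
qed

section \<open>Entropies of joint state families\<close>

lemma finite_words [simp]: "finite (words k :: 'a::finite list set)"
  unfolding words_def using finite_lists_length_eq[of "UNIV :: 'a set" k] by simp

lemma card_words: "card (words k :: 'a::finite list set) = CARD('a) ^ k"
  unfolding words_def using card_lists_length_eq[of "UNIV :: 'a set" k] by simp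

lemma words_0 [simp]: "words 0 = {[]}"
  by (auto simp: words_def)

lemma bij_betw_append:
  "bij_betw (\<lambda>(w, v). w @ v) (words k \<times> words l) (words (k + l))"
  by (rule bij_betw_byWitness[where f' = "\<lambda>u. (take k u, drop k u)"]) (auto simp: words_def)

lemma sum_words_append:
  "(\<Sum>u\<in>words (k + l). f u) = (\<Sum>w\<in>words k. \<Sum>v\<in>words l. f (w @ v))"
  unfolding sum.reindex_bij_betw[OF bij_betw_append, symmetric] sum.cartesian_product
  by (simp add: case_prod_beta)

lemma sum_words_1: "(\<Sum>u\<in>words (Suc 0). f u) = (\<Sum>a\<in>UNIV. f [a])"
  by (rule sum.reindex_bij_witness[where i = "\<lambda>a. [a]" and j = hd]) (auto simp: words_def length_Suc_conv)

lemma sum_words_snoc: "(\<Sum>u\<in>words (Suc l). f u) = (\<Sum>v\<in>words l. \<Sum>a\<in>UNIV. f (v @ [a]))"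
  using sum_words_append[of f l "Suc 0"] by (simp add: sum_words_1)

lemma sum_words_Cons: "(\<Sum>u\<in>words (Suc l). f u) = (\<Sum>a\<in>UNIV. \<Sum>v\<in>words l. f (a # v))"
  using sum_words_append[of f "Suc 0" l] by (simp add: sum_words_1)

lemma mult_add_less: "j < m \<Longrightarrow> b < n \<Longrightarrow> j * n + b < m * (n :: nat)"
proof -
  assume a: "j < m" "b < n"
  then have "j * n + b < Suc j * n" by simp
  also have "\<dots> \<le> m * n" using a by (intro mult_right_mono) auto
  finally show ?thesis .
qed

text \<open>The first component is the leading digit, in accordance with the leftmost site being the
  most significant tensor factor.\<close>

lemma bij_betw_mult_index:
  "bij_betw (\<lambda>(j, b). j * n + b) ({..<m} \<times> {..<n}) {..<m * n :: nat}"
proof (cases "n = 0")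
  case False
  then show ?thesis
    by (intro bij_betw_byWitness[where f' = "\<lambda>x. (x div n, x mod n)"])
      (auto simp: mult_add_less less_mult_imp_div_less)
qed (simp add: bij_betw_def)

lemma sum_mult_index: "(\<Sum>x<m * n. f x) = (\<Sum>j<m. \<Sum>b<n. f (j * n + b :: nat))"
  unfolding sum.reindex_bij_betw[OF bij_betw_mult_index, symmetric] sum.cartesian_product
  by (simp add: case_prod_beta)

abbreviation ents :: "(int \<Rightarrow> nat \<Rightarrow> 'a list \<Rightarrow> complex mat) \<Rightarrow> int \<Rightarrow> nat \<Rightarrow> 'a list \<Rightarrow> nat \<Rightarrow> nat \<Rightarrow> complex" where
  "ents J n k w \<equiv> \<lambda>i j. J n k w $$ (i, j)"

definition out :: "(int \<Rightarrow> nat \<Rightarrow> 'a::finite list \<Rightarrow> complex mat) \<Rightarrow> int \<Rightarrow> nat \<Rightarrow> nat \<Rightarrow> nat \<Rightarrow> complex" where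
  "out J n k = (\<lambda>i j. \<Sum>w\<in>words k. J n k w $$ (i, j))"

text \<open>Both \<open>SJ\<close> and \<open>SB\<close> keep the starting site as an argument
  because a periodic source need not be shift-invariant.\<close>

definition SJ :: "nat \<Rightarrow> (int \<Rightarrow> nat \<Rightarrow> 'a::finite list \<Rightarrow> complex mat) \<Rightarrow> int \<Rightarrow> nat \<Rightarrow> real" where
  "SJ d J n k = (\<Sum>w\<in>words k. ent {..<d ^ k} (ents J n k w))"

definition SB :: "nat \<Rightarrow> (int \<Rightarrow> nat \<Rightarrow> 'a::finite list \<Rightarrow> complex mat) \<Rightarrow> int \<Rightarrow> nat \<Rightarrow> real" where
  "SB d J n k = ent {..<d ^ k} (out J n k)"

lemma tr_on_mtrace: "M \<in> carrier_mat n n \<Longrightarrow> tr_on {..<n} (\<lambda>i j. M $$ (i, j)) = Re (mtrace M)"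
  by (simp add: tr_on_def mtrace_def)

section \<open>Local densities of a joint state and their marginals\<close>

context
  fixes d :: nat and J :: "int \<Rightarrow> nat \<Rightarrow> 'a::finite list \<Rightarrow> complex mat"
  assumes d: "d \<ge> 1" and J: "joint_state_family d J"
begin

lemma jsf_carrier: "w \<in> words k \<Longrightarrow> J n k w \<in> carrier_mat (d ^ k) (d ^ k)"
  using J unfolding joint_state_family_def by blast

lemma jsf_psd: "w \<in> words k \<Longrightarrow> psd_on {..<d ^ k} (ents J n k w)"
  using J psd_iff_psd_on[OF jsf_carrier] unfolding joint_state_family_def by blast

lemma jsf_trace: "(\<Sum>w\<in>words k. tr_on {..<d ^ k} (ents J n k w)) = 1"
proof -
  have "(\<Sum>w\<in>words k. tr_on {..<d ^ k} (ents J n k w)) = Re (\<Sum>w\<in>words k. mtrace (J n k w))"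
    by (simp add: tr_on_mtrace[OF jsf_carrier])
  then show ?thesis using J unfolding joint_state_family_def by simp
qed

lemma jsf_last1:
  assumes w: "w \<in> words k" and i: "i < d ^ k" "i' < d ^ k"
  shows "J n k w $$ (i, i') = (\<Sum>a\<in>UNIV. \<Sum>b<d. J n (Suc k) (w @ [a]) $$ (i * d + b, i' * d + b))"
proof -
  have "J n k w = msum (d ^ k) (\<lambda>a. ptrace_last d (J n (Suc k) (w @ [a]))) UNIV"
    using J w unfolding joint_state_family_def by simp
  also have "\<dots> $$ (i, i') = (\<Sum>a\<in>UNIV. ptrace_last d (J n (Suc k) (w @ [a])) $$ (i, i'))"
    unfolding msum_def using i by simp
  also have "\<dots> = (\<Sum>a\<in>UNIV. \<Sum>b<d. J n (Suc k) (w @ [a]) $$ (i * d + b, i' * d + b))"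
  proof (intro sum.cong refl)
    fix a :: 'a
    have "J n (Suc k) (w @ [a]) \<in> carrier_mat (d ^ Suc k) (d ^ Suc k)"
      using w by (intro jsf_carrier) (simp add: words_def)
    then have "dim_row (J n (Suc k) (w @ [a])) div d = d ^ k" using d by auto
    then show "ptrace_last d (J n (Suc k) (w @ [a])) $$ (i, i') = (\<Sum>b<d. J n (Suc k) (w @ [a]) $$ (i * d + b, i' * d + b))"
      using i unfolding ptrace_last_def Let_def by simp
  qed
  finally show ?thesis .
qed

lemma jsf_first1:
  assumes w: "w \<in> words k" and i: "i < d ^ k" "i' < d ^ k"
  shows "J (n + 1) k w $$ (i, i') = (\<Sum>a\<in>UNIV. \<Sum>b<d. J n (Suc k) (a # w) $$ (b * d ^ k + i, b * d ^ k + i'))"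
proof -
  have "J (n + 1) k w = msum (d ^ k) (\<lambda>a. ptrace_first d (J n (Suc k) (a # w))) UNIV"
    using J w unfolding joint_state_family_def by simp
  also have "\<dots> $$ (i, i') = (\<Sum>a\<in>UNIV. ptrace_first d (J n (Suc k) (a # w)) $$ (i, i'))"
    unfolding msum_def using i by simp
  also have "\<dots> = (\<Sum>a\<in>UNIV. \<Sum>b<d. J n (Suc k) (a # w) $$ (b * d ^ k + i, b * d ^ k + i'))"
  proof (intro sum.cong refl)
    fix a :: 'a
    have "J n (Suc k) (a # w) \<in> carrier_mat (d ^ Suc k) (d ^ Suc k)"
      using w by (intro jsf_carrier) (simp add: words_def)
    then have "dim_row (J n (Suc k) (a # w)) div d = d ^ k" using d by auto
    then show "ptrace_first d (J n (Suc k) (a # w)) $$ (i, i') = (\<Sum>b<d. J n (Suc k) (a # w) $$ (b * d ^ k + i, b * d ^ k + i'))"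
      using i unfolding ptrace_first_def Let_def by simp
  qed
  finally show ?thesis .
qed

lemma jsf_last:
  assumes w: "w \<in> words k" and i: "i < d ^ k" "i' < d ^ k"
  shows "J n k w $$ (i, i') = (\<Sum>v\<in>words l. \<Sum>j<d ^ l. J n (k + l) (w @ v) $$ (i * d ^ l + j, i' * d ^ l + j))"
proof (induction l)
  case (Suc l)
  let ?f = "\<lambda>v j. J n (k + Suc l) (w @ v) $$ (i * d ^ Suc l + j, i' * d ^ Suc l + j)"
  have "(\<Sum>v\<in>words l. \<Sum>j<d ^ l. J n (k + l) (w @ v) $$ (i * d ^ l + j, i' * d ^ l + j)) =
     (\<Sum>v\<in>words l. \<Sum>j<d ^ l. \<Sum>a\<in>UNIV. \<Sum>b<d. ?f (v @ [a]) (j * d + b))"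
  proof (intro sum.cong refl)
    fix v :: "'a list" and j assume vj: "v \<in> words l" "j \<in> {..<d ^ l}"
    have "w @ v \<in> words (k + l)" using w vj by (simp add: words_def)
    moreover have "i * d ^ l + j < d ^ (k + l)" "i' * d ^ l + j < d ^ (k + l)"
      unfolding power_add using i vj by (auto intro: mult_add_less)
    ultimately show "J n (k + l) (w @ v) $$ (i * d ^ l + j, i' * d ^ l + j) = (\<Sum>a\<in>UNIV. \<Sum>b<d. ?f (v @ [a]) (j * d + b))"
      by (simp add: jsf_last1 algebra_simps)
  qed
  also have "\<dots> = (\<Sum>v\<in>words l. \<Sum>a\<in>UNIV. \<Sum>j<d ^ l. \<Sum>b<d. ?f (v @ [a]) (j * d + b))"
    by (intro sum.cong refl sum.swap)
  also have "\<dots> = (\<Sum>v\<in>words (Suc l). \<Sum>j<d ^ l. \<Sum>b<d. ?f v (j * d + b))"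
    by (rule sum_words_snoc[symmetric])
  also have "\<dots> = (\<Sum>v\<in>words (Suc l). \<Sum>j<d ^ l * d. ?f v j)"
    by (simp only: sum_mult_index)
  finally show ?case using Suc by (simp add: mult.commute)
qed simp

lemma jsf_first:
  assumes v: "v \<in> words l" and j: "j < d ^ l" "j' < d ^ l"
  shows "J (n + int k) l v $$ (j, j') = (\<Sum>w\<in>words k. \<Sum>i<d ^ k. J n (k + l) (w @ v) $$ (i * d ^ l + j, i * d ^ l + j'))"
proof (induction k arbitrary: n)
  case (Suc k)
  let ?f = "\<lambda>w i. J n (Suc k + l) (w @ v) $$ (i * d ^ l + j, i * d ^ l + j')"
  have "J (n + int (Suc k)) l v $$ (j, j') = J ((n + 1) + int k) l v $$ (j, j')"
    by (simp add: algebra_simps)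
  also have "\<dots> = (\<Sum>w\<in>words k. \<Sum>i<d ^ k. J (n + 1) (k + l) (w @ v) $$ (i * d ^ l + j, i * d ^ l + j'))"
    by (rule Suc)
  also have "\<dots> = (\<Sum>w\<in>words k. \<Sum>i<d ^ k. \<Sum>a\<in>UNIV. \<Sum>b<d. ?f (a # w) (b * d ^ k + i))"
  proof (intro sum.cong refl)
    fix w :: "'a list" and i assume wi: "w \<in> words k" "i \<in> {..<d ^ k}"
    have "w @ v \<in> words (k + l)" using v wi by (simp add: words_def)
    moreover have "i * d ^ l + j < d ^ (k + l)" "i * d ^ l + j' < d ^ (k + l)"
      unfolding power_add using j wi by (auto intro: mult_add_less)
    ultimately have "J (n + 1) (k + l) (w @ v) $$ (i * d ^ l + j, i * d ^ l + j') =
       (\<Sum>a\<in>UNIV. \<Sum>b<d. J n (Suc (k + l)) (a # (w @ v)) $$ (b * d ^ (k + l) + (i * d ^ l + j), b * d ^ (k + l) + (i * d ^ l + j')))"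
      by (rule jsf_first1)
    then show "J (n + 1) (k + l) (w @ v) $$ (i * d ^ l + j, i * d ^ l + j') = (\<Sum>a\<in>UNIV. \<Sum>b<d. ?f (a # w) (b * d ^ k + i))"
      by (simp add: power_add algebra_simps)
  qed
  also have "\<dots> = (\<Sum>w\<in>words k. \<Sum>a\<in>UNIV. \<Sum>i<d ^ k. \<Sum>b<d. ?f (a # w) (b * d ^ k + i))"
    by (intro sum.cong refl sum.swap)
  also have "\<dots> = (\<Sum>a\<in>UNIV. \<Sum>w\<in>words k. \<Sum>i<d ^ k. \<Sum>b<d. ?f (a # w) (b * d ^ k + i))"
    by (rule sum.swap)
  also have "\<dots> = (\<Sum>w\<in>words (Suc k). \<Sum>i<d ^ k. \<Sum>b<d. ?f w (b * d ^ k + i))"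
    by (rule sum_words_Cons[symmetric])
  also have "\<dots> = (\<Sum>w\<in>words (Suc k). \<Sum>b<d. \<Sum>i<d ^ k. ?f w (b * d ^ k + i))"
    by (intro sum.cong refl sum.swap)
  also have "\<dots> = (\<Sum>w\<in>words (Suc k). \<Sum>i<d * d ^ k. ?f w i)"
    by (simp only: sum_mult_index)
  finally show ?case by simp
qed simp

text \<open>Splitting word and index after k sites presents two adjacent blocks as a bipartite
  labelled family, the form that \<open>strong_subadditivity\<close> takes.\<close>

definition split_fam :: "int \<Rightarrow> nat \<Rightarrow> nat \<Rightarrow> 'a list \<Rightarrow> 'a list \<Rightarrow> nat \<times> nat \<Rightarrow> nat \<times> nat \<Rightarrow> complex" where
  "split_fam n k l w v = (\<lambda>p q. J n (k + l) (w @ v) $$ ((\<lambda>(j, b). j * d ^ l + b) p, (\<lambda>(j, b). j * d ^ l + b) q))"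

lemma bij_split: "bij_betw (\<lambda>(j, b). j * d ^ l + b) ({..<d ^ k} \<times> {..<d ^ l}) {..<d ^ (k + l)}"
  unfolding power_add by (rule bij_betw_mult_index)

lemma split_fam_props:
  assumes "w \<in> words k" "v \<in> words l"
  shows "psd_on ({..<d ^ k} \<times> {..<d ^ l}) (split_fam n k l w v)"
    and "ent ({..<d ^ k} \<times> {..<d ^ l}) (split_fam n k l w v) = ent {..<d ^ (k + l)} (ents J n (k + l) (w @ v))"
    and "tr_on ({..<d ^ k} \<times> {..<d ^ l}) (split_fam n k l w v) = tr_on {..<d ^ (k + l)} (ents J n (k + l) (w @ v))"
proof -
  have "w @ v \<in> words (k + l)" using assms by (simp add: words_def)
  note p = jsf_psd[OF this, of n]
  show "psd_on ({..<d ^ k} \<times> {..<d ^ l}) (split_fam n k l w v)"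
    using psd_on_reindex[OF bij_split, of k l "ents J n (k + l) (w @ v)"] p unfolding split_fam_def by simp
  show "ent ({..<d ^ k} \<times> {..<d ^ l}) (split_fam n k l w v) = ent {..<d ^ (k + l)} (ents J n (k + l) (w @ v))"
    using ent_reindex[OF bij_split finite_lessThan p] unfolding split_fam_def by simp
  show "tr_on ({..<d ^ k} \<times> {..<d ^ l}) (split_fam n k l w v) = tr_on {..<d ^ (k + l)} (ents J n (k + l) (w @ v))"
    using tr_on_reindex[OF bij_split, of k l "ents J n (k + l) (w @ v)"] unfolding split_fam_def by simp
qed

lemma split_fam_trace:
  "(\<Sum>w\<in>words k. \<Sum>v\<in>words l. tr_on ({..<d ^ k} \<times> {..<d ^ l}) (split_fam n k l w v)) = 1"
proof -
  have "(\<Sum>w\<in>words k. \<Sum>v\<in>words l. tr_on ({..<d ^ k} \<times> {..<d ^ l}) (split_fam n k l w v)) =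
    (\<Sum>w\<in>words k. \<Sum>v\<in>words l. tr_on {..<d ^ (k + l)} (ents J n (k + l) (w @ v)))"
    by (intro sum.cong refl split_fam_props)
  also have "\<dots> = (\<Sum>u\<in>words (k + l). tr_on {..<d ^ (k + l)} (ents J n (k + l) u))"
    by (rule sum_words_append[symmetric])
  finally show ?thesis by (simp only: jsf_trace)
qed

lemma split_fam_marg1:
  assumes "w \<in> words k" "i \<in> {..<d ^ k}" "i' \<in> {..<d ^ k}"
  shows "marg1 (words l) {..<d ^ l} (split_fam n k l) w i i' = J n k w $$ (i, i')"
proof -
  have "marg1 (words l) {..<d ^ l} (split_fam n k l) w i i' =
    (\<Sum>j<d ^ l. \<Sum>v\<in>words l. J n (k + l) (w @ v) $$ (i * d ^ l + j, i' * d ^ l + j))"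
    unfolding marg1_def ptr2_def split_fam_def by simp
  also have "\<dots> = (\<Sum>v\<in>words l. \<Sum>j<d ^ l. J n (k + l) (w @ v) $$ (i * d ^ l + j, i' * d ^ l + j))"
    by (rule sum.swap)
  finally show ?thesis using jsf_last[OF assms(1), of i i'] assms by simp
qed

lemma split_fam_marg2:
  assumes "v \<in> words l" "j \<in> {..<d ^ l}" "j' \<in> {..<d ^ l}"
  shows "marg2 (words k) {..<d ^ k} (split_fam n k l) v j j' = J (n + int k) l v $$ (j, j')"
proof -
  have "marg2 (words k) {..<d ^ k} (split_fam n k l) v j j' =
    (\<Sum>i<d ^ k. \<Sum>w\<in>words k. J n (k + l) (w @ v) $$ (i * d ^ l + j, i * d ^ l + j'))"
    unfolding marg2_def ptr1_def split_fam_def by simp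
  also have "\<dots> = (\<Sum>w\<in>words k. \<Sum>i<d ^ k. J n (k + l) (w @ v) $$ (i * d ^ l + j, i * d ^ l + j'))"
    by (rule sum.swap)
  finally show ?thesis using jsf_first[OF assms(1), of j j'] assms by simp
qed

abbreviation split_out :: "int \<Rightarrow> nat \<Rightarrow> nat \<Rightarrow> nat \<times> nat \<Rightarrow> nat \<times> nat \<Rightarrow> complex" where
  "split_out n k l \<equiv> \<lambda>p q. \<Sum>w\<in>words k. \<Sum>v\<in>words l. split_fam n k l w v p q"

lemma out_psd: "psd_on {..<d ^ k} (out J n k)"
  unfolding out_def by (intro psd_on_sum jsf_psd)

lemma out_trace: "tr_on {..<d ^ k} (out J n k) = 1"
  unfolding out_def tr_on_sum by (rule jsf_trace)

lemma split_out_props: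
  shows "psd_on ({..<d ^ k} \<times> {..<d ^ l}) (split_out n k l)"
    and "ent ({..<d ^ k} \<times> {..<d ^ l}) (split_out n k l) = SB d J n (k + l)"
    and "tr_on ({..<d ^ k} \<times> {..<d ^ l}) (split_out n k l) = 1"
    and "ent {..<d ^ k} (ptr2 {..<d ^ l} (split_out n k l)) = SB d J n k"
    and "ent {..<d ^ l} (ptr1 {..<d ^ k} (split_out n k l)) = SB d J (n + int k) l"
proof -
  show "psd_on ({..<d ^ k} \<times> {..<d ^ l}) (split_out n k l)"
    by (intro psd_on_sum split_fam_props)
  show "tr_on ({..<d ^ k} \<times> {..<d ^ l}) (split_out n k l) = 1"
    unfolding tr_on_sum by (rule split_fam_trace)
  have "split_out n k l = (\<lambda>p q. out J n (k + l) ((\<lambda>(j, b). j * d ^ l + b) p) ((\<lambda>(j, b). j * d ^ l + b) q))"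
    unfolding split_fam_def out_def sum_words_append ..
  then show "ent ({..<d ^ k} \<times> {..<d ^ l}) (split_out n k l) = SB d J n (k + l)"
    unfolding SB_def using ent_reindex[OF bij_split finite_lessThan out_psd] by simp
  have "ptr2 {..<d ^ l} (split_out n k l) i i' = out J n k i i'" if "i \<in> {..<d ^ k}" "i' \<in> {..<d ^ k}" for i i'
  proof -
    have "ptr2 {..<d ^ l} (split_out n k l) i i' = (\<Sum>w\<in>words k. marg1 (words l) {..<d ^ l} (split_fam n k l) w i i')"
      unfolding ptr2_def marg1_def by (rule sum.swap)
    then show ?thesis unfolding out_def using split_fam_marg1 that by simp
  qed
  then show "ent {..<d ^ k} (ptr2 {..<d ^ l} (split_out n k l)) = SB d J n k"
    unfolding SB_def by (rule ent_cong)
  have "ptr1 {..<d ^ k} (split_out n k l) j j' = out J (n + int k) l j j'" if "j \<in> {..<d ^ l}" "j' \<in> {..<d ^ l}" for j j'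
  proof -
    have "ptr1 {..<d ^ k} (split_out n k l) j j' = (\<Sum>i<d ^ k. \<Sum>v\<in>words l. \<Sum>w\<in>words k. split_fam n k l w v (i, j) (i, j'))"
      unfolding ptr1_def by (intro sum.cong refl sum.swap)
    also have "\<dots> = (\<Sum>v\<in>words l. marg2 (words k) {..<d ^ k} (split_fam n k l) v j j')"
      unfolding ptr1_def marg2_def by (rule sum.swap)
    finally show ?thesis unfolding out_def using split_fam_marg2 that by simp
  qed
  then show "ent {..<d ^ l} (ptr1 {..<d ^ k} (split_out n k l)) = SB d J (n + int k) l"
    unfolding SB_def by (rule ent_cong)
qed

lemma SJ_split:
  shows "(\<Sum>w\<in>words k. \<Sum>v\<in>words l. ent ({..<d ^ k} \<times> {..<d ^ l}) (split_fam n k l w v)) = SJ d J n (k + l)"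
    and "(\<Sum>w\<in>words k. ent {..<d ^ k} (marg1 (words l) {..<d ^ l} (split_fam n k l) w)) = SJ d J n k"
    and "(\<Sum>v\<in>words l. ent {..<d ^ l} (marg2 (words k) {..<d ^ k} (split_fam n k l) v)) = SJ d J (n + int k) l"
proof -
  have "(\<Sum>w\<in>words k. \<Sum>v\<in>words l. ent ({..<d ^ k} \<times> {..<d ^ l}) (split_fam n k l w v)) =
     (\<Sum>w\<in>words k. \<Sum>v\<in>words l. ent {..<d ^ (k + l)} (ents J n (k + l) (w @ v)))"
    by (intro sum.cong refl split_fam_props)
  then show "(\<Sum>w\<in>words k. \<Sum>v\<in>words l. ent ({..<d ^ k} \<times> {..<d ^ l}) (split_fam n k l w v)) = SJ d J n (k + l)"
    unfolding SJ_def sum_words_append .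
  show "(\<Sum>w\<in>words k. ent {..<d ^ k} (marg1 (words l) {..<d ^ l} (split_fam n k l) w)) = SJ d J n k"
    unfolding SJ_def by (intro sum.cong refl ent_cong split_fam_marg1)
  show "(\<Sum>v\<in>words l. ent {..<d ^ l} (marg2 (words k) {..<d ^ k} (split_fam n k l) v)) = SJ d J (n + int k) l"
    unfolding SJ_def by (intro sum.cong refl ent_cong split_fam_marg2)
qed

text \<open>Strong subadditivity for adjacent blocks: the mutual information of their outputs is at
  most that of inputs and outputs together. Rearranged, \<open>SB - SJ\<close> is superadditive;
  \<open>info_block_le\<close> rests on this.\<close>

theorem gain_superadditive:
  "SB d J n k + SB d J (n + int k) l - SB d J n (k + l) \<le> SJ d J n k + SJ d J (n + int k) l - SJ d J n (k + l)"
  and SB_subadditive: "SB d J n (k + l) \<le> SB d J n k + SB d J (n + int k) l"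
  using strong_subadditivity[OF finite_words finite_words finite_lessThan finite_lessThan split_fam_props(1) split_fam_trace, of k l n]
  unfolding SJ_split split_out_props by auto

lemma SJ_subadditive: "SJ d J n (k + l) \<le> SJ d J n k + SJ d J (n + int k) l"
  using gain_superadditive[of n k l] SB_subadditive[of n k l] by simp

section \<open>Cost of dropping sites, and size bounds\<close>

lemma log_pow_d: "log 2 (real d ^ k) = real k * log 2 (real d)"
  using d by (simp add: log_nat_power)

lemma SB_drop_last: "SB d J n k \<le> SB d J n (k + l) + real l * log 2 (real d)"
  using ent_ptr2[OF finite_lessThan finite_lessThan split_out_props(1), of k l n]
  unfolding split_out_props by (simp add: log_pow_d)

lemma SB_drop_first: "SB d J (n + int k) l \<le> SB d J n (k + l) + real k * log 2 (real d)"
  using ent_ptr1[OF finite_lessThan finite_lessThan split_out_props(1), of l k n]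
  unfolding split_out_props by (simp add: log_pow_d)

text \<open>Merging blocks over the discarded letters can only lower the sum of their entropies, so
  only the quantum part of the dropped sites is paid for.\<close>

lemma SJ_drop_last: "SJ d J n k \<le> SJ d J n (k + l) + real l * log 2 (real d)"
proof -
  let ?I = "{..<d ^ k}" and ?J = "{..<d ^ l}"
  have "SJ d J n k = (\<Sum>w\<in>words k. ent ?I (marg1 (words l) ?J (split_fam n k l) w))"
    by (rule SJ_split(2)[symmetric])
  also have "\<dots> \<le> (\<Sum>w\<in>words k. \<Sum>v\<in>words l. ent ?I (ptr2 ?J (split_fam n k l w v)))"
  proof (rule sum_mono)
    fix w :: "'a list" assume w: "w \<in> words k"
    have "marg1 (words l) ?J (split_fam n k l) w = (\<lambda>x y. \<Sum>v\<in>words l. ptr2 ?J (split_fam n k l w v) x y)"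
      unfolding marg1_def ptr2_def[abs_def] by (intro ext sum.swap)
    then show "ent ?I (marg1 (words l) ?J (split_fam n k l) w) \<le> (\<Sum>v\<in>words l. ent ?I (ptr2 ?J (split_fam n k l w v)))"
      using ent_sum_le[OF finite_lessThan finite_words psd_ptr2(1)[OF finite_lessThan finite_lessThan split_fam_props(1)[OF w]]]
      by simp
  qed
  also have "\<dots> \<le> (\<Sum>w\<in>words k. \<Sum>v\<in>words l. ent (?I \<times> ?J) (split_fam n k l w v) + tr_on (?I \<times> ?J) (split_fam n k l w v) * log 2 (real (card ?J)))"
    by (intro sum_mono ent_ptr2 finite_lessThan split_fam_props)
  also have "\<dots> = SJ d J n (k + l) + 1 * log 2 (real (d ^ l))"
    unfolding sum.distrib SJ_split sum_distrib_right[symmetric] split_fam_trace by simp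
  finally show ?thesis by (simp add: log_pow_d)
qed

lemma SJ_drop_first: "SJ d J (n + int k) l \<le> SJ d J n (k + l) + real k * log 2 (real d)"
proof -
  let ?I = "{..<d ^ k}" and ?J = "{..<d ^ l}"
  have "SJ d J (n + int k) l = (\<Sum>v\<in>words l. ent ?J (marg2 (words k) ?I (split_fam n k l) v))"
    by (rule SJ_split(3)[symmetric])
  also have "\<dots> \<le> (\<Sum>v\<in>words l. \<Sum>w\<in>words k. ent ?J (ptr1 ?I (split_fam n k l w v)))"
  proof (rule sum_mono)
    fix v :: "'a list" assume v: "v \<in> words l"
    have "marg2 (words k) ?I (split_fam n k l) v = (\<lambda>x y. \<Sum>w\<in>words k. ptr1 ?I (split_fam n k l w v) x y)"
      unfolding marg2_def ptr1_def[abs_def] by (intro ext sum.swap)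
    then show "ent ?J (marg2 (words k) ?I (split_fam n k l) v) \<le> (\<Sum>w\<in>words k. ent ?J (ptr1 ?I (split_fam n k l w v)))"
      using ent_sum_le[OF finite_lessThan finite_words psd_ptr1(1)[OF finite_lessThan finite_lessThan split_fam_props(1)[OF _ v]]]
      by simp
  qed
  also have "\<dots> = (\<Sum>w\<in>words k. \<Sum>v\<in>words l. ent ?J (ptr1 ?I (split_fam n k l w v)))"
    by (rule sum.swap)
  also have "\<dots> \<le> (\<Sum>w\<in>words k. \<Sum>v\<in>words l. ent (?I \<times> ?J) (split_fam n k l w v) + tr_on (?I \<times> ?J) (split_fam n k l w v) * log 2 (real (card ?I)))"
    by (intro sum_mono ent_ptr1 finite_lessThan split_fam_props)
  also have "\<dots> = SJ d J n (k + l) + 1 * log 2 (real (d ^ k))"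
    unfolding sum.distrib SJ_split sum_distrib_right[symmetric] split_fam_trace by simp
  finally show ?thesis by (simp add: log_pow_d)
qed

lemma jsf_tr_nonneg: "w \<in> words k \<Longrightarrow> 0 \<le> tr_on {..<d ^ k} (ents J n k w)"
  by (rule tr_on_psd_nonneg[OF finite_lessThan jsf_psd])

lemma jsf_tr_le_1: "w \<in> words k \<Longrightarrow> tr_on {..<d ^ k} (ents J n k w) \<le> 1"
  using member_le_sum[of w "words k" "\<lambda>w. tr_on {..<d ^ k} (ents J n k w)"] jsf_tr_nonneg jsf_trace
  by simp

lemma SJ_nonneg: "0 \<le> SJ d J n k"
  unfolding SJ_def by (intro sum_nonneg ent_nonneg finite_lessThan jsf_psd jsf_tr_le_1)

lemma SB_nonneg: "0 \<le> SB d J n k"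
  unfolding SB_def by (intro ent_nonneg finite_lessThan out_psd) (simp add: out_trace)

lemma SB_le: "SB d J n k \<le> real k * log 2 (real d)"
  using ent_le_card[OF finite_lessThan out_psd, of k n] unfolding SB_def out_trace by (simp add: log_pow_d)

lemma SJ_le: "SJ d J n k \<le> real k * (log 2 (real d) + log 2 (real CARD('a)))"
proof -
  have "SJ d J n k \<le> (\<Sum>w\<in>words k. eta (tr_on {..<d ^ k} (ents J n k w)) + tr_on {..<d ^ k} (ents J n k w) * log 2 (real (card {..<d ^ k})))"
    unfolding SJ_def by (intro sum_mono ent_le_card finite_lessThan jsf_psd)
  also have "\<dots> = (\<Sum>w\<in>words k. eta (tr_on {..<d ^ k} (ents J n k w))) + real k * log 2 (real d)"
    unfolding sum.distrib sum_distrib_right[symmetric] jsf_trace by (simp add: log_pow_d)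
  also have "(\<Sum>w\<in>words k. eta (tr_on {..<d ^ k} (ents J n k w))) \<le>
     eta (\<Sum>w\<in>words k. tr_on {..<d ^ k} (ents J n k w)) + (\<Sum>w\<in>words k. tr_on {..<d ^ k} (ents J n k w)) * log 2 (real (CARD('a) ^ k))"
    by (intro eta_sum_le_card finite_words jsf_tr_nonneg) (simp_all add: card_words)
  finally show ?thesis unfolding jsf_trace by (simp add: log_nat_power algebra_simps)
qed

end

section \<open>Entropy rates\<close>

text \<open>The limit is the infimum L: a near-optimal N is repeated, and the remainders below N
  cost at most the fixed amount K.\<close>

lemma fekete:
  fixes b :: "nat \<Rightarrow> real"
  assumes pos: "\<And>n. 0 \<le> b n" and sub: "\<And>m n. b (m + n) \<le> b m + b n"
  shows "convergent (\<lambda>n. b n / real n)"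
proof -
  define L where "L = (INF n\<in>{1..}. b n / real n)"
  have bdd: "bdd_below ((\<lambda>n. b n / real n) ` {1..})"
    by (rule bdd_belowI[of _ 0]) (auto simp: pos)
  have lower: "L \<le> b n / real n" if "n \<ge> 1" for n
    unfolding L_def by (rule cINF_lower[OF bdd]) (use that in auto)
  have mult: "b (q * N + r) \<le> real q * b N + b r" for q N r
  proof (induction q)
    case (Suc q)
    have "b (Suc q * N + r) = b (N + (q * N + r))" by (simp add: algebra_simps)
    also have "\<dots> \<le> b N + b (q * N + r)" by (rule sub)
    finally show ?case using Suc by (simp add: algebra_simps)
  qed simp
  have "(\<lambda>n. b n / real n) \<longlonglongrightarrow> L"
  proof (rule LIMSEQ_I)
    fix e :: real assume e: "e > 0"
    then have "L < L + e / 2" by simp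
    then obtain N where N: "N \<ge> 1" "b N / real N < L + e / 2"
      unfolding L_def by (subst (asm) cINF_less_iff[OF _ bdd]) auto
    define K where "K = (\<Sum>r<N. b r)"
    have bK: "b r \<le> K" if "r < N" for r
      unfolding K_def using that pos by (intro member_le_sum) auto
    obtain n0 :: nat where n0: "2 * K / e < real n0" using reals_Archimedean2 by blast
    show "\<exists>no. \<forall>n\<ge>no. norm (b n / real n - L) < e"
    proof (intro exI allI impI)
      fix n assume n: "n \<ge> max 1 n0"
      then have n1: "real n > 0" by simp
      have "b n = b ((n div N) * N + n mod N)" by simp
      also have "\<dots> \<le> real (n div N) * b N + b (n mod N)" by (rule mult)
      also have "\<dots> \<le> real (n div N) * b N + K" using N bK[of "n mod N"] by simp
      also have "real (n div N) * b N \<le> (real n / real N) * b N"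
        using pos of_nat_div_le_of_nat[of n N] by (intro mult_right_mono) auto
      finally have "b n \<le> real n * (b N / real N) + K" by (simp add: field_simps)
      then have "b n / real n \<le> b N / real N + K / real n" using n1 by (simp add: field_simps)
      moreover have "K / real n < e / 2"
      proof -
        have "2 * K / e < real n" using n0 n by linarith
        then show ?thesis using e n1 by (simp add: field_simps)
      qed
      ultimately have "b n / real n < L + e" using N(2) by linarith
      moreover have "L \<le> b n / real n" using n by (intro lower) simp
      ultimately show "norm (b n / real n - L) < e" by simp
    qed
  qed
  then show ?thesis by (rule convergentI)
qed

text \<open>The common profile of source, output and joint entropies: subadditive over adjacent
  blocks, and decreasing by at most C for each site removed from a longer block at either end. It
  suffices for a rate that does not depend on the starting site.\<close>

definition tame :: "real \<Rightarrow> (int \<Rightarrow> nat \<Rightarrow> real) \<Rightarrow> bool" where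
  "tame C S \<longleftrightarrow> (\<forall>n k. 0 \<le> S n k \<and> S n k \<le> C * real k) \<and>
     (\<forall>n k l. S n (k + l) \<le> S n k + S (n + int k) l \<and> S n k \<le> S n (k + l) + C * real l \<and>
        S (n + int k) l \<le> S n (k + l) + C * real k)"

lemma tame_C_nonneg: "tame C S \<Longrightarrow> 0 \<le> C"
  unfolding tame_def by (metis mult.right_neutral of_nat_1 order_trans)

text \<open>Both blocks are compared with the block of length s + k that contains them.\<close>

lemma tame_start:
  assumes "tame C S"
  shows "\<bar>S (n + int s) k - S n k\<bar> \<le> 2 * C * real s"
proof -
  have a: "S (n + int s) k \<le> S n (s + k) + C * real s" "S n (s + k) \<le> S n s + S (n + int s) k" "S n s \<le> C * real s"
    "S n k \<le> S n (k + s) + C * real s" "S n (k + s) \<le> S n k + S (n + int k) s" "S (n + int k) s \<le> C * real s"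
    using assms unfolding tame_def by blast+
  then show ?thesis by (simp add: add.commute)
qed

lemma bounded_over_n: "(\<lambda>n. K / real n) \<longlonglongrightarrow> 0"
  by (rule tendsto_divide_0[OF tendsto_const filterlim_at_top_imp_at_infinity[OF filterlim_real_sequentially]])

lemma tendsto_bounded_diff:
  assumes f: "(\<lambda>n. f n / real n) \<longlonglongrightarrow> L" and d: "\<And>n. \<bar>g n - f n\<bar> \<le> K"
  shows "(\<lambda>n. g n / real n) \<longlonglongrightarrow> L"
proof -
  have "(\<lambda>n. (g n - f n) / real n) \<longlonglongrightarrow> 0"
  proof (rule tendsto_0_le[OF bounded_over_n[of K], of _ 1])
    show "\<forall>\<^sub>F n in sequentially. norm ((g n - f n) / real n) \<le> norm (K / real n) * 1"
    proof (intro always_eventually allI)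
      fix n
      have "\<bar>g n - f n\<bar> \<le> \<bar>K\<bar>" using d[of n] by linarith
      then show "norm ((g n - f n) / real n) \<le> norm (K / real n) * 1" by (simp add: divide_right_mono)
    qed
  qed
  from tendsto_add[OF f this] show ?thesis by (simp add: add_divide_distrib[symmetric])
qed

text \<open>Along multiples of the period the starting point of a block is irrelevant and Fekete's
  lemma applies. The other lengths, and any other start m, change S by a bounded amount.\<close>

lemma rate_exists:
  assumes S: "tame C S" and t: "t > 0" and per: "\<And>n k. S (n + int t) k = S n k"
  shows "\<exists>L. \<forall>m. (\<lambda>k. S m k / real k) \<longlonglongrightarrow> L"
proof -
  have perk: "S (n + int (i * t)) k = S n k" for n i k
  proof (induction i)
    case (Suc i)
    have "S (n + int (Suc i * t)) k = S ((n + int (i * t)) + int t) k" by (simp add: algebra_simps)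
    then show ?case using per Suc by simp
  qed simp
  have C: "0 \<le> C" using tame_C_nonneg[OF S] .
  have "convergent (\<lambda>j. S 0 (j * t) / real j)"
  proof (rule fekete)
    show "0 \<le> S 0 (n * t)" for n using S unfolding tame_def by blast
    show "S 0 ((m + n) * t) \<le> S 0 (m * t) + S 0 (n * t)" for m n
    proof -
      have "S 0 (m * t + n * t) \<le> S 0 (m * t) + S (0 + int (m * t)) (n * t)"
        using S unfolding tame_def by blast
      then show ?thesis using perk[of 0] by (simp add: algebra_simps)
    qed
  qed
  then obtain L' where L': "(\<lambda>j. S 0 (j * t) / real j) \<longlonglongrightarrow> L'" unfolding convergent_def by blast
  have "filterlim (\<lambda>k. k div t) at_top sequentially"
    unfolding filterlim_at_top
  proof
    fix Z
    show "\<forall>\<^sub>F k in sequentially. Z \<le> k div t"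
      using eventually_ge_at_top[of "Z * t"]
    proof eventually_elim
      case (elim k)
      then have "Z * t div t \<le> k div t" by (rule div_le_mono)
      then show ?case using t by simp
    qed
  qed
  from filterlim_compose[OF L' this]
  have 1: "(\<lambda>k. S 0 ((k div t) * t) / real (k div t)) \<longlonglongrightarrow> L'" .
  have 2: "(\<lambda>k. real (k div t) / real k) \<longlonglongrightarrow> 1 / real t"
  proof -
    have "(\<lambda>k. (real k / real t) / real k) \<longlonglongrightarrow> 1 / real t"
    proof (rule Lim_transform_eventually[OF tendsto_const])
      show "\<forall>\<^sub>F k in sequentially. 1 / real t = (real k / real t) / real k"
        using eventually_gt_at_top[of 0] by eventually_elim simp
    qed
    then show ?thesis
    proof (rule tendsto_bounded_diff)
      fix k
      have "real k = real t * real (k div t) + real (k mod t)"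
        by (metis mult_div_mod_eq of_nat_add of_nat_mult)
      then have "real k / real t - real (k div t) = real (k mod t) / real t"
        using t by (simp add: field_simps)
      moreover have "real (k mod t) / real t \<le> 1" using t by (simp add: less_imp_le)
      moreover have "0 \<le> real (k mod t) / real t" by simp
      ultimately show "\<bar>real (k div t) - real k / real t\<bar> \<le> 1" by linarith
    qed
  qed
  have 3: "(\<lambda>k. S 0 ((k div t) * t) / real k) \<longlonglongrightarrow> L' * (1 / real t)"
  proof (rule Lim_transform_eventually[OF tendsto_mult[OF 1 2]])
    show "\<forall>\<^sub>F k in sequentially. S 0 ((k div t) * t) / real (k div t) * (real (k div t) / real k) = S 0 ((k div t) * t) / real k"
      using eventually_ge_at_top[of t]
    proof eventually_elim
      case (elim k)
      then have "k div t > 0" using t by (simp add: div_greater_zero_iff)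
      then show ?case by simp
    qed
  qed
  have 4: "(\<lambda>k. S 0 k / real k) \<longlonglongrightarrow> L' * (1 / real t)"
  proof (rule tendsto_bounded_diff[OF 3])
    fix k
    define j where "j = (k div t) * t"
    define r where "r = k mod t"
    have k: "k = j + r" unfolding j_def r_def by simp
    have r: "real r \<le> real t" unfolding r_def using t by (simp add: less_imp_le)
    have "S 0 (j + r) \<le> S 0 j + S (0 + int j) r" "S (0 + int j) r \<le> C * real r" "S 0 j \<le> S 0 (j + r) + C * real r"
      using S unfolding tame_def by blast+
    moreover have "C * real r \<le> C * real t" using r C by (rule mult_left_mono)
    ultimately have "\<bar>S 0 (j + r) - S 0 j\<bar> \<le> C * real t" by linarith
    then show "\<bar>S 0 k - S 0 (k div t * t)\<bar> \<le> C * real t" by (simp only: k[symmetric] j_def[symmetric])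
  qed
  have "(\<lambda>k. S m k / real k) \<longlonglongrightarrow> L' * (1 / real t)" for m
  proof (cases "m \<ge> 0")
    case True
    have "\<bar>S m k - S 0 k\<bar> \<le> 2 * C * real (nat m)" for k
      using tame_start[OF S, of 0 "nat m" k] True by simp
    then show ?thesis by (rule tendsto_bounded_diff[OF 4])
  next
    case False
    have "\<bar>S m k - S 0 k\<bar> \<le> 2 * C * real (nat (- m))" for k
      using tame_start[OF S, of m "nat (- m)" k] False by (simp add: abs_minus_commute)
    then show ?thesis by (rule tendsto_bounded_diff[OF 4])
  qed
  then show ?thesis by blast
qed

section \<open>Sources\<close>

definition wd :: "int \<Rightarrow> nat \<Rightarrow> 'a seq \<Rightarrow> 'a list" where
  "wd n k x = map (\<lambda>j. x (n + int j)) [0..<k]"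

definition sh :: "int \<Rightarrow> 'a seq \<Rightarrow> 'a seq" where
  "sh s x = (\<lambda>i. x (i + s))"

lemma length_wd [simp]: "length (wd n k x) = k"
  by (simp add: wd_def)

lemma wd_in_words [simp]: "wd n k x \<in> words k"
  by (simp add: words_def)

lemma nth_wd: "j < k \<Longrightarrow> wd n k x ! j = x (n + int j)"
  by (simp add: wd_def)

lemma cyl_wd: "w \<in> words k \<Longrightarrow> cyl n w = {x. wd n k x = w}"
  by (auto simp: cyl_def words_def list_eq_iff_nth_eq nth_wd)

lemma wd_append: "wd n (k + l) x = wd n k x @ wd (n + int k) l x"
  by (rule nth_equalityI) (auto simp: nth_wd nth_append of_nat_diff algebra_simps)

lemma shift_sh: "shift = sh 1"
  by (simp add: shift_def[abs_def] sh_def[abs_def])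

lemma sh_sh: "sh s (sh r x) = sh (s + r) x"
  by (simp add: sh_def algebra_simps)

lemma space_seq [simp]: "space (seq_space :: ('a seq) measure) = UNIV"
  by (simp add: seq_space_def space_PiM)

lemma component_measurable [measurable]: "(\<lambda>x. x i) \<in> measurable seq_space (count_space UNIV)"
  unfolding seq_space_def by (rule measurable_component_singleton) simp

lemma measurable_seqI:
  assumes "\<And>i. (\<lambda>\<omega>. f \<omega> i) \<in> measurable N (count_space UNIV)"
  shows "f \<in> measurable N seq_space"
  unfolding seq_space_def using measurable_PiM_single'[of UNIV "\<lambda>i \<omega>. f \<omega> i" N "\<lambda>_. count_space UNIV"] assms
  by simp

lemma sh_measurable [measurable]: "sh s \<in> measurable seq_space seq_space"
  unfolding sh_def[abs_def] by (rule measurable_seqI) simp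

lemma wd_measurable [measurable]: "wd n k \<in> measurable (seq_space :: ('a::countable seq) measure) (count_space UNIV)"
proof -
  have "wd n k -` {w} \<inter> space seq_space \<in> sets seq_space" for w :: "'a list"
  proof -
    have "wd n k -` {w} \<inter> space seq_space = {x \<in> space seq_space. length w = k \<and> (\<forall>j\<in>{..<k}. x (n + int j) = w ! j)}"
      by (auto simp: list_eq_iff_nth_eq nth_wd)
    also have "\<dots> \<in> sets seq_space" by measurable
    finally show ?thesis .
  qed
  then show ?thesis by (subst measurable_count_space_eq_countable) auto
qed

lemma cyl_sets [measurable]: "cyl n (w :: 'a::countable list) \<in> sets seq_space"
proof -
  have "cyl n w = wd n (length w) -` {w} \<inter> space seq_space"
    using cyl_wd[of w "length w" n] by (auto simp: words_def)
  also have "\<dots> \<in> sets seq_space" by (rule measurable_sets[OF wd_measurable]) simp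
  finally show ?thesis .
qed

lemma source_space: "is_source p \<Longrightarrow> space p = UNIV"
  unfolding is_source_def using sets_eq_imp_space_eq[of p seq_space] by simp

lemma source_sets [measurable_cong]: "is_source p \<Longrightarrow> sets p = sets seq_space"
  unfolding is_source_def by simp

lemma source_prob: "is_source p \<Longrightarrow> prob_space p"
  unfolding is_source_def by simp

lemma source_measurable: "is_source p \<Longrightarrow> measurable p N = measurable seq_space N"
  by (rule measurable_cong_sets) (simp_all add: source_sets)

lemma source_measure_words:
  fixes p :: "('a::finite seq) measure"
  assumes p: "is_source p"
  shows "measure p {x. P (wd n k x)} = (\<Sum>w\<in>{w \<in> words k. P w}. measure p (cyl n w))"
proof -
  interpret prob_space p by (rule source_prob[OF p])
  have "x \<in> cyl n (wd n k x)" for x :: "'a seq" by (simp add: cyl_wd[OF wd_in_words])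
  moreover have "wd n k x = w" if "w \<in> words k" "x \<in> cyl n w" for x :: "'a seq" and w
    using that by (simp add: cyl_wd)
  ultimately have "{x. P (wd n k x)} = (\<Union>w\<in>{w \<in> words k. P w}. cyl n w)"
    using wd_in_words[of n k] by blast
  also have "measure p \<dots> = (\<Sum>w\<in>{w \<in> words k. P w}. measure p (cyl n w))"
  proof (rule finite_measure_finite_Union)
    show "cyl n ` {w \<in> words k. P w} \<subseteq> events" by (auto simp: source_sets[OF p])
    show "disjoint_family_on (cyl n) {w \<in> words k. P w}" by (auto simp: disjoint_family_on_def cyl_wd)
  qed simp
  finally show ?thesis .
qed

lemma sum_indicator_cyl:
  "(\<Sum>w\<in>words k. indicator (cyl n w) x) = (1 :: 'b::semiring_1)" for x :: "'a::finite seq"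
proof -
  have "(\<Sum>w\<in>words k. indicator (cyl n w) x) = (\<Sum>w\<in>words k. if w = wd n k x then 1 else (0 :: 'b))"
    by (intro sum.cong refl) (auto simp: cyl_wd indicator_def)
  then show ?thesis by simp
qed

text \<open>Every finite-dimensional event is determined by the sites from 1 - N t to N t for large
  N. Such a window consists of whole blocks, the only cylinders on which a periodic product is
  prescribed.\<close>

lemma source_eqI:
  fixes p q :: "('a::finite seq) measure"
  assumes p: "is_source p" and q: "is_source q" and t: "t > 0"
    and eq: "\<And>N w. w \<in> words (2 * N * t) \<Longrightarrow> measure p (cyl (1 - int (N * t)) w) = measure q (cyl (1 - int (N * t)) w)"
  shows "p = q"
proof (rule measure_eqI_PiM_infinite[of p UNIV "\<lambda>_. count_space UNIV" q])
  interpret P: prob_space p by (rule source_prob[OF p])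
  interpret Q: prob_space q by (rule source_prob[OF q])
  show "finite_measure p" by (rule P.finite_measure_axioms)
  show "sets p = sets (PiM UNIV (\<lambda>_. count_space UNIV))" "sets q = sets (PiM UNIV (\<lambda>_. count_space UNIV))"
    using source_sets[OF p] source_sets[OF q] by (simp_all add: seq_space_def)
  fix A :: "int \<Rightarrow> 'a set" and J :: "int set"
  assume J: "finite J"
  define N where "N = nat (Max (insert 0 (abs ` J))) + 1"
  have N: "1 - int (N * t) \<le> j \<and> j < 1 + int (N * t)" if "j \<in> J" for j
  proof -
    have "\<bar>j\<bar> \<le> Max (insert 0 (abs ` J))" using J that by (intro Max_ge) auto
    moreover have "0 \<le> Max (insert 0 (abs ` J))" using J by (intro Max_ge) auto
    ultimately have "\<bar>j\<bar> < int N" unfolding N_def by linarith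
    also have "N \<le> N * t" using t by simp
    then have "int N \<le> int (N * t)" by (simp only: of_nat_le_iff)
    finally show ?thesis by linarith
  qed
  define P where "P = (\<lambda>w. \<forall>j\<in>J. w ! nat (j - (1 - int (N * t))) \<in> A j)"
  have "prod_emb UNIV (\<lambda>_. count_space UNIV) J (Pi\<^sub>E J A) = {x. \<forall>j\<in>J. x j \<in> A j}"
    by (auto simp: prod_emb_def)
  also have "\<dots> = {x. P (wd (1 - int (N * t)) (2 * N * t) x)}"
  proof -
    have "wd (1 - int (N * t)) (2 * N * t) x ! nat (j - (1 - int (N * t))) = x j" if "j \<in> J" for x :: "'a seq" and j
    proof -
      have "nat (j - (1 - int (N * t))) < 2 * N * t" using N[OF that] by (simp add: nat_less_iff)
      then show ?thesis using N[OF that] by (simp add: nth_wd)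
    qed
    then show ?thesis unfolding P_def by simp
  qed
  finally have E: "prod_emb UNIV (\<lambda>_. count_space UNIV) J (Pi\<^sub>E J A) = {x. P (wd (1 - int (N * t)) (2 * N * t) x)}" .
  show "emeasure p (prod_emb UNIV (\<lambda>_. count_space UNIV) J (Pi\<^sub>E J A)) = emeasure q (prod_emb UNIV (\<lambda>_. count_space UNIV) J (Pi\<^sub>E J A))"
    unfolding E P.emeasure_eq_measure Q.emeasure_eq_measure source_measure_words[OF p] source_measure_words[OF q]
    by (intro arg_cong[where f = ennreal] sum.cong refl eq) auto
qed

lemma is_source_distr:
  assumes "prob_space M" "f \<in> measurable M seq_space"
  shows "is_source (distr M seq_space f)"
  unfolding is_source_def using prob_space.prob_space_distr[OF assms] by simp

section \<open>Shifted and periodic sources\<close>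

definition shs :: "int \<Rightarrow> ('a seq) measure \<Rightarrow> ('a seq) measure" where
  "shs s p = distr p seq_space (sh s)"

lemma is_source_shs: "is_source p \<Longrightarrow> is_source (shs s p)"
  unfolding shs_def by (intro is_source_distr) (simp_all add: source_prob source_measurable)

lemma measure_shs:
  assumes "is_source p" "S \<in> sets seq_space"
  shows "measure (shs s p) S = measure p (sh s -` S)"
  unfolding shs_def using assms
  by (subst measure_distr) (simp_all add: source_measurable source_space)

lemma sh_vimage_cyl: "sh s -` cyl n w = cyl (n + s) w"
  by (auto simp: cyl_def sh_def algebra_simps)

definition periodic :: "nat \<Rightarrow> ('a seq) measure \<Rightarrow> bool" where
  "periodic t p \<longleftrightarrow> is_source p \<and> shs (int t) p = p"

lemma stationary_periodic: "stationary_source p \<Longrightarrow> periodic 1 p"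
  unfolding periodic_def
proof (intro conjI)
  assume s: "stationary_source p"
  then show p: "is_source p" unfolding stationary_source_def by blast
  interpret P: prob_space p by (rule source_prob[OF p])
  interpret Q: prob_space "shs 1 p" by (rule source_prob[OF is_source_shs[OF p]])
  have "shs 1 p = p"
  proof (rule measure_eqI)
    show "sets (shs 1 p) = sets p" using source_sets[OF p] by (simp add: shs_def)
    fix S assume "S \<in> sets (shs 1 p)"
    then have S: "S \<in> sets seq_space" by (simp add: shs_def)
    then show "emeasure (shs 1 p) S = emeasure p S"
      unfolding P.emeasure_eq_measure Q.emeasure_eq_measure measure_shs[OF p S]
      using s unfolding stationary_source_def shift_sh by simp
  qed
  then show "shs (int 1) p = p" by simp
qed

section \<open>Ergodicity of Bernoulli measures\<close>

context
  fixes \<pi> :: "'b::countable pmf"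
begin

text \<open>The symbols of this process will be the blocks of a periodic product source; the
  alphabet is therefore allowed to be countable, as the type of all lists is.\<close>

definition bern :: "(int \<Rightarrow> 'b) measure" where
  "bern = PiM UNIV (\<lambda>_. measure_pmf \<pi>)"

interpretation product_prob_space "\<lambda>_::int. measure_pmf \<pi>" UNIV
  by unfold_locales

lemma space_bern [simp]: "space bern = UNIV"
  by (simp add: bern_def space_PiM)

lemma prob_space_bern: "prob_space bern"
  unfolding bern_def by (rule prob_space_PiM) (rule prob_space_measure_pmf)

lemma bern_component [measurable]: "(\<lambda>x. x i) \<in> measurable bern (count_space UNIV)"
  unfolding bern_def using measurable_component_singleton[of i UNIV "\<lambda>_. measure_pmf \<pi>"] by simp

lemma bern_box:
  assumes "finite J"
  shows "{\<omega>. \<forall>i\<in>J. \<omega> i \<in> X i} \<in> sets bern"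
    and "measure bern {\<omega>. \<forall>i\<in>J. \<omega> i \<in> X i} = (\<Prod>i\<in>J. measure (measure_pmf \<pi>) (X i))"
proof -
  have e: "prod_emb UNIV (\<lambda>_. measure_pmf \<pi>) J (Pi\<^sub>E J X) = {\<omega>. \<forall>i\<in>J. \<omega> i \<in> X i}"
    by (auto simp: prod_emb_def space_PiM)
  show "measure bern {\<omega>. \<forall>i\<in>J. \<omega> i \<in> X i} = (\<Prod>i\<in>J. measure (measure_pmf \<pi>) (X i))"
    unfolding bern_def e[symmetric] using assms by (intro measure_PiM_emb) auto
  show "{\<omega>. \<forall>i\<in>J. \<omega> i \<in> X i} \<in> sets bern"
    unfolding bern_def e[symmetric] using assms by (intro sets_PiM_I) auto
qed

lemma bern_shift_measurable: "sh s \<in> measurable bern bern"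
proof -
  have "(\<lambda>\<omega> i. \<omega> (i + s)) \<in> measurable (PiM UNIV (\<lambda>_. measure_pmf \<pi>)) (PiM UNIV (\<lambda>_. measure_pmf \<pi>))"
    by (rule measurable_PiM_single') (auto simp: space_PiM intro: bern_component[unfolded bern_def])
  then show ?thesis unfolding bern_def sh_def[abs_def] .
qed

lemma bern_box_shift: "sh s -` {\<omega>. \<forall>i\<in>J. \<omega> i \<in> X i} = {\<omega>. \<forall>i\<in>(\<lambda>i. i + s) ` J. \<omega> i \<in> X (i - s)}"
  by (auto simp: sh_def)

lemma bern_shift_inv: "distr bern bern (sh s) = bern"
proof -
  interpret B: prob_space bern by (rule prob_space_bern)
  interpret D: prob_space "distr bern bern (sh s)" by (rule B.prob_space_distr[OF bern_shift_measurable])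
  show ?thesis
  proof (rule measure_eqI_PiM_infinite[of _ UNIV "\<lambda>_. measure_pmf \<pi>"])
    show "sets (distr bern bern (sh s)) = sets (PiM UNIV (\<lambda>_. measure_pmf \<pi>))" "sets bern = sets (PiM UNIV (\<lambda>_. measure_pmf \<pi>))"
      by (simp_all add: bern_def)
    show "finite_measure (distr bern bern (sh s))" by (rule D.finite_measure_axioms)
    fix A :: "int \<Rightarrow> 'b set" and J :: "int set" assume J: "finite J"
    have e: "prod_emb UNIV (\<lambda>_. measure_pmf \<pi>) J (Pi\<^sub>E J A) = {\<omega>. \<forall>i\<in>J. \<omega> i \<in> A i}"
      by (auto simp: prod_emb_def space_PiM)
    have "measure (distr bern bern (sh s)) {\<omega>. \<forall>i\<in>J. \<omega> i \<in> A i} = measure bern {\<omega>. \<forall>i\<in>(\<lambda>i. i + s) ` J. \<omega> i \<in> A (i - s)}"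
      using measure_distr[OF bern_shift_measurable bern_box(1)[OF J], of s A] by (simp only: bern_box_shift space_bern Int_UNIV_right)
    also have "\<dots> = (\<Prod>i\<in>(\<lambda>i. i + s) ` J. measure (measure_pmf \<pi>) (A (i - s)))"
      using J by (intro bern_box) auto
    also have "\<dots> = (\<Prod>i\<in>J. measure (measure_pmf \<pi>) (A i))"
      by (subst prod.reindex) (auto simp: inj_on_def)
    also have "\<dots> = measure bern {\<omega>. \<forall>i\<in>J. \<omega> i \<in> A i}" by (rule bern_box(2)[OF J, symmetric])
    finally show "emeasure (distr bern bern (sh s)) (prod_emb UNIV (\<lambda>_. measure_pmf \<pi>) J (Pi\<^sub>E J A)) =
       emeasure bern (prod_emb UNIV (\<lambda>_. measure_pmf \<pi>) J (Pi\<^sub>E J A))"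
      unfolding e B.emeasure_eq_measure D.emeasure_eq_measure by simp
  qed
qed

lemma measure_bern_shift: "A \<in> sets bern \<Longrightarrow> measure bern (sh s -` A) = measure bern A"
  using measure_distr[OF bern_shift_measurable, of A s] by (simp add: bern_shift_inv)

text \<open>Induction over the sigma-algebra in E only. For a box E the coordinates of a far shift
  of F are disjoint from those of E, so the product formula is eventually exact; complements and
  disjoint unions preserve the limit.\<close>

lemma bern_mixing:
  fixes X :: "int \<Rightarrow> 'b set"
  assumes E: "E \<in> sets bern" and J: "finite J"
  defines "F \<equiv> {\<omega>. \<forall>i\<in>J. \<omega> i \<in> X i}"
  shows "(\<lambda>n. measure bern (E \<inter> sh (int n) -` F)) \<longlonglongrightarrow> measure bern E * measure bern F"
proof -
  interpret B: prob_space bern by (rule prob_space_bern)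
  have F: "F \<in> sets bern" unfolding F_def by (rule bern_box(1)[OF J])
  have Fn: "sh (int n) -` F \<in> sets bern" for n
    using measurable_sets[OF bern_shift_measurable F] by simp
  have sb: "sets bern = sigma_sets (\<Pi>\<^sub>E i\<in>UNIV. space (measure_pmf \<pi>)) (prod_algebra UNIV (\<lambda>_. measure_pmf \<pi>))"
    unfolding bern_def by (rule sets_PiM)
  have "E \<in> sigma_sets (\<Pi>\<^sub>E i\<in>(UNIV::int set). space (measure_pmf \<pi>)) (prod_algebra UNIV (\<lambda>_. measure_pmf \<pi>))"
    using E unfolding sb .
  with Int_stable_prod_algebra prod_algebra_sets_into_space show ?thesis
  proof (induction rule: sigma_sets_induct_disjoint)
    case (basic A)
    then obtain K Y where K: "A = prod_emb UNIV (\<lambda>_. measure_pmf \<pi>) K (Pi\<^sub>E K Y)" "finite K"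
      by (elim prod_algebraE) blast
    then have A: "A = {\<omega>. \<forall>i\<in>K. \<omega> i \<in> Y i}" by (auto simp: prod_emb_def space_PiM)
    \<comment> \<open>From this shift on, no coordinate in K can meet a shifted coordinate of
      J.\<close>
    define n0 where "n0 = nat (Max (insert 0 (abs ` K)) + Max (insert 0 (abs ` J))) + 1"
    have "measure bern (A \<inter> sh (int n) -` F) = measure bern A * measure bern F" if n: "n \<ge> n0" for n
    proof -
      have dis: "K \<inter> (\<lambda>i. i + int n) ` J = {}"
      proof -
        have "k \<noteq> j + int n" if "k \<in> K" "j \<in> J" for k j
        proof -
          have "\<bar>k\<bar> \<le> Max (insert 0 (abs ` K))" "\<bar>j\<bar> \<le> Max (insert 0 (abs ` J))"
            using that K(2) J by (auto intro!: Max_ge)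
          moreover have "Max (insert 0 (abs ` K)) + Max (insert 0 (abs ` J)) < int n" using n unfolding n0_def by linarith
          ultimately show ?thesis by linarith
        qed
        then show ?thesis by auto
      qed
      define Z where "Z = (\<lambda>i. if i \<in> K then Y i else X (i - int n))"
      have "A \<inter> sh (int n) -` F = {\<omega>. \<forall>i\<in>K \<union> (\<lambda>i. i + int n) ` J. \<omega> i \<in> Z i}"
      proof (rule Set.set_eqI)
        fix \<omega> :: "int \<Rightarrow> 'b"
        have "\<omega> \<in> A \<inter> sh (int n) -` F \<longleftrightarrow> (\<forall>i\<in>K. \<omega> i \<in> Y i) \<and> (\<forall>j\<in>J. \<omega> (j + int n) \<in> X j)"
          by (simp add: A F_def sh_def)
        also have "\<dots> \<longleftrightarrow> (\<forall>i\<in>K. \<omega> i \<in> Z i) \<and> (\<forall>j\<in>J. \<omega> (j + int n) \<in> Z (j + int n))"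
          using dis by (auto simp: Z_def)
        finally show "\<omega> \<in> A \<inter> sh (int n) -` F \<longleftrightarrow> \<omega> \<in> {\<omega>. \<forall>i\<in>K \<union> (\<lambda>i. i + int n) ` J. \<omega> i \<in> Z i}"
          by auto
      qed
      also have "measure bern \<dots> = (\<Prod>i\<in>K \<union> (\<lambda>i. i + int n) ` J. measure (measure_pmf \<pi>) (Z i))"
        using K(2) J by (intro bern_box) auto
      also have "\<dots> = (\<Prod>i\<in>K. measure (measure_pmf \<pi>) (Z i)) * (\<Prod>i\<in>(\<lambda>i. i + int n) ` J. measure (measure_pmf \<pi>) (Z i))"
        using K(2) J dis by (intro prod.union_disjoint) auto
      also have "(\<Prod>i\<in>K. measure (measure_pmf \<pi>) (Z i)) = measure bern A"
        unfolding A bern_box(2)[OF K(2)] by (intro prod.cong refl) (simp add: Z_def)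
      also have "(\<Prod>i\<in>(\<lambda>i. i + int n) ` J. measure (measure_pmf \<pi>) (Z i)) = (\<Prod>i\<in>J. measure (measure_pmf \<pi>) (Z (i + int n)))"
        by (subst prod.reindex) (auto simp: inj_on_def)
      also have "\<dots> = measure bern F"
        unfolding F_def bern_box(2)[OF J] using dis by (intro prod.cong refl) (auto simp: Z_def)
      finally show ?thesis .
    qed
    then show ?case
      by (intro tendsto_eventually) (auto simp: eventually_at_top_linorder)
  next
    case empty
    then show ?case by simp
  next
    case (compl A)
    have A: "A \<in> sets bern" using compl(1) unfolding sb .
    have c1: "measure bern (((\<Pi>\<^sub>E i\<in>UNIV. space (measure_pmf \<pi>)) - A) \<inter> sh (int n) -` F) =
       measure bern F - measure bern (A \<inter> sh (int n) -` F)" for n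
    proof -
      have "((\<Pi>\<^sub>E i\<in>UNIV. space (measure_pmf \<pi>)) - A) \<inter> sh (int n) -` F = sh (int n) -` F - (A \<inter> sh (int n) -` F)" by auto
      also have "measure bern \<dots> = measure bern (sh (int n) -` F) - measure bern (A \<inter> sh (int n) -` F)"
        using A Fn by (intro B.finite_measure_Diff) auto
      finally show ?thesis by (simp add: measure_bern_shift[OF F])
    qed
    have c2: "measure bern ((\<Pi>\<^sub>E i\<in>UNIV. space (measure_pmf \<pi>)) - A) = 1 - measure bern A"
      using B.prob_compl[OF A] by simp
    show ?case
      using tendsto_diff[OF tendsto_const compl(2), of "measure bern F"] unfolding c1 c2
      by (simp add: left_diff_distrib)
  next
    case (union A)
    have A: "A i \<in> sets bern" for i using union(2) unfolding sb by auto
    have s: "(\<lambda>i. measure bern (A i)) sums measure bern (\<Union>i. A i)"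
      using A union(1) by (intro B.finite_measure_UNION) auto
    have eq: "measure bern ((\<Union>i. A i) \<inter> sh (int n) -` F) = (\<Sum>i. measure bern (A i \<inter> sh (int n) -` F))" for n
    proof -
      have "(\<lambda>i. measure bern (A i \<inter> sh (int n) -` F)) sums measure bern (\<Union>i. A i \<inter> sh (int n) -` F)"
      proof (rule B.finite_measure_UNION)
        show "range (\<lambda>i. A i \<inter> sh (int n) -` F) \<subseteq> sets bern" using A Fn by auto
        show "disjoint_family (\<lambda>i. A i \<inter> sh (int n) -` F)"
          using union(1) unfolding disjoint_family_on_def by blast
      qed
      then show ?thesis by (simp add: sums_iff)
    qed
    \<comment> \<open>Tannery's theorem exchanges limit and series: the terms are dominated by the
      summable masses of the disjoint pieces.\<close>
    have "((\<lambda>n. \<Sum>i. measure bern (A i \<inter> sh (int n) -` F)) \<longlongrightarrow> (\<Sum>i. measure bern (A i) * measure bern F)) sequentially"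
    proof (intro conjunct2[OF conjunct2[OF tannerys_theorem]])
      show "\<And>k. (\<lambda>n. measure bern (A k \<inter> sh (int n) -` F)) \<longlonglongrightarrow> measure bern (A k) * measure bern F"
        by (rule union(3))
      show "\<forall>\<^sub>F (k, n) in sequentially \<times>\<^sub>F sequentially. norm (measure bern (A k \<inter> sh (int n) -` F)) \<le> measure bern (A k)"
        using A by (intro always_eventually) (auto intro!: B.finite_measure_mono)
      show "summable (\<lambda>k. measure bern (A k))" using s by (simp add: sums_iff)
    qed simp
    also have "(\<Sum>i. measure bern (A i) * measure bern F) = measure bern (\<Union>i. A i) * measure bern F"
      using sums_mult2[OF s, of "measure bern F"] by (simp add: sums_iff)
    finally show ?case unfolding eq .
  qed
qed

text \<open>For invariant S the mixing limit is a constant sequence, so S is independent of every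
  box. The law restricted to S and the law multiplied by the measure of S therefore agree on boxes,
  hence on S itself, whose measure equals its square.\<close>

theorem bern_zero_one:
  assumes S: "S \<in> sets bern" and inv: "sh 1 -` S = S"
  shows "measure bern S = 0 \<or> measure bern S = 1"
proof -
  interpret B: prob_space bern by (rule prob_space_bern)
  have invn: "sh (int n) -` S = S" for n
  proof (induction n)
    case (Suc n)
    have "sh (int (Suc n)) -` S = sh 1 -` (sh (int n) -` S)"
      by (auto simp: sh_sh add.commute)
    then show ?case using Suc inv by simp
  qed (auto simp: sh_def)
  have box: "measure bern (S \<inter> F) = measure bern S * measure bern F" if J: "finite J" and F: "F = {\<omega>. \<forall>i\<in>J. \<omega> i \<in> X i}" for J X F
  proof -
    have Fs: "F \<in> sets bern" unfolding F by (rule bern_box(1)[OF J])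
    have "measure bern (S \<inter> sh (int n) -` F) = measure bern (S \<inter> F)" for n
    proof -
      have "S \<inter> sh (int n) -` F = sh (int n) -` (S \<inter> F)" using invn[of n] by auto
      then show ?thesis using measure_bern_shift[of "S \<inter> F"] S Fs by simp
    qed
    then have "(\<lambda>n. measure bern (S \<inter> F)) \<longlonglongrightarrow> measure bern S * measure bern F"
      using bern_mixing[OF S J, of X] unfolding F[symmetric] by simp
    then show ?thesis by (simp add: LIMSEQ_const_iff)
  qed
  define P where "P = density bern (indicator S)"
  define Q where "Q = density bern (\<lambda>_. ennreal (measure bern S))"
  have eP: "emeasure P F = ennreal (measure bern (S \<inter> F))" if "F \<in> sets bern" for F
    unfolding P_def using that S
    by (subst emeasure_density) (auto simp: B.emeasure_eq_measure indicator_inter_arith[symmetric])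
  have eQ: "emeasure Q F = ennreal (measure bern S * measure bern F)" if "F \<in> sets bern" for F
    unfolding Q_def using that
    by (subst emeasure_density) (auto simp: nn_integral_cmult_indicator B.emeasure_eq_measure ennreal_mult)
  have "P = Q"
  proof (rule measure_eqI_PiM_infinite[of _ UNIV "\<lambda>_. measure_pmf \<pi>"])
    show "sets P = sets (PiM UNIV (\<lambda>_. measure_pmf \<pi>))" "sets Q = sets (PiM UNIV (\<lambda>_. measure_pmf \<pi>))"
      by (simp_all add: P_def Q_def bern_def)
    show "finite_measure P"
    proof (rule finite_measureI)
      have "space P = space bern" by (simp add: P_def)
      then show "emeasure P (space P) \<noteq> \<infinity>" using eP[of "space bern"] by (simp add: sets.top[of bern, simplified])
    qed
    fix A :: "int \<Rightarrow> 'b set" and J :: "int set" assume J: "finite J"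
    have e: "prod_emb UNIV (\<lambda>_. measure_pmf \<pi>) J (Pi\<^sub>E J A) = {\<omega>. \<forall>i\<in>J. \<omega> i \<in> A i}"
      by (auto simp: prod_emb_def space_PiM)
    show "emeasure P (prod_emb UNIV (\<lambda>_. measure_pmf \<pi>) J (Pi\<^sub>E J A)) = emeasure Q (prod_emb UNIV (\<lambda>_. measure_pmf \<pi>) J (Pi\<^sub>E J A))"
      unfolding e eP[OF bern_box(1)[OF J]] eQ[OF bern_box(1)[OF J]] using box[OF J refl] by simp
  qed
  then have "ennreal (measure bern (S \<inter> S)) = ennreal (measure bern S * measure bern S)"
    using eP[OF S] eQ[OF S] by simp
  then have "measure bern S = measure bern S * measure bern S"
    by (subst (asm) ennreal_inj) auto
  then show ?thesis by auto
qed

end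

section \<open>Periodic product sources\<close>

lemma split_into_blocks:
  "w \<in> words (n * t) \<Longrightarrow> \<exists>us. w = concat us \<and> length us = n \<and> (\<forall>u\<in>set us. length u = t)"
proof (induction n arbitrary: w)
  case (Suc n)
  have "drop t w \<in> words (n * t)" using Suc.prems by (simp add: words_def)
  from Suc.IH[OF this] obtain us where us: "drop t w = concat us" "length us = n" "\<forall>u\<in>set us. length u = t" by blast
  have "w = concat (take t w # us)" using us(1) by (metis append_take_drop_id concat.simps(2))
  moreover have "length (take t w) = t" using Suc.prems by (simp add: words_def)
  ultimately show ?case using us by (intro exI[of _ "take t w # us"]) auto
qed (simp add: words_def)

lemma length_concat_blocks: "\<forall>u\<in>set us. length u = t \<Longrightarrow> length (concat us) = length us * t"
  by (induction us) auto

lemma map_upt_eq_iff: "length xs = n \<Longrightarrow> map f [0..<n] = xs \<longleftrightarrow> (\<forall>j<n. f j = xs ! j)"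
  by (auto simp: list_eq_iff_nth_eq)

text \<open>Block k occupies the sites k t + 1 to (k + 1) t, hence the 1 subtracted before
  dividing.\<close>

definition blk :: "nat \<Rightarrow> (int \<Rightarrow> 'a list) \<Rightarrow> 'a seq" where
  "blk t \<omega> = (\<lambda>i. \<omega> ((i - 1) div int t) ! nat ((i - 1) mod int t))"

text \<open>A concrete model of a periodic product; \<open>ppm_unique\<close> identifies every
  source that meets the specification with it.\<close>

definition ppm :: "nat \<Rightarrow> 'a::countable list pmf \<Rightarrow> ('a seq) measure" where
  "ppm t \<pi> = distr (bern \<pi>) seq_space (blk t)"

lemma blk_measurable: "blk t \<in> measurable (bern (\<pi> :: 'a::countable list pmf)) seq_space"
  unfolding blk_def[abs_def]
proof (rule measurable_seqI)
  fix i
  have "(\<lambda>w. w ! nat ((i - 1) mod int t)) \<in> measurable (count_space (UNIV :: 'a list set)) (count_space UNIV)" by simp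
  from measurable_compose[OF bern_component this]
  show "(\<lambda>\<omega>. \<omega> ((i - 1) div int t) ! nat ((i - 1) mod int t)) \<in> measurable (bern \<pi>) (count_space UNIV)" .
qed

lemma source_ppm: "is_source (ppm t \<pi>)"
  unfolding ppm_def by (rule is_source_distr[OF prob_space_bern blk_measurable])

lemma measure_ppm: "S \<in> sets seq_space \<Longrightarrow> measure (ppm t \<pi>) S = measure (bern \<pi>) (blk t -` S)"
  unfolding ppm_def by (subst measure_distr[OF blk_measurable]) simp_all

lemma blk_sh:
  assumes "t > 0"
  shows "blk t (sh 1 \<omega>) = sh (int t) (blk t \<omega>)"
proof
  fix i
  have "(i + int t - 1) div int t = (i - 1) div int t + 1" "(i + int t - 1) mod int t = (i - 1) mod int t"
    using assms div_add_self2[of "int t" "i - 1"] mod_add_self2[of "i - 1" "int t"]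
    by (simp_all add: algebra_simps)
  then show "blk t (sh 1 \<omega>) i = sh (int t) (blk t \<omega>) i" by (simp add: blk_def sh_def)
qed

lemma wd_blk:
  assumes t: "t > 0"
  shows "wd (k * int t + 1) (n * t) (blk t \<omega>) = concat (map (\<lambda>j. map (\<lambda>r. \<omega> (k + int j) ! r) [0..<t]) [0..<n])"
proof (induction n)
  case (Suc n)
  have "wd (k * int t + 1 + int (n * t)) t (blk t \<omega>) = map (\<lambda>r. \<omega> (k + int n) ! r) [0..<t]"
  proof (rule nth_equalityI)
    fix j assume "j < length (wd (k * int t + 1 + int (n * t)) t (blk t \<omega>))"
    then have j: "j < t" by simp
    have e: "k * int t + 1 + int (n * t) + int j - 1 = int j + (k + int n) * int t" by (simp add: algebra_simps)
    have "(int j + (k + int n) * int t) div int t = k + int n" "(int j + (k + int n) * int t) mod int t = int j"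
      using j by simp_all
    then show "wd (k * int t + 1 + int (n * t)) t (blk t \<omega>) ! j = map (\<lambda>r. \<omega> (k + int n) ! r) [0..<t] ! j"
      using j by (simp add: nth_wd blk_def e)
  qed simp
  then show ?case using Suc wd_append[of "k * int t + 1" "n * t" t "blk t \<omega>"] by (simp add: add.commute)
qed (simp add: wd_def)

context
  fixes t :: nat and \<pi> :: "'a::finite list pmf"
  assumes t: "t > 0" and supp: "set_pmf \<pi> \<subseteq> words t"
begin

text \<open>\<open>blk\<close> reads only the first t entries of a symbol; on the support, where
  symbols have length t, nothing is lost.\<close>

lemma pmf_block_measure:
  assumes "length u = t"
  shows "measure (measure_pmf \<pi>) {w. map (\<lambda>r. w ! r) [0..<t] = u} = pmf \<pi> u"
proof -
  have "{w. map (\<lambda>r. w ! r) [0..<t] = u} \<inter> set_pmf \<pi> = {u} \<inter> set_pmf \<pi>"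
    using supp map_nth by (auto simp: words_def)
  then have "measure (measure_pmf \<pi>) {w. map (\<lambda>r. w ! r) [0..<t] = u} = measure (measure_pmf \<pi>) {u}"
    by (metis measure_Int_set_pmf)
  then show ?thesis by (simp add: measure_pmf_single)
qed

lemma ppm_cyl_blocks:
  assumes us: "\<forall>u\<in>set us. length u = t"
  shows "measure (ppm t \<pi>) (cyl (k * int t + 1) (concat us)) = (\<Prod>u\<leftarrow>us. pmf \<pi> u)"
proof -
  define n where "n = length us"
  define J where "J = (\<lambda>j. k + int j) ` {..<n}"
  define X where "X = (\<lambda>i. {w. map (\<lambda>r. w ! r) [0..<t] = us ! nat (i - k)})"
  have len: "concat us \<in> words (n * t)" unfolding words_def n_def using length_concat_blocks[OF us] by simp
  have "blk t -` cyl (k * int t + 1) (concat us) = {\<omega>. \<forall>i\<in>J. \<omega> i \<in> X i}"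
  proof (rule Set.set_eqI)
    fix \<omega> :: "int \<Rightarrow> 'a list"
    have "\<omega> \<in> blk t -` cyl (k * int t + 1) (concat us) \<longleftrightarrow> wd (k * int t + 1) (n * t) (blk t \<omega>) = concat us"
      unfolding vimage_eq cyl_wd[OF len] mem_Collect_eq ..
    also have "\<dots> \<longleftrightarrow> map (\<lambda>j. map (\<lambda>r. \<omega> (k + int j) ! r) [0..<t]) [0..<n] = us"
      unfolding wd_blk[OF t]
    proof (rule concat_eq_concat_iff)
      show "\<forall>(x, y)\<in>set (zip (map (\<lambda>j. map (\<lambda>r. \<omega> (k + int j) ! r) [0..<t]) [0..<n]) us). length x = length y"
      proof (clarify)
        fix x y assume "(x, y) \<in> set (zip (map (\<lambda>j. map (\<lambda>r. \<omega> (k + int j) ! r) [0..<t]) [0..<n]) us)"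
        then have "x \<in> set (map (\<lambda>j. map (\<lambda>r. \<omega> (k + int j) ! r) [0..<t]) [0..<n])" "y \<in> set us"
          by (auto dest: set_zip_leftD set_zip_rightD)
        then show "length x = length y" using us by auto
      qed
      show "length (map (\<lambda>j. map (\<lambda>r. \<omega> (k + int j) ! r) [0..<t]) [0..<n]) = length us" by (simp add: n_def)
    qed
    also have "\<dots> \<longleftrightarrow> (\<forall>j<n. map (\<lambda>r. \<omega> (k + int j) ! r) [0..<t] = us ! j)"
      by (rule map_upt_eq_iff) (simp add: n_def)
    also have "\<dots> \<longleftrightarrow> \<omega> \<in> {\<omega>. \<forall>i\<in>J. \<omega> i \<in> X i}" unfolding J_def X_def by auto
    finally show "\<omega> \<in> blk t -` cyl (k * int t + 1) (concat us) \<longleftrightarrow> \<omega> \<in> {\<omega>. \<forall>i\<in>J. \<omega> i \<in> X i}" .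
  qed
  then have "measure (ppm t \<pi>) (cyl (k * int t + 1) (concat us)) = (\<Prod>i\<in>J. measure (measure_pmf \<pi>) (X i))"
    unfolding measure_ppm[OF cyl_sets] using bern_box(2)[of J] by (simp add: J_def)
  also have "\<dots> = (\<Prod>j<n. measure (measure_pmf \<pi>) (X (k + int j)))"
    unfolding J_def by (subst prod.reindex) (auto simp: inj_on_def)
  also have "\<dots> = (\<Prod>j<n. pmf \<pi> (us ! j))"
    unfolding X_def using us by (intro prod.cong refl) (simp add: pmf_block_measure n_def)
  also have "\<dots> = (\<Prod>u\<leftarrow>us. pmf \<pi> u)"
    unfolding n_def by (simp add: prod.list_conv_set_nth atLeast0LessThan)
  finally show ?thesis .
qed

lemma periodic_product_ppm: "periodic_product (ppm t \<pi>)"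
  unfolding periodic_product_def using source_ppm t supp ppm_cyl_blocks by blast

lemma ppm_unique:
  assumes p: "is_source p"
    and cyl: "\<And>k us. \<forall>u\<in>set us. length u = t \<Longrightarrow> measure p (cyl (k * int t + 1) (concat us)) = (\<Prod>u\<leftarrow>us. pmf \<pi> u)"
  shows "p = ppm t \<pi>"
proof (rule source_eqI[OF p source_ppm t])
  fix N and w :: "'a list" assume "w \<in> words (2 * N * t)"
  then obtain us where us: "w = concat us" "\<forall>u\<in>set us. length u = t" using split_into_blocks by blast
  have "1 - int (N * t) = (- int N) * int t + 1" by simp
  then show "measure p (cyl (1 - int (N * t)) w) = measure (ppm t \<pi>) (cyl (1 - int (N * t)) w)"
    unfolding us(1) using cyl[OF us(2)] ppm_cyl_blocks[OF us(2)] by metis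
qed

lemma ppm_periodic: "periodic t (ppm t \<pi>)"
  unfolding periodic_def
proof (intro conjI source_ppm ppm_unique is_source_shs)
  fix k :: int and us :: "'a list list" assume us: "\<forall>u\<in>set us. length u = t"
  have "k * int t + 1 + int t = (k + 1) * int t + 1" by (simp add: algebra_simps)
  then show "measure (shs (int t) (ppm t \<pi>)) (cyl (k * int t + 1) (concat us)) = (\<Prod>u\<leftarrow>us. pmf \<pi> u)"
    unfolding measure_shs[OF source_ppm cyl_sets] sh_vimage_cyl using ppm_cyl_blocks[OF us] by metis
qed

lemma ppm_cyl_block:
  assumes "u \<in> words t"
  shows "measure (ppm t \<pi>) (cyl 1 u) = pmf \<pi> u"
  using ppm_cyl_blocks[of "[u]" 0] assms by (simp add: words_def)

lemma ppm_cyl_append: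
  assumes "w \<in> words (k * t)" "v \<in> words t"
  shows "measure (ppm t \<pi>) (cyl 1 (w @ v)) = measure (ppm t \<pi>) (cyl 1 w) * pmf \<pi> v"
proof -
  obtain us where us: "w = concat us" "\<forall>u\<in>set us. length u = t" using split_into_blocks[OF assms(1)] by blast
  have "w @ v = concat (us @ [v])" using us(1) by simp
  moreover have "\<forall>u\<in>set (us @ [v]). length u = t" using us(2) assms(2) by (auto simp: words_def)
  ultimately show ?thesis using ppm_cyl_blocks[of "us @ [v]" 0] ppm_cyl_blocks[OF us(2), of 0] us(1) by simp
qed

text \<open>A shift by t sites is a shift of the block process by one symbol, so
  \<open>bern_zero_one\<close> applies to the preimage under \<open>blk\<close>.\<close>

lemma ppm_zero_one:
  assumes S: "S \<in> sets seq_space" and inv: "sh (int t) -` S = S"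
  shows "measure (ppm t \<pi>) S = 0 \<or> measure (ppm t \<pi>) S = 1"
  unfolding measure_ppm[OF S]
proof (rule bern_zero_one)
  show "blk t -` S \<in> sets (bern \<pi>)" using measurable_sets[OF blk_measurable S, of t \<pi>] by simp
  have "sh 1 -` (blk t -` S) = blk t -` (sh (int t) -` S)" by (auto simp: blk_sh[OF t])
  then show "sh 1 -` (blk t -` S) = blk t -` S" using inv by simp
qed

end

lemma periodic_productE:
  assumes "periodic_product (p :: ('a::finite seq) measure)"
  obtains t \<pi> where "t > 0" "set_pmf \<pi> \<subseteq> words t" "p = ppm t \<pi>"
proof -
  obtain t \<pi> where *: "is_source p" "t > 0" "set_pmf \<pi> \<subseteq> words t"
    "\<forall>k::int. \<forall>us. (\<forall>u\<in>set us. length u = t) \<longrightarrow> measure p (cyl (k * int t + 1) (concat us)) = (\<Prod>u\<leftarrow>us. pmf \<pi> u)"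
    using assms unfolding periodic_product_def by blast
  have "p = ppm t \<pi>" using *(4) by (intro ppm_unique *) blast
  then show ?thesis using that * by blast
qed

section \<open>Averages over a period\<close>

text \<open>The translate of p by a uniformly random phase. As the image of a product of probability
  measures it needs no separate construction as a mixture.\<close>

definition avg :: "nat \<Rightarrow> ('a seq) measure \<Rightarrow> ('a seq) measure" where
  "avg t p = distr (measure_pmf (pmf_of_set {..<t}) \<Otimes>\<^sub>M p) seq_space (\<lambda>(s, x). sh (int s) x)"

context
  fixes t :: nat and p :: "('a::finite seq) measure"
  assumes t: "t > 0" and p: "is_source p"
begin

interpretation P: prob_space p by (rule source_prob[OF p])
interpretation PP: pair_prob_space "measure_pmf (pmf_of_set {..<t})" p ..

lemma avg_map_measurable: "(\<lambda>(s, x). sh (int s) x) \<in> measurable (measure_pmf (pmf_of_set {..<t}) \<Otimes>\<^sub>M p) seq_space"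
proof -
  have "(\<lambda>(s, x). sh (int s) x) \<in> measurable (count_space UNIV \<Otimes>\<^sub>M seq_space) seq_space"
    by (rule measurable_pair_measure_countable1) simp_all
  moreover have "sets (measure_pmf (pmf_of_set {..<t}) \<Otimes>\<^sub>M p) = sets (count_space UNIV \<Otimes>\<^sub>M seq_space)"
    by (rule sets_pair_measure_cong) (simp_all add: source_sets[OF p])
  ultimately show ?thesis using measurable_cong_sets by blast
qed

lemma source_avg: "is_source (avg t p)"
  unfolding avg_def by (rule is_source_distr[OF PP.prob_space_axioms avg_map_measurable])

lemma integral_avg:
  fixes g :: "'a seq \<Rightarrow> 'c::{banach, second_countable_topology}"
  assumes g: "g \<in> borel_measurable seq_space" and B: "\<And>x. norm (g x) \<le> B"
  shows "(LINT x|avg t p. g x) = (\<Sum>s<t. (1 / real t) *\<^sub>R (LINT x|shs (int s) p. g x))"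
proof -
  let ?U = "measure_pmf (pmf_of_set {..<t})"
  let ?f = "\<lambda>(s, x). sh (int s) x"
  have m: "(\<lambda>z. g (?f z)) \<in> borel_measurable (?U \<Otimes>\<^sub>M p)"
    by (rule measurable_compose[OF avg_map_measurable g])
  have int: "integrable (?U \<Otimes>\<^sub>M p) (\<lambda>z. g (?f z))"
    by (rule PP.integrable_const_bound[of _ B]) (use B m in auto)
  have ne: "{..<t} \<noteq> {}" "finite {..<t}" using t by auto
  have "(LINT x|avg t p. g x) = (LINT z|(?U \<Otimes>\<^sub>M p). g (?f z))"
    unfolding avg_def by (rule integral_distr[OF avg_map_measurable g])
  also have "\<dots> = (LINT s|?U. LINT x|p. g (sh (int s) x))"
    using PP.integral_fst'[OF int] by simp
  also have "\<dots> = (\<Sum>s<t. pmf (pmf_of_set {..<t}) s *\<^sub>R (LINT x|p. g (sh (int s) x)))"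
    by (rule integral_measure_pmf) (use ne in \<open>auto simp: set_pmf_of_set\<close>)
  also have "\<dots> = (\<Sum>s<t. (1 / real t) *\<^sub>R (LINT x|shs (int s) p. g x))"
  proof (intro sum.cong refl)
    fix s assume "s \<in> {..<t}"
    moreover have "(LINT x|shs (int s) p. g x) = (LINT x|p. g (sh (int s) x))"
      unfolding shs_def by (rule integral_distr) (simp_all add: source_measurable[OF p] g)
    ultimately show "pmf (pmf_of_set {..<t}) s *\<^sub>R (LINT x|p. g (sh (int s) x)) = (1 / real t) *\<^sub>R (LINT x|shs (int s) p. g x)"
      using ne by (simp add: pmf_of_set)
  qed
  finally show ?thesis .
qed

lemma measure_avg:
  assumes S: "S \<in> sets seq_space"
  shows "measure (avg t p) S = (\<Sum>s<t. measure p (sh (int s) -` S)) / real t"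
proof -
  have "measure (avg t p) S = (LINT x|avg t p. indicator S x)"
    using S by (simp add: source_space[OF source_avg])
  also have "\<dots> = (\<Sum>s<t. (1 / real t) *\<^sub>R (LINT x|shs (int s) p. indicator S x :: real))"
    by (rule integral_avg[where B = 1]) (use S in \<open>auto simp: indicator_def\<close>)
  also have "\<dots> = (\<Sum>s<t. (1 / real t) *\<^sub>R measure p (sh (int s) -` S))"
    using S by (intro sum.cong refl) (simp add: measure_shs[OF p S, symmetric] source_space[OF is_source_shs[OF p]])
  finally show ?thesis by (simp add: sum_divide_distrib)
qed

end

text \<open>Stationarity telescopes, since the translates by t and by 0 agree. A shift-invariant set
  has equal measure under all translates, so its measure is the one under the product source, which
  is 0 or 1.\<close>

lemma ergodic_avg_ppm:
  fixes \<pi> :: "'a::finite list pmf"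
  assumes t: "t > 0" and supp: "set_pmf \<pi> \<subseteq> words t"
  shows "ergodic_source (avg t (ppm t \<pi>))"
proof -
  note p = source_ppm[of t \<pi>]
  note m = measure_avg[OF t p]
  have "measure (avg t (ppm t \<pi>)) (shift -` S) = measure (avg t (ppm t \<pi>)) S" if S: "S \<in> sets seq_space" for S
  proof -
    let ?a = "\<lambda>s. measure (ppm t \<pi>) (sh (int s) -` S)"
    have sS: "shift -` S \<in> sets seq_space" unfolding shift_sh using measurable_sets[OF sh_measurable S, of 1] by simp
    have "?a t = ?a 0"
    proof -
      have "?a t = measure (shs (int t) (ppm t \<pi>)) S" by (rule measure_shs[OF p S, symmetric])
      also have "\<dots> = measure (ppm t \<pi>) S" using ppm_periodic[OF t supp] by (simp add: periodic_def)
      finally have "?a t = measure (ppm t \<pi>) S" .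
      moreover have "sh (int 0) -` S = S" by (auto simp: sh_def)
      ultimately show ?thesis by simp
    qed
    moreover have "(\<Sum>s<Suc t. ?a s) = ?a 0 + (\<Sum>s<t. ?a (Suc s))" by (rule sum.lessThan_Suc_shift)
    moreover have "(\<Sum>s<Suc t. ?a s) = (\<Sum>s<t. ?a s) + ?a t" by (rule sum.lessThan_Suc)
    ultimately have "(\<Sum>s<t. ?a (Suc s)) = (\<Sum>s<t. ?a s)" by linarith
    moreover have "sh (int s) -` (shift -` S) = sh (int (Suc s)) -` S" for s
      by (auto simp: shift_sh sh_sh add.commute)
    ultimately show ?thesis unfolding m[OF S] m[OF sS] by simp
  qed
  then have st: "stationary_source (avg t (ppm t \<pi>))"
    unfolding stationary_source_def using source_avg[OF t p] by blast
  have "measure (avg t (ppm t \<pi>)) S = 0 \<or> measure (avg t (ppm t \<pi>)) S = 1"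
    if S: "S \<in> sets seq_space" and inv: "shift -` S = S" for S
  proof -
    have inv': "sh (int s) -` S = S" for s
    proof (induction s)
      case (Suc s)
      have "sh (int (Suc s)) -` S = sh (int s) -` (shift -` S)" by (auto simp: shift_sh sh_sh add.commute)
      then show ?case using Suc inv by simp
    qed (auto simp: sh_def)
    have "measure (avg t (ppm t \<pi>)) S = measure (ppm t \<pi>) S"
      unfolding m[OF S] inv' using t by simp
    then show ?thesis using ppm_zero_one[OF t supp S inv'] by simp
  qed
  then show ?thesis unfolding ergodic_source_def using st by blast
qed

definition block_law :: "('a::finite seq) measure \<Rightarrow> nat \<Rightarrow> 'a list pmf" where
  "block_law p t = embed_pmf (\<lambda>u. if u \<in> words t then measure p (cyl 1 u) else 0)"

lemma sum_measure_cyl: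
  fixes p :: "('a::finite seq) measure"
  assumes p: "is_source p"
  shows "(\<Sum>w\<in>words k. measure p (cyl n w)) = 1"
  using source_measure_words[OF p, of "\<lambda>_. True" n k] prob_space.prob_space[OF source_prob[OF p]]
  by (simp add: source_space[OF p])

lemma block_law:
  assumes p: "is_source p"
  shows "set_pmf (block_law p t) \<subseteq> words t" "u \<in> words t \<Longrightarrow> pmf (block_law p t) u = measure p (cyl 1 u)"
proof -
  let ?f = "\<lambda>u. if u \<in> words t then measure p (cyl 1 u) else 0"
  have "(\<integral>\<^sup>+u. ennreal (?f u) \<partial>count_space UNIV) = (\<Sum>u\<in>words t. ennreal (?f u))"
    by (rule nn_integral_count_space') auto
  also have "\<dots> = ennreal (\<Sum>u\<in>words t. ?f u)" by (rule sum_ennreal) simp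
  also have "\<dots> = 1" using sum_measure_cyl[OF p, where n = 1 and k = t] by simp
  finally have e: "pmf (block_law p t) u = ?f u" for u
    unfolding block_law_def by (intro pmf_embed_pmf) auto
  show "set_pmf (block_law p t) \<subseteq> words t" using e by (auto simp: set_pmf_iff split: if_splits)
  show "u \<in> words t \<Longrightarrow> pmf (block_law p t) u = measure p (cyl 1 u)" using e by simp
qed

section \<open>Joint states of a source and a channel\<close>

text \<open>Gives all matrix entries of a channel the bound 1, and thereby integrability against any
  source.\<close>

lemma psd_entry_bound:
  assumes fin: "finite I" and p: "psd_on I A" and x: "x \<in> I" and y: "y \<in> I"
  shows "cmod (A x y) \<le> tr_on I A"
proof -
  obtain e l where s: "spec I A e l" "\<And>k. k \<in> I \<Longrightarrow> 0 \<le> l k" using psd_spec[OF fin p] by metis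
  have e1: "cmod (e k z) \<le> 1" if "k \<in> I" "z \<in> I" for k z
  proof -
    have "(cmod (e k z))\<^sup>2 \<le> (\<Sum>x\<in>I. (cmod (e k x))\<^sup>2)" using fin that by (intro member_le_sum) auto
    also have "\<dots> = 1" by (rule onb_norm[OF specD(1)[OF s(1)] that(1)])
    finally show ?thesis by (simp add: abs_square_le_1)
  qed
  have "cmod (A x y) \<le> (\<Sum>k\<in>I. cmod (complex_of_real (l k) * e k x * cnj (e k y)))"
    unfolding specD(2)[OF s(1) x y] by (rule norm_sum)
  also have "\<dots> \<le> (\<Sum>k\<in>I. l k)"
  proof (rule sum_mono)
    fix k assume k: "k \<in> I"
    have "cmod (e k x) * cmod (e k y) \<le> 1 * 1" using e1 k x y by (intro mult_mono) auto
    then have "l k * (cmod (e k x) * cmod (e k y)) \<le> l k * 1" using s(2)[OF k] by (intro mult_left_mono) auto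
    then show "cmod (complex_of_real (l k) * e k x * cnj (e k y)) \<le> l k"
      using s(2)[OF k] by (simp add: norm_mult mult.assoc)
  qed
  finally show ?thesis unfolding spec_tr[OF fin s(1)] .
qed

lemma integral_wd:
  fixes p :: "('a::finite seq) measure" and f :: "'a list \<Rightarrow> real"
  assumes p: "is_source p"
  shows "(LINT x|p. f (wd n k x)) = (\<Sum>w\<in>words k. f w * measure p (cyl n w))"
proof -
  interpret P: prob_space p by (rule source_prob[OF p])
  have "f (wd n k x) = (\<Sum>w\<in>words k. f w * indicator (cyl n w) x)" for x :: "'a seq"
  proof -
    have "(\<Sum>w\<in>words k. f w * indicator (cyl n w) x) = (\<Sum>w\<in>words k. if w = wd n k x then f w else 0)"
      by (intro sum.cong refl) (auto simp: cyl_wd indicator_def)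
    then show ?thesis by simp
  qed
  then have "(LINT x|p. f (wd n k x)) = (LINT x|p. (\<Sum>w\<in>words k. f w * indicator (cyl n w) x))" by simp
  also have "\<dots> = (\<Sum>w\<in>words k. (LINT x|p. f w * indicator (cyl n w) x))"
    by (intro Bochner_Integration.integral_sum integrable_mult_right) (auto simp: source_sets[OF p] P.emeasure_eq_measure)
  finally show ?thesis by (simp add: source_space[OF p])
qed

context
  fixes d :: nat and W :: "('a::finite) seq \<Rightarrow> int \<Rightarrow> nat \<Rightarrow> complex mat"
  assumes d: "d \<ge> 1" and W: "cq_channel d W"
begin

lemma channel_carrier: "W x n k \<in> carrier_mat (d ^ k) (d ^ k)"
  using W unfolding cq_channel_def local_state_family_def by blast

lemma channel_psd: "psd_on {..<d ^ k} (\<lambda>i j. W x n k $$ (i, j))"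
  using W psd_iff_psd_on[OF channel_carrier] unfolding cq_channel_def local_state_family_def by blast

lemma channel_trace: "mtrace (W x n k) = 1"
  using W unfolding cq_channel_def local_state_family_def by blast

lemma channel_tr_on: "tr_on {..<d ^ k} (\<lambda>i j. W x n k $$ (i, j)) = 1"
  unfolding tr_on_mtrace[OF channel_carrier] channel_trace by simp

lemma channel_measurable: "i < d ^ k \<Longrightarrow> j < d ^ k \<Longrightarrow> (\<lambda>x. W x n k $$ (i, j)) \<in> borel_measurable seq_space"
  using W unfolding cq_channel_def by blast

lemma channel_entry_le: "i < d ^ k \<Longrightarrow> j < d ^ k \<Longrightarrow> cmod (W x n k $$ (i, j)) \<le> 1"
  using psd_entry_bound[OF finite_lessThan channel_psd, of i k j] by (simp add: channel_tr_on)

lemma channel_last: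
  assumes "i < d ^ k" "i' < d ^ k"
  shows "(\<Sum>b<d. W x n (Suc k) $$ (i * d + b, i' * d + b)) = W x n k $$ (i, i')"
proof -
  have "W x n k = ptrace_last d (W x n (Suc k))"
    using W unfolding cq_channel_def local_state_family_def by simp
  moreover have "dim_row (W x n (Suc k)) div d = d ^ k" using channel_carrier[of x n "Suc k"] d by auto
  ultimately show ?thesis using assms unfolding ptrace_last_def Let_def by simp
qed

lemma channel_first:
  assumes "i < d ^ k" "i' < d ^ k"
  shows "(\<Sum>b<d. W x n (Suc k) $$ (b * d ^ k + i, b * d ^ k + i')) = W x (n + 1) k $$ (i, i')"
proof -
  have "W x (n + 1) k = ptrace_first d (W x n (Suc k))"
    using W unfolding cq_channel_def local_state_family_def by simp
  moreover have "dim_row (W x n (Suc k)) div d = d ^ k" using channel_carrier[of x n "Suc k"] d by auto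
  ultimately show ?thesis using assms unfolding ptrace_first_def Let_def by simp
qed

section \<open>The joint state for a fixed source\<close>

context
  fixes p :: "('a seq) measure"
  assumes p: "is_source p"
begin

interpretation P: prob_space p by (rule source_prob[OF p])

lemma jf_integrable:
  assumes "i < d ^ k" "j < d ^ k"
  shows "integrable p (\<lambda>x. indicator (cyl n' w) x * W x n k $$ (i, j))"
proof (rule P.integrable_const_bound[of _ 1])
  show "AE x in p. cmod (indicator (cyl n' w) x * W x n k $$ (i, j)) \<le> 1"
    using channel_entry_le[OF assms] by (intro AE_I2) (simp add: norm_mult indicator_def)
  have "(\<lambda>x. indicator (cyl n' w) x * W x n k $$ (i, j)) \<in> borel_measurable seq_space"
    by (intro borel_measurable_times borel_measurable_indicator cyl_sets channel_measurable assms)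
  then show "(\<lambda>x. indicator (cyl n' w) x * W x n k $$ (i, j)) \<in> borel_measurable p"
    by (simp add: source_measurable[OF p])
qed

lemma jf_entry:
  "i < d ^ k \<Longrightarrow> j < d ^ k \<Longrightarrow> joint_fam d p W n k w $$ (i, j) = (LINT x|p. indicator (cyl n w) x * W x n k $$ (i, j))"
  by (simp add: joint_fam_def)

text \<open>A linear functional of the local density is the integral of the same functional of
  \<open>W x\<close>; positivity, traces and test probabilities of the joint state are
  instances.\<close>

lemma jf_functional:
  "(\<Sum>i<d ^ k. \<Sum>j<d ^ k. c i j * joint_fam d p W n k w $$ (i, j)) =
     (LINT x|p. indicator (cyl n w) x * (\<Sum>i<d ^ k. \<Sum>j<d ^ k. c i j * W x n k $$ (i, j)))"
  "integrable p (\<lambda>x. indicator (cyl n w) x * (\<Sum>i<d ^ k. \<Sum>j<d ^ k. c i j * W x n k $$ (i, j)))"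
proof -
  have i: "integrable p (\<lambda>x. c i j * (indicator (cyl n w) x * W x n k $$ (i, j)))"
    if "i \<in> {..<d ^ k}" "j \<in> {..<d ^ k}" for i j
    using that by (intro integrable_mult_right jf_integrable) auto
  have e: "indicator (cyl n w) x * (\<Sum>i<d ^ k. \<Sum>j<d ^ k. c i j * W x n k $$ (i, j)) =
     (\<Sum>i<d ^ k. \<Sum>j<d ^ k. c i j * (indicator (cyl n w) x * W x n k $$ (i, j)))" for x
    by (simp add: sum_distrib_left mult_ac)
  show "integrable p (\<lambda>x. indicator (cyl n w) x * (\<Sum>i<d ^ k. \<Sum>j<d ^ k. c i j * W x n k $$ (i, j)))"
    unfolding e by (intro Bochner_Integration.integrable_sum i)
  have "(\<Sum>i<d ^ k. \<Sum>j<d ^ k. c i j * joint_fam d p W n k w $$ (i, j)) =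
    (\<Sum>i<d ^ k. \<Sum>j<d ^ k. (LINT x|p. c i j * (indicator (cyl n w) x * W x n k $$ (i, j))))"
    by (intro sum.cong refl) (simp add: jf_entry)
  also have "\<dots> = (\<Sum>i<d ^ k. (LINT x|p. (\<Sum>j<d ^ k. c i j * (indicator (cyl n w) x * W x n k $$ (i, j)))))"
    by (intro sum.cong refl Bochner_Integration.integral_sum[symmetric] i)
  also have "\<dots> = (LINT x|p. (\<Sum>i<d ^ k. \<Sum>j<d ^ k. c i j * (indicator (cyl n w) x * W x n k $$ (i, j))))"
    by (intro Bochner_Integration.integral_sum[symmetric] Bochner_Integration.integrable_sum i)
  finally show "(\<Sum>i<d ^ k. \<Sum>j<d ^ k. c i j * joint_fam d p W n k w $$ (i, j)) =
     (LINT x|p. indicator (cyl n w) x * (\<Sum>i<d ^ k. \<Sum>j<d ^ k. c i j * W x n k $$ (i, j)))"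
    unfolding e .
qed

lemma jf_psd: "psd_on {..<d ^ k} (ents (joint_fam d p W) n k w)"
  unfolding psd_on_def
proof
  fix v :: "nat \<Rightarrow> complex"
  have q: "qf {..<d ^ k} A v v = (\<Sum>i<d ^ k. \<Sum>j<d ^ k. (cnj (v i) * v j) * A i j)" for A
    unfolding qf_def by (intro sum.cong refl) (simp add: mult_ac)
  let ?g = "\<lambda>x. indicator (cyl n w) x * qf {..<d ^ k} (\<lambda>i j. W x n k $$ (i, j)) v v"
  have 1: "qf {..<d ^ k} (ents (joint_fam d p W) n k w) v v = (LINT x|p. ?g x)"
    unfolding q by (rule jf_functional)
  have 2: "integrable p ?g" unfolding q by (rule jf_functional)
  have g: "Im (?g x) = 0" "0 \<le> Re (?g x)" for x
    using channel_psd[of k x n] unfolding psd_on_def by (auto simp: indicator_def)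
  have "Im (LINT x|p. ?g x) = (LINT x|p. Im (?g x))" by (rule integral_Im[OF 2, symmetric])
  also have "\<dots> = 0" by (simp only: g Bochner_Integration.integral_zero)
  finally have a: "Im (LINT x|p. ?g x) = 0" .
  have "Re (LINT x|p. ?g x) = (LINT x|p. Re (?g x))" by (rule integral_Re[OF 2, symmetric])
  also have "\<dots> \<ge> 0" using g(2) by (rule Bochner_Integration.integral_nonneg)
  finally show "Im (qf {..<d ^ k} (ents (joint_fam d p W) n k w) v v) = 0 \<and> 0 \<le> Re (qf {..<d ^ k} (ents (joint_fam d p W) n k w) v v)"
    unfolding 1 using a by simp
qed

lemma jf_carrier: "joint_fam d p W n k w \<in> carrier_mat (d ^ k) (d ^ k)"
  by (simp add: joint_fam_def)

lemma integral_ind_cyl: "(LINT x|p. indicator (cyl n w) x :: complex) = complex_of_real (measure p (cyl n w))"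
proof -
  have "(LINT x|p. indicator (cyl n w) x :: complex) = (LINT x|p. complex_of_real (indicator (cyl n w) x))"
    by (intro Bochner_Integration.integral_cong refl) (simp add: indicator_def)
  also have "\<dots> = complex_of_real (LINT x|p. indicator (cyl n w) x)" by (rule integral_complex_of_real)
  finally show ?thesis by (simp add: source_space[OF p])
qed

lemma jf_mtrace: "mtrace (joint_fam d p W n k w) = complex_of_real (measure p (cyl n w))"
proof -
  have m: "mtrace M = (\<Sum>i<d ^ k. \<Sum>j<d ^ k. (if i = j then 1 else 0) * M $$ (i, j))" if "M \<in> carrier_mat (d ^ k) (d ^ k)" for M
    using that by (simp add: mtrace_def mult_delta_left)
  have "mtrace (joint_fam d p W n k w) = (LINT x|p. indicator (cyl n w) x * mtrace (W x n k))"
    unfolding m[OF jf_carrier] m[OF channel_carrier] by (rule jf_functional)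
  then show ?thesis by (simp add: channel_trace integral_ind_cyl)
qed

lemma jf_tr_on: "tr_on {..<d ^ k} (ents (joint_fam d p W) n k w) = measure p (cyl n w)"
  unfolding tr_on_mtrace[OF jf_carrier] jf_mtrace by simp

lemma jf_state_family: "joint_state_family d (joint_fam d p W)"
  unfolding joint_state_family_def
proof (intro conjI allI ballI)
  fix n k and w :: "'a list"
  show "joint_fam d p W n k w \<in> carrier_mat (d ^ k) (d ^ k)" by (rule jf_carrier)
  show "psd (joint_fam d p W n k w)" using psd_iff_psd_on[OF jf_carrier] jf_psd by blast
  show "(\<Sum>w\<in>words k. mtrace (joint_fam d p W n k w)) = 1"
    unfolding jf_mtrace of_real_sum[symmetric] sum_measure_cyl[OF p] by simp
  assume w: "w \<in> words k"
  show "msum (d ^ k) (\<lambda>a. ptrace_last d (joint_fam d p W n (Suc k) (w @ [a]))) UNIV = joint_fam d p W n k w"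
  proof (rule eq_matI)
    fix i j assume "i < dim_row (joint_fam d p W n k w)" "j < dim_col (joint_fam d p W n k w)"
    then have ij: "i < d ^ k" "j < d ^ k" by (auto simp: joint_fam_def)
    have i': "i * d + b < d ^ Suc k" "j * d + b < d ^ Suc k" if "b < d" for b
      using mult_add_less[OF ij(1) that] mult_add_less[OF ij(2) that] by (simp_all add: mult.commute)
    \<comment> \<open>Along a given x exactly one letter continues w, so the cylinders of the
      extended words partition the cylinder of w.\<close>
    have ind: "(\<Sum>a\<in>UNIV. indicator (cyl n (w @ [a])) x) = (indicator (cyl n w) x :: complex)" for x
    proof -
      have "wd n (Suc k) x = w @ [a] \<longleftrightarrow> wd n k x = w \<and> a = x (n + int k)" for a
        using wd_append[of n k 1 x] by (auto simp: wd_def)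
      moreover have "x \<in> cyl n (w @ [a]) \<longleftrightarrow> wd n (Suc k) x = w @ [a]" for a
        using cyl_wd[of "w @ [a]" "Suc k" n] w by (auto simp: words_def)
      moreover have "x \<in> cyl n w \<longleftrightarrow> wd n k x = w" using cyl_wd[OF w] by auto
      ultimately have "indicator (cyl n (w @ [a])) x = (if a = x (n + int k) then indicator (cyl n w) x else (0 :: complex))" for a
        by (simp add: indicator_def)
      then show ?thesis by simp
    qed
    have "msum (d ^ k) (\<lambda>a. ptrace_last d (joint_fam d p W n (Suc k) (w @ [a]))) UNIV $$ (i, j) =
       (\<Sum>a\<in>UNIV. \<Sum>b<d. joint_fam d p W n (Suc k) (w @ [a]) $$ (i * d + b, j * d + b))"
      using ij d by (simp add: msum_def ptrace_last_def joint_fam_def Let_def)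
    also have "\<dots> = (\<Sum>a\<in>UNIV. \<Sum>b<d. (LINT x|p. indicator (cyl n (w @ [a])) x * W x n (Suc k) $$ (i * d + b, j * d + b)))"
      by (intro sum.cong refl jf_entry i') auto
    also have "\<dots> = (\<Sum>a\<in>UNIV. (LINT x|p. (\<Sum>b<d. indicator (cyl n (w @ [a])) x * W x n (Suc k) $$ (i * d + b, j * d + b))))"
      by (intro sum.cong refl Bochner_Integration.integral_sum[symmetric] jf_integrable i') auto
    also have "\<dots> = (LINT x|p. (\<Sum>a\<in>UNIV. \<Sum>b<d. indicator (cyl n (w @ [a])) x * W x n (Suc k) $$ (i * d + b, j * d + b)))"
      by (intro Bochner_Integration.integral_sum[symmetric] Bochner_Integration.integrable_sum jf_integrable i') auto
    also have "\<dots> = (LINT x|p. indicator (cyl n w) x * W x n k $$ (i, j))"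
      unfolding sum_product[symmetric] ind channel_last[OF ij] by simp
    finally show "msum (d ^ k) (\<lambda>a. ptrace_last d (joint_fam d p W n (Suc k) (w @ [a]))) UNIV $$ (i, j) = joint_fam d p W n k w $$ (i, j)"
      using ij by (simp add: jf_entry)
  qed (auto simp: msum_def joint_fam_def)
  show "msum (d ^ k) (\<lambda>a. ptrace_first d (joint_fam d p W n (Suc k) (a # w))) UNIV = joint_fam d p W (n + 1) k w"
  proof (rule eq_matI)
    fix i j assume "i < dim_row (joint_fam d p W (n + 1) k w)" "j < dim_col (joint_fam d p W (n + 1) k w)"
    then have ij: "i < d ^ k" "j < d ^ k" by (auto simp: joint_fam_def)
    have i': "b * d ^ k + i < d ^ Suc k" "b * d ^ k + j < d ^ Suc k" if "b < d" for b
      using mult_add_less[OF that ij(1)] mult_add_less[OF that ij(2)] by (simp_all add: mult.commute)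
    have ind: "(\<Sum>a\<in>UNIV. indicator (cyl n (a # w)) x) = (indicator (cyl (n + 1) w) x :: complex)" for x
    proof -
      have "wd n (Suc k) x = a # w \<longleftrightarrow> wd (n + 1) k x = w \<and> a = x n" for a
        using wd_append[of n 1 k x] by (auto simp: wd_def)
      moreover have "x \<in> cyl n (a # w) \<longleftrightarrow> wd n (Suc k) x = a # w" for a
        using cyl_wd[of "a # w" "Suc k" n] w by (auto simp: words_def)
      moreover have "x \<in> cyl (n + 1) w \<longleftrightarrow> wd (n + 1) k x = w" using cyl_wd[OF w] by auto
      ultimately have "indicator (cyl n (a # w)) x = (if a = x n then indicator (cyl (n + 1) w) x else (0 :: complex))" for a
        by (simp add: indicator_def)
      then show ?thesis by simp
    qed
    have "msum (d ^ k) (\<lambda>a. ptrace_first d (joint_fam d p W n (Suc k) (a # w))) UNIV $$ (i, j) =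
       (\<Sum>a\<in>UNIV. \<Sum>b<d. joint_fam d p W n (Suc k) (a # w) $$ (b * d ^ k + i, b * d ^ k + j))"
      using ij d by (simp add: msum_def ptrace_first_def joint_fam_def Let_def)
    also have "\<dots> = (\<Sum>a\<in>UNIV. \<Sum>b<d. (LINT x|p. indicator (cyl n (a # w)) x * W x n (Suc k) $$ (b * d ^ k + i, b * d ^ k + j)))"
      by (intro sum.cong refl jf_entry i') auto
    also have "\<dots> = (\<Sum>a\<in>UNIV. (LINT x|p. (\<Sum>b<d. indicator (cyl n (a # w)) x * W x n (Suc k) $$ (b * d ^ k + i, b * d ^ k + j))))"
      by (intro sum.cong refl Bochner_Integration.integral_sum[symmetric] jf_integrable i') auto
    also have "\<dots> = (LINT x|p. (\<Sum>a\<in>UNIV. \<Sum>b<d. indicator (cyl n (a # w)) x * W x n (Suc k) $$ (b * d ^ k + i, b * d ^ k + j)))"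
      by (intro Bochner_Integration.integral_sum[symmetric] Bochner_Integration.integrable_sum jf_integrable i') auto
    also have "\<dots> = (LINT x|p. indicator (cyl (n + 1) w) x * W x (n + 1) k $$ (i, j))"
      unfolding sum_product[symmetric] ind channel_first[OF ij] by simp
    finally show "msum (d ^ k) (\<lambda>a. ptrace_first d (joint_fam d p W n (Suc k) (a # w))) UNIV $$ (i, j) = joint_fam d p W (n + 1) k w $$ (i, j)"
      using ij by (simp add: jf_entry)
  qed (auto simp: msum_def joint_fam_def)
qed

lemma output_eq:
  assumes "i < d ^ k" "j < d ^ k"
  shows "output_fam d p W n k $$ (i, j) = out (joint_fam d p W) n k i j"
proof -
  have "out (joint_fam d p W) n k i j = (\<Sum>w\<in>words k. (LINT x|p. indicator (cyl n w) x * W x n k $$ (i, j)))"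
    unfolding out_def using assms by (simp add: jf_entry)
  also have "\<dots> = (LINT x|p. (\<Sum>w\<in>words k. indicator (cyl n w) x * W x n k $$ (i, j)))"
    by (intro Bochner_Integration.integral_sum[symmetric] jf_integrable assms)
  also have "\<dots> = (LINT x|p. W x n k $$ (i, j))"
    unfolding sum_distrib_right[symmetric] sum_indicator_cyl by simp
  finally show ?thesis using assms by (simp add: output_fam_def)
qed

lemma SJ_jf: "(\<Sum>w\<in>words k. vn_entropy (joint_fam d p W n k w)) = SJ d (joint_fam d p W) n k"
  unfolding SJ_def using psd_iff_psd_on[OF jf_carrier] jf_psd
  by (intro sum.cong refl vn_entropy_ent[OF jf_carrier]) blast

lemma SB_jf: "vn_entropy (output_fam d p W n k) = SB d (joint_fam d p W) n k"
proof -
  have c: "output_fam d p W n k \<in> carrier_mat (d ^ k) (d ^ k)" by (simp add: output_fam_def)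
  have "psd_on {..<d ^ k} (\<lambda>i j. output_fam d p W n k $$ (i, j)) = psd_on {..<d ^ k} (out (joint_fam d p W) n k)"
    by (rule psd_on_cong) (simp add: output_eq)
  then have "psd (output_fam d p W n k)"
    unfolding psd_iff_psd_on[OF c] using out_psd[OF d jf_state_family] by simp
  then have "vn_entropy (output_fam d p W n k) = ent {..<d ^ k} (\<lambda>i j. output_fam d p W n k $$ (i, j))"
    by (rule vn_entropy_ent[OF c])
  also have "\<dots> = SB d (joint_fam d p W) n k" unfolding SB_def by (rule ent_cong) (simp add: output_eq)
  finally show ?thesis .
qed

text \<open>One constant serves both entropies. The source entropy is covered as well, through the
  channel with trivial output and d = 1.\<close>

lemma tame_SJ_SB:
  defines "C \<equiv> log 2 (real d) + log 2 (real CARD('a))"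
  shows "tame C (SJ d (joint_fam d p W))" "tame C (SB d (joint_fam d p W))"
proof -
  note J = d jf_state_family
  have l: "0 \<le> log 2 (real d)" "0 \<le> log 2 (real CARD('a))" using d by simp_all
  have le: "real k * log 2 (real d) \<le> C * real k" for k
    unfolding C_def using l by (simp add: algebra_simps)
  show "tame C (SJ d (joint_fam d p W))"
    unfolding tame_def
  proof (intro conjI allI)
    fix n k l
    show "0 \<le> SJ d (joint_fam d p W) n k" by (rule SJ_nonneg[OF J])
    show "SJ d (joint_fam d p W) n k \<le> C * real k" using SJ_le[OF J, of n k] by (simp add: C_def mult.commute)
    show "SJ d (joint_fam d p W) n (k + l) \<le> SJ d (joint_fam d p W) n k + SJ d (joint_fam d p W) (n + int k) l"
      by (rule SJ_subadditive[OF J])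
    show "SJ d (joint_fam d p W) n k \<le> SJ d (joint_fam d p W) n (k + l) + C * real l"
      using SJ_drop_last[OF J, of n k l] le[of l] by linarith
    show "SJ d (joint_fam d p W) (n + int k) l \<le> SJ d (joint_fam d p W) n (k + l) + C * real k"
      using SJ_drop_first[OF J, of n k l] le[of k] by linarith
  qed
  show "tame C (SB d (joint_fam d p W))"
    unfolding tame_def
  proof (intro conjI allI)
    fix n k l
    show "0 \<le> SB d (joint_fam d p W) n k" by (rule SB_nonneg[OF J])
    show "SB d (joint_fam d p W) n k \<le> C * real k" using SB_le[OF J, of n k] le[of k] by linarith
    show "SB d (joint_fam d p W) n (k + l) \<le> SB d (joint_fam d p W) n k + SB d (joint_fam d p W) (n + int k) l"
      by (rule SB_subadditive[OF J])
    show "SB d (joint_fam d p W) n k \<le> SB d (joint_fam d p W) n (k + l) + C * real l"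
      using SB_drop_last[OF J, of n k l] le[of l] by linarith
    show "SB d (joint_fam d p W) (n + int k) l \<le> SB d (joint_fam d p W) n (k + l) + C * real k"
      using SB_drop_first[OF J, of n k l] le[of k] by linarith
  qed
qed

end

section \<open>Stationary channels: translates and averages of the source\<close>

context
  assumes st: "stationary_channel W"
begin

lemma channel_sh: "W (sh (int s) x) n k = W x (n + int s) k"
proof (induction s arbitrary: n)
  case (Suc s)
  have "sh (int (Suc s)) x = shift (sh (int s) x)" unfolding shift_sh sh_sh by simp
  then have "W (sh (int (Suc s)) x) n k = W (sh (int s) x) (n + 1) k"
    using st unfolding stationary_channel_def by simp
  then show ?case using Suc[of "n + 1"] by (simp add: algebra_simps)
qed (simp add: sh_def)

lemma jf_shs:
  assumes p: "is_source p"
  shows "joint_fam d (shs (int s) p) W n k w = joint_fam d p W (n + int s) k w"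
proof (rule eq_matI)
  fix i j assume "i < dim_row (joint_fam d p W (n + int s) k w)" "j < dim_col (joint_fam d p W (n + int s) k w)"
  then have ij: "i < d ^ k" "j < d ^ k" by (auto simp: joint_fam_def)
  have m: "(\<lambda>x. indicator (cyl n w) x * W x n k $$ (i, j)) \<in> borel_measurable seq_space"
    by (intro borel_measurable_times borel_measurable_indicator cyl_sets channel_measurable ij)
  have "(LINT x|shs (int s) p. indicator (cyl n w) x * W x n k $$ (i, j)) =
     (LINT x|p. indicator (cyl n w) (sh (int s) x) * W (sh (int s) x) n k $$ (i, j))"
    unfolding shs_def by (rule integral_distr[OF _ m]) (simp add: source_measurable[OF p])
  also have "\<dots> = (LINT x|p. indicator (cyl (n + int s) w) x * W x (n + int s) k $$ (i, j))"
    unfolding channel_sh sh_vimage_cyl[symmetric] indicator_vimage[symmetric] by (simp add: indicator_def)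
  finally show "joint_fam d (shs (int s) p) W n k w $$ (i, j) = joint_fam d p W (n + int s) k w $$ (i, j)"
    using ij by (simp add: joint_fam_def)
qed (auto simp: joint_fam_def)

lemma jf_periodic: "periodic t p \<Longrightarrow> joint_fam d p W (n + int t) k w = joint_fam d p W n k w"
  using jf_shs[of p t n k w] unfolding periodic_def by simp

lemma SJ_SB_periodic:
  assumes "periodic t p"
  shows "SJ d (joint_fam d p W) (n + int t) k = SJ d (joint_fam d p W) n k"
    "SB d (joint_fam d p W) (n + int t) k = SB d (joint_fam d p W) n k"
  unfolding SJ_def SB_def out_def by (simp_all add: jf_periodic[OF assms])

lemma jf_avg:
  assumes p: "is_source p" and t: "t > 0" and ij: "i < d ^ k" "j < d ^ k"
  shows "joint_fam d (avg t p) W n k w $$ (i, j) = (\<Sum>s<t. complex_of_real (1 / real t) * joint_fam d p W (n + int s) k w $$ (i, j))"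
proof -
  have m: "(\<lambda>x. indicator (cyl n w) x * W x n k $$ (i, j)) \<in> borel_measurable seq_space"
    by (intro borel_measurable_times borel_measurable_indicator cyl_sets channel_measurable ij)
  have "joint_fam d (avg t p) W n k w $$ (i, j) = (LINT x|avg t p. indicator (cyl n w) x * W x n k $$ (i, j))"
    using ij by (simp add: joint_fam_def)
  also have "\<dots> = (\<Sum>s<t. (1 / real t) *\<^sub>R (LINT x|shs (int s) p. indicator (cyl n w) x * W x n k $$ (i, j)))"
    by (rule integral_avg[OF t p m, of 1]) (use channel_entry_le[OF ij] in \<open>simp add: norm_mult indicator_def\<close>)
  also have "\<dots> = (\<Sum>s<t. (1 / real t) *\<^sub>R joint_fam d (shs (int s) p) W n k w $$ (i, j))"
    using ij by (simp add: joint_fam_def)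
  finally show ?thesis unfolding jf_shs[OF p] by (simp add: scaleR_conv_of_real)
qed

text \<open>The lower deviation is excluded by concavity; the upper one is the entropy log t of the
  uniform weights, per unit of trace.\<close>

lemma ent_mixture:
  assumes fin: "finite I" and A: "\<And>s. s < t \<Longrightarrow> psd_on I (A s)" and t: "t > 0"
  shows "\<bar>ent I (\<lambda>x y. \<Sum>s<t. complex_of_real (1 / real t) * A s x y) - (\<Sum>s<t. ent I (A s)) / real t\<bar>
    \<le> ((\<Sum>s<t. tr_on I (A s)) / real t) * log 2 (real t)"
proof -
  let ?B = "\<lambda>s x y. complex_of_real (1 / real t) * A s x y"
  have B: "psd_on I (?B s)" if "s \<in> {..<t}" for s using A that by (intro psd_on_scale) auto
  have e: "eta (1 / real t) = log 2 (real t) / real t" using t by (simp add: eta_eq log_divide)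
  have "ent I (?B s) = (1 / real t) * ent I (A s) + tr_on I (A s) * (log 2 (real t) / real t)" if "s \<in> {..<t}" for s
    using ent_scale[OF fin A, of s "1 / real t"] that unfolding e by simp
  then have s1: "(\<Sum>s<t. ent I (?B s)) = (\<Sum>s<t. ent I (A s)) / real t + ((\<Sum>s<t. tr_on I (A s)) / real t) * log 2 (real t)"
    by (simp add: sum.distrib sum_divide_distrib sum_distrib_right)
  have s2: "(\<Sum>s<t. tr_on I (?B s)) = (\<Sum>s<t. tr_on I (A s)) / real t"
    unfolding tr_on_scale by (simp add: sum_divide_distrib)
  have "ent I (\<lambda>x y. \<Sum>s<t. ?B s x y) \<le> (\<Sum>s<t. ent I (?B s))"
    by (rule ent_sum_le[OF fin _ B]) simp
  moreover have "(\<Sum>s<t. ent I (?B s)) \<le> ent I (\<lambda>x y. \<Sum>s<t. ?B s x y) + (\<Sum>s<t. tr_on I (?B s)) * log 2 (real t)"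
    by (rule ent_sum_ge[OF fin _ _ B]) simp_all
  moreover have "0 \<le> ((\<Sum>s<t. tr_on I (A s)) / real t) * log 2 (real t)"
    using t A fin by (intro mult_nonneg_nonneg divide_nonneg_nonneg sum_nonneg tr_on_psd_nonneg) auto
  ultimately show ?thesis unfolding s1 s2 by linarith
qed

text \<open>For the joint entropy the mixture estimate is summed over words, whose masses add up to
  1. The error log t does not depend on k and thus vanishes in the rate.\<close>

lemma SJ_SB_avg:
  assumes p: "is_source p" and t: "t > 0"
  shows "\<bar>SJ d (joint_fam d (avg t p) W) n k - (\<Sum>s<t. SJ d (joint_fam d p W) (n + int s) k) / real t\<bar> \<le> log 2 (real t)"
    "\<bar>SB d (joint_fam d (avg t p) W) n k - (\<Sum>s<t. SB d (joint_fam d p W) (n + int s) k) / real t\<bar> \<le> log 2 (real t)"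
proof -
  let ?A = "\<lambda>w s. ents (joint_fam d p W) (n + int s) k w"
  have e: "ent {..<d ^ k} (ents (joint_fam d (avg t p) W) n k w) = ent {..<d ^ k} (\<lambda>x y. \<Sum>s<t. complex_of_real (1 / real t) * ?A w s x y)" for w
    by (rule ent_cong) (simp add: jf_avg[OF p t])
  have a: "\<bar>ent {..<d ^ k} (ents (joint_fam d (avg t p) W) n k w) - (\<Sum>s<t. ent {..<d ^ k} (?A w s)) / real t\<bar>
    \<le> ((\<Sum>s<t. measure p (cyl (n + int s) w)) / real t) * log 2 (real t)" for w
    unfolding e using ent_mixture[of "{..<d ^ k}" t "?A w", OF finite_lessThan jf_psd[OF p] t]
    unfolding jf_tr_on[OF p] by simp
  have sw: "(\<Sum>s<t. SJ d (joint_fam d p W) (n + int s) k) = (\<Sum>w\<in>words k. \<Sum>s<t. ent {..<d ^ k} (?A w s))"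
    unfolding SJ_def by (rule sum.swap)
  have sw': "(\<Sum>s<t. \<Sum>w\<in>words k. measure p (cyl (n + int s) w)) = (\<Sum>w\<in>words k. \<Sum>s<t. measure p (cyl (n + int s) w))"
    by (rule sum.swap)
  have eq: "SJ d (joint_fam d (avg t p) W) n k - (\<Sum>s<t. SJ d (joint_fam d p W) (n + int s) k) / real t =
    (\<Sum>w\<in>words k. ent {..<d ^ k} (ents (joint_fam d (avg t p) W) n k w) - (\<Sum>s<t. ent {..<d ^ k} (?A w s)) / real t)"
    unfolding sw sum_subtractf sum_divide_distrib[symmetric] by (simp only: SJ_def)
  have "\<bar>\<Sum>w\<in>words k. ent {..<d ^ k} (ents (joint_fam d (avg t p) W) n k w) - (\<Sum>s<t. ent {..<d ^ k} (?A w s)) / real t\<bar>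
    \<le> (\<Sum>w\<in>words k. ((\<Sum>s<t. measure p (cyl (n + int s) w)) / real t) * log 2 (real t))"
    by (rule order_trans[OF sum_abs]) (intro sum_mono a)
  also have "\<dots> = ((\<Sum>s<t. \<Sum>w\<in>words k. measure p (cyl (n + int s) w)) / real t) * log 2 (real t)"
    unfolding sw' sum_divide_distrib sum_distrib_right ..
  also have "\<dots> = log 2 (real t)" unfolding sum_measure_cyl[OF p] using t by simp
  finally show "\<bar>SJ d (joint_fam d (avg t p) W) n k - (\<Sum>s<t. SJ d (joint_fam d p W) (n + int s) k) / real t\<bar> \<le> log 2 (real t)"
    unfolding eq .
  have "SB d (joint_fam d (avg t p) W) n k = ent {..<d ^ k} (\<lambda>x y. \<Sum>s<t. complex_of_real (1 / real t) * out (joint_fam d p W) (n + int s) k x y)"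
    unfolding SB_def
  proof (rule ent_cong)
    fix x y assume xy: "x \<in> {..<d ^ k}" "y \<in> {..<d ^ k}"
    have "out (joint_fam d (avg t p) W) n k x y = (\<Sum>w\<in>words k. \<Sum>s<t. complex_of_real (1 / real t) * ?A w s x y)"
      unfolding out_def using xy by (simp add: jf_avg[OF p t])
    then show "out (joint_fam d (avg t p) W) n k x y = (\<Sum>s<t. complex_of_real (1 / real t) * out (joint_fam d p W) (n + int s) k x y)"
      unfolding out_def sum_distrib_left by (subst sum.swap) simp
  qed
  then show "\<bar>SB d (joint_fam d (avg t p) W) n k - (\<Sum>s<t. SB d (joint_fam d p W) (n + int s) k) / real t\<bar> \<le> log 2 (real t)"
    using ent_mixture[of "{..<d ^ k}" t "\<lambda>s. out (joint_fam d p W) (n + int s) k", OF finite_lessThan out_psd[OF d jf_state_family[OF p]] t]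
    unfolding SB_def out_trace[OF d jf_state_family[OF p]] using t by simp
qed

end

end

section \<open>Information rates\<close>

text \<open>A channel with one-dimensional output turns the source entropy into a joint entropy, so
  that the results for \<open>SJ\<close> carry over to \<open>HX\<close>.\<close>

definition triv :: "'a seq \<Rightarrow> int \<Rightarrow> nat \<Rightarrow> complex mat" where
  "triv x n k = 1\<^sub>m 1"

lemma triv_channel: "cq_channel 1 (triv :: 'a seq \<Rightarrow> int \<Rightarrow> nat \<Rightarrow> complex mat)"
proof -
  have "psd (1\<^sub>m 1 :: complex mat)"
    unfolding psd_iff_psd_on[OF one_carrier_mat] psd_on_def qf_def
    by (auto simp: complex_norm_square[symmetric] mult.commute simp del: of_real_power)
  moreover have "mtrace (1\<^sub>m 1 :: complex mat) = 1" by (simp add: mtrace_def)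
  moreover have "ptrace_last 1 (1\<^sub>m 1 :: complex mat) = 1\<^sub>m 1" "ptrace_first 1 (1\<^sub>m 1 :: complex mat) = 1\<^sub>m 1"
    by (auto simp: ptrace_last_def ptrace_first_def Let_def intro!: eq_matI)
  ultimately show ?thesis unfolding cq_channel_def local_state_family_def triv_def by simp
qed

lemma triv_stationary: "stationary_channel triv"
  by (simp add: stationary_channel_def triv_def)

definition HX :: "('a::finite seq) measure \<Rightarrow> int \<Rightarrow> nat \<Rightarrow> real" where
  "HX p n k = (\<Sum>w\<in>words k. eta (measure p (cyl n w)))"

lemma HX_SJ:
  assumes p: "is_source p"
  shows "SJ 1 (joint_fam 1 p triv) n k = HX p n k"
  unfolding SJ_def HX_def
proof (intro sum.cong refl)
  fix w :: "'a list" assume "w \<in> words k"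
  note J = jf_psd[OF order_refl triv_channel p, of k n w]
  note t = jf_tr_on[OF order_refl triv_channel p, of k n w]
  show "ent {..<1 ^ k} (ents (joint_fam 1 p triv) n k w) = eta (measure p (cyl n w))"
    using ent_ge_eta_trace[OF finite_lessThan J] ent_le_card[OF finite_lessThan J] unfolding t by simp
qed

context
  fixes d :: nat and W :: "('a::finite) seq \<Rightarrow> int \<Rightarrow> nat \<Rightarrow> complex mat"
  assumes d: "d \<ge> 1" and W: "cq_channel d W" and st: "stationary_channel W"
begin

definition info :: "('a seq) measure \<Rightarrow> int \<Rightarrow> nat \<Rightarrow> real" where
  "info p n k = HX p n k + SB d (joint_fam d p W) n k - SJ d (joint_fam d p W) n k"

text \<open>The limits are exhibited separately and for every starting site: \<open>lim\<close>
  becomes usable only after convergence, and \<open>mutual_info_avg\<close> compares the three rates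
  one at a time.\<close>

lemma info_rates:
  assumes t: "t > 0" and per: "periodic t p"
  shows "\<exists>LX LB LJ. (\<forall>m. (\<lambda>k. HX p m k / real k) \<longlonglongrightarrow> LX) \<and>
    (\<forall>m. (\<lambda>k. SB d (joint_fam d p W) m k / real k) \<longlonglongrightarrow> LB) \<and>
    (\<forall>m. (\<lambda>k. SJ d (joint_fam d p W) m k / real k) \<longlonglongrightarrow> LJ) \<and>
    mutual_info d p W = LX + LB - LJ"
proof -
  have p: "is_source p" using per by (simp add: periodic_def)
  have hx: "SJ 1 (joint_fam 1 p triv) = HX p" using HX_SJ[OF p] by (intro ext)
  obtain LX where X: "\<And>m. (\<lambda>k. HX p m k / real k) \<longlonglongrightarrow> LX"
    using rate_exists[OF tame_SJ_SB(1)[OF order_refl triv_channel p] t SJ_SB_periodic(1)[OF order_refl triv_channel triv_stationary per]]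
    unfolding hx by blast
  obtain LB where B: "\<And>m. (\<lambda>k. SB d (joint_fam d p W) m k / real k) \<longlonglongrightarrow> LB"
    using rate_exists[OF tame_SJ_SB(2)[OF d W p] t SJ_SB_periodic(2)[OF d W st per]] by blast
  obtain LJ where J: "\<And>m. (\<lambda>k. SJ d (joint_fam d p W) m k / real k) \<longlonglongrightarrow> LJ"
    using rate_exists[OF tame_SJ_SB(1)[OF d W p] t SJ_SB_periodic(1)[OF d W st per]] by blast
  have "s_source p = LX" unfolding s_source_def using limI[OF X[of 1]] by (simp add: HX_def)
  moreover have "s_output d p W = LB" unfolding s_output_def SB_jf[OF d W p] using limI[OF B[of 1]] .
  moreover have "s_joint d p W = LJ" unfolding s_joint_def SJ_jf[OF d W p] using limI[OF J[of 1]] .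
  ultimately have "mutual_info d p W = LX + LB - LJ" unfolding mutual_info_def by simp
  then show ?thesis using X B J by blast
qed

lemma info_rate:
  assumes t: "t > 0" and per: "periodic t p"
  shows "(\<lambda>k. info p m k / real k) \<longlonglongrightarrow> mutual_info d p W"
proof -
  obtain LX LB LJ where L: "\<And>m. (\<lambda>k. HX p m k / real k) \<longlonglongrightarrow> LX"
    "\<And>m. (\<lambda>k. SB d (joint_fam d p W) m k / real k) \<longlonglongrightarrow> LB"
    "\<And>m. (\<lambda>k. SJ d (joint_fam d p W) m k / real k) \<longlonglongrightarrow> LJ"
    "mutual_info d p W = LX + LB - LJ" using info_rates[OF t per] by blast
  show ?thesis unfolding L(4) info_def add_divide_distrib diff_divide_distrib
    by (intro tendsto_intros L(1-3))
qed

lemma HX_le: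
  fixes p :: "('a seq) measure"
  assumes p: "is_source p"
  shows "HX p n k \<le> real k * log 2 (real CARD('a))"
  using tame_SJ_SB(1)[OF order_refl triv_channel p] unfolding tame_def HX_SJ[OF p]
  by (simp add: mult.commute)

lemma mutual_info_le:
  assumes t: "t > 0" and per: "periodic t p"
  shows "mutual_info d p W \<le> (log 2 (real d) + log 2 (real CARD('a)))"
proof (rule LIMSEQ_le_const2[OF info_rate[OF t per, of 1]])
  have p: "is_source p" using per by (simp add: periodic_def)
  have "info p 1 k / real k \<le> (log 2 (real d) + log 2 (real CARD('a)))" if "k \<ge> 1" for k
  proof -
    have "info p 1 k \<le> real k * (log 2 (real d) + log 2 (real CARD('a)))"
      using HX_le[OF p, of 1 k] SB_le[OF d jf_state_family[OF d W p], of 1 k] SJ_nonneg[OF d jf_state_family[OF d W p], of 1 k]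
      unfolding info_def by (simp add: distrib_left)
    then show ?thesis using that by (simp add: field_simps)
  qed
  then show "\<exists>N. \<forall>n\<ge>N. info p 1 n / real n \<le> (log 2 (real d) + log 2 (real CARD('a)))" by blast
qed

section \<open>Finiteness of the two suprema\<close>

lemma ergodic_periodic: "ergodic_source p \<Longrightarrow> periodic 1 p"
  unfolding ergodic_source_def by (blast intro: stationary_periodic)

lemma bdd_erg: "bdd_above ((\<lambda>p. mutual_info d p W) ` {p. ergodic_source p})"
  using mutual_info_le[of 1, OF _ ergodic_periodic] by (intro bdd_aboveI[of _ "log 2 (real d) + log 2 (real CARD('a))"]) auto

lemma pp_periodic:
  assumes "periodic_product (p :: ('a seq) measure)"
  shows "\<exists>t>0. periodic t p"
  by (rule periodic_productE[OF assms]) (use ppm_periodic in blast)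

lemma bdd_pp: "bdd_above ((\<lambda>p. mutual_info d p W) ` {p. periodic_product p})"
  using mutual_info_le pp_periodic by (intro bdd_aboveI[of _ "log 2 (real d) + log 2 (real CARD('a))"]) blast

lemma mutual_info_le_C_erg: "ergodic_source p \<Longrightarrow> mutual_info d p W \<le> C_erg d W"
  unfolding C_erg_def by (rule cSUP_upper[OF _ bdd_erg]) simp

lemma mutual_info_le_C_pp: "periodic_product p \<Longrightarrow> mutual_info d p W \<le> C_pp d W"
  unfolding C_pp_def by (rule cSUP_upper[OF _ bdd_pp]) simp

section \<open>Periodic products against ergodic sources\<close>

lemma HX_ppm_blocks:
  fixes \<pi> :: "'a list pmf"
  assumes t: "t > 0" and supp: "set_pmf \<pi> \<subseteq> words t"
  shows "HX (ppm t \<pi>) 1 (k * t) = real k * HX (ppm t \<pi>) 1 t"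
proof (induction k)
  case 0
  have "cyl 1 [] = (UNIV :: 'a seq set)" by (auto simp: cyl_def)
  then show ?case
    using prob_space.prob_space[OF source_prob[OF source_ppm[of t \<pi>]]] source_space[OF source_ppm[of t \<pi>]]
    by (simp add: HX_def)
next
  case (Suc k)
  let ?p = "ppm t \<pi>"
  have "HX ?p 1 (k * t + t) = (\<Sum>w\<in>words (k * t). \<Sum>v\<in>words t. measure ?p (cyl 1 w) * eta (pmf \<pi> v) + pmf \<pi> v * eta (measure ?p (cyl 1 w)))"
    unfolding HX_def sum_words_append
    by (intro sum.cong refl) (simp add: ppm_cyl_append[OF t supp] eta_mult)
  also have "\<dots> = (\<Sum>w\<in>words (k * t). measure ?p (cyl 1 w)) * (\<Sum>v\<in>words t. eta (pmf \<pi> v)) + (\<Sum>v\<in>words t. pmf \<pi> v) * HX ?p 1 (k * t)"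
    unfolding HX_def by (simp add: sum.distrib sum_distrib_left[symmetric] sum_distrib_right[symmetric])
  also have "(\<Sum>w\<in>words (k * t). measure ?p (cyl 1 w)) = 1" by (rule sum_measure_cyl[OF source_ppm])
  also have "(\<Sum>v\<in>words t. eta (pmf \<pi> v)) = HX ?p 1 t"
    unfolding HX_def by (intro sum.cong refl) (simp add: ppm_cyl_block[OF t supp])
  also have "(\<Sum>v\<in>words t. pmf \<pi> v) = (\<Sum>v\<in>words t. measure ?p (cyl 1 v))"
    by (intro sum.cong refl) (simp add: ppm_cyl_block[OF t supp])
  also have "\<dots> = 1" by (rule sum_measure_cyl[OF source_ppm])
  finally show ?case using Suc by (simp add: algebra_simps)
qed

text \<open>For independent blocks the source entropy is exactly additive and the gain is
  superadditive, so k blocks carry at least k times the information of the first one; division by k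
  t and the limit give the rate.\<close>

lemma info_block_le:
  fixes \<pi> :: "'a list pmf"
  assumes t: "t > 0" and supp: "set_pmf \<pi> \<subseteq> words t"
  shows "info (ppm t \<pi>) 1 t / real t \<le> mutual_info d (ppm t \<pi>) W"
proof -
  let ?p = "ppm t \<pi>" let ?J = "joint_fam d ?p W"
  note per = ppm_periodic[OF t supp]
  have p: "is_source ?p" by (rule source_ppm)
  note JF = d jf_state_family[OF d W p]
  have perk: "SB d ?J (n + int (i * t)) k = SB d ?J n k \<and> SJ d ?J (n + int (i * t)) k = SJ d ?J n k" for n i k
  proof (induction i)
    case (Suc i)
    have e: "n + int (Suc i * t) = (n + int (i * t)) + int t" by (simp add: algebra_simps)
    show ?case unfolding e SJ_SB_periodic[OF d W st per] by (rule Suc.IH)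
  qed simp
  have "real k * (SB d ?J 1 t - SJ d ?J 1 t) \<le> SB d ?J 1 (k * t) - SJ d ?J 1 (k * t)" for k
  proof (induction k)
    case 0
    have "SJ d ?J 1 0 \<le> 0" using SJ_le[OF JF, of 1 0] by simp
    then show ?case using SB_nonneg[OF JF, of 1 0] by simp
  next
    case (Suc k)
    have "SB d ?J 1 (k * t) + SB d ?J 1 t - SB d ?J 1 (k * t + t) \<le> SJ d ?J 1 (k * t) + SJ d ?J 1 t - SJ d ?J 1 (k * t + t)"
      using gain_superadditive[OF JF, of 1 "k * t" t] perk[of 1 k t] by simp
    moreover have "Suc k * t = k * t + t" by simp
    ultimately show ?case using Suc by (simp add: algebra_simps)
  qed
  then have ge: "real k * info ?p 1 t \<le> info ?p 1 (k * t)" for k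
    unfolding info_def using HX_ppm_blocks[OF t supp, of k] by (simp add: algebra_simps)
  have "filterlim (\<lambda>k. k * t) at_top sequentially"
    using t by (intro filterlim_at_top_mono[OF filterlim_ident]) auto
  from filterlim_compose[OF info_rate[OF t per, of 1] this]
  have "(\<lambda>k. info ?p 1 (k * t) / real (k * t)) \<longlonglongrightarrow> mutual_info d ?p W" .
  moreover have "info ?p 1 t / real t \<le> info ?p 1 (k * t) / real (k * t)" if "k \<ge> 1" for k
    using ge[of k] that t by (simp add: field_simps)
  ultimately show ?thesis by (intro LIMSEQ_le_const) blast+
qed

text \<open>Each entropy rate is the same for all t translates, and passing to their mixture changes
  a block entropy by at most log t beyond averaging.\<close>

lemma mutual_info_avg:
  fixes \<pi> :: "'a list pmf"
  assumes t: "t > 0" and supp: "set_pmf \<pi> \<subseteq> words t"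
  shows "mutual_info d (avg t (ppm t \<pi>)) W = mutual_info d (ppm t \<pi>) W"
proof -
  let ?p = "ppm t \<pi>" let ?q = "avg t ?p"
  have p: "is_source ?p" by (rule source_ppm)
  have q: "is_source ?q" by (rule source_avg[OF t p])
  have hx: "SJ 1 (joint_fam 1 ?p triv) = HX ?p" "SJ 1 (joint_fam 1 ?q triv) = HX ?q"
    using HX_SJ[OF p] HX_SJ[OF q] by (auto intro!: ext)
  obtain LX LB LJ where L: "\<And>m. (\<lambda>k. HX ?p m k / real k) \<longlonglongrightarrow> LX"
    "\<And>m. (\<lambda>k. SB d (joint_fam d ?p W) m k / real k) \<longlonglongrightarrow> LB"
    "\<And>m. (\<lambda>k. SJ d (joint_fam d ?p W) m k / real k) \<longlonglongrightarrow> LJ"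
    "mutual_info d ?p W = LX + LB - LJ" using info_rates[OF t ppm_periodic[OF t supp]] by blast
  obtain LX' LB' LJ' where L': "\<And>m. (\<lambda>k. HX ?q m k / real k) \<longlonglongrightarrow> LX'"
    "\<And>m. (\<lambda>k. SB d (joint_fam d ?q W) m k / real k) \<longlonglongrightarrow> LB'"
    "\<And>m. (\<lambda>k. SJ d (joint_fam d ?q W) m k / real k) \<longlonglongrightarrow> LJ'"
    "mutual_info d ?q W = LX' + LB' - LJ'"
    using info_rates[of 1, OF _ ergodic_periodic[OF ergodic_avg_ppm[OF t supp]]] by auto
  have same: "L = L'" if lim: "\<And>m. (\<lambda>k. S m k / real k) \<longlonglongrightarrow> L" and lim': "(\<lambda>k. S' k / real k) \<longlonglongrightarrow> L'"
    and close: "\<And>k. \<bar>S' k - (\<Sum>s<t. S (1 + int s) k) / real t\<bar> \<le> log 2 (real t)"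
    for S :: "int \<Rightarrow> nat \<Rightarrow> real" and S' L L'
  proof -
    have "(\<lambda>k. (\<Sum>s<t. S (1 + int s) k / real k) / real t) \<longlonglongrightarrow> (\<Sum>s<t. L) / real t"
      by (intro tendsto_divide tendsto_sum lim tendsto_const) (use t in simp)
    moreover have "(\<lambda>k. (\<Sum>s<t. S (1 + int s) k / real k) / real t) = (\<lambda>k. ((\<Sum>s<t. S (1 + int s) k) / real t) / real k)"
      by (simp add: sum_divide_distrib[symmetric] mult.commute)
    ultimately have "(\<lambda>k. ((\<Sum>s<t. S (1 + int s) k) / real t) / real k) \<longlonglongrightarrow> L" using t by simp
    from tendsto_bounded_diff[OF this close] show ?thesis using lim' LIMSEQ_unique by blast
  qed
  have "LX = LX'"
    by (rule same[OF L(1) L'(1)[of 1]]) (rule SJ_SB_avg(1)[OF order_refl triv_channel triv_stationary p t, of 1, unfolded hx])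
  moreover have "LB = LB'" by (rule same[OF L(2) L'(2)[of 1]]) (rule SJ_SB_avg(2)[OF d W st p t])
  moreover have "LJ = LJ'" by (rule same[OF L(3) L'(3)[of 1]]) (rule SJ_SB_avg(1)[OF d W st p t])
  ultimately show ?thesis using L(4) L'(4) by simp
qed

lemma C_pp_le_C_erg: "C_pp d W \<le> C_erg d W"
  unfolding C_pp_def
proof (rule cSUP_least)
  \<comment> \<open>The constant source shows that the supremum runs over a nonempty set.\<close>
  have "periodic_product (ppm 1 (return_pmf [undefined :: 'a]))"
    by (rule periodic_product_ppm) (auto simp: words_def)
  then show "{p :: ('a seq) measure. periodic_product p} \<noteq> {}" by blast
  fix p :: "('a seq) measure" assume "p \<in> {p. periodic_product p}"
  then have pp: "periodic_product p" by simp
  obtain t \<pi> where *: "t > 0" "set_pmf \<pi> \<subseteq> words t" "p = ppm t \<pi>" by (rule periodic_productE[OF pp])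
  show "mutual_info d p W \<le> C_erg d W"
    using mutual_info_le_C_erg[OF ergodic_avg_ppm[OF *(1,2)]] mutual_info_avg[OF *(1,2)] *(3) by simp
qed

end

section \<open>Decoding and the weak converse\<close>

lemma trp_scale_left: "trp I (\<lambda>x y. complex_of_real c * A x y) B = c * trp I A B"
  and trp_scale_right: "trp I A (\<lambda>x y. complex_of_real c * B x y) = c * trp I A B"
  unfolding trp_def by (simp_all add: sum_distrib_left algebra_simps)

lemma trp_sum_left: "trp I (\<lambda>x y. \<Sum>s\<in>S. A s x y) B = (\<Sum>s\<in>S. trp I (A s) B)"
proof -
  have "(\<Sum>x\<in>I. \<Sum>y\<in>I. (\<Sum>s\<in>S. A s x y) * B y x) = (\<Sum>x\<in>I. \<Sum>s\<in>S. \<Sum>y\<in>I. A s x y * B y x)"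
    unfolding sum_distrib_right by (intro sum.cong refl sum.swap)
  also have "\<dots> = (\<Sum>s\<in>S. \<Sum>x\<in>I. \<Sum>y\<in>I. A s x y * B y x)" by (rule sum.swap)
  finally show ?thesis unfolding trp_def by simp
qed

lemma trp_sum_right: "trp I A (\<lambda>x y. \<Sum>s\<in>S. B s x y) = (\<Sum>s\<in>S. trp I A (B s))"
proof -
  have "(\<Sum>x\<in>I. \<Sum>y\<in>I. A x y * (\<Sum>s\<in>S. B s y x)) = (\<Sum>x\<in>I. \<Sum>s\<in>S. \<Sum>y\<in>I. A x y * B s y x)"
    unfolding sum_distrib_left by (intro sum.cong refl sum.swap)
  also have "\<dots> = (\<Sum>s\<in>S. \<Sum>x\<in>I. \<Sum>y\<in>I. A x y * B s y x)" by (rule sum.swap)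
  finally show ?thesis unfolding trp_def by simp
qed

lemma trp_cong: "(\<And>x y. x \<in> I \<Longrightarrow> y \<in> I \<Longrightarrow> A x y = A' x y) \<Longrightarrow> (\<And>x y. x \<in> I \<Longrightarrow> y \<in> I \<Longrightarrow> B x y = B' x y) \<Longrightarrow>
  trp I A B = trp I A' B'"
  unfolding trp_def by (intro arg_cong[where f = Re] sum.cong refl) auto

lemma trp_one: "finite I \<Longrightarrow> trp I A (\<lambda>x y. if x = y then 1 else 0) = tr_on I A"
  unfolding trp_def tr_on_def by (simp add: mult_delta_right)

lemma trp_diff_right: "trp I A (\<lambda>x y. B x y - C x y) = trp I A B - trp I A C"
  unfolding trp_def by (simp add: right_diff_distrib sum_subtractf)

lemma trp_effect:
  assumes fin: "finite I" and A: "psd_on I A" and T: "effect_on I T"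
  shows "0 \<le> trp I A T" "trp I A T \<le> tr_on I A"
proof -
  have "psd_on I T" "psd_on I (\<lambda>x y. (if x = y then 1 else 0) - T x y)" using T by (auto simp: effect_on_def)
  from trp_nonneg[OF fin A this(1)] trp_nonneg[OF fin A this(2)]
  show "0 \<le> trp I A T" "trp I A T \<le> tr_on I A" unfolding trp_diff_right trp_one[OF fin] by simp_all
qed

text \<open>A form of Fano's inequality.\<close>
lemma test_information:
  fixes J :: "'w \<Rightarrow> 'i \<Rightarrow> 'i \<Rightarrow> complex"
  assumes fin: "finite \<Omega>" "finite I" and J: "\<And>w. w \<in> \<Omega> \<Longrightarrow> psd_on I (J w)"
    and tr: "(\<Sum>w\<in>\<Omega>. tr_on I (J w)) = 1" and T: "\<And>w. w \<in> \<Omega> \<Longrightarrow> effect_on I (T w)" and M: "1 \<le> M"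
  defines "P \<equiv> \<lambda>x y. \<Sum>w\<in>\<Omega>. J w x y"
  assumes q: "(\<Sum>w\<in>\<Omega>. tr_on I (J w) * trp I P (T w)) \<le> 1 / M"
  shows "(\<Sum>w\<in>\<Omega>. trp I (J w) (T w)) * log 2 M - 1 \<le> (\<Sum>w\<in>\<Omega>. eta (tr_on I (J w))) + ent I P - (\<Sum>w\<in>\<Omega>. ent I (J w))"
proof -
  have pP: "psd_on I P" unfolding P_def by (intro psd_on_sum J)
  have trP: "tr_on I P = 1" unfolding P_def tr_on_sum by (rule tr)
  obtain f m where f: "spec I P f m" "\<And>k. k \<in> I \<Longrightarrow> 0 \<le> m k" "ent I P = (\<Sum>k\<in>I. eta (m k))"
    using psd_spec[OF fin(2) pP] by metis
  note of = specD(1)[OF f(1)]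
  define \<pi> where "\<pi> = (\<lambda>w. tr_on I (J w))"
  have \<pi>0: "0 \<le> \<pi> w" if "w \<in> \<Omega>" for w unfolding \<pi>_def by (rule tr_on_psd_nonneg[OF fin(2) J[OF that]])
  \<comment> \<open>The product of the classical and the quantum marginal, written as a labelled
    family; it is the reference against which J is tested.\<close>
  define S where "S = (\<lambda>w x y. complex_of_real (\<pi> w) * P x y)"
  have S: "psd_on I (S w)" if "w \<in> \<Omega>" for w unfolding S_def by (rule psd_on_scale[OF pP \<pi>0[OF that]])
  have specS: "spec I (S w) f (\<lambda>k. \<pi> w * m k)" for w unfolding S_def by (rule spec_scale[OF f(1)])
  have trS: "tr_on I (S w) = \<pi> w" for w unfolding S_def tr_on_scale trP by simp
  define qv where "qv = (\<lambda>w j. Re (qf I (J w) (f j) (f j)))"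
  have q0: "0 \<le> qv w j" if "w \<in> \<Omega>" for w j unfolding qv_def by (rule qf_psd_nonneg[OF J[OF that]])
  have qw: "(\<Sum>j\<in>I. qv w j) = \<pi> w" for w unfolding qv_def \<pi>_def by (rule onb_trace[OF fin(2) of])
  have qj: "(\<Sum>w\<in>\<Omega>. qv w j) = m j" if "j \<in> I" for j
    using spec_qf_basis[OF fin(2) f(1) that that] unfolding P_def qf_sum qv_def by (metis Re_complex_of_real Re_sum)
  have supp: "qv w j = 0" if "w \<in> \<Omega>" "j \<in> I" "\<pi> w * m j = 0" for w j
  proof -
    have "(\<Sum>j\<in>I. qv w j) = 0 \<or> (\<Sum>w\<in>\<Omega>. qv w j) = 0" using that qw qj by auto
    then show ?thesis using that q0 fin by (auto simp: sum_nonneg_eq_0_iff)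
  qed
  have int1: "((\<lambda>u. (1 - u) * Qu I (J w) (S w) u) has_integral
      (- ln 2 * ent I (J w) - (\<Sum>j\<in>I. qv w j * ln (\<pi> w * m j)))) {0<..<1}" if w: "w \<in> \<Omega>" for w
    using rel_entropy_integral[OF fin(2) J[OF w] S[OF w] specS[of w]] supp[OF w]
    unfolding trS qv_def[symmetric] by (simp add: \<pi>_def qv_def)
  have int2: "((\<lambda>u. \<Sum>w\<in>\<Omega>. (1 - u) * Qu I (J w) (S w) u) has_integral
      (\<Sum>w\<in>\<Omega>. - ln 2 * ent I (J w) - (\<Sum>j\<in>I. qv w j * ln (\<pi> w * m j)))) {0<..<1}"
    by (intro has_integral_sum fin int1)
  have lg: "(\<Sum>j\<in>I. qv w j * ln (\<pi> w * m j)) = \<pi> w * ln (\<pi> w) + (\<Sum>j\<in>I. qv w j * ln (m j))" if w: "w \<in> \<Omega>" for w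
  proof -
    have "(\<Sum>j\<in>I. qv w j * ln (\<pi> w * m j)) = (\<Sum>j\<in>I. qv w j * ln (\<pi> w) + qv w j * ln (m j))"
    proof (intro sum.cong refl)
      fix j assume j: "j \<in> I"
      show "qv w j * ln (\<pi> w * m j) = qv w j * ln (\<pi> w) + qv w j * ln (m j)"
      proof (cases "\<pi> w * m j = 0")
        case False
        then have "0 < \<pi> w" "0 < m j" using \<pi>0[OF w] f(2)[OF j] by (auto simp: less_le)
        then show ?thesis by (simp add: ln_mult distrib_left)
      qed (use supp[OF w j] in simp)
    qed
    then show ?thesis by (simp add: sum.distrib sum_distrib_right[symmetric] qw)
  qed
  have "(\<Sum>w\<in>\<Omega>. - ln 2 * ent I (J w) - (\<Sum>j\<in>I. qv w j * ln (\<pi> w * m j))) =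
     (\<Sum>w\<in>\<Omega>. - ln 2 * ent I (J w) + ln 2 * eta (\<pi> w) - (\<Sum>j\<in>I. qv w j * ln (m j)))"
    by (intro sum.cong refl) (simp add: lg eta_ln[OF \<pi>0])
  also have "\<dots> = ln 2 * ((\<Sum>w\<in>\<Omega>. eta (\<pi> w)) - (\<Sum>w\<in>\<Omega>. ent I (J w))) - (\<Sum>w\<in>\<Omega>. \<Sum>j\<in>I. qv w j * ln (m j))"
    by (simp add: sum.distrib sum_subtractf sum_distrib_left right_diff_distrib sum_negf)
  also have "(\<Sum>w\<in>\<Omega>. \<Sum>j\<in>I. qv w j * ln (m j)) = (\<Sum>j\<in>I. \<Sum>w\<in>\<Omega>. qv w j * ln (m j))" by (rule sum.swap)
  also have "\<dots> = (\<Sum>j\<in>I. m j * ln (m j))"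
    unfolding sum_distrib_right[symmetric] by (intro sum.cong refl) (simp add: qj)
  also have "\<dots> = - ln 2 * ent I P"
    unfolding f(3) sum_distrib_left by (intro sum.cong refl) (use eta_ln[OF f(2)] in simp)
  finally have val: "(\<Sum>w\<in>\<Omega>. - ln 2 * ent I (J w) - (\<Sum>j\<in>I. qv w j * ln (\<pi> w * m j))) =
     ln 2 * ((\<Sum>w\<in>\<Omega>. eta (\<pi> w)) + ent I P - (\<Sum>w\<in>\<Omega>. ent I (J w)))" by (simp add: algebra_simps)
  have int: "((\<lambda>u. (1 - u) * (\<Sum>w\<in>\<Omega>. Qu I (J w) (S w) u)) has_integral
     ln 2 * ((\<Sum>w\<in>\<Omega>. eta (\<pi> w)) + ent I P - (\<Sum>w\<in>\<Omega>. ent I (J w)))) {0<..<1}"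
    using int2 unfolding val sum_distrib_left[symmetric] .
  define p where "p = (\<Sum>w\<in>\<Omega>. trp I (J w) (T w))"
  define q' where "q' = (\<Sum>w\<in>\<Omega>. trp I (S w) (T w))"
  have q': "q' = (\<Sum>w\<in>\<Omega>. \<pi> w * trp I P (T w))" unfolding q'_def S_def trp_scale_left ..
  note rng = trp_effect[OF fin(2)]
  have PJ: "trp I P B = (\<Sum>w\<in>\<Omega>. trp I (J w) B)" for B unfolding P_def by (rule trp_sum_left)
  \<comment> \<open>Each J w is a summand of P, so an outcome that is impossible under the product
    reference is impossible under the joint state. \<open>abs1\<close> treats the complementary
    outcome.\<close>
  have abs0: "trp I (J w) (T w) = 0" if "q' = 0" and w: "w \<in> \<Omega>" for w
  proof -
    have "\<pi> w * trp I P (T w) = 0"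
      using that(1) w unfolding q' using \<pi>0 rng(1)[OF pP T] fin(1) by (subst (asm) sum_nonneg_eq_0_iff) auto
    then have "\<pi> w = 0 \<or> (\<Sum>w'\<in>\<Omega>. trp I (J w') (T w)) = 0" unfolding PJ by simp
    then show ?thesis
    proof
      assume "\<pi> w = 0" then show ?thesis using rng[OF J[OF w] T[OF w]] by (simp add: \<pi>_def)
    next
      assume "(\<Sum>w'\<in>\<Omega>. trp I (J w') (T w)) = 0"
      then show ?thesis using w fin(1) rng(1)[OF J T[OF w]] by (subst (asm) sum_nonneg_eq_0_iff) auto
    qed
  qed
  have abs1: "trp I (J w) (T w) = \<pi> w" if "q' = 1" and w: "w \<in> \<Omega>" for w
  proof -
    have "(\<Sum>w\<in>\<Omega>. \<pi> w * (1 - trp I P (T w))) = 0"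
      using that(1) tr unfolding q' \<pi>_def by (simp add: right_diff_distrib sum_subtractf)
    then have "\<pi> w * (1 - trp I P (T w)) = 0"
      using w \<pi>0 rng(2)[OF pP T] fin(1) trP by (subst (asm) sum_nonneg_eq_0_iff) auto
    then have "\<pi> w = 0 \<or> (\<Sum>w'\<in>\<Omega>. \<pi> w' - trp I (J w') (T w)) = 0"
      unfolding PJ using tr by (simp add: \<pi>_def sum_subtractf)
    then show ?thesis
    proof
      assume "\<pi> w = 0" then show ?thesis using rng[OF J[OF w] T[OF w]] by (simp add: \<pi>_def)
    next
      assume "(\<Sum>w'\<in>\<Omega>. \<pi> w' - trp I (J w') (T w)) = 0"
      then have "\<pi> w - trp I (J w) (T w) = 0"
        using w fin(1) rng(2)[OF J T[OF w]] by (subst (asm) sum_nonneg_eq_0_iff) (auto simp: \<pi>_def)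
      then show ?thesis by simp
    qed
  qed
  have "p * ln M - ln 2 \<le> ln 2 * ((\<Sum>w\<in>\<Omega>. eta (\<pi> w)) + ent I P - (\<Sum>w\<in>\<Omega>. ent I (J w)))"
  proof (rule test_integral_bound[OF fin(2) J S T tr _ p_def q'_def int M])
    show "(\<Sum>w\<in>\<Omega>. tr_on I (S w)) = 1" unfolding trS \<pi>_def by (rule tr)
    show "q' \<le> 1 / M" using q unfolding q' \<pi>_def .
    show "p = 0" if "q' = 0" unfolding p_def using abs0[OF that] by simp
    show "p = 1" if "q' = 1" unfolding p_def using abs1[OF that] tr by (simp add: \<pi>_def)
  qed
  then have "(p * ln M - ln 2) / ln 2 \<le> (\<Sum>w\<in>\<Omega>. eta (\<pi> w)) + ent I P - (\<Sum>w\<in>\<Omega>. ent I (J w))"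
    by (simp add: field_simps)
  then show ?thesis unfolding p_def \<pi>_def by (simp add: log_def diff_divide_distrib)
qed

lemma mtrace_mult:
  assumes "A \<in> carrier_mat n n" "B \<in> carrier_mat n n"
  shows "Re (mtrace (A * B)) = trp {..<n} (\<lambda>i j. A $$ (i, j)) (\<lambda>i j. B $$ (i, j))"
proof -
  have "mtrace (A * B) = (\<Sum>i<n. \<Sum>j<n. A $$ (i, j) * B $$ (j, i))"
    using assms unfolding mtrace_def by (intro sum.cong) (auto simp: scalar_prod_def atLeast0LessThan)
  then show ?thesis unfolding trp_def by simp
qed

lemma jf_trp:
  fixes W :: "('a::finite) seq \<Rightarrow> int \<Rightarrow> nat \<Rightarrow> complex mat"
  assumes d: "d \<ge> 1" and W: "cq_channel d W" and p: "is_source p"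
  shows "trp {..<d ^ k} (ents (joint_fam d p W) n k w) B = (LINT x|p. indicator (cyl n w) x * trp {..<d ^ k} (\<lambda>i j. W x n k $$ (i, j)) B)"
    and "integrable p (\<lambda>x. indicator (cyl n w) x * trp {..<d ^ k} (\<lambda>i j. W x n k $$ (i, j)) B)"
proof -
  let ?f = "\<lambda>x. \<Sum>i<d ^ k. \<Sum>j<d ^ k. B j i * W x n k $$ (i, j)"
  note jf = jf_functional[OF d W p, where c = "\<lambda>i j. B j i" and n = n and k = k and w = w]
  have t: "trp {..<d ^ k} A B = Re (\<Sum>i<d ^ k. \<Sum>j<d ^ k. B j i * A i j)" for A
    unfolding trp_def by (simp add: mult.commute)
  have r: "indicator (cyl n w) x * trp {..<d ^ k} (\<lambda>i j. W x n k $$ (i, j)) B = Re (indicator (cyl n w) x * ?f x)" for x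
    unfolding t by (simp add: indicator_def)
  show "integrable p (\<lambda>x. indicator (cyl n w) x * trp {..<d ^ k} (\<lambda>i j. W x n k $$ (i, j)) B)"
    unfolding r by (rule integrable_Re[OF jf(2)])
  show "trp {..<d ^ k} (ents (joint_fam d p W) n k w) B = (LINT x|p. indicator (cyl n w) x * trp {..<d ^ k} (\<lambda>i j. W x n k $$ (i, j)) B)"
    unfolding r unfolding t jf(1) by (rule integral_Re[OF jf(2), symmetric])
qed

lemma psd_on_one:
  assumes "finite I"
  shows "psd_on I (\<lambda>x y. if x = y then 1 else 0)"
proof -
  have "qf I (\<lambda>x y. if x = y then 1 else 0) v v = ip I v v" for v
    unfolding qf_def ip_def using assms
    by (intro sum.cong refl) (simp add: mult_delta_left mult_delta_right)
  then show ?thesis unfolding psd_on_def ip_same by (simp add: sum_nonneg)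
qed

section \<open>Codes as tests on the joint state\<close>

context
  fixes d :: nat and W :: "('a::finite) seq \<Rightarrow> int \<Rightarrow> nat \<Rightarrow> complex mat"
  assumes d: "d \<ge> 1" and W: "cq_channel d W" and st: "stationary_channel W"
begin

lemma code_effect:
  assumes code: "is_code d n M u b" and i: "i < M"
  shows "effect_on {..<d ^ n} (\<lambda>x y. b i $$ (x, y))"
    and "psd_on {..<d ^ n} (\<lambda>x y. (if x = y then 1 else 0) - (\<Sum>i<M. b i $$ (x, y)))"
proof -
  let ?I = "{..<d ^ n}"
  have c: "b i \<in> carrier_mat (d ^ n) (d ^ n)" "psd (b i)" if "i < M" for i
    using code that unfolding is_code_def by auto
  have p: "psd_on ?I (\<lambda>x y. b i $$ (x, y))" if "i < M" for i
    using c[OF that] psd_iff_psd_on by blast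
  have cm: "1\<^sub>m (d ^ n) - msum (d ^ n) b {..<M} \<in> carrier_mat (d ^ n) (d ^ n)"
    by (intro minus_carrier_mat) (simp add: msum_def)
  have "psd_on ?I (\<lambda>x y. (1\<^sub>m (d ^ n) - msum (d ^ n) b {..<M}) $$ (x, y))"
    using code psd_iff_psd_on[OF cm] unfolding is_code_def by simp
  also have "psd_on ?I (\<lambda>x y. (1\<^sub>m (d ^ n) - msum (d ^ n) b {..<M}) $$ (x, y)) =
     psd_on ?I (\<lambda>x y. (if x = y then 1 else 0) - (\<Sum>i<M. b i $$ (x, y)))"
    by (rule psd_on_cong) (simp add: msum_def)
  finally show s: "psd_on ?I (\<lambda>x y. (if x = y then 1 else 0) - (\<Sum>i<M. b i $$ (x, y)))" .
  \<comment> \<open>Adding the other decoding operators back to the slack of the code leaves 1 - b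
    i.\<close>
  have "psd_on ?I (\<lambda>x y. ((if x = y then 1 else 0) - (\<Sum>i<M. b i $$ (x, y))) + (\<Sum>j\<in>{..<M} - {i}. b j $$ (x, y)))"
    using p by (intro psd_on_add s psd_on_sum) auto
  moreover have "((if x = y then 1 else 0) - (\<Sum>i<M. b i $$ (x, y))) + (\<Sum>j\<in>{..<M} - {i}. b j $$ (x, y)) = (if x = y then 1 else 0) - b i $$ (x, y)" for x y
    using i by (simp add: sum.remove[of "{..<M}" i])
  ultimately show "effect_on ?I (\<lambda>x y. b i $$ (x, y))" unfolding effect_on_def using p[OF i] by simp
qed

text \<open>Several messages may share a code word, and the test for that word averages their
  decoding operators. For a word without a message the average is the zero effect.\<close>

lemma effect_average:
  assumes fin: "finite I" and K: "finite K" and B: "\<And>i. i \<in> K \<Longrightarrow> effect_on I (B i)"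
  shows "effect_on I (\<lambda>x y. complex_of_real (1 / real (card K)) * (\<Sum>i\<in>K. B i x y))"
  unfolding effect_on_def
proof
  show "psd_on I (\<lambda>x y. complex_of_real (1 / real (card K)) * (\<Sum>i\<in>K. B i x y))"
    using B by (intro psd_on_scale psd_on_sum) (auto simp: effect_on_def)
  show "psd_on I (\<lambda>x y. (if x = y then 1 else 0) - complex_of_real (1 / real (card K)) * (\<Sum>i\<in>K. B i x y))"
  proof (cases "K = {}")
    case True
    then show ?thesis using psd_on_one[OF fin] by simp
  next
    case False
    then have c: "real (card K) \<noteq> 0" using K by simp
    have "psd_on I (\<lambda>x y. complex_of_real (1 / real (card K)) * (\<Sum>i\<in>K. (if x = y then 1 else 0) - B i x y))"
      using B by (intro psd_on_scale psd_on_sum) (auto simp: effect_on_def)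
    moreover have "complex_of_real (1 / real (card K)) * (\<Sum>i\<in>K. (if x = y then 1 else 0) - B i x y) =
      (if x = y then 1 else 0) - complex_of_real (1 / real (card K)) * (\<Sum>i\<in>K. B i x y)" for x y
      using c by (simp add: sum_subtractf right_diff_distrib)
    ultimately show ?thesis by simp
  qed
qed

lemma code_error:
  assumes code: "is_code d n M u b" and i: "i < M"
  defines "e \<equiv> (SUP x\<in>cyl 1 (u i). 1 - Re (mtrace (W x 1 n * b i)))"
  shows "x \<in> cyl 1 (u i) \<Longrightarrow> 1 - e \<le> trp {..<d ^ n} (\<lambda>j k. W x 1 n $$ (j, k)) (\<lambda>j k. b i $$ (j, k))"
    and "e \<le> 1"
proof -
  have c: "b i \<in> carrier_mat (d ^ n) (d ^ n)" using code i unfolding is_code_def by auto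
  have m: "Re (mtrace (W x 1 n * b i)) = trp {..<d ^ n} (\<lambda>j k. W x 1 n $$ (j, k)) (\<lambda>j k. b i $$ (j, k))" for x
    by (rule mtrace_mult[OF channel_carrier[OF d W] c])
  have t0: "0 \<le> trp {..<d ^ n} (\<lambda>j k. W x 1 n $$ (j, k)) (\<lambda>j k. b i $$ (j, k))" for x
    by (rule trp_effect(1)[OF finite_lessThan channel_psd[OF d W] code_effect(1)[OF code i]])
  \<comment> \<open>The code word, continued arbitrarily outside its sites, lies in its cylinder;
    the supremum is therefore over a nonempty set.\<close>
  have "(\<lambda>k. u i ! nat (k - 1)) \<in> cyl 1 (u i)" by (simp add: cyl_def)
  then have ne: "cyl 1 (u i) \<noteq> {}" by blast
  show "e \<le> 1" unfolding e_def m by (rule cSUP_least[OF ne]) (simp add: t0)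
  have "bdd_above ((\<lambda>x. 1 - Re (mtrace (W x 1 n * b i))) ` cyl 1 (u i))"
    unfolding m by (intro bdd_aboveI[of _ 1]) (auto simp: t0)
  then show "x \<in> cyl 1 (u i) \<Longrightarrow> 1 - e \<le> trp {..<d ^ n} (\<lambda>j k. W x 1 n $$ (j, k)) (\<lambda>j k. b i $$ (j, k))"
    using cSUP_upper[of x "cyl 1 (u i)" "\<lambda>x. 1 - Re (mtrace (W x 1 n * b i))"] unfolding e_def m by simp
qed

text \<open>For a uniform message, the test that compares the decoded word with the sent one
  succeeds with probability at least 1 - error under the joint state, but at most 1 / M under the
  product of its marginals, because the b i sum to at most 1. \<open>test_information\<close> turns
  this into a lower bound on the block information, and \<open>info_block_le\<close> bounds that
  information by n times a rate below \<open>C_pp\<close>.\<close>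

lemma code_converse:
  assumes n: "n \<ge> 1" and M: "M \<ge> 1" and code: "is_code d n M u b"
  shows "(1 - avg_error d W n M u b) * log 2 (real M) - 1 \<le> real n * C_pp d W"
proof -
  let ?I = "{..<d ^ n}"
  define \<pi> where "\<pi> = map_pmf u (pmf_of_set {..<M})"
  define p where "p = ppm n \<pi>"
  \<comment> \<open>The messages with code word w; u need not be injective.\<close>
  define cl where "cl = (\<lambda>w. {i. i < M \<and> u i = w})"
  have "0 \<in> {..<M}" using M by simp
  then have ne: "{..<M} \<noteq> {}" "finite {..<M}" by blast+
  have uw: "u i \<in> words n" if "i < M" for i using code that unfolding is_code_def words_def by simp
  have supp: "set_pmf \<pi> \<subseteq> words n" unfolding \<pi>_def using ne uw by (auto simp: set_pmf_of_set)
  have n0: "n > 0" using n by simp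
  have p: "is_source p" unfolding p_def by (rule source_ppm)
  have fcl: "finite (cl w)" for w unfolding cl_def by simp
  have pi: "measure p (cyl 1 w) = real (card (cl w)) / real M" if "w \<in> words n" for w
  proof -
    have "pmf \<pi> w = measure (pmf_of_set {..<M}) (u -` {w})" unfolding \<pi>_def by (rule pmf_map)
    also have "\<dots> = real (card ({..<M} \<inter> u -` {w})) / real (card {..<M})" by (rule measure_pmf_of_set[OF ne])
    also have "{..<M} \<inter> u -` {w} = cl w" unfolding cl_def by auto
    finally show ?thesis using ppm_cyl_block[OF n0 supp that] by (simp add: p_def)
  qed
  define B where "B = (\<lambda>i x y. b i $$ (x, y))"
  define T where "T = (\<lambda>w x y. complex_of_real (1 / real (card (cl w))) * (\<Sum>i\<in>cl w. B i x y))"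
  define J where "J = (\<lambda>w. ents (joint_fam d p W) 1 n w)"
  define P where "P = out (joint_fam d p W) 1 n"
  define e where "e = (\<lambda>i. SUP x\<in>cyl 1 (u i). 1 - Re (mtrace (W x 1 n * b i)))"
  have J: "psd_on ?I (J w)" for w unfolding J_def by (rule jf_psd[OF d W p])
  have trJ: "tr_on ?I (J w) = measure p (cyl 1 w)" for w unfolding J_def by (rule jf_tr_on[OF d W p])
  have P: "psd_on ?I P" "tr_on ?I P = 1"
    unfolding P_def by (rule out_psd[OF d jf_state_family[OF d W p]], rule out_trace[OF d jf_state_family[OF d W p]])
  have eB: "effect_on ?I (B i)" if "i < M" for i unfolding B_def by (rule code_effect(1)[OF code that])
  have eT: "effect_on ?I (T w)" for w
    unfolding T_def by (rule effect_average[OF finite_lessThan fcl]) (auto simp: cl_def intro: eB)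
  have group: "(\<Sum>w\<in>words n. \<Sum>i\<in>cl w. h i) = (\<Sum>i<M. h i)" for h :: "nat \<Rightarrow> real"
    using sum.group[of "{..<M}" "words n" u h] uw by (simp add: cl_def image_subset_iff)
  have trpT: "trp ?I A (T w) = 1 / real (card (cl w)) * (\<Sum>i\<in>cl w. trp ?I A (B i))" for A w
    unfolding T_def trp_scale_right trp_sum_right ..
  have q: "(\<Sum>w\<in>words n. tr_on ?I (J w) * trp ?I P (T w)) \<le> 1 / real M"
  proof -
    have "tr_on ?I (J w) * trp ?I P (T w) = (\<Sum>i\<in>cl w. trp ?I P (B i)) / real M" if w: "w \<in> words n" for w
      unfolding trJ pi[OF w] trpT using fcl[of w] by (cases "cl w = {}") (auto simp: card_eq_0_iff)
    then have "(\<Sum>w\<in>words n. tr_on ?I (J w) * trp ?I P (T w)) = (\<Sum>i<M. trp ?I P (B i)) / real M"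
      by (simp add: sum_divide_distrib[symmetric] group)
    also have "(\<Sum>i<M. trp ?I P (B i)) = trp ?I P (\<lambda>x y. \<Sum>i<M. B i x y)" by (rule trp_sum_right[symmetric])
    also have "\<dots> \<le> 1"
      using trp_nonneg[OF finite_lessThan P(1) code_effect(2)[OF code]] M P(2)
      unfolding trp_diff_right trp_one[OF finite_lessThan] B_def by (simp add: Suc_le_eq)
    finally show ?thesis by (simp add: divide_right_mono)
  qed
  have trJB: "(1 - e i) * measure p (cyl 1 w) \<le> trp ?I (J w) (B i)" if "i \<in> cl w" for i w
  proof -
    have i: "i < M" "u i = w" using that by (auto simp: cl_def)
    interpret PS: prob_space p by (rule source_prob[OF p])
    have "(1 - e i) * measure p (cyl 1 w) = (LINT x|p. (1 - e i) * indicator (cyl 1 w) x)"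
      by (simp add: source_space[OF p])
    also have "\<dots> \<le> (LINT x|p. indicator (cyl 1 w) x * trp ?I (\<lambda>j k. W x 1 n $$ (j, k)) (B i))"
    proof (rule integral_mono[OF _ jf_trp(2)[OF d W p]])
      show "integrable p (\<lambda>x. (1 - e i) * indicator (cyl 1 w) x)"
        by (intro integrable_mult_right) (auto simp: source_sets[OF p] PS.emeasure_eq_measure)
      show "(1 - e i) * indicator (cyl 1 w) x \<le> indicator (cyl 1 w) x * trp ?I (\<lambda>j k. W x 1 n $$ (j, k)) (B i)" for x
        using code_error(1)[OF code i(1), of x] i(2) unfolding e_def B_def by (simp add: indicator_def)
    qed
    also have "\<dots> = trp ?I (J w) (B i)" unfolding J_def by (rule jf_trp(1)[OF d W p, symmetric])
    finally show ?thesis .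
  qed
  have ae: "1 - avg_error d W n M u b = (\<Sum>i<M. 1 - e i) / real M"
    unfolding avg_error_def e_def using M by (simp add: sum_subtractf diff_divide_distrib)
  also have "\<dots> = (\<Sum>w\<in>words n. (\<Sum>i\<in>cl w. 1 - e i) / real M)"
    unfolding sum_divide_distrib[symmetric] group ..
  also have "\<dots> \<le> (\<Sum>w\<in>words n. trp ?I (J w) (T w))"
  proof (rule sum_mono)
    fix w :: "'a list" assume w: "w \<in> words n"
    show "(\<Sum>i\<in>cl w. 1 - e i) / real M \<le> trp ?I (J w) (T w)"
    proof (cases "cl w = {}")
      case True
      then show ?thesis by (simp add: trpT)
    next
      case False
      then have c: "real (card (cl w)) > 0" using fcl[of w] by (simp add: card_gt_0_iff)
      have "(\<Sum>i\<in>cl w. 1 - e i) / real M = 1 / real (card (cl w)) * (\<Sum>i\<in>cl w. (1 - e i) * measure p (cyl 1 w))"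
        unfolding pi[OF w] sum_distrib_right[symmetric] using c by simp
      also have "\<dots> \<le> 1 / real (card (cl w)) * (\<Sum>i\<in>cl w. trp ?I (J w) (B i))"
        using c by (intro mult_left_mono sum_mono trJB) auto
      finally show ?thesis unfolding trpT .
    qed
  qed
  finally have "(1 - avg_error d W n M u b) * log 2 (real M) \<le> (\<Sum>w\<in>words n. trp ?I (J w) (T w)) * log 2 (real M)"
    using M by (intro mult_right_mono) auto
  also have "\<dots> - 1 \<le> (\<Sum>w\<in>words n. eta (tr_on ?I (J w))) + ent ?I (\<lambda>x y. \<Sum>w\<in>words n. J w x y) - (\<Sum>w\<in>words n. ent ?I (J w))"
  proof (rule test_information[OF finite_words finite_lessThan J _ eT])
    show "(\<Sum>w\<in>words n. tr_on ?I (J w)) = 1" unfolding trJ by (rule sum_measure_cyl[OF p])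
    show "1 \<le> real M" using M by simp
    show "(\<Sum>w\<in>words n. tr_on ?I (J w) * trp ?I (\<lambda>x y. \<Sum>w\<in>words n. J w x y) (T w)) \<le> 1 / real M"
      using q unfolding P_def out_def J_def .
  qed
  also have "\<dots> = info d W p 1 n"
    unfolding info_def[OF d W st] HX_def SB_def SJ_def out_def trJ unfolding J_def ..
  finally have "(1 - avg_error d W n M u b) * log 2 (real M) - 1 \<le> info d W p 1 n" by simp
  also have "\<dots> \<le> real n * mutual_info d p W"
    using info_block_le[OF d W st n0 supp] n0 unfolding p_def by (simp add: field_simps)
  also have "\<dots> \<le> real n * C_pp d W"
    using mutual_info_le_C_pp[OF d W st periodic_product_ppm[OF n0 supp]] unfolding p_def by (intro mult_left_mono) auto
  finally show ?thesis .
qed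

text \<open>A code with a single message has log M = 0, so the converse gives -1 \<le> n C_pp for
  every n.\<close>

lemma C_pp_nonneg: "0 \<le> C_pp d W"
proof -
  have code: "is_code d n 1 (\<lambda>_. replicate n (undefined :: 'a)) (\<lambda>_. 1\<^sub>m (d ^ n))" for n
  proof -
    have "psd_on {..<d ^ n} (\<lambda>i j. 1\<^sub>m (d ^ n) $$ (i, j))" "psd_on {..<d ^ n} (\<lambda>i j. (1\<^sub>m (d ^ n) - msum (d ^ n) (\<lambda>_. 1\<^sub>m (d ^ n)) {..<1::nat}) $$ (i, j))"
    proof -
      have z: "psd_on {..<d ^ n} (\<lambda>x y. 0)" by (simp add: psd_on_def qf_def)
      have "psd_on {..<d ^ n} (\<lambda>x y. (if x = y then 1 else 0))" by (rule psd_on_one) simp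
      moreover have "psd_on {..<d ^ n} (\<lambda>i j. 1\<^sub>m (d ^ n) $$ (i, j)) = psd_on {..<d ^ n} (\<lambda>x y. (if x = y then 1 else 0))"
        by (rule psd_on_cong) simp
      ultimately show "psd_on {..<d ^ n} (\<lambda>i j. 1\<^sub>m (d ^ n) $$ (i, j))" by simp
      have "psd_on {..<d ^ n} (\<lambda>i j. (1\<^sub>m (d ^ n) - msum (d ^ n) (\<lambda>_. 1\<^sub>m (d ^ n)) {..<1::nat}) $$ (i, j)) = psd_on {..<d ^ n} (\<lambda>x y. 0)"
        by (rule psd_on_cong) (simp add: msum_def)
      then show "psd_on {..<d ^ n} (\<lambda>i j. (1\<^sub>m (d ^ n) - msum (d ^ n) (\<lambda>_. 1\<^sub>m (d ^ n)) {..<1::nat}) $$ (i, j))" using z by simp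
    qed
    moreover have "1\<^sub>m (d ^ n) - msum (d ^ n) (\<lambda>_. 1\<^sub>m (d ^ n)) {..<1::nat} \<in> carrier_mat (d ^ n) (d ^ n)"
      by (intro minus_carrier_mat) (simp add: msum_def)
    ultimately show ?thesis unfolding is_code_def
      by (simp only: psd_iff_psd_on[OF one_carrier_mat] psd_iff_psd_on) simp
  qed
  have "- 1 / real n \<le> C_pp d W" if "n \<ge> 1" for n
    using code_converse[OF that le_refl code] that by (simp add: field_simps)
  then show ?thesis
    by (intro LIMSEQ_le_const2[OF bounded_over_n[of "- 1"]]) blast
qed


section \<open>Finite input memory: ergodic sources against periodic products\<close>

text \<open>With the input fixed on the sites 1 to t, the output on the inner sites 1 + m0 to t - a0
  depends on the rest of the input by at most \<epsilon>. The margins do not depend on t.\<close>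

lemma dima_window:
  assumes D: "dima d W" and \<epsilon>: "\<epsilon> > 0"
  obtains m0 a0 where "\<And>t x x' T. m0 + a0 < t \<Longrightarrow> wd 1 t x = wd 1 t x' \<Longrightarrow> effect_on {..<d ^ (t - m0 - a0)} T \<Longrightarrow>
    \<bar>trp {..<d ^ (t - m0 - a0)} (\<lambda>i j. W x (1 + int m0) (t - m0 - a0) $$ (i, j)) T
     - trp {..<d ^ (t - m0 - a0)} (\<lambda>i j. W x' (1 + int m0) (t - m0 - a0) $$ (i, j)) T\<bar> \<le> \<epsilon>"
proof -
  from D \<epsilon> obtain m0 a0 where *: "\<And>n k b m a x x'.
     b \<in> carrier_mat (d ^ (k + 1)) (d ^ (k + 1)) \<and> psd b \<and> psd (1\<^sub>m (d ^ (k + 1)) - b) \<and>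
     m \<ge> m0 \<and> a \<ge> a0 \<and>
     (\<forall>i. n - int m \<le> i \<and> i \<le> n + int k + int a \<longrightarrow> x i = x' i) \<Longrightarrow>
     cmod (mtrace (W x n (k + 1) * b) - mtrace (W x' n (k + 1) * b)) \<le> \<epsilon>"
    unfolding dima_def by blast
  show ?thesis
  proof (rule that)
    fix t and x x' :: "'a seq" and T
    assume t: "m0 + a0 < t" and eq: "wd 1 t x = wd 1 t x'" and T: "effect_on {..<d ^ (t - m0 - a0)} T"
    \<comment> \<open>\<open>dima\<close> speaks of the sites n to n + k, which are k + 1 in number,
      hence the subtracted 1.\<close>
    define k where "k = t - m0 - a0 - 1"
    have k: "t - m0 - a0 = k + 1" unfolding k_def using t by simp
    let ?D = "d ^ (k + 1)"
    define b where "b = mat ?D ?D (\<lambda>(i, j). T i j)"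
    have b: "b \<in> carrier_mat ?D ?D" unfolding b_def by simp
    have b': "1\<^sub>m ?D - b \<in> carrier_mat ?D ?D" using b by (rule minus_carrier_mat)
    have "psd_on {..<?D} (\<lambda>i j. b $$ (i, j)) = psd_on {..<?D} T"
      by (rule psd_on_cong) (simp add: b_def)
    then have p1: "psd b" using T unfolding psd_iff_psd_on[OF b] k effect_on_def by simp
    have "psd_on {..<?D} (\<lambda>i j. (1\<^sub>m ?D - b) $$ (i, j)) = psd_on {..<?D} (\<lambda>x y. (if x = y then 1 else 0) - T x y)"
      by (rule psd_on_cong) (simp add: b_def)
    then have p2: "psd (1\<^sub>m ?D - b)" using T unfolding psd_iff_psd_on[OF b'] k effect_on_def by simp
    have agree: "x i = x' i" if "(1 + int m0) - int m0 \<le> i" "i \<le> (1 + int m0) + int k + int a0" for i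
    proof -
      have "nat (i - 1) < t" "i = 1 + int (nat (i - 1))" using that t k by linarith+
      then show ?thesis using eq by (metis nth_wd)
    qed
    have "cmod (mtrace (W x (1 + int m0) (k + 1) * b) - mtrace (W x' (1 + int m0) (k + 1) * b)) \<le> \<epsilon>"
      by (rule *[of b k m0 a0 "1 + int m0" x x']) (use b p1 p2 agree in blast)
    then have "\<bar>Re (mtrace (W x (1 + int m0) (k + 1) * b)) - Re (mtrace (W x' (1 + int m0) (k + 1) * b))\<bar> \<le> \<epsilon>"
      using abs_Re_le_cmod[of "mtrace (W x (1 + int m0) (k + 1) * b) - mtrace (W x' (1 + int m0) (k + 1) * b)"] by simp
    moreover have "trp {..<?D} A (\<lambda>i j. b $$ (i, j)) = trp {..<?D} A T" for A
      by (rule trp_cong) (simp_all add: b_def)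
    ultimately show "\<bar>trp {..<d ^ (t - m0 - a0)} (\<lambda>i j. W x (1 + int m0) (t - m0 - a0) $$ (i, j)) T
     - trp {..<d ^ (t - m0 - a0)} (\<lambda>i j. W x' (1 + int m0) (t - m0 - a0) $$ (i, j)) T\<bar> \<le> \<epsilon>"
      unfolding k mtrace_mult[OF channel_carrier[OF d W] b] by simp
  qed
qed

text \<open>Up to \<epsilon> the integrand depends only on the word at the sites 1 to t, whose law
  is the same for p and q. Both states are compared with the value obtained from one representative
  input per word, which costs \<epsilon> twice, times the mass of the cylinder.\<close>

lemma joint_close:
  fixes p q :: "('a seq) measure"
  assumes p: "is_source p" and q: "is_source q"
    and same: "\<And>v. v \<in> words t \<Longrightarrow> measure p (cyl 1 v) = measure q (cyl 1 v)"
    and fit: "t = m + c + a" and w: "w \<in> words c"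
    and close: "\<And>x x'. wd 1 t x = wd 1 t x' \<Longrightarrow>
      \<bar>trp {..<d ^ c} (\<lambda>i j. W x (1 + int m) c $$ (i, j)) T - trp {..<d ^ c} (\<lambda>i j. W x' (1 + int m) c $$ (i, j)) T\<bar> \<le> \<epsilon>"
  shows "measure p (cyl (1 + int m) w) = measure q (cyl (1 + int m) w)"
    and "\<bar>trp {..<d ^ c} (ents (joint_fam d p W) (1 + int m) c w) T - trp {..<d ^ c} (ents (joint_fam d q W) (1 + int m) c w) T\<bar>
      \<le> 2 * \<epsilon> * measure p (cyl (1 + int m) w)"
proof -
  let ?n = "1 + int m"
  define mid where "mid = (\<lambda>v :: 'a list. take c (drop m v))"
  have mid: "wd ?n c x = mid (wd 1 t x)" for x :: "'a seq"
    unfolding mid_def fit using wd_append[of 1 m "c + a" x] wd_append[of ?n c a x] by (simp add: add.assoc)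
  have cylmid: "x \<in> cyl ?n w \<longleftrightarrow> mid (wd 1 t x) = w" for x
    using cyl_wd[OF w, of ?n] mid[of x] by auto
  then have "cyl ?n w = {x. mid (wd 1 t x) = w}" by auto
  then have ms: "measure r (cyl ?n w) = (\<Sum>v\<in>{v \<in> words t. mid v = w}. measure r (cyl 1 v))" if "is_source r" for r
    using source_measure_words[OF that, of "\<lambda>v. mid v = w" 1 t] by simp
  show eqm: "measure p (cyl ?n w) = measure q (cyl ?n w)"
    unfolding ms[OF p] ms[OF q] by (intro sum.cong refl same) simp
  \<comment> \<open>The word v is read as a sequence from site 1 on; its values outside 1 to t are
    arbitrary, which \<open>close\<close> tolerates.\<close>
  define f where "f = (\<lambda>v. if mid v = w then trp {..<d ^ c} (\<lambda>i j. W (\<lambda>i. v ! nat (i - 1)) ?n c $$ (i, j)) T else 0)"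
  have one: "\<bar>trp {..<d ^ c} (ents (joint_fam d r W) ?n c w) T - (\<Sum>v\<in>words t. f v * measure r (cyl 1 v))\<bar> \<le> \<epsilon> * measure r (cyl ?n w)"
    if r: "is_source r" for r
  proof -
    interpret R: prob_space r by (rule source_prob[OF r])
    let ?g = "\<lambda>x. indicator (cyl ?n w) x * trp {..<d ^ c} (\<lambda>i j. W x ?n c $$ (i, j)) T"
    have ig: "integrable r ?g" by (rule jf_trp(2)[OF d W r])
    have ih: "integrable r (\<lambda>x. f (wd 1 t x))"
    proof (rule R.integrable_const_bound[of _ "Max (insert 0 ((\<lambda>v. norm (f v)) ` words t))"])
      show "AE x in r. norm (f (wd 1 t x)) \<le> Max (insert 0 ((\<lambda>v. norm (f v)) ` words t))"
        by (intro AE_I2 Max_ge) auto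
      show "(\<lambda>x. f (wd 1 t x)) \<in> borel_measurable r"
        unfolding source_measurable[OF r] by (rule measurable_compose[OF wd_measurable]) simp
    qed
    have pt: "\<bar>?g x - f (wd 1 t x)\<bar> \<le> \<epsilon> * indicator (cyl ?n w) x" for x
    proof (cases "x \<in> cyl ?n w")
      case True
      have "wd 1 t (\<lambda>i. wd 1 t x ! nat (i - 1)) = wd 1 t x"
        by (rule nth_equalityI) (simp_all add: nth_wd)
      then show ?thesis using True close[of x "\<lambda>i. wd 1 t x ! nat (i - 1)"] cylmid[of x] by (simp add: f_def)
    qed (use cylmid[of x] in \<open>simp add: f_def\<close>)
    have eq: "trp {..<d ^ c} (ents (joint_fam d r W) ?n c w) T - (\<Sum>v\<in>words t. f v * measure r (cyl 1 v)) = (LINT x|r. ?g x - f (wd 1 t x))"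
      unfolding jf_trp(1)[OF d W r] integral_wd[OF r, symmetric] by (rule Bochner_Integration.integral_diff[OF ig ih, symmetric])
    have "\<bar>LINT x|r. ?g x - f (wd 1 t x)\<bar> \<le> (LINT x|r. \<bar>?g x - f (wd 1 t x)\<bar>)" by (rule integral_abs_bound)
    also have "\<dots> \<le> (LINT x|r. \<epsilon> * indicator (cyl ?n w) x)"
      using ig ih by (intro integral_mono pt) (auto simp: source_sets[OF r] R.emeasure_eq_measure intro!: integrable_mult_right)
    also have "\<dots> = \<epsilon> * measure r (cyl ?n w)" by (simp add: source_space[OF r])
    finally show ?thesis unfolding eq .
  qed
  have "(\<Sum>v\<in>words t. f v * measure p (cyl 1 v)) = (\<Sum>v\<in>words t. f v * measure q (cyl 1 v))"
    by (intro sum.cong refl) (simp add: same)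
  then show "\<bar>trp {..<d ^ c} (ents (joint_fam d p W) ?n c w) T - trp {..<d ^ c} (ents (joint_fam d q W) ?n c w) T\<bar>
      \<le> 2 * \<epsilon> * measure p (cyl ?n w)"
    using one[OF p] one[OF q] eqm by simp
qed

text \<open>\<open>ent_continuity\<close> is used word by word with trace and error proportional to
  the mass of the word; summing the masses removes the number of words from the bound. Both
  inequalities point in the direction that bounds the gain of q from below.\<close>

lemma gain_close:
  fixes p q :: "('a seq) measure"
  assumes p: "is_source p" and q: "is_source q" and \<epsilon>: "\<epsilon> > 0"
    and mass: "\<And>w. w \<in> words c \<Longrightarrow> measure p (cyl n w) = measure q (cyl n w)"
    and close: "\<And>w T. w \<in> words c \<Longrightarrow> effect_on {..<d ^ c} T \<Longrightarrow>
      \<bar>trp {..<d ^ c} (ents (joint_fam d p W) n c w) T - trp {..<d ^ c} (ents (joint_fam d q W) n c w) T\<bar> \<le> 2 * \<epsilon> * measure p (cyl n w)"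
  shows "SJ d (joint_fam d q W) n c \<le> SJ d (joint_fam d p W) n c + 2 * \<epsilon> * (real c * log 2 (real d)) + (1 + 2 * \<epsilon>)"
    and "SB d (joint_fam d p W) n c \<le> SB d (joint_fam d q W) n c + 2 * \<epsilon> * (real c * log 2 (real d)) + (1 + 2 * \<epsilon>)"
proof -
  let ?I = "{..<d ^ c}"
  have cI: "card ?I \<ge> 1" using d by simp
  have lg: "log 2 (real (card ?I)) = real c * log 2 (real d)" using d by (simp add: log_nat_power)
  let ?m = "\<lambda>w. measure p (cyl n w)"
  have "SJ d (joint_fam d q W) n c \<le> (\<Sum>w\<in>words c. ent ?I (ents (joint_fam d p W) n c w) + (2 * \<epsilon> * ?m w) * (real c * log 2 (real d)) + (?m w + 2 * \<epsilon> * ?m w))"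
    unfolding SJ_def
  proof (rule sum_mono)
    fix w :: "'a list" assume w: "w \<in> words c"
    have "trp ?I (ents (joint_fam d p W) n c w) T - trp ?I (ents (joint_fam d q W) n c w) T \<le> 2 * \<epsilon> * ?m w"
      if "effect_on ?I T" for T using close[OF w that] by linarith
    then show "ent ?I (ents (joint_fam d q W) n c w) \<le> ent ?I (ents (joint_fam d p W) n c w) + (2 * \<epsilon> * ?m w) * (real c * log 2 (real d)) + (?m w + 2 * \<epsilon> * ?m w)"
      using ent_continuity[OF finite_lessThan cI jf_psd[OF d W p] jf_psd[OF d W q] jf_tr_on[OF d W p] _ ]
        jf_tr_on[OF d W q, of c n w] mass[OF w] unfolding lg by metis
  qed
  also have "\<dots> = (\<Sum>w\<in>words c. ent ?I (ents (joint_fam d p W) n c w) + ?m w * (2 * \<epsilon> * (real c * log 2 (real d))) + ?m w * (1 + 2 * \<epsilon>))"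
    by (intro sum.cong refl) (simp add: algebra_simps)
  also have "\<dots> = SJ d (joint_fam d p W) n c + (\<Sum>w\<in>words c. ?m w) * (2 * \<epsilon> * (real c * log 2 (real d))) + (\<Sum>w\<in>words c. ?m w) * (1 + 2 * \<epsilon>)"
    unfolding SJ_def sum.distrib sum_distrib_right[symmetric] ..
  finally show "SJ d (joint_fam d q W) n c \<le> SJ d (joint_fam d p W) n c + 2 * \<epsilon> * (real c * log 2 (real d)) + (1 + 2 * \<epsilon>)"
    unfolding sum_measure_cyl[OF p] by simp
  have "trp ?I (out (joint_fam d q W) n c) T - trp ?I (out (joint_fam d p W) n c) T \<le> 2 * \<epsilon>" if T: "effect_on ?I T" for T
  proof -
    have "trp ?I (out (joint_fam d q W) n c) T - trp ?I (out (joint_fam d p W) n c) T =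
      (\<Sum>w\<in>words c. trp ?I (ents (joint_fam d q W) n c w) T - trp ?I (ents (joint_fam d p W) n c w) T)"
      unfolding out_def trp_sum_left by (simp add: sum_subtractf)
    also have "\<dots> \<le> (\<Sum>w\<in>words c. 2 * \<epsilon> * ?m w)"
    proof (rule sum_mono)
      fix w :: "'a list" assume w: "w \<in> words c"
      show "trp ?I (ents (joint_fam d q W) n c w) T - trp ?I (ents (joint_fam d p W) n c w) T \<le> 2 * \<epsilon> * ?m w"
        using close[OF w T] by linarith
    qed
    also have "\<dots> = 2 * \<epsilon>" unfolding sum_distrib_left[symmetric] sum_measure_cyl[OF p] by simp
    finally show ?thesis .
  qed
  from ent_continuity[OF finite_lessThan cI out_psd[OF d jf_state_family[OF d W q]] out_psd[OF d jf_state_family[OF d W p]]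
      out_trace[OF d jf_state_family[OF d W q]] out_trace[OF d jf_state_family[OF d W p]] this]
  show "SB d (joint_fam d p W) n c \<le> SB d (joint_fam d q W) n c + 2 * \<epsilon> * (real c * log 2 (real d)) + (1 + 2 * \<epsilon>)"
    unfolding SB_def lg by simp
qed

text \<open>The product source has the same law on the first block, so the source entropies agree
  and only the gain can change. On the inner sites \<open>gain_close\<close> controls it; the m + a
  outer sites are removed for p by the bounds for dropped sites and restored for q by
  superadditivity. K depends neither on p nor on t.\<close>

lemma info_ppm_ge:
  assumes D: "dima d W" and \<epsilon>: "\<epsilon> > 0"
  shows "\<exists>K. \<forall>p t. is_source p \<and> t > 0 \<longrightarrow>
    info d W p 1 t - 4 * \<epsilon> * (real t * log 2 (real d)) - K \<le> info d W (ppm t (block_law p t)) 1 t"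
proof -
  define C where "C = log 2 (real d) + log 2 (real CARD('a))"
  have l: "0 \<le> log 2 (real d)" "0 \<le> log 2 (real CARD('a))" using d by simp_all
  have C0: "0 \<le> C" unfolding C_def using l by simp
  obtain m a where win: "\<And>t x x' T. m + a < t \<Longrightarrow> wd 1 t x = wd 1 t x' \<Longrightarrow> effect_on {..<d ^ (t - m - a)} T \<Longrightarrow>
    \<bar>trp {..<d ^ (t - m - a)} (\<lambda>i j. W x (1 + int m) (t - m - a) $$ (i, j)) T
     - trp {..<d ^ (t - m - a)} (\<lambda>i j. W x' (1 + int m) (t - m - a) $$ (i, j)) T\<bar> \<le> \<epsilon>"
    using dima_window[OF D \<epsilon>] by blast
  \<comment> \<open>The outer sites cost at most C (m + a) in each of the output entropy of p, the
    joint entropy of p and the joint entropy of q, which the first term covers; the second is the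
    constant of \<open>gain_close\<close>, used twice.\<close>
  define K where "K = 4 * (C * real (m + a)) + 2 * (1 + 2 * \<epsilon>)"
  have "info d W p 1 t - 4 * \<epsilon> * (real t * log 2 (real d)) - K \<le> info d W (ppm t (block_law p t)) 1 t"
    if p: "is_source p" and t: "t > 0" for p t
  proof -
    let ?q = "ppm t (block_law p t)"
    have q: "is_source ?q" by (rule source_ppm)
    note Jp = d jf_state_family[OF d W p] and Jq = d jf_state_family[OF d W q]
    have same: "measure p (cyl 1 v) = measure ?q (cyl 1 v)" if "v \<in> words t" for v
      using ppm_cyl_block[OF t block_law(1)[OF p] that] block_law(2)[OF p that] by simp
    have HX: "HX ?q 1 t = HX p 1 t" unfolding HX_def by (intro sum.cong refl) (simp add: same)
    note tp = tame_SJ_SB[OF d W p, folded C_def] and tq = tame_SJ_SB[OF d W q, folded C_def]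
    show ?thesis
    proof (cases "m + a < t")
      case False
      \<comment> \<open>Blocks too short to have inner sites: every entropy is at most C t \<le> C
        (m + a) and is absorbed by K.\<close>
      have arith: "h + b - j - E - (4 * Z + 2 * (1 + 2 * \<epsilon>)) \<le> h + b' - j'"
        if "b \<le> V" "0 \<le> j" "0 \<le> b'" "j' \<le> V" "V \<le> Z" "0 \<le> Z" "0 \<le> E" for h b j E Z V b' j' :: real
        using that \<epsilon> by argo
      have "SB d (joint_fam d p W) 1 t \<le> C * real t" "0 \<le> SJ d (joint_fam d p W) 1 t"
        "0 \<le> SB d (joint_fam d ?q W) 1 t" "SJ d (joint_fam d ?q W) 1 t \<le> C * real t"
        using tp tq unfolding tame_def by blast+
      then show ?thesis unfolding info_def[OF d W st] HX K_def
        by (rule arith) (use False C0 \<epsilon> l in \<open>simp_all add: mult_left_mono\<close>)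
    next
      case True
      define c where "c = t - m - a"
      let ?n = "1 + int m"
      have fit: "t = m + c + a" unfolding c_def using True by simp
      have mass: "measure p (cyl ?n w) = measure ?q (cyl ?n w)"
        and close: "effect_on {..<d ^ c} T \<Longrightarrow> \<bar>trp {..<d ^ c} (ents (joint_fam d p W) ?n c w) T - trp {..<d ^ c} (ents (joint_fam d ?q W) ?n c w) T\<bar>
          \<le> 2 * \<epsilon> * measure p (cyl ?n w)" if w: "w \<in> words c" for w T
      proof -
        \<comment> \<open>The equality of masses involves no test, so \<open>joint_close\<close> is
          instantiated with the zero effect.\<close>
        have z: "effect_on {..<d ^ c} (\<lambda>x y. 0)"
          unfolding effect_on_def using psd_on_one[of "{..<d ^ c}"] by (simp add: psd_on_def qf_def)
        show "measure p (cyl ?n w) = measure ?q (cyl ?n w)"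
          by (rule joint_close(1)[OF p q same fit w, of "\<lambda>x y. 0" \<epsilon>]) (use win[OF True] z in \<open>simp_all add: c_def\<close>)
        show "effect_on {..<d ^ c} T \<Longrightarrow> \<bar>trp {..<d ^ c} (ents (joint_fam d p W) ?n c w) T - trp {..<d ^ c} (ents (joint_fam d ?q W) ?n c w) T\<bar>
          \<le> 2 * \<epsilon> * measure p (cyl ?n w)"
          by (rule joint_close(2)[OF p q same fit w]) (use win[OF True] in \<open>simp_all add: c_def\<close>)
      qed
      have gc: "SJ d (joint_fam d ?q W) ?n c \<le> SJ d (joint_fam d p W) ?n c + 2 * \<epsilon> * (real c * log 2 (real d)) + (1 + 2 * \<epsilon>)"
        "SB d (joint_fam d p W) ?n c \<le> SB d (joint_fam d ?q W) ?n c + 2 * \<epsilon> * (real c * log 2 (real d)) + (1 + 2 * \<epsilon>)"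
        using gain_close[OF p q \<epsilon>, of c ?n] mass close by blast+
      have e: "?n + int c = 1 + int (m + c)" by simp
      have sup: "SB d (joint_fam d ?q W) 1 m + SB d (joint_fam d ?q W) ?n c - SB d (joint_fam d ?q W) 1 (m + c) \<le>
           SJ d (joint_fam d ?q W) 1 m + SJ d (joint_fam d ?q W) ?n c - SJ d (joint_fam d ?q W) 1 (m + c)"
        "SB d (joint_fam d ?q W) 1 (m + c) + SB d (joint_fam d ?q W) (1 + int (m + c)) a - SB d (joint_fam d ?q W) 1 (m + c + a) \<le>
           SJ d (joint_fam d ?q W) 1 (m + c) + SJ d (joint_fam d ?q W) (1 + int (m + c)) a - SJ d (joint_fam d ?q W) 1 (m + c + a)"
        by (rule gain_superadditive[OF Jq])+
      have qb: "SJ d (joint_fam d ?q W) 1 m \<le> C * real m" "SJ d (joint_fam d ?q W) (1 + int (m + c)) a \<le> C * real a"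
         "0 \<le> SB d (joint_fam d ?q W) 1 m" "0 \<le> SB d (joint_fam d ?q W) (1 + int (m + c)) a"
        using tq unfolding tame_def by blast+
      have pb: "SB d (joint_fam d p W) 1 (m + c + a) \<le> SB d (joint_fam d p W) 1 (m + c) + SB d (joint_fam d p W) (1 + int (m + c)) a"
        "SB d (joint_fam d p W) 1 (m + c) \<le> SB d (joint_fam d p W) 1 m + SB d (joint_fam d p W) ?n c"
        "SB d (joint_fam d p W) 1 m \<le> C * real m" "SB d (joint_fam d p W) (1 + int (m + c)) a \<le> C * real a"
        "SJ d (joint_fam d p W) ?n c \<le> SJ d (joint_fam d p W) 1 (m + c) + C * real m"
        "SJ d (joint_fam d p W) 1 (m + c) \<le> SJ d (joint_fam d p W) 1 (m + c + a) + C * real a"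
        using tp unfolding tame_def by blast+
      have "real c * log 2 (real d) \<le> real t * log 2 (real d)" using l fit by (intro mult_right_mono) auto
      then have lc: "2 * \<epsilon> * (real c * log 2 (real d)) \<le> 2 * \<epsilon> * (real t * log 2 (real d))" using \<epsilon> by (intro mult_left_mono) auto
      \<comment> \<open>b and j stand for output and joint entropies of the product source, p and r
        for those of the given source. The suffixes 1, n, a, c, t name the first m sites, the inner
        sites, the last a sites, the first m + c sites and the whole block.\<close>
      have arith: "h + pt - rt - L4 - (4 * Z + 2 * (1 + 2 * \<epsilon>)) \<le> h + bt - jt"
        if "b1 + bn - bc \<le> j1 + jn - jc" "bc + ba - bt \<le> jc + ja - jt" "j1 \<le> Cm" "ja \<le> Ca" "0 \<le> b1" "0 \<le> ba"
          "pt \<le> pc + pa" "pc \<le> p1 + pn" "p1 \<le> Cm" "pa \<le> Ca" "rn \<le> rc + Cm" "rc \<le> rt + Ca"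
          "jn \<le> rn + L + (1 + 2 * \<epsilon>)" "pn \<le> bn + L + (1 + 2 * \<epsilon>)" "L \<le> L2" "L4 = 2 * L2" "Z = Cm + Ca" "0 \<le> Cm" "0 \<le> Ca"
        for h pt rt L4 Z bt jt b1 bn bc j1 jn jc ba ja Cm Ca pc pa p1 pn rn rc L L2 :: real
        using that by argo
      show ?thesis unfolding info_def[OF d W st] HX K_def
        by (rule arith[OF sup[folded fit] qb pb[folded fit] gc lc]) (use C0 in \<open>simp_all add: distrib_left\<close>)
    qed
  qed
  then show ?thesis by blast
qed

text \<open>For fixed \<epsilon> the block length tends to infinity first, which removes K / n
  although K depends on \<epsilon>; only then does \<epsilon> tend to 0.\<close>

lemma C_erg_le_C_pp:
  assumes D: "dima d W"
  shows "C_erg d W \<le> C_pp d W"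
  unfolding C_erg_def
proof (rule cSUP_least)
  have "ergodic_source (avg 1 (ppm 1 (return_pmf [undefined :: 'a])))"
    by (rule ergodic_avg_ppm) (auto simp: words_def)
  then show "{p :: ('a seq) measure. ergodic_source p} \<noteq> {}" by blast
  fix p :: "('a seq) measure" assume "p \<in> {p. ergodic_source p}"
  then have per: "periodic 1 p" using ergodic_periodic[OF d W st] by blast
  then have p: "is_source p" by (simp add: periodic_def)
  have l: "0 \<le> log 2 (real d)" using d by simp
  have step: "mutual_info d p W - 4 * \<epsilon> * log 2 (real d) \<le> C_pp d W" if \<epsilon>: "\<epsilon> > 0" for \<epsilon>
  proof -
    obtain K where K: "\<And>t. t > 0 \<Longrightarrow> info d W p 1 t - 4 * \<epsilon> * (real t * log 2 (real d)) - K \<le> info d W (ppm t (block_law p t)) 1 t"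
      using info_ppm_ge[OF D \<epsilon>] p by blast
    have "info d W p 1 t / real t - 4 * \<epsilon> * log 2 (real d) - K / real t \<le> C_pp d W" if t: "t > 0" for t
    proof -
      have "info d W p 1 t / real t - 4 * \<epsilon> * log 2 (real d) - K / real t =
        (info d W p 1 t - 4 * \<epsilon> * (real t * log 2 (real d)) - K) / real t"
        using t by (simp add: diff_divide_distrib)
      also have "\<dots> \<le> info d W (ppm t (block_law p t)) 1 t / real t"
        using K[OF t] by (intro divide_right_mono) auto
      also have "\<dots> \<le> mutual_info d (ppm t (block_law p t)) W"
        by (rule info_block_le[OF d W st t block_law(1)[OF p]])
      also have "\<dots> \<le> C_pp d W"
        by (rule mutual_info_le_C_pp[OF d W st periodic_product_ppm[OF t block_law(1)[OF p]]])
      finally show ?thesis .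
    qed
    then have ev: "\<exists>N. \<forall>n\<ge>N. info d W p 1 n / real n - 4 * \<epsilon> * log 2 (real d) - K / real n \<le> C_pp d W"
      by (intro exI[of _ 1]) auto
    have "(\<lambda>n. info d W p 1 n / real n - 4 * \<epsilon> * log 2 (real d) - K / real n) \<longlonglongrightarrow> mutual_info d p W - 4 * \<epsilon> * log 2 (real d) - 0"
      by (intro tendsto_diff tendsto_const bounded_over_n info_rate[OF d W st _ per]) simp
    from LIMSEQ_le_const2[OF this ev] show ?thesis by simp
  qed
  show "mutual_info d p W \<le> C_pp d W"
  proof (rule field_le_epsilon)
    fix e :: real assume e: "e > 0"
    \<comment> \<open>The added 1 keeps the denominator positive when d = 1.\<close>
    define \<epsilon> where "\<epsilon> = e / (4 * (log 2 (real d) + 1))"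
    have "\<epsilon> > 0" unfolding \<epsilon>_def using e l by simp
    moreover have "4 * \<epsilon> * log 2 (real d) \<le> e"
    proof -
      have "4 * \<epsilon> * log 2 (real d) \<le> 4 * \<epsilon> * (log 2 (real d) + 1)" using \<open>\<epsilon> > 0\<close> by simp
      also have "\<dots> = e" unfolding \<epsilon>_def using l by (simp add: field_simps)
      finally show ?thesis .
    qed
    ultimately show "mutual_info d p W \<le> C_pp d W + e" using step[of \<epsilon>] by linarith
  qed
qed

end

theorem theorem8:
  fixes d :: nat and W :: "('a::finite) seq \<Rightarrow> int \<Rightarrow> nat \<Rightarrow> complex mat"
  assumes "d \<ge> 1"
    and "cq_channel d W"
    and "stationary_channel W"
    and "ergodic_channel d W"
    and "dima d W"
  shows "C_pp d W = C_erg d W \<and>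
    (\<forall>\<epsilon>>0. \<forall>n::nat. \<forall>M u b. n \<ge> 1 \<and> is_code d n M u b \<and>
        real M \<ge> 2 powr (real n * (C_pp d W + \<epsilon>)) \<longrightarrow>
        avg_error d W n M u b \<ge> 1 - (C_pp d W + 1 / real n) / (C_pp d W + \<epsilon>))"
proof (intro conjI allI impI)
  note W = assms(1,2,3)
  show "C_pp d W = C_erg d W"
    using C_pp_le_C_erg[OF W] C_erg_le_C_pp[OF W assms(5)] by (rule antisym)
  fix \<epsilon> :: real and n M and u :: "nat \<Rightarrow> 'a list" and b
  assume \<epsilon>: "\<epsilon> > 0" and h: "n \<ge> 1 \<and> is_code d n M u b \<and> real M \<ge> 2 powr (real n * (C_pp d W + \<epsilon>))"
  let ?C = "C_pp d W" and ?s = "1 - avg_error d W n M u b"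
  have C0: "0 \<le> ?C" by (rule C_pp_nonneg[OF W])
  have nC: "0 < real n * (?C + \<epsilon>)" using h C0 \<epsilon> by simp
  have "0 < real M" using h powr_gt_zero[of 2 "real n * (?C + \<epsilon>)"] by linarith
  then have M: "M \<ge> 1" by simp
  have "real n * (?C + \<epsilon>) = log 2 (2 powr (real n * (?C + \<epsilon>)))" by simp
  also have "\<dots> \<le> log 2 (real M)" using h M by (subst log_le_cancel_iff) auto
  finally have lM: "real n * (?C + \<epsilon>) \<le> log 2 (real M)" .
  \<comment> \<open>Nonnegativity of the success probability allows the lower bound on log M to be
    multiplied by it.\<close>
  have s0: "0 \<le> ?s"
  proof -
    have "(\<Sum>i<M. (SUP x\<in>cyl 1 (u i). 1 - Re (mtrace (W x 1 n * b i)))) \<le> (\<Sum>i<M. 1)"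
      using code_error(2)[OF W] h by (intro sum_mono) auto
    then show ?thesis unfolding avg_error_def using M by (simp add: field_simps)
  qed
  have "?s * (real n * (?C + \<epsilon>)) \<le> ?s * log 2 (real M)" by (rule mult_left_mono[OF lM s0])
  also have "\<dots> \<le> real n * ?C + 1" using code_converse[OF W _ M, of n u b] h by simp
  finally have "?s \<le> (real n * ?C + 1) / (real n * (?C + \<epsilon>))" using nC by (simp add: field_simps)
  also have "\<dots> = (?C + 1 / real n) / (?C + \<epsilon>)" using h nC by (simp add: field_simps)
  finally show "avg_error d W n M u b \<ge> 1 - (?C + 1 / real n) / (?C + \<epsilon>)" by simp
qed

end
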